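(* Let $X$ be a Lefschetz complex filtered by a discrete Morse function $h$, and let $\alpha$ be a reversible $k$-dimensional birth-death pair of $h$ with $\mathcal R^{\urcorner}_h(\alpha)\cap\mathcal R^{\llcorner}_h(\alpha)=\emptyset$. Then the simplification algorithm (described in the context), given as input $X$, $h$, $\mathcal V_h$, $\mathrm{BD}(h)$, all homological and cohomological relations among the off-diagonal pairs of $h$, and $\alpha$, returns a topological simplification $h'$ of $h$. Moreover, the output of the algorithm contains the updated vector field $\mathcal V_{h'}$ and the homological and cohomological relations (among off-diagonal pairs) for $h'$.
   Context: Lefschetz complex: a triple $(X,\dim,D)$ with $X$ a finite set of cells, $\dim:X\to\mathbb N$, $D:X\times X\to\mathbb Z_2$ such that $D(x,y)\neq0$ implies $\dim x+1=\dim y$ ($x$ is a facet of $y$, $y$ a cofacet of $x$), and $\sum_{z}D(x,z)D(z,y)=0$ for all $x,y$. $X_n$ is the set of $n$-cells; $D^{\perp}(y,x)=D(x,y)$. $D_n$ is the matrix of $D$ with rows $X_{n-1}$, columns $X_n$; $D^{\perp}_n$ is the matrix of $D^\perp$ with rows $X_{n+1}$, columns $X_n$. Discrete Morse function (dMf): $h:X\to\mathbb R$ such that (i) $D(x,y)=1$ implies $h(x)\le h(y)$; (ii) for $x\ne y$, $h(x)=h(y)$ implies $D(x,y)=1$ or $D(y,x)=1$; (iii) $\#h^{-1}(a)\le2$ for every $a\in\mathbb R$. The $h$-order: $x<_hy$ iff $h(x)<h(y)$, or $h(x)=h(y)$ and $\dim x<\dim y$. $X$ is filtered by $h$ when such $h$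 is fixed. Rows and columns of $D_n$ are ordered by the $h$-order, those of $D_n^\perp$ by the reversed $h$-order. Lazy reduction (over $\mathbb Z_2$) of a matrix $M$: start with $R=M$, $U=I$ (indexed by the columns of $M$). For columns $y$ from left to right: while $R[:,y]\ne0$ and some preceding column $x$ has $\mathrm{low}(R[:,x])=\mathrm{low}(R[:,y])$ (low = row index of the lowest nonzero entry), set $R[:,y]\leftarrow R[:,y]+R[:,x]$ and $U[x,:]\leftarrow U[x,:]+U[y,:]$. This gives $M=RU$; applied to $D_n$ and $D_n^\perp$ it yields $D_n=R_nU_n$, $D^\perp_n=R^\perp_nU^\perp_n$. Birth-death pairs: $\alpha=(\alpha^\circ,\alpha^\times)\in X_n\times X_{n+1}$ is an $n$-dimensional birth-death pair if $\mathrm{low}(R_{n+1}[:,\alpha^\times])=\alpha^\circ$ (equivalently $\mathrm{low}(R^\perp_n[:,\alpha^\circ])=\alpha^\times$); $\alpha^\circ$ is a birth cell, $\alpha^\times$ a death cell. By convention an unpaired cell is the birth cell of a pair with undefined second component. $\mathrm{BD}(h)$, $\mathrm{BD}_n(h)$ denote the sets of all, resp. $n$-dimensional, pairs; $\widehat{\mathrm{BD}}(h)$, $\widehat{\mathrm{BD}}_n(h)$ the subsets of off-diagonal pairs (those not satisfying $h(\alpha^\circ)=h(\alpha^\times)$). A topological simplification of $h$ is a dMf $h'$ on $X$ with $\widehat{\mathrm{BD}}(h')\subset\widehat{\mathrm{BD}}(h)$ and $h'(\beta^\circ)=h(\beta^\circ)$, $h'(\beta^\times)=h(\beta^\times)$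 for every $\beta\in\widehat{\mathrm{BD}}(h')$. Relations: for distinct $x,y\in X_n$, $x\to^{\times}y$ iff $U_n[x,y]=1$ (homological), $x\to^{\circ}y$ iff $U_n^\perp[x,y]=1$ (cohomological). For distinct pairs, $\beta\to^{\times}\alpha$ iff $\beta^\times\to^\times c$ for a component $c$ of $\alpha$, and $\beta\to^\circ\alpha$ iff $\beta^\circ\to^\circ c$ for a component $c$ of $\alpha$. Vector fields: a combinatorial vector field $\mathcal V$ on $X$ is a partition of $X$ into singletons (critical cells, forming $\mathrm{Crit}(\mathcal V)$) and facet–cofacet pairs (vectors). $G_{\mathcal V}$ is the digraph on $X$ with an arc from $x$ to $y$ whenever $x$ is a facet of $y$ and $\{x,y\}\in\mathcal V$, or $y$ is a facet of $x$ and $\{x,y\}\notin\mathcal V$. $x\rightsquigarrow y$ means there is a directed path from $x$ to $y$; $\mathcal V$ is gradient if $G_{\mathcal V}$ is acyclic. $\mathcal V_h$ is the (gradient) partition of $X$ into nonempty fibres of $h$. An off-diagonal pair $\alpha$ (with both components defined) is reversible if there is exactly one path from $\alpha^\times$ to $\alpha^\circ$ in $G_{\mathcal V_h}$. The Morse complex $\mathcal M(\mathcal V)$ is the Lefschetz complex with cells $\mathrm{Crit}(\mathcal V)$, restricted $\dim$, and $D_{\mathcal M}(x,y)$ the number mod 2 of paths in $G_{\mathcal V}$ from $y$ to $x$ if $\dim y=\dim x+1$, and $0$ otherwise. Forbidden regions of an $n$-dimensional $\alpha\in\widehat{\mathrm{BD}}(h)$ (subsets of $[-\infty,\infty]^2$):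 $$\mathcal R^{\urcorner}_h(\alpha)=\bigcup_{\beta\in\widehat{\mathrm{BD}}_n(h),\ \beta\ne\alpha,\ \beta\to^\times\alpha}[-\infty,h(\beta^\circ)]\times[-\infty,h(\beta^\times)]\ \cup\bigcup_{x\in\mathrm{Crit}(\mathcal V_h),\ x\ne\alpha^\times,\ \alpha^\times\rightsquigarrow x}[-\infty,h(x)]^2,$$ $$\mathcal R^{\llcorner}_h(\alpha)=\bigcup_{\beta\in\widehat{\mathrm{BD}}_n(h),\ \beta\ne\alpha,\ \beta\to^\circ\alpha}[h(\beta^\circ),+\infty]\times[h(\beta^\times),+\infty]\ \cup\bigcup_{y\in\mathrm{Crit}(\mathcal V_h),\ y\ne\alpha^\circ,\ y\rightsquigarrow\alpha^\circ}[h(y),+\infty]^2.$$ Moves. For an interval $[a,b]$ and a cell $x$ with $g(x)\in[a,b]$, the linear coefficient of $x$ is $t\in[0,1]$ with $g(x)=at+(1-t)b$. Let $g$ be the current dMf. Right move: choose $g(\alpha^\circ)<\delta<\xi<g(\alpha^\times)$ with $g^{-1}([\delta,\xi])=\emptyset$, at most one critical cell $e$ with $g(e)\in(g(\alpha^\circ),\delta)$, and $e\not\rightsquigarrow\alpha^\circ$; every $x$ with $g(x)\in[g(\alpha^\circ),\xi]$, $x\rightsquigarrow\alpha^\circ$ (or $x=\alpha^\circ$) and $x\notin\mathrm{Crit}(\mathcal V_g)\setminus\{\alpha^\circ\}$ gets the new value $t_x\delta+(1-t_x)\xi$, $t_x$ being its linear coefficient on $[g(\alpha^\circ),\xi]$;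 other values are unchanged. Down move: choose $g(\alpha^\circ)<\xi<\delta<g(\alpha^\times)$ with $g^{-1}([\xi,\delta])=\emptyset$, at most one critical $e$ with $g(e)\in(\delta,g(\alpha^\times))$, and $\alpha^\times\not\rightsquigarrow e$; every $x$ with $g(x)\in[\xi,g(\alpha^\times)]$, $\alpha^\times\rightsquigarrow x$ (or $x=\alpha^\times$) and $x\notin\mathrm{Crit}(\mathcal V_g)\setminus\{\alpha^\times\}$ gets the new value $t_x\xi+(1-t_x)\delta$, $t_x$ being its linear coefficient on $[\xi,g(\alpha^\times)]$; other values are unchanged. Simplification algorithm. Step 1. Starting with $g=h$, as long as there are critical cells strictly between $\alpha^\circ$ and $\alpha^\times$ in the $g$-order, let $x$ be the first and $y$ the last of them. If $x\not\rightsquigarrow\alpha^\circ$ and ($x$ is a death cell or not $x\to^\circ\alpha^\circ$), perform a right move with $\delta>g(x)$; otherwise, if $\alpha^\times\not\rightsquigarrow y$ and ($y$ is a birth cell or not $y\to^\times\alpha^\times$), perform a down move with $\delta<g(y)$. When no critical cell is left in between, perform further right/down moves, bypassing no critical cell, until $g^{-1}([g(\alpha^\circ),g(\alpha^\times)])=\rho$, where $\rho$ is the unique path from $\alpha^\times$ to $\alpha^\circ$. Whenever a move makes a component of $\alpha$ bypass a critical cell, the relations among critical cells (entries of the matrices $U_n,U^\perp_n$ indexed by critical cells) are updated, using the order before the transposition, as follows; here for two $k$-dimensional pairs $\sigma,\tau$, $D^{\sigma,\tau}$ is the $(k+1)$-st boundary matrix of $\mathcal M(\mathcal V_g)$ after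 iteratively performing Lefschetz cancellations, always of shallow pairs, of all pairs other than $\sigma,\tau$ lying in $(g(\sigma^\circ),\infty]\times[-\infty,g(\sigma^\times)]$ or in $(g(\tau^\circ),\infty]\times[-\infty,g(\tau^\times)]$. (a) If $\alpha^\circ$ bypasses the birth cell $\beta^\circ$ of a $k$-dimensional pair $\beta$ (both death cells defined), write $\{\sigma,\tau\}=\{\alpha,\beta\}$ with $g(\tau^\times)<g(\sigma^\times)$; if not $\tau\to^\circ\sigma$, and ($\tau\to^\times\sigma$ or $D^{\sigma,\tau}[\tau^\circ,\sigma^\times]=1$), replace the row $U_{k+1}[\tau^\times,:]$ by $U_{k+1}[\tau^\times,:]+U_{k+1}[\sigma^\times,:]$. (b) If $\alpha^\times$ bypasses the death cell $\beta^\times$ of a $k$-dimensional pair $\beta$, write $\{\sigma,\tau\}=\{\alpha,\beta\}$ with $g(\sigma^\circ)<g(\tau^\circ)$; if not $\tau\to^\times\sigma$, and ($\tau\to^\circ\sigma$ or $D^{\sigma,\tau}[\sigma^\circ,\tau^\times]=1$), replace the row $U^\perp_k[\tau^\circ,:]$ by $U^\perp_k[\tau^\circ,:]+U^\perp_k[\sigma^\circ,:]$. (c) In all other cases nothing is updated. (A pair $(s,t)$ with $D(s,t)=1$ is shallow if $s$ has maximal value among the facets of $t$ and $t$ minimal value among the cofacets of $s$; its Lefschetz cancellation removes $s,t$ and sets $\hat D(x,y)=D(x,y)+D(s,y)D(x,t)$.) Step 2. Write $\rho=(\alpha^\circ=x_0,x_1,\dots,x_m=\alpha^\times)$ and define $h'(x_i)=g(x_{m-2\lfloor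 i/2\rfloor})$ for $0\le i\le m$ and $h'(x)=g(x)$ for $x\notin\rho$. Output: $X$, $h'$; the vector field obtained from $\mathcal V_h$ by reversing $\rho$ (replacing the vectors contained in $\rho$ and the critical cells $\alpha^\circ,\alpha^\times$ by the vectors $\{x_{2j},x_{2j+1}\}$); the set of birth-death pairs, whose off-diagonal part is $\widehat{\mathrm{BD}}(h)\setminus\{\alpha\}$ and whose diagonal part is the set of vectors; and the updated relations restricted to the remaining off-diagonal pairs. *)

theory Defs
  imports
    "HOL-Library.Z2"
    "HOL-Library.Extended_Real"
    "HOL-Library.While_Combinator"
begin

section \<open>Lefschetz complexes and discrete Morse functions\<close>

text \<open>
  The functions \<open>cdim\<close> and \<open>inc\<close> are total; only their values on \<open>cells\<close> are ever used.
  The incidence \<open>inc X x y\<close> is the coefficient \<open>D(x,y)\<close> over the field with two elements.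
\<close>

record 'a lefschetz =
  cells :: "'a set"
  cdim :: "'a \<Rightarrow> nat"
  inc :: "'a \<Rightarrow> 'a \<Rightarrow> bit"

definition lefschetz_complex :: "'a lefschetz \<Rightarrow> bool" where
  "lefschetz_complex X \<longleftrightarrow>
     finite (cells X) \<and>
     (\<forall>x\<in>cells X. \<forall>y\<in>cells X. inc X x y \<noteq> 0 \<longrightarrow> cdim X x + 1 = cdim X y) \<and>
     (\<forall>x\<in>cells X. \<forall>y\<in>cells X. (\<Sum>z\<in>cells X. inc X x z * inc X z y) = 0)"

definition cells_of_dim :: "'a lefschetz \<Rightarrow> nat \<Rightarrow> 'a set" where
  "cells_of_dim X n = {x \<in> cells X. cdim X x = n}"

definition facet :: "'a lefschetz \<Rightarrow> 'a \<Rightarrow> 'a \<Rightarrow> bool" where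
  "facet X x y \<longleftrightarrow> x \<in> cells X \<and> y \<in> cells X \<and> inc X x y \<noteq> 0"

definition dMf :: "'a lefschetz \<Rightarrow> ('a \<Rightarrow> real) \<Rightarrow> bool" where
  "dMf X h \<longleftrightarrow>
     (\<forall>x\<in>cells X. \<forall>y\<in>cells X. inc X x y = 1 \<longrightarrow> h x \<le> h y) \<and>
     (\<forall>x\<in>cells X. \<forall>y\<in>cells X. x \<noteq> y \<and> h x = h y \<longrightarrow> inc X x y = 1 \<or> inc X y x = 1) \<and>
     (\<forall>a. card {x \<in> cells X. h x = a} \<le> 2)"

definition h_less :: "'a lefschetz \<Rightarrow> ('a \<Rightarrow> real) \<Rightarrow> 'a \<Rightarrow> 'a \<Rightarrow> bool" where
  "h_less X h x y \<longleftrightarrow> h x < h y \<or> h x = h y \<and> cdim X x < cdim X y"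

section \<open>Lazy reduction\<close>

text \<open>
  A matrix is indexed by cells, \<open>M x y\<close> being the entry in row \<open>x\<close> and column \<open>y\<close>; it is zero
  outside its row and column index sets. The order of the rows is a strict order \<open>r\<close>, the order of
  the columns is given by a list.
\<close>

type_synonym 'a mat = "'a \<Rightarrow> 'a \<Rightarrow> bit"

definition boundary_matrix :: "'a lefschetz \<Rightarrow> nat \<Rightarrow> 'a mat" where
  "boundary_matrix X n = (\<lambda>x y.
     if x \<in> cells X \<and> y \<in> cells X \<and> cdim X x + 1 = n \<and> cdim X y = n then inc X x y else 0)"

definition coboundary_matrix :: "'a lefschetz \<Rightarrow> nat \<Rightarrow> 'a mat" where
  "coboundary_matrix X n = (\<lambda>y x.
     if y \<in> cells X \<and> x \<in> cells X \<and> cdim X y = n + 1 \<and> cdim X x = n then inc X x y else 0)"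

definition identity_matrix :: "'a set \<Rightarrow> 'a mat" where
  "identity_matrix A = (\<lambda>x y. if x = y \<and> x \<in> A then 1 else 0)"

definition low :: "('a \<Rightarrow> 'a \<Rightarrow> bool) \<Rightarrow> 'a mat \<Rightarrow> 'a \<Rightarrow> 'a option" where
  "low r M y =
     (if \<exists>x. M x y \<noteq> 0
      then Some (THE x. M x y \<noteq> 0 \<and> (\<forall>z. M z y \<noteq> 0 \<longrightarrow> z = x \<or> r z x))
      else None)"

text \<open>\<open>add_column x y\<close> adds column \<open>x\<close> to column \<open>y\<close>; \<open>add_row x y\<close> adds row \<open>y\<close> to row \<open>x\<close>.\<close>

definition add_column :: "'a \<Rightarrow> 'a \<Rightarrow> 'a mat \<Rightarrow> 'a mat" where
  "add_column x y M = (\<lambda>i j. if j = y then M i y + M i x else M i j)"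

definition add_row :: "'a \<Rightarrow> 'a \<Rightarrow> 'a mat \<Rightarrow> 'a mat" where
  "add_row x y M = (\<lambda>i j. if i = x then M x j + M y j else M i j)"

definition reduce_column ::
    "('a \<Rightarrow> 'a \<Rightarrow> bool) \<Rightarrow> 'a list \<Rightarrow> 'a \<Rightarrow> 'a mat \<times> 'a mat \<Rightarrow> 'a mat \<times> 'a mat" where
  "reduce_column r preceding y =
     while
       (\<lambda>(R, U). low r R y \<noteq> None \<and> (\<exists>x\<in>set preceding. low r R x = low r R y))
       (\<lambda>(R, U). let x = (SOME x. x \<in> set preceding \<and> low r R x = low r R y)
                 in (add_column x y R, add_row x y U))"

definition lazy_reduction ::
    "('a \<Rightarrow> 'a \<Rightarrow> bool) \<Rightarrow> 'a list \<Rightarrow> 'a mat \<Rightarrow> 'a mat \<times> 'a mat" where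
  "lazy_reduction r cols M =
     fold (\<lambda>i. reduce_column r (take i cols) (cols ! i)) [0..<length cols]
       (M, identity_matrix (set cols))"

definition ordered_list :: "('a \<Rightarrow> 'a \<Rightarrow> bool) \<Rightarrow> 'a set \<Rightarrow> 'a list" where
  "ordered_list r A = (THE cs. set cs = A \<and> sorted_wrt r cs)"

definition reduced_boundary :: "'a lefschetz \<Rightarrow> ('a \<Rightarrow> real) \<Rightarrow> nat \<Rightarrow> 'a mat \<times> 'a mat" where
  "reduced_boundary X h n =
     (let r = h_less X h
      in lazy_reduction r (ordered_list r (cells_of_dim X n)) (boundary_matrix X n))"

definition reduced_coboundary :: "'a lefschetz \<Rightarrow> ('a \<Rightarrow> real) \<Rightarrow> nat \<Rightarrow> 'a mat \<times> 'a mat" where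
  "reduced_coboundary X h n =
     (let r = (\<lambda>x y. h_less X h y x)
      in lazy_reduction r (ordered_list r (cells_of_dim X n)) (coboundary_matrix X n))"

definition R_mat :: "'a lefschetz \<Rightarrow> ('a \<Rightarrow> real) \<Rightarrow> nat \<Rightarrow> 'a mat" where
  "R_mat X h n = fst (reduced_boundary X h n)"

definition U_mat :: "'a lefschetz \<Rightarrow> ('a \<Rightarrow> real) \<Rightarrow> nat \<Rightarrow> 'a mat" where
  "U_mat X h n = snd (reduced_boundary X h n)"

definition U_perp_mat :: "'a lefschetz \<Rightarrow> ('a \<Rightarrow> real) \<Rightarrow> nat \<Rightarrow> 'a mat" where
  "U_perp_mat X h n = snd (reduced_coboundary X h n)"

section \<open>Birth-death pairs\<close>

text \<open>The second component of a pair is \<open>None\<close> for an unpaired (birth) cell.\<close>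

type_synonym 'a bd_pair = "'a \<times> 'a option"

abbreviation birth :: "'a bd_pair \<Rightarrow> 'a" where
  "birth \<alpha> \<equiv> fst \<alpha>"

text \<open>Only meaningful for pairs whose second component is defined.\<close>

abbreviation death :: "'a bd_pair \<Rightarrow> 'a" where
  "death \<alpha> \<equiv> the (snd \<alpha>)"

definition components :: "'a bd_pair \<Rightarrow> 'a set" where
  "components \<alpha> = insert (fst \<alpha>) (set_option (snd \<alpha>))"

definition matched :: "'a lefschetz \<Rightarrow> ('a \<Rightarrow> real) \<Rightarrow> nat \<Rightarrow> 'a \<Rightarrow> 'a \<Rightarrow> bool" where
  "matched X h n x y \<longleftrightarrow>
     x \<in> cells_of_dim X n \<and> y \<in> cells_of_dim X (n + 1) \<and>
     low (h_less X h) (R_mat X h (n + 1)) y = Some x"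

definition BD_dim :: "'a lefschetz \<Rightarrow> ('a \<Rightarrow> real) \<Rightarrow> nat \<Rightarrow> 'a bd_pair set" where
  "BD_dim X h n =
     {(x, Some y) | x y. matched X h n x y} \<union>
     {(x, None) | x. x \<in> cells_of_dim X n \<and> \<not> (\<exists>m z. matched X h m x z \<or> matched X h m z x)}"

definition BD :: "'a lefschetz \<Rightarrow> ('a \<Rightarrow> real) \<Rightarrow> 'a bd_pair set" where
  "BD X h = (\<Union>n. BD_dim X h n)"

text \<open>An undefined death cell has value \<open>\<infinity>\<close>; in particular such a pair is off-diagonal.\<close>

definition birth_value :: "('a \<Rightarrow> real) \<Rightarrow> 'a bd_pair \<Rightarrow> ereal" where
  "birth_value h \<alpha> = ereal (h (fst \<alpha>))"

definition death_value :: "('a \<Rightarrow> real) \<Rightarrow> 'a bd_pair \<Rightarrow> ereal" where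
  "death_value h \<alpha> = (case snd \<alpha> of None \<Rightarrow> \<infinity> | Some y \<Rightarrow> ereal (h y))"

definition off_diagonal :: "('a \<Rightarrow> real) \<Rightarrow> 'a bd_pair set \<Rightarrow> 'a bd_pair set" where
  "off_diagonal h P = {\<alpha> \<in> P. birth_value h \<alpha> \<noteq> death_value h \<alpha>}"

definition topological_simplification ::
    "'a lefschetz \<Rightarrow> ('a \<Rightarrow> real) \<Rightarrow> ('a \<Rightarrow> real) \<Rightarrow> bool" where
  "topological_simplification X h h' \<longleftrightarrow>
     dMf X h' \<and>
     off_diagonal h' (BD X h') \<subseteq> off_diagonal h (BD X h) \<and>
     (\<forall>\<beta>\<in>off_diagonal h' (BD X h').
        birth_value h' \<beta> = birth_value h \<beta> \<and> death_value h' \<beta> = death_value h \<beta>)"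

section \<open>Homological and cohomological relations\<close>

text \<open>
  The relations are parametrised by families of matrices (indexed by dimension), so that they apply
  both to the matrices of a discrete Morse function and to those maintained by the algorithm.
  The family is \<open>U_mat X h\<close> in the homological and \<open>U_perp_mat X h\<close> in the cohomological case.
\<close>

definition cell_rel :: "'a lefschetz \<Rightarrow> (nat \<Rightarrow> 'a mat) \<Rightarrow> 'a \<Rightarrow> 'a \<Rightarrow> bool" where
  "cell_rel X U x y \<longleftrightarrow>
     x \<in> cells X \<and> y \<in> cells X \<and> x \<noteq> y \<and> cdim X x = cdim X y \<and> U (cdim X x) x y = 1"

definition hom_rel :: "'a lefschetz \<Rightarrow> (nat \<Rightarrow> 'a mat) \<Rightarrow> 'a bd_pair \<Rightarrow> 'a bd_pair \<Rightarrow> bool" where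
  "hom_rel X U \<beta> \<alpha> \<longleftrightarrow>
     \<beta> \<noteq> \<alpha> \<and> (\<exists>y c. snd \<beta> = Some y \<and> c \<in> components \<alpha> \<and> cell_rel X U y c)"

definition cohom_rel :: "'a lefschetz \<Rightarrow> (nat \<Rightarrow> 'a mat) \<Rightarrow> 'a bd_pair \<Rightarrow> 'a bd_pair \<Rightarrow> bool" where
  "cohom_rel X W \<beta> \<alpha> \<longleftrightarrow>
     \<beta> \<noteq> \<alpha> \<and> (\<exists>c. c \<in> components \<alpha> \<and> cell_rel X W (fst \<beta>) c)"

definition hom_rel_on ::
    "'a lefschetz \<Rightarrow> (nat \<Rightarrow> 'a mat) \<Rightarrow> 'a bd_pair set \<Rightarrow> ('a bd_pair \<times> 'a bd_pair) set" where
  "hom_rel_on X U Q = {(\<beta>, \<alpha>). \<beta> \<in> Q \<and> \<alpha> \<in> Q \<and> hom_rel X U \<beta> \<alpha>}"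

definition cohom_rel_on ::
    "'a lefschetz \<Rightarrow> (nat \<Rightarrow> 'a mat) \<Rightarrow> 'a bd_pair set \<Rightarrow> ('a bd_pair \<times> 'a bd_pair) set" where
  "cohom_rel_on X W Q = {(\<beta>, \<alpha>). \<beta> \<in> Q \<and> \<alpha> \<in> Q \<and> cohom_rel X W \<beta> \<alpha>}"

section \<open>Vector fields, reversible pairs and the Morse complex\<close>

definition fibre_field :: "'a lefschetz \<Rightarrow> ('a \<Rightarrow> real) \<Rightarrow> 'a set set" where
  "fibre_field X h = (\<lambda>x. {y \<in> cells X. h y = h x}) ` cells X"

definition Crit :: "'a set set \<Rightarrow> 'a set" where
  "Crit V = {x. {x} \<in> V}"

definition arc :: "'a lefschetz \<Rightarrow> 'a set set \<Rightarrow> 'a \<Rightarrow> 'a \<Rightarrow> bool" where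
  "arc X V x y \<longleftrightarrow> facet X x y \<and> {x, y} \<in> V \<or> facet X y x \<and> {x, y} \<notin> V"

definition paths :: "'a lefschetz \<Rightarrow> 'a set set \<Rightarrow> 'a \<Rightarrow> 'a \<Rightarrow> 'a list set" where
  "paths X V x y =
     {p. p \<noteq> [] \<and> set p \<subseteq> cells X \<and> hd p = x \<and> last p = y \<and> successively (arc X V) p}"

definition reaches :: "'a lefschetz \<Rightarrow> 'a set set \<Rightarrow> 'a \<Rightarrow> 'a \<Rightarrow> bool" where
  "reaches X V x y \<longleftrightarrow> paths X V x y \<noteq> {}"

definition reversible :: "'a lefschetz \<Rightarrow> ('a \<Rightarrow> real) \<Rightarrow> 'a bd_pair \<Rightarrow> bool" where
  "reversible X h \<alpha> \<longleftrightarrow>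
     \<alpha> \<in> off_diagonal h (BD X h) \<and>
     (\<exists>y. snd \<alpha> = Some y \<and> (\<exists>!p. p \<in> paths X (fibre_field X h) y (fst \<alpha>)))"

definition morse_complex :: "'a lefschetz \<Rightarrow> 'a set set \<Rightarrow> 'a lefschetz" where
  "morse_complex X V =
     \<lparr>cells = Crit V,
      cdim = cdim X,
      inc = (\<lambda>x y. if cdim X y = cdim X x + 1 then of_nat (card (paths X V y x)) else 0)\<rparr>"

section \<open>Forbidden regions\<close>

definition region_urcorner ::
    "'a lefschetz \<Rightarrow> ('a \<Rightarrow> real) \<Rightarrow> nat \<Rightarrow> 'a bd_pair \<Rightarrow> (ereal \<times> ereal) set" where
  "region_urcorner X h n \<alpha> =
     (\<Union>\<beta>\<in>{\<beta> \<in> off_diagonal h (BD_dim X h n). \<beta> \<noteq> \<alpha> \<and> hom_rel X (U_mat X h) \<beta> \<alpha>}.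
        {-\<infinity>..birth_value h \<beta>} \<times> {-\<infinity>..death_value h \<beta>}) \<union>
     (\<Union>x\<in>{x \<in> Crit (fibre_field X h).
            \<exists>d. snd \<alpha> = Some d \<and> x \<noteq> d \<and> reaches X (fibre_field X h) d x}.
        {-\<infinity>..ereal (h x)} \<times> {-\<infinity>..ereal (h x)})"

definition region_llcorner ::
    "'a lefschetz \<Rightarrow> ('a \<Rightarrow> real) \<Rightarrow> nat \<Rightarrow> 'a bd_pair \<Rightarrow> (ereal \<times> ereal) set" where
  "region_llcorner X h n \<alpha> =
     (\<Union>\<beta>\<in>{\<beta> \<in> off_diagonal h (BD_dim X h n). \<beta> \<noteq> \<alpha> \<and> cohom_rel X (U_perp_mat X h) \<beta> \<alpha>}.
        {birth_value h \<beta>..\<infinity>} \<times> {death_value h \<beta>..\<infinity>}) \<union>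
     (\<Union>y\<in>{y \<in> Crit (fibre_field X h).
            y \<noteq> fst \<alpha> \<and> reaches X (fibre_field X h) y (fst \<alpha>)}.
        {ereal (h y)..\<infinity>} \<times> {ereal (h y)..\<infinity>})"

section \<open>Moves\<close>

text \<open>The solution \<open>t\<close> of \<open>v = a * t + (1 - t) * b\<close>, for \<open>a < b\<close>.\<close>

definition lin_coeff :: "real \<Rightarrow> real \<Rightarrow> real \<Rightarrow> real" where
  "lin_coeff a b v = (b - v) / (b - a)"

definition right_bypassed ::
    "'a lefschetz \<Rightarrow> 'a bd_pair \<Rightarrow> real \<Rightarrow> ('a \<Rightarrow> real) \<Rightarrow> 'a set" where
  "right_bypassed X \<alpha> \<delta> g = {e \<in> Crit (fibre_field X g). g (birth \<alpha>) < g e \<and> g e < \<delta>}"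

definition right_move ::
    "'a lefschetz \<Rightarrow> 'a bd_pair \<Rightarrow> real \<Rightarrow> real \<Rightarrow> ('a \<Rightarrow> real) \<Rightarrow> ('a \<Rightarrow> real) \<Rightarrow> bool" where
  "right_move X \<alpha> \<delta> \<xi> g g' \<longleftrightarrow>
     (let b = birth \<alpha>; V = fibre_field X g in
        g b < \<delta> \<and> \<delta> < \<xi> \<and> \<xi> < g (death \<alpha>) \<and>
        {x \<in> cells X. \<delta> \<le> g x \<and> g x \<le> \<xi>} = {} \<and>
        card (right_bypassed X \<alpha> \<delta> g) \<le> 1 \<and>
        (\<forall>e\<in>right_bypassed X \<alpha> \<delta> g. \<not> reaches X V e b) \<and>
        g' = (\<lambda>x.
          if x \<in> cells X \<and> g b \<le> g x \<and> g x \<le> \<xi> \<and> (reaches X V x b \<or> x = b) \<and> x \<notin> Crit V - {b}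
          then let t = lin_coeff (g b) \<xi> (g x) in t * \<delta> + (1 - t) * \<xi>
          else g x))"

definition down_bypassed ::
    "'a lefschetz \<Rightarrow> 'a bd_pair \<Rightarrow> real \<Rightarrow> ('a \<Rightarrow> real) \<Rightarrow> 'a set" where
  "down_bypassed X \<alpha> \<delta> g = {e \<in> Crit (fibre_field X g). \<delta> < g e \<and> g e < g (death \<alpha>)}"

definition down_move ::
    "'a lefschetz \<Rightarrow> 'a bd_pair \<Rightarrow> real \<Rightarrow> real \<Rightarrow> ('a \<Rightarrow> real) \<Rightarrow> ('a \<Rightarrow> real) \<Rightarrow> bool" where
  "down_move X \<alpha> \<delta> \<xi> g g' \<longleftrightarrow>
     (let d = death \<alpha>; V = fibre_field X g in
        g (birth \<alpha>) < \<xi> \<and> \<xi> < \<delta> \<and> \<delta> < g d \<and>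
        {x \<in> cells X. \<xi> \<le> g x \<and> g x \<le> \<delta>} = {} \<and>
        card (down_bypassed X \<alpha> \<delta> g) \<le> 1 \<and>
        (\<forall>e\<in>down_bypassed X \<alpha> \<delta> g. \<not> reaches X V d e) \<and>
        g' = (\<lambda>x.
          if x \<in> cells X \<and> \<xi> \<le> g x \<and> g x \<le> g d \<and> (reaches X V d x \<or> x = d) \<and> x \<notin> Crit V - {d}
          then let t = lin_coeff \<xi> (g d) (g x) in t * \<xi> + (1 - t) * \<delta>
          else g x))"

section \<open>Lefschetz cancellations\<close>

definition shallow :: "'a lefschetz \<Rightarrow> ('a \<Rightarrow> real) \<Rightarrow> 'a \<Rightarrow> 'a \<Rightarrow> bool" where
  "shallow C g s t \<longleftrightarrow>
     facet C s t \<and> (\<forall>x. facet C x t \<longrightarrow> g x \<le> g s) \<and> (\<forall>y. facet C s y \<longrightarrow> g t \<le> g y)"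

definition cancel :: "'a \<Rightarrow> 'a \<Rightarrow> 'a lefschetz \<Rightarrow> 'a lefschetz" where
  "cancel s t C =
     \<lparr>cells = cells C - {s, t},
      cdim = cdim C,
      inc = (\<lambda>x y. inc C x y + inc C s y * inc C x t)\<rparr>"

text \<open>\<open>cancels_to g P C C'\<close>: cancelling the pairs of \<open>P\<close> in some order, each being shallow when it
  is cancelled, turns \<open>C\<close> into \<open>C'\<close>.\<close>

inductive cancels_to ::
    "('a \<Rightarrow> real) \<Rightarrow> 'a bd_pair set \<Rightarrow> 'a lefschetz \<Rightarrow> 'a lefschetz \<Rightarrow> bool"
  for g :: "'a \<Rightarrow> real" where
  cancels_to_empty: "cancels_to g {} C C"
| cancels_to_step:
    "\<lbrakk>(s, Some t) \<in> P; shallow C g s t; cancels_to g (P - {(s, Some t)}) (cancel s t C) C'\<rbrakk>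
     \<Longrightarrow> cancels_to g P C C'"

definition nested_pairs ::
    "('a \<Rightarrow> real) \<Rightarrow> 'a bd_pair set \<Rightarrow> 'a bd_pair \<Rightarrow> 'a bd_pair \<Rightarrow> 'a bd_pair set" where
  "nested_pairs g P \<sigma> \<tau> =
     {\<beta> \<in> off_diagonal g P - {\<sigma>, \<tau>}.
        (birth_value g \<beta>, death_value g \<beta>)
          \<in> {birth_value g \<sigma><..\<infinity>} \<times> {-\<infinity>..death_value g \<sigma>} \<union>
            {birth_value g \<tau><..\<infinity>} \<times> {-\<infinity>..death_value g \<tau>}}"

text \<open>\<open>partially_cancelled X g P \<sigma> \<tau> C\<close>: \<open>C\<close> is a complex whose incidence function provides
  \<open>D\<^bsup>\<sigma>,\<tau>\<^esup>\<close>.\<close>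

definition partially_cancelled ::
    "'a lefschetz \<Rightarrow> ('a \<Rightarrow> real) \<Rightarrow> 'a bd_pair set \<Rightarrow> 'a bd_pair \<Rightarrow> 'a bd_pair \<Rightarrow> 'a lefschetz \<Rightarrow> bool"
where
  "partially_cancelled X g P \<sigma> \<tau> C \<longleftrightarrow>
     cancels_to g (nested_pairs g P \<sigma> \<tau>) (morse_complex X (fibre_field X g)) C"

section \<open>The simplification algorithm\<close>

text \<open>
  The algorithm moves the two components of a pair towards each other (\<open>step1\<close>), first past the
  critical cells between them (\<open>bypass_step\<close>) and then past all other cells off the path connecting
  them (\<open>squeeze_step\<close>); finally it reverses that path (\<open>step2\<close>). A state consists of the current
  discrete Morse function and of the current matrices of the homological and cohomological
  relations, restricted to critical cells. The input consists of
  \<open>X\<close>, the function \<open>h\<close>, the vector field \<open>V\<close>, the set \<open>P\<close> of birth-death pairs, the relation matrices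
  \<open>U\<close> and \<open>W\<close>, and the pair \<open>\<alpha>\<close> to be removed.
\<close>

record 'a state =
  fn :: "'a \<Rightarrow> real"
  hom :: "nat \<Rightarrow> 'a mat"
  cohom :: "nat \<Rightarrow> 'a mat"

definition restrict_entries :: "'a set \<Rightarrow> (nat \<Rightarrow> 'a mat) \<Rightarrow> nat \<Rightarrow> 'a mat" where
  "restrict_entries A U = (\<lambda>n x y. if x \<in> A \<and> y \<in> A then U n x y else 0)"

definition critical_between ::
    "'a lefschetz \<Rightarrow> 'a bd_pair \<Rightarrow> ('a \<Rightarrow> real) \<Rightarrow> 'a set" where
  "critical_between X \<alpha> g =
     {x \<in> Crit (fibre_field X g). h_less X g (birth \<alpha>) x \<and> h_less X g x (death \<alpha>)}"

definition is_first :: "('a \<Rightarrow> 'a \<Rightarrow> bool) \<Rightarrow> 'a set \<Rightarrow> 'a \<Rightarrow> bool" where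
  "is_first r B x \<longleftrightarrow> x \<in> B \<and> (\<forall>z\<in>B. z = x \<or> r x z)"

definition is_last :: "('a \<Rightarrow> 'a \<Rightarrow> bool) \<Rightarrow> 'a set \<Rightarrow> 'a \<Rightarrow> bool" where
  "is_last r B x \<longleftrightarrow> x \<in> B \<and> (\<forall>z\<in>B. z = x \<or> r z x)"

definition may_move_right ::
    "'a lefschetz \<Rightarrow> 'a bd_pair set \<Rightarrow> 'a bd_pair \<Rightarrow> 'a state \<Rightarrow> 'a \<Rightarrow> bool" where
  "may_move_right X P \<alpha> s x \<longleftrightarrow>
     \<not> reaches X (fibre_field X (fn s)) x (birth \<alpha>) \<and>
     ((\<exists>\<beta>\<in>P. snd \<beta> = Some x) \<or> \<not> cell_rel X (cohom s) x (birth \<alpha>))"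

definition may_move_down ::
    "'a lefschetz \<Rightarrow> 'a bd_pair set \<Rightarrow> 'a bd_pair \<Rightarrow> 'a state \<Rightarrow> 'a \<Rightarrow> bool" where
  "may_move_down X P \<alpha> s y \<longleftrightarrow>
     \<not> reaches X (fibre_field X (fn s)) (death \<alpha>) y \<and>
     ((\<exists>\<beta>\<in>P. fst \<beta> = y) \<or> \<not> cell_rel X (hom s) y (death \<alpha>))"

text \<open>
  \<open>birth_switch X P \<alpha> e s U'\<close>: the homological matrices become \<open>U'\<close> when the birth cell of \<open>\<alpha>\<close>
  bypasses the critical cell \<open>e\<close> in state \<open>s\<close> (taken before the move). Nothing changes unless \<open>e\<close> is
  the birth cell of a pair \<open>\<beta>\<close> of the same dimension as \<open>\<alpha>\<close> with defined death cell.
\<close>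

definition birth_switch ::
    "'a lefschetz \<Rightarrow> 'a bd_pair set \<Rightarrow> 'a bd_pair \<Rightarrow> 'a \<Rightarrow> 'a state \<Rightarrow> (nat \<Rightarrow> 'a mat) \<Rightarrow> bool" where
  "birth_switch X P \<alpha> e s U' \<longleftrightarrow>
     (let k = cdim X (birth \<alpha>); g = fn s; U = hom s in
      if \<exists>y. (e, Some y) \<in> P \<and> cdim X e = k
      then \<exists>\<beta> \<sigma> \<tau> C.
        \<beta> \<in> P \<and> birth \<beta> = e \<and> snd \<beta> \<noteq> None \<and>
        {\<sigma>, \<tau>} = {\<alpha>, \<beta>} \<and> g (death \<tau>) < g (death \<sigma>) \<and>
        partially_cancelled X g P \<sigma> \<tau> C \<and>
        U' = (if \<not> cohom_rel X (cohom s) \<tau> \<sigma> \<and>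
                 (hom_rel X U \<tau> \<sigma> \<or> inc C (birth \<tau>) (death \<sigma>) = 1)
              then U(k + 1 := add_row (death \<tau>) (death \<sigma>) (U (k + 1)))
              else U)
      else U' = U)"

definition death_switch ::
    "'a lefschetz \<Rightarrow> 'a bd_pair set \<Rightarrow> 'a bd_pair \<Rightarrow> 'a \<Rightarrow> 'a state \<Rightarrow> (nat \<Rightarrow> 'a mat) \<Rightarrow> bool" where
  "death_switch X P \<alpha> e s W' \<longleftrightarrow>
     (let k = cdim X (birth \<alpha>); g = fn s; W = cohom s in
      if \<exists>x. (x, Some e) \<in> P \<and> cdim X x = k
      then \<exists>\<beta> \<sigma> \<tau> C.
        \<beta> \<in> P \<and> snd \<beta> = Some e \<and>
        {\<sigma>, \<tau>} = {\<alpha>, \<beta>} \<and> g (birth \<sigma>) < g (birth \<tau>) \<and>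
        partially_cancelled X g P \<sigma> \<tau> C \<and>
        W' = (if \<not> hom_rel X (hom s) \<tau> \<sigma> \<and>
                 (cohom_rel X W \<tau> \<sigma> \<or> inc C (birth \<sigma>) (death \<tau>) = 1)
              then W(k := add_row (birth \<tau>) (birth \<sigma>) (W k))
              else W)
      else W' = W)"

inductive bypass_step ::
    "'a lefschetz \<Rightarrow> 'a bd_pair set \<Rightarrow> 'a bd_pair \<Rightarrow> 'a state \<Rightarrow> 'a state \<Rightarrow> bool"
  for X :: "'a lefschetz" and P :: "'a bd_pair set" and \<alpha> :: "'a bd_pair" where
  bypass_right:
    "\<lbrakk>is_first (h_less X (fn s)) (critical_between X \<alpha> (fn s)) x;
      may_move_right X P \<alpha> s x;
      right_move X \<alpha> \<delta> \<xi> (fn s) g'; fn s x < \<delta>;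
      birth_switch X P \<alpha> x s U'\<rbrakk>
     \<Longrightarrow> bypass_step X P \<alpha> s \<lparr>fn = g', hom = U', cohom = cohom s\<rparr>"
| bypass_down:
    "\<lbrakk>is_first (h_less X (fn s)) (critical_between X \<alpha> (fn s)) x;
      \<not> may_move_right X P \<alpha> s x;
      is_last (h_less X (fn s)) (critical_between X \<alpha> (fn s)) y;
      may_move_down X P \<alpha> s y;
      down_move X \<alpha> \<delta> \<xi> (fn s) g'; \<delta> < fn s y;
      death_switch X P \<alpha> y s W'\<rbrakk>
     \<Longrightarrow> bypass_step X P \<alpha> s \<lparr>fn = g', hom = hom s, cohom = W'\<rparr>"

text \<open>The list \<open>x\<^sub>0, \<dots>, x\<^sub>m\<close>, i.e. the unique path read backwards from the birth to the death cell.\<close>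

definition rho :: "'a lefschetz \<Rightarrow> 'a set set \<Rightarrow> 'a bd_pair \<Rightarrow> 'a list" where
  "rho X V \<alpha> = rev (THE p. p \<in> paths X V (death \<alpha>) (birth \<alpha>))"

definition step1_done ::
    "'a lefschetz \<Rightarrow> 'a set set \<Rightarrow> 'a bd_pair \<Rightarrow> 'a state \<Rightarrow> bool" where
  "step1_done X V \<alpha> s \<longleftrightarrow>
     critical_between X \<alpha> (fn s) = {} \<and>
     {x \<in> cells X. fn s (birth \<alpha>) \<le> fn s x \<and> fn s x \<le> fn s (death \<alpha>)} = set (rho X V \<alpha>)"

inductive squeeze_step ::
    "'a lefschetz \<Rightarrow> 'a set set \<Rightarrow> 'a bd_pair \<Rightarrow> 'a state \<Rightarrow> 'a state \<Rightarrow> bool"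
  for X :: "'a lefschetz" and V :: "'a set set" and \<alpha> :: "'a bd_pair" where
  squeeze_right:
    "\<lbrakk>critical_between X \<alpha> (fn s) = {}; \<not> step1_done X V \<alpha> s;
      right_move X \<alpha> \<delta> \<xi> (fn s) g'; right_bypassed X \<alpha> \<delta> (fn s) = {}\<rbrakk>
     \<Longrightarrow> squeeze_step X V \<alpha> s (s\<lparr>fn := g'\<rparr>)"
| squeeze_down:
    "\<lbrakk>critical_between X \<alpha> (fn s) = {}; \<not> step1_done X V \<alpha> s;
      down_move X \<alpha> \<delta> \<xi> (fn s) g'; down_bypassed X \<alpha> \<delta> (fn s) = {}\<rbrakk>
     \<Longrightarrow> squeeze_step X V \<alpha> s (s\<lparr>fn := g'\<rparr>)"

definition step1 ::
    "'a lefschetz \<Rightarrow> 'a set set \<Rightarrow> 'a bd_pair set \<Rightarrow> 'a bd_pair \<Rightarrow> 'a state \<Rightarrow> 'a state \<Rightarrow> bool" where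
  "step1 X V P \<alpha> s s' \<longleftrightarrow> bypass_step X P \<alpha> s s' \<or> squeeze_step X V \<alpha> s s'"

record 'a result =
  res_complex :: "'a lefschetz"
  res_fn :: "'a \<Rightarrow> real"
  res_field :: "'a set set"
  res_pairs :: "'a bd_pair set"
  res_hom :: "('a bd_pair \<times> 'a bd_pair) set"
  res_cohom :: "('a bd_pair \<times> 'a bd_pair) set"

definition reverse_values :: "'a list \<Rightarrow> ('a \<Rightarrow> real) \<Rightarrow> 'a \<Rightarrow> real" where
  "reverse_values xs g x =
     (let m = length xs - 1 in
      if x \<in> set xs
      then let i = (THE i. i < length xs \<and> xs ! i = x) in g (xs ! (m - 2 * (i div 2)))
      else g x)"

definition reverse_field :: "'a list \<Rightarrow> 'a bd_pair \<Rightarrow> 'a set set \<Rightarrow> 'a set set" where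
  "reverse_field xs \<alpha> V =
     (V - ({S \<in> V. card S = 2 \<and> S \<subseteq> set xs} \<union> {{birth \<alpha>}, {death \<alpha>}})) \<union>
     {{xs ! (2 * j), xs ! (2 * j + 1)} | j. 2 * j + 1 < length xs}"

definition step2 ::
    "'a lefschetz \<Rightarrow> ('a \<Rightarrow> real) \<Rightarrow> 'a set set \<Rightarrow> 'a bd_pair set \<Rightarrow> 'a bd_pair \<Rightarrow> 'a state \<Rightarrow> 'a result"
where
  "step2 X h V P \<alpha> s =
     (let \<rho> = rho X V \<alpha>;
          V' = reverse_field \<rho> \<alpha> V;
          Q = off_diagonal h P - {\<alpha>}
      in \<lparr>res_complex = X,
          res_fn = reverse_values \<rho> (fn s),
          res_field = V',
          res_pairs = Q \<union> {(x, Some y) | x y. facet X x y \<and> {x, y} \<in> V'},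
          res_hom = hom_rel_on X (hom s) Q,
          res_cohom = cohom_rel_on X (cohom s) Q\<rparr>)"

text \<open>
  The choices of \<open>\<delta>\<close> and \<open>\<xi>\<close> make the algorithm nondeterministic: \<open>simplification_returns\<close> relates
  the input to the result of every completed run.
\<close>

definition simplification_returns ::
    "'a lefschetz \<Rightarrow> ('a \<Rightarrow> real) \<Rightarrow> 'a set set \<Rightarrow> 'a bd_pair set \<Rightarrow> (nat \<Rightarrow> 'a mat) \<Rightarrow>
     (nat \<Rightarrow> 'a mat) \<Rightarrow> 'a bd_pair \<Rightarrow> 'a result \<Rightarrow> bool"
where
  "simplification_returns X h V P U W \<alpha> out \<longleftrightarrow>
     (\<exists>s. (step1 X V P \<alpha>)\<^sup>*\<^sup>* \<lparr>fn = h, hom = U, cohom = W\<rparr> s \<and> step1_done X V \<alpha> s \<and>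
          out = step2 X h V P \<alpha> s)"

text \<open>
  Whatever choices are made, critical cells are bypassed only finitely often and every partial run
  can be completed. (The squeezing moves only come to an end for suitable choices, since a move may
  leave the set of cells between the components of \<open>\<alpha>\<close> unchanged.)
\<close>

definition simplification_completes ::
    "'a lefschetz \<Rightarrow> ('a \<Rightarrow> real) \<Rightarrow> 'a set set \<Rightarrow> 'a bd_pair set \<Rightarrow> (nat \<Rightarrow> 'a mat) \<Rightarrow>
     (nat \<Rightarrow> 'a mat) \<Rightarrow> 'a bd_pair \<Rightarrow> bool"
where
  "simplification_completes X h V P U W \<alpha> \<longleftrightarrow>
     (let s\<^sub>0 = \<lparr>fn = h, hom = U, cohom = W\<rparr> in
      \<not> (\<exists>run. run 0 = s\<^sub>0 \<and> (\<forall>i::nat. bypass_step X P \<alpha> (run i) (run (Suc i)))) \<and>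
      (\<forall>s. (step1 X V P \<alpha>)\<^sup>*\<^sup>* s\<^sub>0 s \<longrightarrow>
           (\<exists>s'. (step1 X V P \<alpha>)\<^sup>*\<^sup>* s s' \<and> step1_done X V \<alpha> s')))"

end

theory Submission
  imports Defs
begin

text \<open>
  The result of a lazy reduction is determined by a few of its properties (the predicate \<open>lazy\<close>):
  the pivots of the columns of \<open>R\<close> are distinct, and \<open>U x y = 1\<close> for \<open>x \<noteq> y\<close> forces \<open>x\<close> to precede
  \<open>y\<close> and the pivot of \<open>x\<close> to lie below that of \<open>y\<close>. Hence the effect of a change of the order can
  be found by exhibiting a factorisation with these properties for the new order. By this principle
  the entries between critical cells are computed by the reduction of the Morse complex, so a move
  matters only if it transposes two adjacent critical cells, and it then changes at most one row of
  one of the matrices \<open>U\<close>, which is decided by a minor that survives the cancellation of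
  the nested pairs. Cohomology is homology of the dual complex.

  Bypassing a cell never creates a relation into the pair \<open>\<alpha>\<close>. So if both moves are blocked, the cells
  responsible give rectangles of the forbidden regions of the original function; their corners have
  values of critical cells between the components of \<open>\<alpha>\<close>, where the first and the last one are
  extremal, and the rectangles meet. Once nothing but the path is left between the components,
  reversing it only permutes a block of consecutive cells which are paired among each other,
  and all other pairs and relations are kept.
\<close>

section \<open>Lazily reduced matrices\<close>

text \<open>Two critical n-cells that change places are columns of \<open>D_n\<close> and of its
  coboundary counterpart, and rows of the boundary matrix one dimension above and of the coboundary
  matrix one dimension below. As columns they can be exchanged as long as neither is added to the
  other, which the tests before a move guarantee together with the roles of the components of
  \<alpha> as birth and death cell; as rows they may force one column addition. This is why row
  order and column order are separate parameters throughout. That the pairing survives is invisible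
  in the matrix whose rows change; it is read off the transposed matrix, where the same two cells
  are columns. So duality is needed even for the homological relations alone. A move also shifts
  many noncritical cells, which disturbs the orders of the full matrices. The remedy is the
  functional that counts, mod 2, the paths from a cell to a fixed critical cell: it annihilates the
  reduced columns of all noncritical cells and turns the columns of critical cells into the Morse
  boundary, which depends on the vector field only.\<close>

declare add_bit_eq_xor [simp del] mult_bit_eq_and [simp del]

lemma bit_mult_eq_1_iff: "a * b = 1 \<longleftrightarrow> a = 1 \<and> b = 1" for a b :: bit
  by (cases a; cases b) auto

lemma bit_add_self: "a + a = 0" for a :: bit
  by (cases a) auto

lemma bit_add_eq_0_iff: "a + b = 0 \<longleftrightarrow> a = b" for a b :: bit
  by (cases a; cases b) auto

lemma bit_add_swap: "a + b = c + d \<Longrightarrow> a + c = b + d" for a b c d :: bit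
  by (cases a; cases b; cases c; cases d) auto

lemma bit_sum_eq_1D: "(\<Sum>x\<in>A. f x) = (1::bit) \<Longrightarrow> \<exists>x\<in>A. f x = 1"
  by (rule ccontr) (simp add: sum.neutral)

lemma bit_sum_eq_0I: "(\<And>x. x \<in> A \<Longrightarrow> f x = 1 \<Longrightarrow> False) \<Longrightarrow> (\<Sum>x\<in>A. f x) = (0::bit)"
  using bit_sum_eq_1D[of f A] by (cases "\<Sum>x\<in>A. f x") auto

lemma bit_sum_mult_eq_1D: "(\<Sum>x\<in>A. f x * g x) = (1::bit) \<Longrightarrow> \<exists>x\<in>A. f x = 1 \<and> g x = 1"
  using bit_sum_eq_1D[of "\<lambda>x. f x * g x" A] by (simp add: bit_mult_eq_1_iff)

text \<open>Totality is demanded on \<open>A\<close> only, because the order by values alone does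
  not separate the two cells of a vector and is total only on sets such as the critical cells. The
  other laws hold on the whole type, so passing to subsets costs nothing.\<close>

definition lin :: "('a \<Rightarrow> 'a \<Rightarrow> bool) \<Rightarrow> 'a set \<Rightarrow> bool" where
  "lin r A \<longleftrightarrow> (\<forall>x. \<not> r x x) \<and> (\<forall>x y z. r x y \<longrightarrow> r y z \<longrightarrow> r x z) \<and>
     (\<forall>x\<in>A. \<forall>y\<in>A. x = y \<or> r x y \<or> r y x)"

lemma lin_irrefl: "lin r A \<Longrightarrow> \<not> r x x"
  and lin_trans: "lin r A \<Longrightarrow> r x y \<Longrightarrow> r y z \<Longrightarrow> r x z"
  and lin_asym: "lin r A \<Longrightarrow> r x y \<Longrightarrow> \<not> r y x"
  and lin_total: "lin r A \<Longrightarrow> x \<in> A \<Longrightarrow> y \<in> A \<Longrightarrow> x = y \<or> r x y \<or> r y x"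
  unfolding lin_def by blast+

lemma lin_converse: "lin r A \<Longrightarrow> lin (\<lambda>x y. r y x) A"
  unfolding lin_def by blast

lemma lin_subset: "lin r A \<Longrightarrow> B \<subseteq> A \<Longrightarrow> lin r B"
  unfolding lin_def by blast

lemma lin_max:
  assumes "lin r A" "finite B" "B \<noteq> {}" "B \<subseteq> A"
  shows "\<exists>m\<in>B. \<forall>x\<in>B. x = m \<or> r x m"
  using assms(2-4)
proof (induction B rule: finite_ne_induct)
  case (singleton x)
  then show ?case by blast
next
  case (insert x F)
  then obtain m where m: "m \<in> F" "\<forall>x\<in>F. x = m \<or> r x m" by auto
  then have "x = m \<or> r x m \<or> r m x"
    using lin_total[OF assms(1)] insert.prems by blast
  then show ?case
    using m lin_trans[OF assms(1)] by (metis insert_iff)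
qed

text \<open>The number of predecessors in the finite set \<open>J\<close> drops. This is the
  induction over the columns from left to right on which the arguments about reductions
  rest.\<close>

lemma lin_induct [consumes 3, case_names step]:
  assumes "lin c J" "finite J" "y \<in> J"
    and step: "\<And>y. y \<in> J \<Longrightarrow> (\<And>x. x \<in> J \<Longrightarrow> c x y \<Longrightarrow> Q x) \<Longrightarrow> Q y"
  shows "Q y"
  using assms(3)
proof (induction "card {x \<in> J. c x y}" arbitrary: y rule: less_induct)
  case less
  show ?case
  proof (rule step[OF less.prems])
    fix x assume x: "x \<in> J" "c x y"
    have "{z \<in> J. c z x} \<subset> {z \<in> J. c z y}"
      using x lin_trans[OF assms(1)] lin_irrefl[OF assms(1)] by blast
    then have "card {z \<in> J. c z x} < card {z \<in> J. c z y}"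
      using assms(2) by (intro psubset_card_mono) auto
    then show "Q x" using less.hyps x(1) by blast
  qed
qed

text \<open>A relational version of \<open>low\<close>: a zero column simply has no lead, and
  entries outside \<open>I\<close> are ignored, so that the same columns can be read on fewer
  rows.\<close>

definition lead :: "('a \<Rightarrow> 'a \<Rightarrow> bool) \<Rightarrow> 'a set \<Rightarrow> ('a \<Rightarrow> bit) \<Rightarrow> 'a \<Rightarrow> bool" where
  "lead r I v a \<longleftrightarrow> a \<in> I \<and> v a = 1 \<and> (\<forall>z\<in>I. v z = 1 \<longrightarrow> z = a \<or> r z a)"

abbreviation pivot :: "('a \<Rightarrow> 'a \<Rightarrow> bool) \<Rightarrow> 'a set \<Rightarrow> 'a mat \<Rightarrow> 'a \<Rightarrow> 'a \<Rightarrow> bool" where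
  "pivot r I R y a \<equiv> lead r I (\<lambda>i. R i y) a"

lemma lead_exists:
  assumes "lin r I" "finite I" "i \<in> I" "v i = 1"
  shows "\<exists>a. lead r I v a \<and> (i = a \<or> r i a)"
  using lin_max[OF assms(1), of "{i\<in>I. v i = 1}"] assms unfolding lead_def by auto

lemma lead_unique: "lin r I \<Longrightarrow> lead r I v a \<Longrightarrow> lead r I v b \<Longrightarrow> a = b"
  unfolding lead_def using lin_asym by metis

lemma lead_cong: "(\<And>i. i \<in> I \<Longrightarrow> v i = w i) \<Longrightarrow> lead r I v a = lead r I w a"
  unfolding lead_def by auto

text \<open>Each addition of the lazy reduction cancels the current lowest entry, so every column
  added to \<open>y\<close> has its pivot strictly below the final one of \<open>y\<close>; if
  \<open>y\<close> becomes zero the comparison is vacuous. An arbitrary reduction need not have this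
  property, and it is what pins down \<open>U\<close>. The order \<open>r\<close> of the rows and
  the order \<open>c\<close> of the columns are independent.\<close>

definition lazy ::
    "('a \<Rightarrow> 'a \<Rightarrow> bool) \<Rightarrow> ('a \<Rightarrow> 'a \<Rightarrow> bool) \<Rightarrow> 'a set \<Rightarrow> 'a set \<Rightarrow> 'a mat \<Rightarrow> 'a mat \<Rightarrow> 'a mat \<Rightarrow> bool"
where
  "lazy r c I J M R U \<longleftrightarrow>
     finite I \<and> finite J \<and> lin r I \<and> lin c J \<and>
     (\<forall>i\<in>I. \<forall>y\<in>J. M i y = (\<Sum>x\<in>J. R i x * U x y)) \<and>
     (\<forall>y\<in>J. U y y = 1) \<and>
     (\<forall>x\<in>J. \<forall>y\<in>J. U x y = 1 \<longrightarrow> x \<noteq> y \<longrightarrow>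
        c x y \<and> (\<exists>a. pivot r I R x a \<and> (\<forall>b. pivot r I R y b \<longrightarrow> r b a))) \<and>
     (\<forall>x\<in>J. \<forall>y\<in>J. \<forall>a. pivot r I R x a \<longrightarrow> pivot r I R y a \<longrightarrow> x = y)"

lemma lazyD:
  assumes "lazy r c I J M R U"
  shows lazy_finI: "finite I" and lazy_finJ: "finite J" and lazy_linI: "lin r I"
    and lazy_linJ: "lin c J"
    and lazy_eq: "i \<in> I \<Longrightarrow> y \<in> J \<Longrightarrow> M i y = (\<Sum>x\<in>J. R i x * U x y)"
    and lazy_diag: "y \<in> J \<Longrightarrow> U y y = 1"
    and lazy_upper: "x \<in> J \<Longrightarrow> y \<in> J \<Longrightarrow> U x y = 1 \<Longrightarrow> x \<noteq> y \<Longrightarrow> c x y"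
    and lazy_pivot: "x \<in> J \<Longrightarrow> y \<in> J \<Longrightarrow> U x y = 1 \<Longrightarrow> x \<noteq> y \<Longrightarrow>
      \<exists>a. pivot r I R x a \<and> (\<forall>b. pivot r I R y b \<longrightarrow> r b a)"
    and lazy_inj: "x \<in> J \<Longrightarrow> y \<in> J \<Longrightarrow> pivot r I R x a \<Longrightarrow> pivot r I R y a \<Longrightarrow> x = y"
  using assms unfolding lazy_def by blast+

lemma lazy_eq':
  assumes "lazy r c I J M R U" "i \<in> I" "y \<in> J"
  shows "M i y = R i y + (\<Sum>x\<in>J - {y}. R i x * U x y)"
  using lazy_eq[OF assms] lazy_diag[OF assms(1,3)] assms(3) lazy_finJ[OF assms(1)]
  by (simp add: sum.remove)

text \<open>The lowest of the pivots involved cannot cancel, since pivots are distinct and every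
  entry of a column lies at or above its pivot.\<close>

lemma comb_lead:
  assumes "finite I" "finite J" "lin r I"
    and inj: "\<And>x y a. x \<in> J \<Longrightarrow> y \<in> J \<Longrightarrow> pivot r I R x a \<Longrightarrow> pivot r I R y a \<Longrightarrow> x = y"
    and z: "z \<in> J" "a z = 1" "pivot r I R z l"
  shows "\<exists>z\<in>J. \<exists>l. a z = 1 \<and> pivot r I R z l \<and> lead r I (\<lambda>i. \<Sum>x\<in>J. R i x * a x) l \<and>
           (\<forall>z'\<in>J. \<forall>l'. a z' = 1 \<longrightarrow> pivot r I R z' l' \<longrightarrow> l' = l \<or> r l' l)"
proof -
  let ?P = "{l \<in> I. \<exists>z\<in>J. a z = 1 \<and> pivot r I R z l}"
  have "l \<in> ?P" using z unfolding lead_def by blast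
  then obtain m where m: "m \<in> ?P" and max: "\<forall>x\<in>?P. x = m \<or> r x m"
    using lin_max[OF assms(3), of ?P] assms(1) by auto
  then obtain w where w: "w \<in> J" "a w = 1" "pivot r I R w m" by blast
  have bd: "i = m \<and> x = w \<or> r i m" if "i \<in> I" "x \<in> J" "R i x * a x = 1" for i x
  proof -
    have "R i x = 1" "a x = 1" using that(3) by (auto simp: bit_mult_eq_1_iff)
    then obtain b where b: "pivot r I R x b" "i = b \<or> r i b"
      using lead_exists[OF assms(3,1), of i "\<lambda>i. R i x"] \<open>i \<in> I\<close> by auto
    then have "b \<in> ?P" using \<open>a x = 1\<close> that(2) unfolding lead_def by blast
    then have "b = m \<or> r b m" using max by blast
    then show ?thesis using b lin_trans[OF assms(3)] inj[OF that(2) w(1)] w(3) by blast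
  qed
  have "(\<Sum>x\<in>J. R m x * a x) = R m w * a w + (\<Sum>x\<in>J-{w}. R m x * a x)"
    using w(1) assms(2) by (simp add: sum.remove)
  also have "(\<Sum>x\<in>J-{w}. R m x * a x) = 0"
    using bd[of m] m lin_irrefl[OF assms(3), of m] by (intro bit_sum_eq_0I) blast
  also have "R m w * a w = 1" using w unfolding lead_def by simp
  finally have s1: "(\<Sum>x\<in>J. R m x * a x) = 1" by simp
  have "lead r I (\<lambda>i. \<Sum>x\<in>J. R i x * a x) m"
    unfolding lead_def
  proof (intro conjI ballI impI)
    show "m \<in> I" using m by blast
    fix i assume "i \<in> I" "(\<Sum>x\<in>J. R i x * a x) = 1"
    then show "i = m \<or> r i m" using bd bit_sum_eq_1D by blast
  qed (rule s1)
  moreover have "\<forall>z'\<in>J. \<forall>l'. a z' = 1 \<longrightarrow> pivot r I R z' l' \<longrightarrow> l' = m \<or> r l' m"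
    using max unfolding lead_def by blast
  ultimately show ?thesis using w by blast
qed

lemma lazy_comb_lead:
  assumes "lazy r c I J M R U" "K \<subseteq> J" "z \<in> K" "a z = 1" "pivot r I R z l"
  shows "\<exists>z\<in>K. \<exists>l. a z = 1 \<and> pivot r I R z l \<and> lead r I (\<lambda>i. \<Sum>x\<in>K. R i x * a x) l \<and>
           (\<forall>z'\<in>K. \<forall>l'. a z' = 1 \<longrightarrow> pivot r I R z' l' \<longrightarrow> l' = l \<or> r l' l)"
proof (rule comb_lead)
  show "finite K" using lazy_finJ[OF assms(1)] assms(2) by (rule rev_finite_subset)
  show "x = y" if "x \<in> K" "y \<in> K" "pivot r I R x a" "pivot r I R y a" for x y a
    using lazy_inj[OF assms(1)] that assms(2) by blast
qed (use assms lazyD(1,3)[OF assms(1)] in auto)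

lemma lazy_comb_nonzero:
  assumes "lazy r c I J M R U" "K \<subseteq> J" "i \<in> I" "(\<Sum>x\<in>K. R i x * a x) = 1"
  shows "\<exists>z\<in>K. \<exists>l. a z = 1 \<and> pivot r I R z l \<and> lead r I (\<lambda>i. \<Sum>x\<in>K. R i x * a x) l \<and>
           (\<forall>z'\<in>K. \<forall>l'. a z' = 1 \<longrightarrow> pivot r I R z' l' \<longrightarrow> l' = l \<or> r l' l)"
proof -
  obtain x where "x \<in> K" "R i x = 1" "a x = 1"
    using bit_sum_mult_eq_1D[OF assms(4)] by blast
  moreover obtain b where "pivot r I R x b"
    using lead_exists[OF lazy_linI[OF assms(1)] lazy_finI[OF assms(1)] assms(3), of "\<lambda>i. R i x"]
      \<open>R i x = 1\<close> by auto
  ultimately show ?thesis using lazy_comb_lead[OF assms(1,2)] by blast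
qed

text \<open>Column \<open>y\<close> of \<open>R\<close> is a combination of columns of
  \<open>M\<close> up to \<open>y\<close>. Only one such column with an entry in row
  \<open>i\<close> is kept, which is enough to bound values of rows by values of columns.\<close>

lemma lazy_support:
  assumes L: "lazy r c I J M R U" and "i \<in> I" "y \<in> J" "R i y = 1"
  shows "\<exists>x\<in>J. (x = y \<or> c x y) \<and> M i x = 1"
  using lazy_linJ[OF L] lazy_finJ[OF L] assms(3,4)
proof (induction y rule: lin_induct)
  case (step y)
  show ?case
  proof (cases "M i y = 1")
    case False
    then have "(\<Sum>x\<in>J - {y}. R i x * U x y) = 1"
      using lazy_eq'[OF L assms(2) step.hyps] step.prems by auto
    then obtain x where x: "x \<in> J" "x \<noteq> y" "R i x = 1" "U x y = 1"
      using bit_sum_mult_eq_1D[of "\<lambda>x. R i x" "\<lambda>x. U x y" "J - {y}"] by auto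
    then have "c x y" using lazy_upper[OF L] step.hyps by blast
    then show ?thesis using step.IH[OF x(1)] x lin_trans[OF lazy_linJ[OF L]] by blast
  qed (use step in blast)
qed

text \<open>The columns of \<open>R\<close> lie in the span of those of \<open>M\<close>. With the
  rows of the preceding boundary matrix as functionals this shows that reduced columns are
  cycles.\<close>

lemma lazy_functional:
  assumes L: "lazy r c I J M R U" and f: "\<And>y. y \<in> J \<Longrightarrow> (\<Sum>i\<in>I. f i * M i y) = 0"
    and "y \<in> J"
  shows "(\<Sum>i\<in>I. f i * R i y) = 0"
  using lazy_linJ[OF L] lazy_finJ[OF L] assms(3)
proof (induction y rule: lin_induct)
  case (step y)
  have "0 = (\<Sum>i\<in>I. f i * M i y)" using f step by simp
  also have "\<dots> = (\<Sum>i\<in>I. f i * R i y) + (\<Sum>i\<in>I. \<Sum>x\<in>J - {y}. f i * (R i x * U x y))"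
    by (simp add: lazy_eq'[OF L _ step.hyps] distrib_left sum.distrib sum_distrib_left)
  also have "(\<Sum>i\<in>I. \<Sum>x\<in>J - {y}. f i * (R i x * U x y)) =
      (\<Sum>x\<in>J - {y}. U x y * (\<Sum>i\<in>I. f i * R i x))"
    by (subst sum.swap) (simp add: sum_distrib_left algebra_simps)
  also have "\<dots> = 0"
  proof (rule sum.neutral, rule ballI)
    fix x assume x: "x \<in> J - {y}"
    show "U x y * (\<Sum>i\<in>I. f i * R i x) = 0"
      using step.IH[of x] lazy_upper[OF L, of x y] x step.hyps by (cases "U x y") auto
  qed
  finally show ?case by simp
qed

text \<open>\<open>a\<close> is column \<open>y\<close> of the inverse of the unitriangular matrix
  \<open>U\<close>, obtained by substitution from left to right.\<close>

lemma lazy_inverse: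
  assumes L: "lazy r c I J M R U" and "y \<in> J"
  shows "\<exists>a. a y = 1 \<and> (\<forall>x\<in>J. a x = 1 \<longrightarrow> x = y \<or> c x y) \<and>
           (\<forall>i\<in>I. R i y = (\<Sum>x\<in>J. M i x * a x))"
  using lazy_linJ[OF L] lazy_finJ[OF L] assms(2)
proof (induction y rule: lin_induct)
  case (step y)
  have "\<forall>x. \<exists>a. x \<in> J \<longrightarrow> c x y \<longrightarrow> a x = 1 \<and> (\<forall>z\<in>J. a z = 1 \<longrightarrow> z = x \<or> c z x) \<and>
           (\<forall>i\<in>I. R i x = (\<Sum>z\<in>J. M i z * a z))"
    using step.IH by blast
  then obtain a where a: "\<And>x. x \<in> J \<Longrightarrow> c x y \<Longrightarrow> a x x = 1 \<and>
      (\<forall>z\<in>J. a x z = 1 \<longrightarrow> z = x \<or> c z x) \<and> (\<forall>i\<in>I. R i x = (\<Sum>z\<in>J. M i z * a x z))"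
    by metis
  define b where "b z = (if z = y then 1 else 0) + (\<Sum>x\<in>J - {y}. a x z * U x y)" for z
  have lower: "c z y" if "z \<in> J" "x \<in> J - {y}" "a x z * U x y = 1" for x z
  proof -
    have "a x z = 1" "U x y = 1" using that(3) by (auto simp: bit_mult_eq_1_iff)
    then have "c x y" using lazy_upper[OF L] that step.hyps by blast
    then have "z = x \<or> c z x" using a that \<open>a x z = 1\<close> by blast
    then show ?thesis using \<open>c x y\<close> lin_trans[OF lazy_linJ[OF L]] by blast
  qed
  have "b y = 1 + 0"
  proof -
    have "(\<Sum>x\<in>J - {y}. a x y * U x y) = 0"
      using lower[OF step.hyps] lin_irrefl[OF lazy_linJ[OF L]] by (intro bit_sum_eq_0I) blast
    then show ?thesis unfolding b_def by simp
  qed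
  moreover have "x = y \<or> c x y" if "x \<in> J" "b x = 1" for x
    using that lower[OF that(1)] bit_sum_eq_1D[of "\<lambda>z. a z x * U z y" "J - {y}"]
    unfolding b_def by (auto split: if_splits)
  moreover have "R i y = (\<Sum>x\<in>J. M i x * b x)" if i: "i \<in> I" for i
  proof -
    have *: "M i x * b x = (if x = y then M i x else 0) + (\<Sum>z\<in>J - {y}. M i x * (a z x * U z y))" for x
      unfolding b_def by (simp add: distrib_left sum_distrib_left)
    have "(\<Sum>x\<in>J. M i x * b x) =
        (\<Sum>x\<in>J. if x = y then M i x else 0) + (\<Sum>z\<in>J. \<Sum>x\<in>J - {y}. M i z * (a x z * U x y))"
      by (simp only: * sum.distrib)
    also have "(\<Sum>x\<in>J. if x = y then M i x else 0) = M i y"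
      using step.hyps lazy_finJ[OF L] by simp
    also have "(\<Sum>z\<in>J. \<Sum>x\<in>J - {y}. M i z * (a x z * U x y)) =
        (\<Sum>x\<in>J - {y}. U x y * (\<Sum>z\<in>J. M i z * a x z))"
      by (subst sum.swap) (simp add: sum_distrib_left algebra_simps)
    also have "\<dots> = (\<Sum>x\<in>J - {y}. R i x * U x y)"
    proof (rule sum.cong[OF refl])
      fix x assume x: "x \<in> J - {y}"
      show "U x y * (\<Sum>z\<in>J. M i z * a x z) = R i x * U x y"
        using a[of x] lazy_upper[OF L, of x y] x step.hyps i by (cases "U x y") auto
    qed
    finally show ?thesis
      using lazy_eq'[OF L i step.hyps] by (simp add: add.assoc bit_add_self)
  qed
  ultimately show ?case by auto
qed

text \<open>By induction the two factorisations agree on all columns before \<open>y\<close>, so the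
  difference of the two columns \<open>y\<close> is a combination of these. If a column with a pivot
  occurs in it, let \<open>l\<close> be the lowest pivot and \<open>z\<close> its column. Then
  \<open>z\<close> is added to \<open>y\<close> in one factorisation, whose column \<open>y\<close>
  therefore vanishes at \<open>l\<close> and beyond; so the column \<open>y\<close> of the other one
  has pivot \<open>l\<close>, which already belongs to \<open>z\<close>.\<close>

lemma lazy_unique:
  assumes L: "lazy r c I J M R U" and L': "lazy r c I J M R' U'" and "y \<in> J"
  shows "(\<forall>i\<in>I. R i y = R' i y) \<and> (\<forall>x\<in>J. U x y = U' x y)"
  using lazy_linJ[OF L] lazy_finJ[OF L] assms(3)
proof (induction y rule: lin_induct)
  case (step y)
  note fin = lazy_finI[OF L] lazy_finJ[OF L] and li = lazy_linI[OF L]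
  have cl: "c x y" if "x \<in> J - {y}" "U x y + U' x y = 1" for x
    using that lazy_upper[OF L, of x y] lazy_upper[OF L', of x y] step.hyps
    by (cases "U x y"; cases "U' x y") auto
  let ?K = "{x \<in> J. c x y}"
  let ?d = "\<lambda>x. U x y + U' x y"
  have KJ: "?K \<subseteq> J" by blast
  have U0: "U x y = 0 \<and> U' x y = 0" if "x \<in> J - {y} - ?K" for x
    using that lazy_upper[OF L, of x y] lazy_upper[OF L', of x y] step.hyps
    by (cases "U x y"; cases "U' x y") auto
  have KJ': "?K \<subseteq> J - {y}" using lin_irrefl[OF lazy_linJ[OF L]] by blast
  have RR: "R i y + R' i y = (\<Sum>x\<in>?K. R i x * ?d x)" if i: "i \<in> I" for i
  proof -
    have "R i y + (\<Sum>x\<in>J - {y}. R i x * U x y) = R' i y + (\<Sum>x\<in>J - {y}. R' i x * U' x y)"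
      using lazy_eq'[OF L i step.hyps] lazy_eq'[OF L' i step.hyps] by simp
    moreover have "(\<Sum>x\<in>J - {y}. R i x * U x y) = (\<Sum>x\<in>?K. R i x * U x y)"
      using U0 KJ' fin by (intro sum.mono_neutral_right) auto
    moreover have "(\<Sum>x\<in>J - {y}. R' i x * U' x y) = (\<Sum>x\<in>?K. R' i x * U' x y)"
      using U0 KJ' fin by (intro sum.mono_neutral_right) auto
    moreover have "(\<Sum>x\<in>?K. R' i x * U' x y) = (\<Sum>x\<in>?K. R i x * U' x y)"
      using step.IH i by (intro sum.cong) auto
    ultimately have "R i y + (\<Sum>x\<in>?K. R i x * U x y) = R' i y + (\<Sum>x\<in>?K. R i x * U' x y)"
      by simp
    then have "R i y + R' i y = (\<Sum>x\<in>?K. R i x * U x y) + (\<Sum>x\<in>?K. R i x * U' x y)"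
      by (rule bit_add_swap)
    then show ?thesis by (simp add: sum.distrib distrib_left)
  qed
  have pivK: "pivot r I R x a \<longleftrightarrow> pivot r I R' x a" if "x \<in> ?K" for x a
    using step.IH that by (intro lead_cong) auto
  have no: "?d x = 0" if xK: "x \<in> ?K" for x
  proof (rule ccontr)
    assume "?d x \<noteq> 0"
    then have d: "?d x = 1" by simp
    have xJ: "x \<in> J" "x \<noteq> y" using xK KJ' by auto
    obtain a where a: "pivot r I R x a"
      using d lazy_pivot[OF L xJ(1) step.hyps] lazy_pivot[OF L' xJ(1) step.hyps] xJ pivK[OF xK]
      by (cases "U x y"; cases "U' x y") auto
    obtain z l where z: "z \<in> ?K" "?d z = 1" "pivot r I R z l"
      and l: "lead r I (\<lambda>i. \<Sum>x\<in>?K. R i x * ?d x) l"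
      using lazy_comb_lead[OF L KJ xK, of ?d] d a by blast
    have zJ: "z \<in> J" "z \<noteq> y" using z KJ' by auto
    have l': "lead r I (\<lambda>i. R i y + R' i y) l"
      using l RR by (subst lead_cong[where w = "\<lambda>i. \<Sum>x\<in>?K. R i x * ?d x"]) auto
    have "l \<in> I" using l unfolding lead_def by blast
    have nl: "\<not> pivot r I R y l" "\<not> pivot r I R' y l"
      using lazy_inj[OF L zJ(1) step.hyps z(3)] zJ lazy_inj[OF L' zJ(1) step.hyps] pivK[OF z(1)] z(3)
      by auto
    have big: "(\<forall>b. pivot r I R y b \<longrightarrow> r b l) \<or> (\<forall>b. pivot r I R' y b \<longrightarrow> r b l)"
    proof (cases "U z y = 1")
      case True
      then show ?thesis
        using lazy_pivot[OF L zJ(1) step.hyps] zJ z(3) lead_unique[OF li] by metis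
    next
      case False
      then have "U' z y = 1" using z(2) by auto
      then show ?thesis
        using lazy_pivot[OF L' zJ(1) step.hyps] zJ z(3) pivK[OF z(1)] lead_unique[OF li] by metis
    qed
    text \<open>The column whose pivot lies below \<open>l\<close> vanishes at and beyond \<open>l\<close>, so \<open>l\<close> is a pivot of the other.\<close>
    have van: "\<forall>i\<in>I. i = l \<or> r l i \<longrightarrow> S i = 0"
      if "\<forall>b. lead r I S b \<longrightarrow> r b l" for S
    proof (intro ballI impI)
      fix i assume i: "i \<in> I" "i = l \<or> r l i"
      show "S i = 0"
      proof (rule ccontr)
        assume "S i \<noteq> 0"
        then obtain b where "lead r I S b" "i = b \<or> r i b"
          using lead_exists[OF li fin(1) i(1), of S] by auto
        then show False
          using that i lin_trans[OF li] lin_irrefl[OF li] by metis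
      qed
    qed
    have piv: "lead r I S l" if S0: "\<forall>i\<in>I. i = l \<or> r l i \<longrightarrow> T i = 0"
      and ST: "lead r I (\<lambda>i. S i + T i) l" for S T
      unfolding lead_def
    proof (intro conjI ballI impI)
      show "l \<in> I" by fact
      show "S l = 1" using S0 ST \<open>l \<in> I\<close> unfolding lead_def by auto
      fix i assume "i \<in> I" "S i = 1"
      then show "i = l \<or> r i l"
        using S0 ST lin_total[OF li \<open>i \<in> I\<close> \<open>l \<in> I\<close>] unfolding lead_def
        by (metis add.right_neutral)
    qed
    from big show False
    proof
      assume "\<forall>b. pivot r I R y b \<longrightarrow> r b l"
      then have "pivot r I R' y l"
        using piv[OF van, of "\<lambda>i. R i y" "\<lambda>i. R' i y"] l' by (simp add: add.commute)
      then show False using nl by blast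
    next
      assume "\<forall>b. pivot r I R' y b \<longrightarrow> r b l"
      then have "pivot r I R y l"
        using piv[OF van, of "\<lambda>i. R' i y" "\<lambda>i. R i y"] l' by simp
      then show False using nl by blast
    qed
  qed
  have "U x y = U' x y" if "x \<in> J" for x
  proof (cases "x \<in> ?K")
    case True
    then show ?thesis using no bit_add_eq_0_iff by blast
  next
    case False
    then show ?thesis
      using U0[of x] that lazy_diag[OF L] lazy_diag[OF L'] by (cases "x = y") auto
  qed
  moreover have "R i y = R' i y" if "i \<in> I" for i
  proof -
    have "(\<Sum>x\<in>?K. R i x * ?d x) = 0" using no by (intro bit_sum_eq_0I) (auto simp: bit_mult_eq_1_iff)
    then show ?thesis using RR[OF that] bit_add_eq_0_iff by metis
  qed
  ultimately show ?case by blast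
qed

lemma lazy_unique_pivot:
  assumes "lazy r c I J M R U" "lazy r c I J M R' U'" "y \<in> J"
  shows "pivot r I R y a \<longleftrightarrow> pivot r I R' y a"
  using lazy_unique[OF assms] by (intro lead_cong) auto

section \<open>Duality and reordering\<close>

abbreviation (input) conv :: "('a \<Rightarrow> 'a \<Rightarrow> bool) \<Rightarrow> 'a \<Rightarrow> 'a \<Rightarrow> bool" where
  "conv r \<equiv> \<lambda>x y. r y x"

text \<open>The value b^T M a is computed in two ways, where \<open>M a\<close> is column
  \<open>y\<close> of \<open>R\<close> and \<open>M^T b\<close> is column \<open>x\<close> of
  \<open>R'\<close>. Since \<open>b\<close> starts at \<open>x\<close> and column \<open>y\<close>
  ends at \<open>x\<close>, the value is 1. Hence column \<open>x\<close> of \<open>R'\<close> meets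
  the support of \<open>a\<close>, which ends at \<open>y\<close>.\<close>

lemma lazy_dual_nonzero:
  assumes L: "lazy r c I J M R U" and L': "lazy (conv c) (conv r) J I (\<lambda>y x. M x y) R' U'"
    and "y \<in> J" and piv: "pivot r I R y x"
  shows "\<exists>y1. pivot (conv c) J R' x y1 \<and> (y1 = y \<or> c y1 y)"
proof -
  have x: "x \<in> I" using piv unfolding lead_def by blast
  obtain a where a: "\<forall>z\<in>J. a z = 1 \<longrightarrow> z = y \<or> c z y"
    "\<forall>i\<in>I. R i y = (\<Sum>z\<in>J. M i z * a z)"
    using lazy_inverse[OF L \<open>y \<in> J\<close>] by metis
  obtain b where b: "b x = 1" "\<forall>z\<in>I. b z = 1 \<longrightarrow> z = x \<or> r x z"
    "\<forall>j\<in>J. R' j x = (\<Sum>z\<in>I. M z j * b z)"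
    using lazy_inverse[OF L' x] by metis
  have "(\<Sum>j\<in>J. R' j x * a j) = (\<Sum>j\<in>J. \<Sum>z\<in>I. M z j * b z * a j)"
    by (intro sum.cong) (auto simp: b(3) sum_distrib_right)
  also have "\<dots> = (\<Sum>z\<in>I. \<Sum>j\<in>J. M z j * b z * a j)" by (rule sum.swap)
  also have "\<dots> = (\<Sum>z\<in>I. b z * R z y)"
    by (intro sum.cong) (auto simp: a(2) sum_distrib_left algebra_simps)
  also have "\<dots> = b x * R x y + (\<Sum>z\<in>I - {x}. b z * R z y)"
    using x lazy_finI[OF L] by (simp add: sum.remove)
  also have "(\<Sum>z\<in>I - {x}. b z * R z y) = 0"
    using b(2) piv lin_asym[OF lazy_linI[OF L]] unfolding lead_def
    by (intro bit_sum_eq_0I) (auto simp: bit_mult_eq_1_iff)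
  finally have "(\<Sum>j\<in>J. R' j x * a j) = 1" using b(1) piv unfolding lead_def by simp
  then obtain j where j: "j \<in> J" "R' j x = 1" "a j = 1"
    using bit_sum_mult_eq_1D[of "\<lambda>j. R' j x" a] by blast
  then obtain y1 where "pivot (conv c) J R' x y1" "j = y1 \<or> c y1 j"
    using lead_exists[OF lazy_linI[OF L'] lazy_finJ[OF L] j(1), of "\<lambda>i. R' i x"] by auto
  moreover have "j = y \<or> c j y" using a(1) j by blast
  ultimately show ?thesis using lin_trans[OF lazy_linJ[OF L]] by blast
qed

text \<open>Induction from the last row upwards. Passing from \<open>x\<close> to the transposed
  side gives some \<open>y1\<close> not after \<open>y\<close>, and passing back gives some
  \<open>x1\<close> not before \<open>x\<close>. If \<open>x1 = x\<close>, distinctness of the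
  pivots of \<open>R\<close> yields \<open>y1 = y\<close>. Otherwise the hypothesis for the later
  row \<open>x1\<close> makes two columns of \<open>R'\<close> share the pivot
  \<open>y1\<close>.\<close>

lemma lazy_dual_pivot_imp:
  assumes L: "lazy r c I J M R U" and L': "lazy (conv c) (conv r) J I (\<lambda>y x. M x y) R' U'"
    and "x \<in> I" "y \<in> J" "pivot r I R y x"
  shows "pivot (conv c) J R' x y"
proof -
  have "\<forall>y\<in>J. pivot r I R y x \<longrightarrow> pivot (conv c) J R' x y"
    using lazy_linJ[OF L'] lazy_finJ[OF L'] \<open>x \<in> I\<close>
  proof (induction x rule: lin_induct)
    case (step x)
    show ?case
    proof (intro ballI impI)
      fix y assume y: "y \<in> J" "pivot r I R y x"
      obtain y1 where y1: "pivot (conv c) J R' x y1" "y1 = y \<or> c y1 y"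
        using lazy_dual_nonzero[OF L L' y] by blast
      have y1J: "y1 \<in> J" using y1(1) unfolding lead_def by blast
      obtain x1 where x1: "pivot r I R y1 x1" "x1 = x \<or> r x x1"
        using lazy_dual_nonzero[OF L' L step.hyps y1(1)] by blast
      have x1I: "x1 \<in> I" using x1(1) unfolding lead_def by blast
      show "pivot (conv c) J R' x y"
      proof (cases "x1 = x")
        case True
        then have "y1 = y" using lazy_inj[OF L y1J y(1)] x1(1) y(2) by blast
        then show ?thesis using y1(1) by simp
      next
        case False
        then have "pivot (conv c) J R' x1 y1" using step.IH x1 x1I y1J by blast
        then show ?thesis using lazy_inj[OF L' x1I step.hyps] y1(1) False by blast
      qed
    qed
  qed
  then show ?thesis using assms by blast
qed

lemma lazy_dual_pivot:
  assumes "lazy r c I J M R U" "lazy (conv c) (conv r) J I (\<lambda>y x. M x y) R' U'"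
    and "x \<in> I" "y \<in> J"
  shows "pivot r I R y x \<longleftrightarrow> pivot (conv c) J R' x y"
  using lazy_dual_pivot_imp[OF assms(1,2)] lazy_dual_pivot_imp[OF assms(2,1)] assms(3,4) by blast

text \<open>A factorisation compares only columns linked by \<open>U\<close> and their pivots, so it
  is enough that these comparisons survive. One implication for pivots suffices, because leads exist
  and are unique.\<close>

lemma lazy_reorder:
  assumes L: "lazy r c I J M R U" and "lin r' I" "lin c' J"
    and up: "\<And>x y. x \<in> J \<Longrightarrow> y \<in> J \<Longrightarrow> U x y = 1 \<Longrightarrow> x \<noteq> y \<Longrightarrow> c' x y"
    and piv: "\<And>y a. y \<in> J \<Longrightarrow> pivot r I R y a \<Longrightarrow> pivot r' I R y a"
    and ord: "\<And>x y a b. x \<in> J \<Longrightarrow> y \<in> J \<Longrightarrow> U x y = 1 \<Longrightarrow> x \<noteq> y \<Longrightarrow>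
      pivot r I R x a \<Longrightarrow> pivot r I R y b \<Longrightarrow> r b a \<Longrightarrow> r' b a"
  shows "lazy r' c' I J M R U"
    and "\<And>y a. y \<in> J \<Longrightarrow> pivot r' I R y a \<longleftrightarrow> pivot r I R y a"
proof -
  show piv': "pivot r' I R y a \<longleftrightarrow> pivot r I R y a" if y: "y \<in> J" for y a
  proof
    assume a: "pivot r' I R y a"
    then obtain b where b: "pivot r I R y b"
      using lead_exists[OF lazy_linI[OF L] lazy_finI[OF L], of a "\<lambda>i. R i y"]
      unfolding lead_def by blast
    then show "pivot r I R y a" using lead_unique[OF assms(2) a] piv[OF y b] by blast
  qed (use piv y in blast)
  show "lazy r' c' I J M R U"
    unfolding lazy_def
  proof (intro conjI ballI impI allI)
    fix x y assume xy: "x \<in> J" "y \<in> J" "U x y = 1" "x \<noteq> y"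
    show "c' x y" using up xy by blast
    obtain a where "pivot r I R x a" "\<forall>b. pivot r I R y b \<longrightarrow> r b a"
      using lazy_pivot[OF L xy] by blast
    then show "\<exists>a. pivot r' I R x a \<and> (\<forall>b. pivot r' I R y b \<longrightarrow> r' b a)"
      using piv' ord xy by blast
  qed (use L assms(2,3) piv' lazyD[OF L] in auto)
qed

section \<open>Transposition of two adjacent rows\<close>

definition swapped :: "('a \<Rightarrow> 'a \<Rightarrow> bool) \<Rightarrow> ('a \<Rightarrow> 'a \<Rightarrow> bool) \<Rightarrow> 'a set \<Rightarrow> 'a \<Rightarrow> 'a \<Rightarrow> bool" where
  "swapped r r' A i j \<longleftrightarrow> i \<in> A \<and> j \<in> A \<and> i \<noteq> j \<and> r i j \<and> r' j i \<and>
     (\<forall>x\<in>A. \<forall>y\<in>A. {x, y} \<noteq> {i, j} \<longrightarrow> r x y = r' x y)"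

text \<open>Adjacency of \<open>i\<close> and \<open>j\<close> is a consequence: a cell after
  \<open>i\<close> and before \<open>j\<close> in \<open>r\<close> would be so in \<open>r'\<close>,
  and transitivity would contradict \<open>r' j i\<close>.\<close>

lemma swapped_adjacent:
  assumes "swapped r r' A i j" "lin r A" "lin r' A" "z \<in> A" "z \<noteq> i" "z \<noteq> j"
  shows "r z i \<longleftrightarrow> r z j" "r' z i \<longleftrightarrow> r z i" "r' z j \<longleftrightarrow> r z j" "r' i z \<longleftrightarrow> r i z"
    "r' j z \<longleftrightarrow> r j z"
proof -
  have "r z i = r' z i" "r z j = r' z j" "r i z = r' i z" "r j z = r' j z"
    using assms unfolding swapped_def by (auto simp: doubleton_eq_iff)
  moreover have "r i j" "r' j i" using assms unfolding swapped_def by auto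
  ultimately show "r z i \<longleftrightarrow> r z j" "r' z i \<longleftrightarrow> r z i" "r' z j \<longleftrightarrow> r z j" "r' i z \<longleftrightarrow> r i z"
    "r' j z \<longleftrightarrow> r j z"
    using lin_trans[OF assms(2)] lin_trans[OF assms(3)] by blast+
qed

lemma swapped_mono:
  assumes "swapped r r' A i j" "lin r A" "x \<in> A" "y \<in> A" "r x y" "x \<noteq> i \<or> y \<noteq> j"
  shows "r' x y"
proof (cases "{x, y} = {i, j}")
  case True
  then show ?thesis
    using assms lin_asym[OF assms(2)] unfolding swapped_def by (auto simp: doubleton_eq_iff)
next
  case False
  then show ?thesis using assms unfolding swapped_def by blast
qed

lemma swapped_lead:
  assumes sw: "swapped r r' A i j" and "lin r A" "lead r A v a" "a \<noteq> j \<or> v i = 0"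
  shows "lead r' A v a"
  unfolding lead_def
proof (intro conjI ballI impI)
  fix z assume z: "z \<in> A" "v z = 1"
  then have "z = a \<or> r z a" using assms(3) unfolding lead_def by blast
  moreover have "a \<in> A" using assms(3) unfolding lead_def by blast
  moreover have "z \<noteq> i \<or> a \<noteq> j" using assms(4) z by auto
  ultimately show "z = a \<or> r' z a" using swapped_mono[OF sw assms(2) z(1), of a] by blast
qed (use assms(3) in \<open>auto simp: lead_def\<close>)

lemma swapped_lead_i:
  assumes sw: "swapped r r' A i j" and "lin r A" "lin r' A" "v i = 1"
    and "\<And>z. z \<in> A \<Longrightarrow> v z = 1 \<Longrightarrow> z = i \<or> z = j \<or> r z j"
  shows "lead r' A v i"
  unfolding lead_def
proof (intro conjI ballI impI)
  fix z assume "z \<in> A" "v z = 1"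
  then show "z = i \<or> r' z i"
    using assms(5)[of z] swapped_adjacent[OF sw assms(2,3), of z] sw unfolding swapped_def by blast
qed (use assms in \<open>auto simp: swapped_def\<close>)

text \<open>The contribution of \<open>q\<close> that the column addition creates is cancelled by
  the row addition in characteristic 2: (R_q + R_p) U_q + R_p (U_p + U_q) = R_q U_q + R_p
  U_p.\<close>

lemma sum_add_column_add_row:
  assumes "finite J" "p \<in> J" "q \<in> J" "p \<noteq> q"
  shows "(\<Sum>x\<in>J. add_column p q R i x * add_row p q U x y) = (\<Sum>x\<in>J. R i x * U x y)"
proof -
  have *: "(\<Sum>x\<in>J. f x) = f p + (f q + (\<Sum>x\<in>J - {p} - {q}. f x))" for f :: "'a \<Rightarrow> bit"
    using assms by (simp add: sum.remove)
  show ?thesis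
    unfolding *[of "\<lambda>x. R i x * U x y"] *[of "\<lambda>x. add_column p q R i x * add_row p q U x y"]
    using assms(4) by (auto simp: add_column_def add_row_def algebra_simps bit_add_self
      intro!: sum.cong)
qed

section \<open>Lazy factorisations after the transposition of two rows\<close>

locale row_swap =
  fixes r r' c :: "'a \<Rightarrow> 'a \<Rightarrow> bool" and I J M R U i j
  assumes L: "lazy r c I J M R U" and sw: "swapped r r' I i j" and lin': "lin r' I"
begin

lemmas li = lazy_linI[OF L] and lj = lazy_linJ[OF L]

lemma ij: "i \<in> I" "j \<in> I" "i \<noteq> j" "r i j" "r' j i" "\<not> r j i" "\<not> r' i j"
  using sw lin_asym[OF li] lin_asym[OF lin'] unfolding swapped_def by auto

text \<open>The transposition reverses a comparison of two pivots only if the lower one is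
  \<open>j\<close>, and it moves a pivot only away from \<open>j\<close>.\<close>

lemma lazy_unpaired:
  assumes "\<And>y. y \<in> J \<Longrightarrow> \<not> pivot r I R y j"
  shows "lazy r' c I J M R U"
proof (rule lazy_reorder(1)[OF L lin' lj])
  show "c x y" if "x \<in> J" "y \<in> J" "U x y = 1" "x \<noteq> y" for x y
    using lazy_upper[OF L] that .
  show "pivot r' I R y a" if "y \<in> J" "pivot r I R y a" for y a
    using swapped_lead[OF sw li that(2)] assms that by blast
  show "r' b a" if "x \<in> J" "pivot r I R x a" "pivot r I R y b" "r b a" for x y a b
    using swapped_mono[OF sw li, of b a] that assms unfolding lead_def by blast
qed

text \<open>Two things could go wrong. An entry of \<open>q\<close> at \<open>i\<close> would turn
  the pivot of \<open>q\<close> into \<open>i\<close>, which is taken by \<open>p\<close>. And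
  \<open>U q p = 1\<close> asks the pivot \<open>j\<close> of \<open>q\<close> to lie below the
  pivot \<open>i\<close> of \<open>p\<close>, which the new order reverses.\<close>

lemma lazy_keep:
  assumes p: "p \<in> J" "pivot r I R p i" and q: "q \<in> J" "pivot r I R q j"
    and "R i q = 0" "U q p = 0"
  shows "lazy r' c I J M R U"
proof (rule lazy_reorder(1)[OF L lin' lj])
  show "c x y" if "x \<in> J" "y \<in> J" "U x y = 1" "x \<noteq> y" for x y
    using lazy_upper[OF L] that .
  show "pivot r' I R y a" if "y \<in> J" "pivot r I R y a" for y a
    using swapped_lead[OF sw li that(2)] assms(5) lazy_inj[OF L q(1) that(1) q(2)] that by blast
  show "r' b a" if "x \<in> J" "y \<in> J" "U x y = 1" "pivot r I R x a" "pivot r I R y b" "r b a" for x y a b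
  proof (cases "b = i \<and> a = j")
    case True
    then have "x = q" "y = p" using lazy_inj[OF L] p q that by blast+
    then show ?thesis using that assms(6) by simp
  next
    case False
    then show ?thesis using swapped_mono[OF sw li, of b a] that unfolding lead_def by blast
  qed
qed

text \<open>In the new order column \<open>q\<close> has its lowest entry at \<open>i\<close>, like
  the earlier column \<open>p\<close>. So the lazy reduction performs one more addition, that of
  \<open>p\<close>, which removes this entry and leaves \<open>q\<close> with its old pivot
  \<open>j\<close>.\<close>

lemma lazy_add_early:
  assumes p: "p \<in> J" "pivot r I R p i" and q: "q \<in> J" "pivot r I R q j"
    and pq: "c p q" and Riq: "R i q = 1"
  shows "lazy r' c I J M (add_column p q R) (add_row p q U)"
proof -
  let ?R = "add_column p q R" and ?U = "add_row p q U"
  have ne: "p \<noteq> q" using lead_unique[OF li] p q ij by metis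
  have Rjp: "R j p = 0" using p(2) ij unfolding lead_def by (metis bit_not_one_iff)
  have newq: "pivot r' I ?R q j"
    unfolding lead_def
  proof (intro conjI ballI impI)
    show "j \<in> I" using ij by blast
    show "?R j q = 1" using q(2) Rjp unfolding lead_def add_column_def by auto
    fix z assume z: "z \<in> I" "?R z q = 1"
    show "z = j \<or> r' z j"
    proof (cases "z = i \<or> z = j")
      case True
      then show ?thesis using z Riq p(2) unfolding add_column_def lead_def by (auto simp: bit_add_self)
    next
      case False
      have "R z q = 1 \<or> R z p = 1" using z(2) unfolding add_column_def by (cases "R z q") auto
      then have "r z j \<or> r z i" using p(2) q(2) z(1) False unfolding lead_def by blast
      then show ?thesis using swapped_adjacent[OF sw li lin' z(1)] False by blast
    qed
  qed
  have other: "pivot r' I ?R y a \<longleftrightarrow> pivot r' I R y a" if "y \<noteq> q" for y a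
    using that by (intro lead_cong) (auto simp: add_column_def)
  have new: "pivot r' I ?R y a" if "y \<in> J" "pivot r I R y a" for y a
  proof (cases "y = q")
    case True
    then show ?thesis using newq lead_unique[OF li] that(2) q(2) by blast
  next
    case False
    then have "a \<noteq> j" using lazy_inj[OF L] q that by blast
    then show ?thesis using swapped_lead[OF sw li that(2)] other False by blast
  qed
  have old: "pivot r I R y a" if y: "y \<in> J" and a: "pivot r' I ?R y a" for y a
  proof -
    have "\<exists>b. pivot r I R y b"
    proof (cases "y = q")
      case False
      then have "R a y = 1" "a \<in> I" using a unfolding lead_def add_column_def by auto
      then show ?thesis
        using lead_exists[OF li lazy_finI[OF L], of a "\<lambda>i. R i y"] by blast
    qed (use q in blast)
    then show ?thesis using new[OF y] lead_unique[OF lin' a] by blast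
  qed
  show ?thesis
    unfolding lazy_def
  proof (intro conjI ballI impI allI)
    fix x y assume xy: "x \<in> J" "y \<in> J" "?U x y = 1" "x \<noteq> y"
    have "c x y \<and> (\<exists>a. pivot r' I ?R x a \<and> (\<forall>b. pivot r' I ?R y b \<longrightarrow> r' b a))"
    proof (cases "x = p")
      case False
      then have U: "U x y = 1" using xy unfolding add_row_def by simp
      obtain a where a: "pivot r I R x a" "\<forall>b. pivot r I R y b \<longrightarrow> r b a"
        using lazy_pivot[OF L xy(1,2) U xy(4)] by blast
      have "r' b a" if b: "pivot r' I ?R y b" for b
      proof (cases "b = i \<and> a = j")
        case True
        then have "x = q" "y = p" using lazy_inj[OF L] p q a xy old[OF xy(2) b] by blast+
        then show ?thesis using lazy_upper[OF L xy(1,2) U xy(4)] pq lin_asym[OF lj] by blast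
      next
        case False
        then show ?thesis
          using swapped_mono[OF sw li, of b a] a old[OF xy(2) b] unfolding lead_def by blast
      qed
      then show ?thesis using lazy_upper[OF L xy(1,2) U xy(4)] new[OF xy(1) a(1)] by blast
    next
      case True
      have pi: "pivot r' I ?R x i" using new p True by blast
      have "U p y = 1 \<or> U q y = 1" using xy(3) True unfolding add_row_def by (cases "U p y") auto
      then consider "y = q" | "y \<noteq> q" "U p y = 1" | "y \<noteq> q" "U q y = 1" by blast
      then show ?thesis
      proof cases
        case 1
        then show ?thesis using pi pq True newq lead_unique[OF lin'] ij by metis
      next
        case 2
        have "r b i" if "pivot r I R y b" for b
          using lazy_pivot[OF L p(1) xy(2) 2(2)] xy(4) True p(2) lead_unique[OF li] that by metis
        then have "r' b i" if "pivot r' I ?R y b" for b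
          using old[OF xy(2) that] swapped_mono[OF sw li, of b i] ij unfolding lead_def by blast
        then show ?thesis using pi lazy_upper[OF L p(1) xy(2) 2(2)] xy(4) True by blast
      next
        case 3
        have cq: "c q y" using lazy_upper[OF L q(1) xy(2) 3(2)] 3(1) by blast
        have "r' b i" if b: "pivot r' I ?R y b" for b
        proof -
          have b': "pivot r I R y b" using old[OF xy(2) b] .
          have "r b j"
            using lazy_pivot[OF L q(1) xy(2) 3(2)] 3(1) q(2) lead_unique[OF li] b' by metis
          moreover have "b \<noteq> i" using lazy_inj[OF L p(1) xy(2) p(2)] b' xy(4) True by blast
          moreover have "b \<noteq> j" using calculation(1) ij lin_irrefl[OF li] by blast
          moreover have "b \<in> I" using b' unfolding lead_def by blast
          ultimately show ?thesis using swapped_adjacent[OF sw li lin'] by blast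
        qed
        then show ?thesis using pi True pq cq lin_trans[OF lj] by blast
      qed
    qed
    then show "c x y" "\<exists>a. pivot r' I ?R x a \<and> (\<forall>b. pivot r' I ?R y b \<longrightarrow> r' b a)" by blast+
  next
    fix l y assume "l \<in> I" "y \<in> J"
    then show "M l y = (\<Sum>x\<in>J. ?R l x * ?U x y)"
      using sum_add_column_add_row[OF lazy_finJ[OF L] p(1) q(1) ne] lazy_eq[OF L] by simp
  next
    fix y assume "y \<in> J"
    moreover have "U q p = 0" using lazy_upper[OF L q(1) p(1)] ne pq lin_asym[OF lj]
      by (metis bit_not_one_iff)
    ultimately show "?U y y = 1" using lazy_diag[OF L] unfolding add_row_def by auto
  qed (use lazyD[OF L] lin' old in blast)+
qed

text \<open>The old reduction added \<open>q\<close> to \<open>p\<close>, which is no longer lazy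
  because the pivot of \<open>q\<close> now lies above that of \<open>p\<close>. Adding the column
  once more undoes this. Column \<open>p\<close> thereby gets an entry at \<open>j\<close>, but
  \<open>i\<close> is the lower of the two rows now, and it stays occupied because \<open>q\<close>
  has no entry there.\<close>

lemma lazy_add_late:
  assumes p: "p \<in> J" "pivot r I R p i" and q: "q \<in> J" "pivot r I R q j"
    and qp: "c q p" and Riq: "R i q = 0" and Uqp: "U q p = 1"
  shows "lazy r' c I J M (add_column q p R) (add_row q p U)"
proof -
  let ?R = "add_column q p R" and ?U = "add_row q p U"
  have ne: "p \<noteq> q" using lead_unique[OF li] p q ij by metis
  have newp: "pivot r' I ?R p i"
  proof (rule swapped_lead_i[OF sw li lin'])
    show "?R i p = 1" using p(2) Riq unfolding lead_def add_column_def by auto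
    fix z assume z: "z \<in> I" "?R z p = 1"
    then have "R z q = 1 \<or> R z p = 1" unfolding add_column_def by (cases "R z q") auto
    then show "z = i \<or> z = j \<or> r z j"
      using p(2) q(2) z(1) ij lin_trans[OF li] unfolding lead_def by blast
  qed
  have other: "pivot r' I ?R y a \<longleftrightarrow> pivot r' I R y a" if "y \<noteq> p" for y a
    using that by (intro lead_cong) (auto simp: add_column_def)
  have new: "pivot r' I ?R y a" if "y \<in> J" "pivot r I R y a" for y a
  proof (cases "y = p")
    case True
    then show ?thesis using newp lead_unique[OF li] that(2) p(2) by blast
  next
    case False
    then have "a \<noteq> j \<or> R i y = 0" using lazy_inj[OF L] q that Riq by blast
    then show ?thesis using swapped_lead[OF sw li that(2)] other False by blast
  qed
  have old: "pivot r I R y a" if y: "y \<in> J" and a: "pivot r' I ?R y a" for y a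
  proof -
    have "\<exists>b. pivot r I R y b"
    proof (cases "y = p")
      case False
      then have "R a y = 1" "a \<in> I" using a unfolding lead_def add_column_def by auto
      then show ?thesis
        using lead_exists[OF li lazy_finI[OF L], of a "\<lambda>i. R i y"] by blast
    qed (use p in blast)
    then show ?thesis using new[OF y] lead_unique[OF lin' a] by blast
  qed
  have small: "r' b j" if y: "y \<in> J" "y \<noteq> p" "y \<noteq> q" and b: "pivot r I R y b" "r b j \<or> r b i" for y b
  proof -
    have "b \<noteq> i" "b \<noteq> j" using lazy_inj[OF L] p q y b(1) by blast+
    then show ?thesis using b swapped_adjacent[OF sw li lin', of b] unfolding lead_def by blast
  qed
  show ?thesis
    unfolding lazy_def
  proof (intro conjI ballI impI allI)
    fix x y assume xy: "x \<in> J" "y \<in> J" "?U x y = 1" "x \<noteq> y"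
    have "c x y \<and> (\<exists>a. pivot r' I ?R x a \<and> (\<forall>b. pivot r' I ?R y b \<longrightarrow> r' b a))"
    proof (cases "x = q")
      case False
      then have U: "U x y = 1" using xy unfolding add_row_def by simp
      obtain a where a: "pivot r I R x a" "\<forall>b. pivot r I R y b \<longrightarrow> r b a"
        using lazy_pivot[OF L xy(1,2) U xy(4)] by blast
      have "r' b a" if b: "pivot r' I ?R y b" for b
      proof -
        have "a \<noteq> j" using lazy_inj[OF L xy(1) q(1) a(1)] q(2) False by blast
        then show ?thesis
          using swapped_mono[OF sw li, of b a] a old[OF xy(2) b] unfolding lead_def by blast
      qed
      then show ?thesis using lazy_upper[OF L xy(1,2) U xy(4)] new[OF xy(1) a(1)] by blast
    next
      case True
      have qj: "pivot r' I ?R x j" using new q True by blast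
      have yp: "y \<noteq> p"
        using xy(3) True Uqp lazy_diag[OF L p(1)] unfolding add_row_def by (auto simp: bit_add_self)
      have "U q y = 1 \<or> U p y = 1" using xy(3) True unfolding add_row_def by (cases "U p y") auto
      then show ?thesis
      proof
        assume U: "U q y = 1"
        have "r' b j" if "pivot r' I ?R y b" for b
          using lazy_pivot[OF L q(1) xy(2) U] xy(4) True q(2) lead_unique[OF li] old[OF xy(2) that]
            small[OF xy(2) yp] by metis
        then show ?thesis using qj lazy_upper[OF L q(1) xy(2) U] xy(4) True by blast
      next
        assume U: "U p y = 1"
        have "r' b j" if "pivot r' I ?R y b" for b
          using lazy_pivot[OF L p(1) xy(2) U] xy(4) True yp p(2) lead_unique[OF li] old[OF xy(2) that]
            small[OF xy(2) yp] by metis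
        moreover have "c q y" using lazy_upper[OF L p(1) xy(2) U] yp qp lin_trans[OF lj] by blast
        ultimately show ?thesis using qj True by blast
      qed
    qed
    then show "c x y" "\<exists>a. pivot r' I ?R x a \<and> (\<forall>b. pivot r' I ?R y b \<longrightarrow> r' b a)" by blast+
  next
    fix l y assume "l \<in> I" "y \<in> J"
    then show "M l y = (\<Sum>x\<in>J. ?R l x * ?U x y)"
      using sum_add_column_add_row[OF lazy_finJ[OF L] q(1) p(1)] ne lazy_eq[OF L] by simp
  next
    fix y assume "y \<in> J"
    moreover have "U p q = 0" using lazy_upper[OF L p(1) q(1)] ne qp lin_asym[OF lj]
      by (metis bit_not_one_iff)
    ultimately show "?U y y = 1" using lazy_diag[OF L] unfolding add_row_def by auto
  qed (use lazyD[OF L] lin' old in blast)+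
qed

end

lemma lazy_comb:
  assumes L: "lazy r c I J M R U" and "i \<in> I"
  shows "(\<Sum>x\<in>J. M i x * a x) = (\<Sum>z\<in>J. R i z * (\<Sum>x\<in>J. U z x * a x))"
proof -
  have "(\<Sum>x\<in>J. M i x * a x) = (\<Sum>x\<in>J. \<Sum>z\<in>J. R i z * U z x * a x)"
    using lazy_eq[OF L \<open>i \<in> I\<close>] by (intro sum.cong) (auto simp: sum_distrib_right)
  also have "\<dots> = (\<Sum>z\<in>J. \<Sum>x\<in>J. R i z * U z x * a x)" by (rule sum.swap)
  finally show ?thesis by (simp add: sum_distrib_left mult.assoc)
qed

context row_swap
begin

text \<open>Otherwise column \<open>q\<close> has its lowest entry at \<open>i\<close> in the new
  order. As a combination of columns of \<open>R'\<close> up to \<open>q\<close> with distinct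
  pivots, it shows that \<open>i\<close> is the pivot of one of these, whereas the unchanged pairing
  assigns \<open>i\<close> to the later column \<open>p\<close>.\<close>

lemma same_pivots_zero:
  assumes L': "lazy r' c I J M R' U'"
    and same: "\<And>y a. y \<in> J \<Longrightarrow> pivot r I R y a \<longleftrightarrow> pivot r' I R' y a"
    and p: "p \<in> J" "pivot r I R p i" and q: "q \<in> J" "pivot r I R q j"
    and qp: "c q p"
  shows "R i q = 0"
proof (rule ccontr)
  assume "R i q \<noteq> 0"
  then have Riq: "R i q = 1" by simp
  have lq: "lead r' I (\<lambda>l. R l q) i"
    by (rule swapped_lead_i[where v = "\<lambda>l. R l q", OF sw li lin' Riq]) (use q(2) in \<open>auto simp: lead_def\<close>)
  obtain a where a: "\<forall>x\<in>J. a x = 1 \<longrightarrow> x = q \<or> c x q"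
    "\<forall>l\<in>I. R l q = (\<Sum>x\<in>J. M l x * a x)"
    using lazy_inverse[OF L q(1)] by metis
  define e where "e z = (\<Sum>x\<in>J. U' z x * a x)" for z
  have Re: "R l q = (\<Sum>z\<in>J. R' l z * e z)" if "l \<in> I" for l
    using a(2) that lazy_comb[OF L' that, of a] unfolding e_def by simp
  have e: "z = q \<or> c z q" if z: "z \<in> J" "e z = 1" for z
  proof -
    obtain x where "x \<in> J" "U' z x = 1" "a x = 1"
      using z(2) bit_sum_mult_eq_1D[of "\<lambda>x. U' z x" a J] unfolding e_def by blast
    then show ?thesis using lazy_upper[OF L' z(1)] a(1) lin_trans[OF lj] by blast
  qed
  obtain z l where z: "z \<in> J" "e z = 1" "pivot r' I R' z l"
    and l: "lead r' I (\<lambda>i. \<Sum>x\<in>J. R' i x * e x) l"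
    using lazy_comb_nonzero[OF L' subset_refl ij(1), of e] Re[OF ij(1)] Riq by force
  have "lead r' I (\<lambda>i. R i q) l"
    using l Re by (subst lead_cong[where w = "\<lambda>i. \<Sum>x\<in>J. R' i x * e x"]) auto
  then have "l = i" using lq lead_unique[OF lin'] by blast
  then have "z = p" using same[OF z(1)] z(3) p lazy_inj[OF L z(1) p(1)] by blast
  then show False using e[OF z(1,2)] qp lin_asym[OF lj] lin_irrefl[OF lj] by blast
qed

text \<open>The rule by which the algorithm updates its relations: the columns \<open>p\<close> and \<open>q\<close> are paired
  with the transposed rows \<open>i\<close> and \<open>j\<close>, and the pairing is unaffected by the transposition.\<close>

lemma update_early:
  assumes L': "lazy r' c I J M R' U'"
    and p: "p \<in> J" "pivot r I R p i" and q: "q \<in> J" "pivot r I R q j" and "c p q"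
    and xy: "x \<in> J" "y \<in> J"
  shows "U' x y = (if R i q = 1 then add_row p q U else U) x y"
proof (cases "R i q = 1")
  case True
  then show ?thesis
    using lazy_unique[OF L' lazy_add_early[OF p q assms(6)] xy(2)] xy(1) by auto
next
  case False
  have "U q p = 0"
    using lazy_upper[OF L q(1) p(1)] assms(6) lin_asym[OF lj] lin_irrefl[OF lj]
    by (metis bit_not_one_iff)
  then show ?thesis
    using lazy_unique[OF L' lazy_keep[OF p q] xy(2)] xy(1) False by auto
qed

text \<open>Once the preserved pairing has excluded an entry of \<open>q\<close> at
  \<open>i\<close>, only \<open>U q p\<close> is left to decide.\<close>

lemma update_late:
  assumes L': "lazy r' c I J M R' U'"
    and same: "\<And>y a. y \<in> J \<Longrightarrow> pivot r I R y a \<longleftrightarrow> pivot r' I R' y a"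
    and p: "p \<in> J" "pivot r I R p i" and q: "q \<in> J" "pivot r I R q j" and "c q p"
    and xy: "x \<in> J" "y \<in> J"
  shows "U' x y = (if U q p = 1 then add_row q p U else U) x y"
proof -
  have R0: "R i q = 0" using same_pivots_zero[OF L' same p q assms(7)] .
  show ?thesis
  proof (cases "U q p = 1")
    case True
    then show ?thesis
      using lazy_unique[OF L' lazy_add_late[OF p q assms(7) R0] xy(2)] xy(1) by auto
  next
    case False
    then show ?thesis using lazy_unique[OF L' lazy_keep[OF p q R0] xy(2)] xy(1) by auto
  qed
qed

end

text \<open>\<open>v\<close> models a column after cancellations, which may eliminate the columns of
  \<open>K\<close> in another order than the reduction does. The difference of the two sides is a
  combination of the columns of \<open>R\<close> indexed by \<open>K\<close>; were it nonzero, its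
  lowest entry would be at a pivot of \<open>K\<close>, where both sides vanish.\<close>

lemma lazy_partial_reduction:
  assumes L: "lazy r c I J M R U" and y: "y \<in> J" "y \<notin> K" and K: "K \<subseteq> J" and T: "T \<subseteq> K"
    and cl: "\<And>x t. t \<in> K \<Longrightarrow> x \<in> J \<Longrightarrow> U x t = 1 \<Longrightarrow> x \<in> K"
    and v: "\<And>i. i \<in> I \<Longrightarrow> v i = M i y + (\<Sum>t\<in>T. M i t)"
    and zero: "\<And>t. t \<in> K \<Longrightarrow> \<exists>s. pivot r I R t s \<and> v s = 0 \<and> (\<Sum>x\<in>J - K. R s x * U x y) = 0"
    and i: "i \<in> I"
  shows "v i = (\<Sum>x\<in>J - K. R i x * U x y)"
proof -
  define a where "a x = (if x = y then 1 else 0) + (if x \<in> T then 1 else 0 :: bit)" for x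
  define e where "e z = (\<Sum>x\<in>J. U z x * a x)" for z
  have finJ: "finite J" and li: "lin r I" using lazyD[OF L] by auto
  have ve: "v i = (\<Sum>z\<in>J. R i z * e z)" if "i \<in> I" for i
  proof -
    have "M i x * a x = (if x = y then M i x else 0) + (if x \<in> T then M i x else 0)" for x
      unfolding a_def by (simp add: distrib_left)
    then have "(\<Sum>x\<in>J. M i x * a x) = M i y + (\<Sum>x\<in>J. if x \<in> T then M i x else 0)"
      using y(1) finJ by (simp add: sum.distrib)
    also have "(\<Sum>x\<in>J. if x \<in> T then M i x else 0) = (\<Sum>t\<in>T. M i t)"
      using finJ T K by (simp add: sum.If_cases Int_absorb1 subset_trans[OF T K])
    finally show ?thesis using v[OF that] lazy_comb[OF L that, of a] unfolding e_def by simp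
  qed
  have eK: "e z = U z y" if z: "z \<in> J" "z \<notin> K" for z
  proof -
    have "e z = (\<Sum>x\<in>J. (if x = y then U z x else 0) + (if x \<in> T then U z x else 0))"
      unfolding e_def a_def by (intro sum.cong) (auto simp: distrib_left)
    also have "\<dots> = U z y + (\<Sum>x\<in>J. if x \<in> T then U z x else 0)"
      using y(1) finJ by (simp add: sum.distrib)
    also have "(\<Sum>x\<in>J. if x \<in> T then U z x else 0) = 0"
      using cl z T by (intro bit_sum_eq_0I) (auto split: if_splits)
    finally show ?thesis by simp
  qed
  have split: "v i = (\<Sum>x\<in>J - K. R i x * U x y) + (\<Sum>x\<in>K. R i x * e x)" if "i \<in> I" for i
  proof -
    have "v i = (\<Sum>x\<in>J - K. R i x * e x) + (\<Sum>x\<in>K. R i x * e x)"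
      unfolding ve[OF that] using finJ K by (rule sum.subset_diff[rotated])
    also have "(\<Sum>x\<in>J - K. R i x * e x) = (\<Sum>x\<in>J - K. R i x * U x y)"
      using eK by (intro sum.cong) auto
    finally show ?thesis .
  qed
  have "(\<Sum>x\<in>K. R i x * e x) = 0"
  proof (rule ccontr)
    assume "(\<Sum>x\<in>K. R i x * e x) \<noteq> 0"
    then have "(\<Sum>x\<in>K. R i x * e x) = 1" by simp
    then obtain z l where z: "z \<in> K" "pivot r I R z l"
      and l: "lead r I (\<lambda>i. \<Sum>x\<in>K. R i x * e x) l"
      using lazy_comb_nonzero[OF L K i, of e] by blast
    have "l \<in> I" using l unfolding lead_def by blast
    then have "v l = (\<Sum>x\<in>J - K. R l x * U x y) + 1"
      using split l unfolding lead_def by simp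
    moreover have "v l = 0" "(\<Sum>x\<in>J - K. R l x * U x y) = 0"
      using zero[OF z(1)] lead_unique[OF li z(2)] by blast+
    ultimately show False by simp
  qed
  then show ?thesis using split[OF i] by simp
qed

section \<open>Passing to critical cells\<close>

text \<open>Row \<open>a\<close> is replaced by the functional \<open>\<pi> a\<close>, which starts
  at row \<open>a\<close> with coefficient 1. On a column with pivot \<open>p\<close> the functional
  of \<open>p\<close> takes the value 1 and those of later rows vanish, so pivots survive. Columns
  outside \<open>Jc\<close> are annihilated and drop out of the factorisation, and \<open>U\<close>
  itself is kept.\<close>

lemma lazy_transfer:
  assumes L: "lazy r c I J M R U" and Ic: "Ic \<subseteq> I" and Jc: "Jc \<subseteq> J"
    and pi: "\<And>a i. a \<in> Ic \<Longrightarrow> i \<in> I \<Longrightarrow> \<pi> a i = 1 \<Longrightarrow> i = a \<or> r a i"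
    and pi1: "\<And>a. a \<in> Ic \<Longrightarrow> \<pi> a a = 1"
    and van: "\<And>a y. a \<in> Ic \<Longrightarrow> y \<in> J - Jc \<Longrightarrow> (\<Sum>i\<in>I. \<pi> a i * R i y) = 0"
    and crit: "\<And>a y. y \<in> Jc \<Longrightarrow> pivot r I R y a \<Longrightarrow> a \<in> Ic"
  defines "M' \<equiv> \<lambda>a y. \<Sum>i\<in>I. \<pi> a i * M i y" and "R' \<equiv> \<lambda>a y. \<Sum>i\<in>I. \<pi> a i * R i y"
  shows "lazy r c Ic Jc M' R' U"
    and "\<And>y a. y \<in> Jc \<Longrightarrow> pivot r Ic R' y a \<longleftrightarrow> pivot r I R y a"
proof -
  note li = lazy_linI[OF L]
  have fin: "finite I" "finite J" "finite Ic" "finite Jc"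
    using lazyD(1,2)[OF L] Ic Jc finite_subset by auto
  have lin: "lin r Ic" "lin c Jc" using lazyD(3,4)[OF L] lin_subset Ic Jc by auto
  have fwd: "pivot r Ic R' y a" if y: "y \<in> Jc" and a: "pivot r I R y a" for y a
    unfolding lead_def
  proof (intro conjI ballI impI)
    show aI: "a \<in> Ic" using crit y a .
    have "R' a y = \<pi> a a * R a y + (\<Sum>i\<in>I - {a}. \<pi> a i * R i y)"
      unfolding R'_def using aI Ic fin by (intro sum.remove) auto
    also have "(\<Sum>i\<in>I - {a}. \<pi> a i * R i y) = 0"
      using a pi[OF aI] lin_asym[OF li] unfolding lead_def
      by (intro bit_sum_eq_0I) (auto simp: bit_mult_eq_1_iff)
    finally show "R' a y = 1" using pi1[OF aI] a unfolding lead_def by simp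
    fix z assume z: "z \<in> Ic" "R' z y = 1"
    obtain i where i: "i \<in> I" "\<pi> z i = 1" "R i y = 1"
      using bit_sum_mult_eq_1D[of "\<pi> z" "\<lambda>i. R i y" I] z(2) unfolding R'_def by blast
    then show "z = a \<or> r z a"
      using pi[OF z(1) i(1,2)] a lin_trans[OF li] unfolding lead_def by blast
  qed
  show piv: "pivot r Ic R' y a \<longleftrightarrow> pivot r I R y a" if y: "y \<in> Jc" for y a
  proof
    assume a: "pivot r Ic R' y a"
    obtain i where "i \<in> I" "R i y = 1"
      using bit_sum_mult_eq_1D[of "\<pi> a" "\<lambda>i. R i y" I] a unfolding R'_def lead_def by blast
    then obtain b where b: "pivot r I R y b" using lead_exists[OF li fin(1), of i "\<lambda>i. R i y"] by blast
    then show "pivot r I R y a" using lead_unique[OF lin(1) a] fwd[OF y b] by blast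
  qed (rule fwd[OF y])
  show "lazy r c Ic Jc M' R' U"
    unfolding lazy_def
  proof (intro conjI ballI impI allI)
    fix a y assume a: "a \<in> Ic" and y: "y \<in> Jc"
    have "M' a y = (\<Sum>i\<in>I. \<Sum>x\<in>J. \<pi> a i * (R i x * U x y))"
      unfolding M'_def using lazy_eq[OF L] y Jc
      by (intro sum.cong) (auto simp: sum_distrib_left)
    also have "\<dots> = (\<Sum>x\<in>J. R' a x * U x y)"
      unfolding R'_def by (subst sum.swap) (simp add: sum_distrib_right mult.assoc)
    also have "\<dots> = (\<Sum>x\<in>Jc. R' a x * U x y)"
      using van[OF a] fin Jc unfolding R'_def by (intro sum.mono_neutral_right) auto
    finally show "M' a y = (\<Sum>x\<in>Jc. R' a x * U x y)" .
  next
    fix x y assume xy: "x \<in> Jc" "y \<in> Jc" "U x y = 1" "x \<noteq> y"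
    then have xyJ: "x \<in> J" "y \<in> J" using Jc by auto
    show "c x y" using lazy_upper[OF L xyJ xy(3,4)] .
    show "\<exists>a. pivot r Ic R' x a \<and> (\<forall>b. pivot r Ic R' y b \<longrightarrow> r b a)"
      using lazy_pivot[OF L xyJ xy(3,4)] piv xy by blast
  next
    fix x y a assume "x \<in> Jc" "y \<in> Jc" "pivot r Ic R' x a" "pivot r Ic R' y a"
    then show "x = y" using lazy_inj[OF L] piv Jc by blast
  qed (use fin lin lazy_diag[OF L] Jc in auto)
qed

section \<open>Changing the pairing inside a block\<close>

text \<open>\<open>A\<close> is a block of consecutive places of \<open>I\<close> in both orders,
  and the order inside the block is free.\<close>

definition same_outside :: "('a \<Rightarrow> 'a \<Rightarrow> bool) \<Rightarrow> ('a \<Rightarrow> 'a \<Rightarrow> bool) \<Rightarrow> 'a set \<Rightarrow> 'a set \<Rightarrow> bool" where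
  "same_outside r r' I A \<longleftrightarrow> A \<subseteq> I \<and>
     (\<forall>x\<in>I. \<forall>y\<in>I. x \<in> A \<longrightarrow> y \<notin> A \<longrightarrow> (r x y \<longleftrightarrow> r' x y) \<and> (r y x \<longleftrightarrow> r' y x)) \<and>
     (\<forall>x\<in>I - A. \<forall>y\<in>I - A. r x y \<longleftrightarrow> r' x y) \<and>
     (\<forall>z\<in>I - A. (\<forall>a\<in>A. r z a) \<or> (\<forall>a\<in>A. r a z))"

lemma same_outside_imp:
  "same_outside r r' I A \<Longrightarrow> x \<in> I \<Longrightarrow> y \<in> I \<Longrightarrow> r x y \<Longrightarrow> x \<notin> A \<or> y \<notin> A \<Longrightarrow> r' x y"
  unfolding same_outside_def by blast

lemma same_outside_block:
  "same_outside r r' I A \<Longrightarrow> lin r I \<Longrightarrow> z \<in> I \<Longrightarrow> z \<notin> A \<Longrightarrow> a \<in> A \<Longrightarrow> b \<in> A \<Longrightarrow> r z a \<Longrightarrow> r z b"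
  "same_outside r r' I A \<Longrightarrow> lin r I \<Longrightarrow> z \<in> I \<Longrightarrow> z \<notin> A \<Longrightarrow> a \<in> A \<Longrightarrow> b \<in> A \<Longrightarrow> r a z \<Longrightarrow> r b z"
  unfolding same_outside_def using lin_asym[of r I] by (meson DiffI)+

text \<open>The columns of \<open>B\<close> are reduced among themselves with pivots in the block
  \<open>A\<close>, and for the new orders they are reduced as they stand in \<open>M\<close>. What
  a column outside received from \<open>B\<close> is rewritten in these columns. Whether an outside
  pivot lies above a pivot in the block does not depend on the place within the block, so laziness
  carries over.\<close>

lemma lazy_block:
  assumes L: "lazy r c I J M R U" and lin': "lin r' I" "lin c' J"
    and A: "same_outside r r' I A" and B: "same_outside c c' J B"
    and pivB: "\<And>b. b \<in> B \<Longrightarrow> \<exists>a\<in>A. pivot r I R b a"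
    and pivN: "\<And>y a. y \<in> J - B \<Longrightarrow> pivot r I R y a \<Longrightarrow> a \<notin> A"
    and span: "\<And>b x. b \<in> B \<Longrightarrow> x \<in> J \<Longrightarrow> U x b = 1 \<Longrightarrow> x \<in> B"
    and new: "\<And>b. b \<in> B \<Longrightarrow> \<exists>a\<in>A. pivot r' I M b a"
    and inj: "\<And>b b' a. b \<in> B \<Longrightarrow> b' \<in> B \<Longrightarrow> pivot r' I M b a \<Longrightarrow> pivot r' I M b' a \<Longrightarrow> b = b'"
  defines "R' \<equiv> \<lambda>i y. if y \<in> B then M i y else R i y"
  shows "\<exists>U'. lazy r' c' I J M R' U' \<and> (\<forall>x\<in>J - B. \<forall>y\<in>J - B. U' x y = U x y)"
    and "\<And>y a. y \<in> J - B \<Longrightarrow> pivot r' I R' y a \<longleftrightarrow> pivot r I R y a"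
proof -
  note li = lazy_linI[OF L] and lj = lazy_linJ[OF L]
  have AI: "A \<subseteq> I" and BJ: "B \<subseteq> J" using A B unfolding same_outside_def by blast+
  have fin: "finite I" "finite J" "finite A" "finite B"
    using lazyD(1,2)[OF L] AI BJ finite_subset by auto
  have pivR': "pivot r' I R' y a \<longleftrightarrow> pivot r' I M y a" if "y \<in> B" for y a
    using that unfolding R'_def by simp
  have fwd: "pivot r' I R' y a" if y: "y \<in> J - B" and a: "pivot r I R y a" for y a
    using a same_outside_imp[OF A, of _ a] pivN[OF y a] y unfolding lead_def R'_def by auto
  show piv: "pivot r' I R' y a \<longleftrightarrow> pivot r I R y a" if y: "y \<in> J - B" for y a
  proof
    assume a: "pivot r' I R' y a"
    then have "a \<in> I" "R a y = 1" using y unfolding lead_def R'_def by auto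
    then obtain b where b: "pivot r I R y b" using lead_exists[OF li fin(1), of a "\<lambda>i. R i y"] by blast
    then show "pivot r I R y a" using lead_unique[OF lin'(1) a] fwd[OF y b] by blast
  qed (rule fwd[OF y])
  \<comment> \<open>By \<open>span\<close> no column outside \<open>B\<close> is added to one in
    \<open>B\<close>, so the factorisation restricts to these columns.\<close>
  have LB: "lazy r c I B M R U"
    unfolding lazy_def
  proof (intro conjI ballI impI allI)
    fix i y assume "i \<in> I" "y \<in> B"
    then have "M i y = (\<Sum>x\<in>J. R i x * U x y)" using lazy_eq[OF L] BJ by blast
    also have "\<dots> = (\<Sum>x\<in>B. R i x * U x y)"
    proof (rule sum.mono_neutral_right[OF fin(2) BJ], rule ballI)
      fix x assume "x \<in> J - B"
      then show "R i x * U x y = 0" using span[OF \<open>y \<in> B\<close>, of x] by (cases "U x y") auto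
    qed
    finally show "M i y = (\<Sum>x\<in>B. R i x * U x y)" .
  next
    fix x y a assume "x \<in> B" "y \<in> B" "pivot r I R x a" "pivot r I R y a"
    then show "x = y" using lazy_inj[OF L] BJ by blast
  next
    fix x y assume xy: "x \<in> B" "y \<in> B" "U x y = 1" "x \<noteq> y"
    then have xyJ: "x \<in> J" "y \<in> J" using BJ by auto
    show "c x y" using lazy_upper[OF L xyJ xy(3,4)] .
    show "\<exists>a. pivot r I R x a \<and> (\<forall>b. pivot r I R y b \<longrightarrow> r b a)"
      using lazy_pivot[OF L xyJ xy(3,4)] .
  qed (use fin li lin_subset[OF lj BJ] lazy_diag[OF L] BJ in auto)
  have "\<forall>x. \<exists>a. x \<in> B \<longrightarrow> (\<forall>i\<in>I. R i x = (\<Sum>b\<in>B. M i b * a b))"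
    using lazy_inverse[OF LB] by metis
  then obtain a where a: "\<forall>x. x \<in> B \<longrightarrow> (\<forall>i\<in>I. R i x = (\<Sum>b\<in>B. M i b * a x b))" by metis
  \<comment> \<open>The columns of \<open>B\<close> are those of \<open>M\<close>, whence the unit
    columns. For \<open>y\<close> outside, the part coming from \<open>B\<close> is expanded again:
    \<open>a z\<close> holds the coefficients of column \<open>z\<close> of \<open>R\<close> in the
    columns of \<open>M\<close>.\<close>
  define U' where "U' x y = (if y \<in> B then if x = y then 1 else 0
      else if x \<in> B then \<Sum>z\<in>B. a z x * U z y else U x y)" for x y
  have "lazy r' c' I J M R' U'"
    unfolding lazy_def
  proof (intro conjI ballI impI allI)
    fix i y assume i: "i \<in> I" and y: "y \<in> J"
    show "M i y = (\<Sum>x\<in>J. R' i x * U' x y)"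
    proof (cases "y \<in> B")
      case True
      then have "(\<Sum>x\<in>J. R' i x * U' x y) = (\<Sum>x\<in>J. if x = y then R' i y else 0)"
        unfolding U'_def by (intro sum.cong) auto
      then show ?thesis using True y fin unfolding R'_def by simp
    next
      case False
      have "(\<Sum>x\<in>B. R' i x * U' x y) = (\<Sum>x\<in>B. \<Sum>z\<in>B. M i x * (a z x * U z y))"
        unfolding U'_def R'_def using False by (intro sum.cong) (auto simp: sum_distrib_left)
      also have "\<dots> = (\<Sum>z\<in>B. (\<Sum>x\<in>B. M i x * a z x) * U z y)"
        by (subst sum.swap) (simp add: sum_distrib_right mult.assoc)
      also have "\<dots> = (\<Sum>z\<in>B. R i z * U z y)" using a i by (intro sum.cong) auto
      finally have "(\<Sum>x\<in>B. R' i x * U' x y) = (\<Sum>z\<in>B. R i z * U z y)" .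
      moreover have "(\<Sum>x\<in>J - B. R' i x * U' x y) = (\<Sum>x\<in>J - B. R i x * U x y)"
        unfolding U'_def R'_def using False by (intro sum.cong) auto
      ultimately show ?thesis
        using lazy_eq[OF L i y] sum.subset_diff[OF BJ fin(2), of "\<lambda>x. R i x * U x y"]
          sum.subset_diff[OF BJ fin(2), of "\<lambda>x. R' i x * U' x y"] by simp
    qed
  next
    fix y assume "y \<in> J"
    then show "U' y y = 1" using lazy_diag[OF L] unfolding U'_def by auto
  next
    fix x y assume xy: "x \<in> J" "y \<in> J" "U' x y = 1" "x \<noteq> y"
    then have yB: "y \<notin> B" unfolding U'_def by (auto split: if_splits)
    have "c' x y \<and> (\<exists>a. pivot r' I R' x a \<and> (\<forall>b. pivot r' I R' y b \<longrightarrow> r' b a))"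
    proof (cases "x \<in> B")
      case False
      then have U: "U x y = 1" using xy(3) yB unfolding U'_def by simp
      have "c' x y" using same_outside_imp[OF B xy(1,2) lazy_upper[OF L xy(1,2) U xy(4)]] yB by blast
      moreover obtain d where d: "pivot r I R x d" "\<forall>b. pivot r I R y b \<longrightarrow> r b d"
        using lazy_pivot[OF L xy(1,2) U xy(4)] by blast
      have "r' b d" if b: "pivot r' I R' y b" for b
        using same_outside_imp[OF A, of b d] d piv[of y] b xy yB pivN[of x d] False
        unfolding lead_def by blast
      ultimately show ?thesis using piv[of x d] d False xy by blast
    next
      case True
      then obtain z where z: "z \<in> B" "U z y = 1"
        using xy(3) yB bit_sum_mult_eq_1D[of "\<lambda>z. a z x" "\<lambda>z. U z y" B] unfolding U'_def by auto
      have zJ: "z \<in> J" "z \<noteq> y" using z BJ yB by auto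
      have "c z y" using lazy_upper[OF L zJ(1) xy(2) z(2) zJ(2)] .
      then have "c' x y"
        using same_outside_block(2)[OF B lj xy(2) yB z(1) True] same_outside_imp[OF B xy(1,2)] yB by blast
      moreover obtain d where d: "pivot r I R z d" "\<forall>b. pivot r I R y b \<longrightarrow> r b d"
        using lazy_pivot[OF L zJ(1) xy(2) z(2) zJ(2)] by blast
      have dA: "d \<in> A" using pivB[OF z(1)] d(1) lead_unique[OF li] by blast
      obtain d' where d': "d' \<in> A" "pivot r' I M x d'" using new[OF True] by blast
      have "r' b d'" if b: "pivot r' I R' y b" for b
      proof -
        have b': "pivot r I R y b" using piv b xy yB by blast
        then have "b \<in> I" "b \<notin> A" using pivN[of y b] xy yB unfolding lead_def by auto
        then show ?thesis
          using same_outside_block(1)[OF A li _ _ dA d'(1), of b] d(2) b' same_outside_imp[OF A, of b d'] d'(1) AI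
          by blast
      qed
      ultimately show ?thesis using d' pivR'[OF True] by blast
    qed
    then show "c' x y" "\<exists>a. pivot r' I R' x a \<and> (\<forall>b. pivot r' I R' y b \<longrightarrow> r' b a)" by blast+
  next
    have AB: "\<exists>a'\<in>A. a = a'" if "x \<in> B" "pivot r' I R' x a" for x a
      using that new[OF that(1)] pivR'[OF that(1)] lead_unique[OF lin'(1)] by blast
    fix x y a assume xy: "x \<in> J" "y \<in> J" "pivot r' I R' x a" "pivot r' I R' y a"
    show "x = y"
    proof (cases "x \<in> B"; cases "y \<in> B")
      assume "x \<in> B" "y \<in> B"
      then show ?thesis using inj pivR' xy by blast
    next
      assume "x \<in> B" "y \<notin> B"
      then show ?thesis using AB[of x a] pivN[of y a] piv[of y a] xy by blast
    next
      assume "x \<notin> B" "y \<in> B"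
      then show ?thesis using AB[of y a] pivN[of x a] piv[of x a] xy by blast
    next
      assume "x \<notin> B" "y \<notin> B"
      then show ?thesis using lazy_inj[OF L xy(1,2)] piv xy by blast
    qed
  qed (use fin lin' in auto)
  moreover have "\<forall>x\<in>J - B. \<forall>y\<in>J - B. U' x y = U x y" unfolding U'_def by simp
  ultimately show "\<exists>U'. lazy r' c' I J M R' U' \<and> (\<forall>x\<in>J - B. \<forall>y\<in>J - B. U' x y = U x y)" by blast
qed

section \<open>Correctness of the lazy reduction\<close>

lemma low_eq_Some_iff:
  assumes "lin r I" "finite I" "\<And>x. R x y = 1 \<Longrightarrow> x \<in> I"
  shows "low r R y = Some a \<longleftrightarrow> pivot r I R y a"
proof (cases "\<exists>x. R x y = 1")
  case True
  then obtain b where b: "pivot r I R y b"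
    using lead_exists[OF assms(1,2), of _ "\<lambda>i. R i y"] assms(3) by blast
  have *: "R x y = 1 \<and> (\<forall>z. R z y = 1 \<longrightarrow> z = x \<or> r z x) \<longleftrightarrow> pivot r I R y x" for x
    using assms(3) unfolding lead_def by blast
  have "(THE x. pivot r I R y x) = b"
    by (rule the_equality, rule b) (rule lead_unique[OF assms(1) _ b])
  then have "low r R y = Some b" using True by (simp add: low_def *)
  then show ?thesis using b lead_unique[OF assms(1) b, of a] by auto
next
  case False
  then show ?thesis unfolding low_def lead_def by auto
qed

text \<open>\<open>ordered_list\<close> is a definite description, so both existence and uniqueness
  of the sorted list have to be shown; irreflexivity excludes repetitions.\<close>

lemma ordered_list:
  assumes "lin r A" "finite A"
  shows "set (ordered_list r A) = A" "sorted_wrt r (ordered_list r A)" "distinct (ordered_list r A)"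
proof -
  have ex: "\<exists>cs. set cs = A \<and> sorted_wrt r cs"
    using assms(2,1)
  proof (induction A rule: finite_psubset_induct)
    case (psubset A)
    show ?case
    proof (cases "A = {}")
      case False
      then obtain m where m: "m \<in> A" "\<forall>x\<in>A. x = m \<or> r x m"
        using lin_max[OF psubset.prems psubset.hyps(1)] by blast
      obtain cs where cs: "set cs = A - {m}" "sorted_wrt r cs"
        using psubset.IH[of "A - {m}"] lin_subset[OF psubset.prems] m(1) by blast
      then have "set (cs @ [m]) = A \<and> sorted_wrt r (cs @ [m])"
        using m by (auto simp: sorted_wrt_append)
      then show ?thesis by blast
    qed auto
  qed
  have uniq: "cs = ds"
    if "set cs = set ds" "set ds \<subseteq> A" "sorted_wrt r cs" "sorted_wrt r ds" for cs ds
    using that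
  proof (induction cs arbitrary: ds)
    case (Cons x cs)
    then obtain y es where ds: "ds = y # es" by (cases ds) auto
    have irr: "x \<notin> set cs" "y \<notin> set es"
      using Cons.prems ds lin_irrefl[OF assms(1)] by auto
    have "x \<in> insert y (set es)" "y \<in> insert x (set cs)" using Cons.prems ds by auto
    moreover have "\<not> (x \<in> set es \<and> y \<in> set cs)"
      using Cons.prems ds lin_asym[OF assms(1), of x y] by auto
    ultimately have "x = y" by blast
    have "set cs = set es" using Cons.prems(1) ds irr \<open>x = y\<close>
      by (metis insert_ident list.simps(15))
    then have "cs = es" using Cons ds by auto
    then show ?case using ds \<open>x = y\<close> by simp
  qed simp
  have "\<exists>!cs. set cs = A \<and> sorted_wrt r cs"
    using ex uniq by (metis order_refl)
  then have *: "set (ordered_list r A) = A \<and> sorted_wrt r (ordered_list r A)"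
    unfolding ordered_list_def by (rule theI')
  then show "set (ordered_list r A) = A" "sorted_wrt r (ordered_list r A)" by auto
  have "distinct cs" if "sorted_wrt r cs" for cs
    using that lin_irrefl[OF assms(1)] by (induction cs) auto
  then show "distinct (ordered_list r A)" using * by blast
qed

text \<open>The loop invariant of \<open>reduce_column\<close>: \<open>R\<close> and
  \<open>U\<close> are the matrices when column \<open>y\<close> is reached, \<open>s\<close> holds
  the current ones. Every column added so far has its pivot strictly below the current lowest entry
  of \<open>y\<close>, a condition that becomes vacuous with a zero column.\<close>

definition reducing ::
    "('a \<Rightarrow> 'a \<Rightarrow> bool) \<Rightarrow> 'a set \<Rightarrow> 'a set \<Rightarrow> 'a mat \<Rightarrow> 'a mat \<Rightarrow> 'a mat \<Rightarrow> 'a \<Rightarrow> 'a mat \<times> 'a mat \<Rightarrow> bool"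
where
  "reducing r I K M R U y s \<longleftrightarrow> (case s of (R', U') \<Rightarrow>
     (\<forall>z. z \<noteq> y \<longrightarrow> (\<forall>i. R' i z = R i z \<and> U' i z = U i z)) \<and>
     (\<forall>x. R' x y = 1 \<longrightarrow> x \<in> I) \<and> U' y y = 1 \<and>
     (\<forall>x. U' x y = 1 \<longrightarrow> x = y \<or>
        x \<in> K \<and> (\<exists>a. pivot r I R x a \<and> (\<forall>b. pivot r I R' y b \<longrightarrow> r b a))) \<and>
     (\<forall>i. M i y = R' i y + (\<Sum>x\<in>K. R i x * U' x y)))"

lemma reduce_column:
  assumes li: "lin r I" and fin: "finite I" "finite (set K)"
    and R: "\<And>x z. R x z = 1 \<Longrightarrow> x \<in> I" and yK: "y \<notin> set K"
    and Ry: "\<And>x. R x y = M x y" and Uy: "\<And>x. U x y = (if x = y then 1 else 0)"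
    and Uyr: "\<And>z. z \<noteq> y \<Longrightarrow> U y z = 0"
  obtains R' U' where "reduce_column r K y (R, U) = (R', U')" "reducing r I (set K) M R U y (R', U')"
    "\<And>x a. x \<in> set K \<Longrightarrow> pivot r I R x a \<Longrightarrow> \<not> pivot r I R' y a"
proof -
  let ?b = "\<lambda>(R, U). low r R y \<noteq> None \<and> (\<exists>x\<in>set K. low r R x = low r R y)"
  let ?c = "\<lambda>(R, U). let x = (SOME x. x \<in> set K \<and> low r R x = low r R y)
                 in (add_column x y R, add_row x y U)"
  let ?P = "reducing r I (set K) M R U y"
  \<comment> \<open>Termination: the measure counts the rows at or above the current lowest entry of
    column \<open>y\<close>, and this entry rises strictly.\<close>
  let ?m = "\<lambda>(R', U'). card {i \<in> I. \<exists>b. pivot r I R' y b \<and> (i = b \<or> r i b)}"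
  let ?Q = "\<lambda>(R', U'). ?P (R', U') \<and> (\<forall>x\<in>set K. \<forall>a. pivot r I R x a \<longrightarrow> \<not> pivot r I R' y a)"
  have low_y: "low r R' y = Some a \<longleftrightarrow> pivot r I R' y a" if "?P (R', U')" for R' U' a
    by (rule low_eq_Some_iff[OF li fin(1)]) (use that in \<open>auto simp: reducing_def\<close>)
  have low_x: "low r R' x = Some a \<longleftrightarrow> pivot r I R x a" if "?P (R', U')" "x \<in> set K" for R' U' x a
  proof -
    have eq: "R' i x = R i x" for i using that yK unfolding reducing_def by auto
    show ?thesis
      by (subst low_eq_Some_iff[OF li fin(1)]) (auto simp: eq R)
  qed
  have "?Q (while ?b ?c (R, U))"
  proof (rule while_rule2[where P = ?P and r = "Wellfounded.measure ?m"])
    have "(\<Sum>x\<in>set K. R i x * U x y) = 0" for i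
      by (rule sum.neutral) (use yK Uy in auto)
    moreover have "x \<in> I" if "M x y = 1" for x using R[of x y] Ry that by simp
    ultimately show "?P (R, U)" unfolding reducing_def using Ry Uy by auto
  next
    fix s assume P: "?P s" and b: "?b s"
    obtain R' U' where s: "s = (R', U')" by (cases s)
    note P = P[unfolded s] and b = b[unfolded s, simplified]
    define x where "x = (SOME x. x \<in> set K \<and> low r R' x = low r R' y)"
    have x: "x \<in> set K" "low r R' x = low r R' y"
      using someI_ex[of "\<lambda>x. x \<in> set K \<and> low r R' x = low r R' y"] b unfolding x_def by auto
    obtain a where a: "pivot r I R' y a" using b low_y[OF P] by auto
    then have xa: "pivot r I R x a" using x low_y[OF P] low_x[OF P] by metis
    have ne: "x \<noteq> y" using x yK by auto
    \<comment> \<open>A column added earlier has its pivot strictly below the current one, so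
      \<open>x\<close> has not been added before, and its entry in \<open>U'\<close> goes from 0 to
      1 instead of being cancelled.\<close>
    have U0: "U' x y = 0"
    proof (rule ccontr)
      assume "U' x y \<noteq> 0"
      then obtain d where "pivot r I R x d" "r a d"
        using P a ne unfolding reducing_def by auto
      then show False using lead_unique[OF li xa] lin_irrefl[OF li] by blast
    qed
    have cs: "?c s = (add_column x y R', add_row x y U')" unfolding s x_def by (simp add: Let_def)
    have Rx: "R' i x = R i x" for i using P ne unfolding reducing_def by auto
    \<comment> \<open>Row \<open>y\<close> is a unit row until its column is finished, so adding it
      to row \<open>x\<close> changes nothing but the entry in column \<open>y\<close>.\<close>
    have Uyr': "U' y z = 0" if "z \<noteq> y" for z using P that Uyr unfolding reducing_def by auto
    have less: "r b a" if "pivot r I (add_column x y R') y b" for b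
    proof -
      have b: "b \<in> I" "R' b y + R b x = 1" using that Rx unfolding lead_def add_column_def by auto
      then have "b \<noteq> a" using a xa unfolding lead_def by (auto simp: bit_add_self)
      moreover have "R' b y = 1 \<or> R b x = 1" using b(2) by (cases "R' b y") auto
      ultimately show ?thesis using a xa b(1) unfolding lead_def by blast
    qed
    have "?P (add_column x y R', add_row x y U')"
      unfolding reducing_def prod.case
    proof (intro conjI allI impI)
      fix z i assume "z \<noteq> y"
      then show "add_column x y R' i z = R i z" "add_row x y U' i z = U i z"
        using P Uyr' unfolding reducing_def add_column_def add_row_def by auto
    next
      fix i assume "add_column x y R' i y = 1"
      then have "R' i y + R i x = 1" using Rx unfolding add_column_def by simp
      then have "R' i y = 1 \<or> R i x = 1" by (cases "R' i y") auto
      then show "i \<in> I" using R P unfolding reducing_def by blast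
    next
      show "add_row x y U' y y = 1" using P ne unfolding reducing_def add_row_def by auto
    next
      fix z assume "add_row x y U' z y = 1"
      then have "z = x \<or> U' z y = 1" unfolding add_row_def by (auto split: if_splits)
      then show "z = y \<or> z \<in> set K \<and>
          (\<exists>a. pivot r I R z a \<and> (\<forall>b. pivot r I (add_column x y R') y b \<longrightarrow> r b a))"
      proof
        assume "z = x"
        then show ?thesis using x(1) xa less by blast
      next
        assume "U' z y = 1"
        then have "z = y \<or> z \<in> set K \<and> (\<exists>d. pivot r I R z d \<and> r a d)"
          using P a unfolding reducing_def by blast
        then show ?thesis using less lin_trans[OF li] by blast
      qed
    next
      fix i
      have "(\<Sum>z\<in>set K. R i z * add_row x y U' z y) =
          R i x * add_row x y U' x y + (\<Sum>z\<in>set K - {x}. R i z * add_row x y U' z y)"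
        using x(1) fin by (simp add: sum.remove)
      also have "(\<Sum>z\<in>set K - {x}. R i z * add_row x y U' z y) = (\<Sum>z\<in>set K - {x}. R i z * U' z y)"
        by (intro sum.cong) (auto simp: add_row_def)
      also have "R i x * add_row x y U' x y = R i x"
        using U0 P unfolding add_row_def reducing_def by auto
      also have "(\<Sum>z\<in>set K - {x}. R i z * U' z y) = (\<Sum>z\<in>set K. R i z * U' z y)"
        using x(1) fin U0 by (simp add: sum.remove)
      finally have "(\<Sum>z\<in>set K. R i z * add_row x y U' z y) = R i x + (\<Sum>z\<in>set K. R i z * U' z y)" .
      moreover have "M i y = R' i y + (\<Sum>z\<in>set K. R i z * U' z y)"
        using P unfolding reducing_def by blast
      moreover have "add_column x y R' i y = R' i y + R i x" using Rx unfolding add_column_def by simp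
      ultimately show "M i y = add_column x y R' i y + (\<Sum>z\<in>set K. R i z * add_row x y U' z y)"
        by (cases "R i x") (auto simp: algebra_simps bit_add_self simp flip: add.assoc)
    qed
    moreover have "?m (add_column x y R', add_row x y U') < ?m (R', U')"
    proof -
      have "a \<in> I" using a unfolding lead_def by blast
      have "{i \<in> I. \<exists>b. pivot r I (add_column x y R') y b \<and> (i = b \<or> r i b)} \<subset>
          {i \<in> I. \<exists>b. pivot r I R' y b \<and> (i = b \<or> r i b)}" (is "?A \<subset> ?B")
      proof (rule psubsetI)
        show "?A \<subseteq> ?B"
        proof clarify
          fix i b assume "i \<in> I" "pivot r I (add_column x y R') y b" "i = b \<or> r i b"
          then show "\<exists>b. pivot r I R' y b \<and> (i = b \<or> r i b)"
            using less[of b] a lin_trans[OF li, of i b a] by blast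
        qed
        have "a \<in> ?B" using a \<open>a \<in> I\<close> by blast
        moreover have "a \<notin> ?A"
        proof
          assume "a \<in> ?A"
          then obtain b where "pivot r I (add_column x y R') y b" "a = b \<or> r a b" by blast
          then show False using less[of b] lin_asym[OF li, of a b] lin_irrefl[OF li, of a] by blast
        qed
        ultimately show "?A \<noteq> ?B" by blast
      qed
      then have "card ?A < card ?B" using fin by (intro psubset_card_mono) simp_all
      then show ?thesis by simp
    qed
    ultimately show "?P (?c s) \<and> (?c s, s) \<in> Wellfounded.measure ?m"
      unfolding cs by (simp add: s)
  next
    fix s assume P: "?P s" and b: "\<not> ?b s"
    obtain R' U' where s: "s = (R', U')" by (cases s)
    have "\<not> pivot r I R' y a" if "x \<in> set K" "pivot r I R x a" for x a
    proof
      assume "pivot r I R' y a"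
      then have "low r R' y = Some a" using low_y[OF P[unfolded s]] by blast
      moreover have "low r R' x = Some a" using low_x[OF P[unfolded s]] that by blast
      ultimately show False using b that(1) unfolding s by auto
    qed
    then show "?Q s" using P s by auto
  qed auto
  moreover obtain R' U' where w: "while ?b ?c (R, U) = (R', U')" by (cases "while ?b ?c (R, U)")
  ultimately have Q: "?P (R', U')" "\<forall>x\<in>set K. \<forall>a. pivot r I R x a \<longrightarrow> \<not> pivot r I R' y a"
    unfolding w prod.case by blast+
  show thesis
  proof (rule that[OF _ Q(1)])
    show "reduce_column r K y (R, U) = (R', U')" unfolding reduce_column_def w ..
  qed (use Q(2) in blast)
qed

text \<open>Invariant over the prefixes of the list: the processed columns carry a lazy
  factorisation, the other columns of \<open>R\<close> are still those of \<open>M\<close>, and the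
  rows and columns of \<open>U\<close> that belong to them are still those of the identity.\<close>

lemma lazy_reduction_lazy:
  assumes li: "lin r I" and lc: "lin c (set cols)" and fin: "finite I"
    and cols: "distinct cols" "sorted_wrt c cols"
    and M: "\<And>x z. M x z = 1 \<Longrightarrow> x \<in> I"
  obtains R U where "lazy_reduction r cols M = (R, U)" "lazy r c I (set cols) M R U"
    "\<And>x z. R x z = 1 \<Longrightarrow> x \<in> I"
proof -
  let ?Inv = "\<lambda>k (R, U). lazy r c I (set (take k cols)) M R U \<and> (\<forall>x z. R x z = 1 \<longrightarrow> x \<in> I) \<and>
    (\<forall>y. y \<notin> set (take k cols) \<longrightarrow> (\<forall>x. R x y = M x y)) \<and>
    (\<forall>y. y \<in> set cols \<longrightarrow> y \<notin> set (take k cols) \<longrightarrow> 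
       (\<forall>x. U x y = (if x = y then 1 else 0) \<and> (x \<noteq> y \<longrightarrow> U y x = 0)))"
  have "?Inv k (fold (\<lambda>i. reduce_column r (take i cols) (cols ! i)) [0..<k]
       (M, identity_matrix (set cols)))" if "k \<le> length cols" for k
    using that
  proof (induction k)
    case 0
    have "lin c {}" using lin_subset[OF lc] by blast
    then have "lazy r c I (set (take 0 cols)) M M (identity_matrix (set cols))"
      using li fin unfolding lazy_def by simp
    then show ?case by (auto simp: identity_matrix_def dest: M)
  next
    case (Suc k)
    obtain R U where RU: "fold (\<lambda>i. reduce_column r (take i cols) (cols ! i)) [0..<k]
       (M, identity_matrix (set cols)) = (R, U)" by force
    let ?K = "set (take k cols)" and ?y = "cols ! k"
    have Inv: "lazy r c I ?K M R U" "\<And>x z. R x z = 1 \<Longrightarrow> x \<in> I"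
      "\<And>y x. y \<notin> ?K \<Longrightarrow> R x y = M x y"
      "\<And>y x. y \<in> set cols \<Longrightarrow> y \<notin> ?K \<Longrightarrow> U x y = (if x = y then 1 else 0)"
      "\<And>y x. y \<in> set cols \<Longrightarrow> y \<notin> ?K \<Longrightarrow> x \<noteq> y \<Longrightarrow> U y x = 0"
      using Suc RU by auto
    have k: "k < length cols" using Suc.prems by simp
    have y: "?y \<in> set cols" "?y \<notin> ?K"
      using k cols(1) by (auto simp: in_set_conv_nth nth_eq_iff_index_eq)
    have take: "set (take (Suc k) cols) = insert ?y ?K"
      using k by (simp add: take_Suc_conv_app_nth)
    have before: "c x ?y" if "x \<in> ?K" for x
      using that cols(2) k by (auto simp: in_set_conv_nth sorted_wrt_iff_nth_less)
    obtain R' U' where R': "reduce_column r (take k cols) ?y (R, U) = (R', U')"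
      and red: "reducing r I ?K M R U ?y (R', U')"
      and new: "\<And>x a. x \<in> ?K \<Longrightarrow> pivot r I R x a \<Longrightarrow> \<not> pivot r I R' ?y a"
      by (rule reduce_column[where R = R and U = U and M = M, OF li fin finite_set Inv(2) y(2)
            Inv(3)[OF y(2)] Inv(4)[OF y] Inv(5)[OF y]]) simp_all
    have same: "R' i z = R i z" "U' i z = U i z" if "z \<noteq> ?y" for i z
      using red that unfolding reducing_def by auto
    have Rs: "R' x z = 1 \<Longrightarrow> x \<in> I" for x z
      using red same Inv(2) unfolding reducing_def by (cases "z = ?y") auto
    have pivs: "pivot r I R' z a \<longleftrightarrow> pivot r I R z a" if "z \<noteq> ?y" for z a
      using same[OF that] by (intro lead_cong) auto
    have yne: "z \<noteq> ?y" if "z \<in> ?K" for z using that y(2) by blast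
    have "lazy r c I (insert ?y ?K) M R' U'"
      unfolding lazy_def
    proof (intro conjI ballI impI allI)
      show "lin c (insert ?y ?K)"
        by (rule lin_subset[OF lc]) (use y set_take_subset[of k cols] in blast)
    next
      fix i z assume i: "i \<in> I" and z: "z \<in> insert ?y ?K"
      have sm: "(\<Sum>x\<in>insert ?y ?K. R' i x * U' x z) = R' i ?y * U' ?y z + (\<Sum>x\<in>?K. R i x * U' x z)"
        using y(2) yne same(1) by (simp add: sum.insert)
      show "M i z = (\<Sum>x\<in>insert ?y ?K. R' i x * U' x z)"
      proof (cases "z = ?y")
        case True
        then show ?thesis using sm red unfolding reducing_def by auto
      next
        case False
        then have "U' ?y z = 0" using same(2)[OF False] Inv(5)[OF y] by auto
        moreover have "(\<Sum>x\<in>?K. R i x * U' x z) = M i z"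
          using lazy_eq[OF Inv(1) i, of z] z False same(2)[OF False] by simp
        ultimately show ?thesis using sm by simp
      qed
    next
      fix z assume "z \<in> insert ?y ?K"
      then show "U' z z = 1"
        using red lazy_diag[OF Inv(1)] same(2) unfolding reducing_def by (cases "z = ?y") auto
    next
      fix x z assume xz: "x \<in> insert ?y ?K" "z \<in> insert ?y ?K" "U' x z = 1" "x \<noteq> z"
      have "c x z \<and> (\<exists>a. pivot r I R' x a \<and> (\<forall>b. pivot r I R' z b \<longrightarrow> r b a))"
      proof (cases "z = ?y")
        case True
        then have "x \<in> ?K" using xz by blast
        then show ?thesis
          using red xz True before pivs[OF yne] unfolding reducing_def by (auto simp del: bit_not_zero_iff)
      next
        case False
        then have "x \<noteq> ?y" using xz same(2)[OF False] Inv(5)[OF y, of z] by auto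
        then have xz': "x \<in> ?K" "z \<in> ?K" "U x z = 1" using xz False same(2)[OF False] by auto
        then show ?thesis
          using lazy_upper[OF Inv(1) xz' xz(4)] lazy_pivot[OF Inv(1) xz' xz(4)] pivs yne by blast
      qed
      then show "c x z" "\<exists>a. pivot r I R' x a \<and> (\<forall>b. pivot r I R' z b \<longrightarrow> r b a)" by blast+
    next
      fix x z a assume "x \<in> insert ?y ?K" "z \<in> insert ?y ?K" "pivot r I R' x a" "pivot r I R' z a"
      then show "x = z"
        using new pivs yne lazy_inj[OF Inv(1)] by (metis insertE)
    qed (use fin li in auto)
    moreover have "U' x z = (if x = z then 1 else 0)" "x \<noteq> z \<Longrightarrow> U' z x = 0"
      if z: "z \<in> set cols" "z \<notin> insert ?y ?K" for x z
    proof -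
      show "U' x z = (if x = z then 1 else 0)" using same(2) Inv(4) z by auto
      assume "x \<noteq> z"
      show "U' z x = 0"
      proof (cases "x = ?y")
        case True
        have "U' z ?y = 1 \<longrightarrow> z = ?y \<or> z \<in> ?K"
          using red unfolding reducing_def prod.case by blast
        then show ?thesis using z True by (cases "U' z ?y") auto
      next
        case False
        then show ?thesis using same(2) Inv(5) z \<open>x \<noteq> z\<close> by auto
      qed
    qed
    moreover have "R' x z = M x z" if "z \<notin> insert ?y ?K" for x z
      using same(1) Inv(3) that by auto
    moreover have "fold (\<lambda>i. reduce_column r (take i cols) (cols ! i)) [0..<Suc k]
       (M, identity_matrix (set cols)) = (R', U')"
      using RU R' by simp
    ultimately show ?case using Rs by (simp only: take prod.case) blast
  qed
  from this[of "length cols"] show thesis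
    using that unfolding lazy_reduction_def
    by (cases "fold (\<lambda>i. reduce_column r (take i cols) (cols ! i)) [0..<length cols]
       (M, identity_matrix (set cols))") auto
qed

lemma lazy_cong:
  assumes L: "lazy r c I J M R U" and "lin r' I" "lin c' J"
    and r: "\<And>x y. x \<in> I \<Longrightarrow> y \<in> I \<Longrightarrow> r x y \<longleftrightarrow> r' x y"
    and c: "\<And>x y. x \<in> J \<Longrightarrow> y \<in> J \<Longrightarrow> c x y \<longleftrightarrow> c' x y"
    and M: "\<And>x y. x \<in> I \<Longrightarrow> y \<in> J \<Longrightarrow> M x y = M' x y"
  shows "lazy r' c' I J M' R U" and "\<And>v a. lead r' I v a \<longleftrightarrow> lead r I v a"
proof -
  show lead: "lead r' I v a \<longleftrightarrow> lead r I v a" for v a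
    using r unfolding lead_def by blast
  have "lazy r' c' I J M R U"
  proof (rule lazy_reorder(1)[OF L assms(2,3)])
    show "c' x y" if "x \<in> J" "y \<in> J" "U x y = 1" "x \<noteq> y" for x y
      using lazy_upper[OF L that] c that by blast
    show "r' b a" if "pivot r I R x a" "pivot r I R y b" "r b a" for x y a b
      using that r unfolding lead_def by blast
  qed (use lead in blast)
  then show "lazy r' c' I J M' R U" using M unfolding lazy_def by simp
qed

section \<open>The fibres of a discrete Morse function\<close>

locale filtered =
  fixes X :: "'a lefschetz" and g :: "'a \<Rightarrow> real"
  assumes X: "lefschetz_complex X" and g: "dMf X g"
begin

abbreviation V where "V \<equiv> fibre_field X g"
abbreviation r where "r \<equiv> h_less X g"

definition vec :: "'a \<Rightarrow> 'a \<Rightarrow> bool" where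
  "vec s t \<longleftrightarrow> facet X s t \<and> g s = g t"

lemma finite_cells: "finite (cells X)"
  using X unfolding lefschetz_complex_def by blast

lemma facet_dim: "facet X x y \<Longrightarrow> cdim X y = cdim X x + 1"
  using X unfolding lefschetz_complex_def facet_def by (metis)

lemma facet_cells: "facet X x y \<Longrightarrow> x \<in> cells X" "facet X x y \<Longrightarrow> y \<in> cells X"
  unfolding facet_def by auto

lemma facet_irrefl: "\<not> facet X x x"
  using facet_dim by fastforce

lemma facet_asym: "facet X x y \<Longrightarrow> \<not> facet X y x"
  using facet_dim[of x y] facet_dim[of y x] by auto

lemma inc_eq_1: "x \<in> cells X \<Longrightarrow> y \<in> cells X \<Longrightarrow> inc X x y = 1 \<longleftrightarrow> facet X x y"
  unfolding facet_def by simp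

lemma facet_facet_even:
  "x \<in> cells X \<Longrightarrow> y \<in> cells X \<Longrightarrow> (\<Sum>z\<in>cells X. inc X x z * inc X z y) = 0"
  using X unfolding lefschetz_complex_def by blast

lemma facet_le: "facet X x y \<Longrightarrow> g x \<le> g y"
  using g unfolding dMf_def facet_def by auto

lemma same_value: "x \<in> cells X \<Longrightarrow> y \<in> cells X \<Longrightarrow> x \<noteq> y \<Longrightarrow> g x = g y \<Longrightarrow> vec x y \<or> vec y x"
proof -
  assume *: "x \<in> cells X" "y \<in> cells X" "x \<noteq> y" "g x = g y"
  then have "inc X x y = 1 \<or> inc X y x = 1" using g unfolding dMf_def by blast
  then show ?thesis using * unfolding vec_def facet_def by auto
qed

lemma three_values:
  assumes "x \<in> cells X" "y \<in> cells X" "z \<in> cells X" "g x = g y" "g y = g z"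
  shows "x = y \<or> y = z \<or> x = z"
proof (rule ccontr)
  assume *: "\<not> ?thesis"
  have "card {x, y, z} \<le> card {w \<in> cells X. g w = g z}"
    using assms finite_cells by (intro card_mono) auto
  moreover have "card {w \<in> cells X. g w = g z} \<le> 2" using g unfolding dMf_def by blast
  moreover have "card {x, y, z} = 3" using * by simp
  ultimately show False by simp
qed

lemma Crit_iff: "x \<in> Crit V \<longleftrightarrow> x \<in> cells X \<and> (\<forall>y\<in>cells X. g y = g x \<longrightarrow> y = x)"
proof
  assume "x \<in> Crit V"
  then obtain z where z: "{x} = {y \<in> cells X. g y = g z}"
    unfolding Crit_def fibre_field_def by blast
  then have "x \<in> cells X" "g x = g z" by auto
  then show "x \<in> cells X \<and> (\<forall>y\<in>cells X. g y = g x \<longrightarrow> y = x)" using z by auto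
next
  assume *: "x \<in> cells X \<and> (\<forall>y\<in>cells X. g y = g x \<longrightarrow> y = x)"
  then have "{x} = {y \<in> cells X. g y = g x}" by auto
  then show "x \<in> Crit V" using * unfolding Crit_def fibre_field_def by blast
qed

lemma Crit_cells: "x \<in> Crit V \<Longrightarrow> x \<in> cells X"
  unfolding Crit_iff by blast

lemma Crit_value: "x \<in> Crit V \<Longrightarrow> y \<in> cells X \<Longrightarrow> g y = g x \<Longrightarrow> y = x"
  unfolding Crit_iff by blast

lemma finite_Crit: "finite (Crit V)"
  using finite_cells Crit_cells by (meson finite_subset subsetI)

lemma vec_cells: "vec s t \<Longrightarrow> s \<in> cells X" "vec s t \<Longrightarrow> t \<in> cells X" "vec s t \<Longrightarrow> s \<noteq> t"
  unfolding vec_def using facet_cells facet_irrefl by auto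

lemma vec_not_Crit: "vec s t \<Longrightarrow> s \<notin> Crit V" "vec s t \<Longrightarrow> t \<notin> Crit V"
  using Crit_value vec_cells unfolding vec_def by metis+

lemma not_Crit_vec: "x \<in> cells X \<Longrightarrow> x \<notin> Crit V \<Longrightarrow> (\<exists>y. vec x y) \<or> (\<exists>w. vec w x)"
  using same_value unfolding Crit_iff by blast

lemma vec_unique: "vec s t \<Longrightarrow> z \<in> cells X \<Longrightarrow> g z = g s \<Longrightarrow> z = s \<or> z = t"
  using three_values[of z s t] vec_cells[of s t] unfolding vec_def by auto

lemma vec_fun: "vec s t \<Longrightarrow> vec s u \<Longrightarrow> u = t"
proof -
  assume *: "vec s t" "vec s u"
  then have "g u = g s" unfolding vec_def by simp
  then show "u = t" using vec_unique[OF *(1) vec_cells(2)[OF *(2)]] vec_cells(3)[OF *(2)] by blast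
qed

lemma vec_asym: "vec s t \<Longrightarrow> \<not> vec t u"
proof
  assume *: "vec s t" "vec t u"
  then have "g u = g s" unfolding vec_def by simp
  then have "u = s \<or> u = t" using vec_unique[OF *(1) vec_cells(2)[OF *(2)]] by blast
  moreover have "facet X s t" "facet X t u" using * unfolding vec_def by blast+
  ultimately show False using facet_asym[of s t] facet_irrefl by blast
qed

lemma fibre_doubleton:
  assumes "x \<noteq> y"
  shows "{x, y} \<in> V \<longleftrightarrow> vec x y \<or> vec y x"
proof
  assume "{x, y} \<in> V"
  then obtain z where "{x, y} = {w \<in> cells X. g w = g z}" unfolding fibre_field_def by auto
  moreover have "x \<in> {x, y}" "y \<in> {x, y}" by auto
  ultimately have "x \<in> cells X" "y \<in> cells X" "g x = g y" by auto
  then show "vec x y \<or> vec y x" using same_value assms by blast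
next
  have "{s, t} \<in> V" if "vec s t" for s t
  proof -
    have "{s, t} = {w \<in> cells X. g w = g s}"
      using vec_unique[OF that] vec_cells[OF that] that unfolding vec_def by auto
    then show ?thesis using vec_cells[OF that] unfolding fibre_field_def by blast
  qed
  then show "vec x y \<or> vec y x \<Longrightarrow> {x, y} \<in> V" by (metis insert_commute)
qed

lemma arc_iff: "arc X V x y \<longleftrightarrow> vec x y \<or> (facet X y x \<and> g y < g x)"
proof (cases "x = y")
  case True
  then show ?thesis using facet_irrefl unfolding arc_def vec_def by blast
next
  case False
  have "facet X x y \<and> (vec x y \<or> vec y x) \<longleftrightarrow> vec x y"
    using facet_asym[of x y] unfolding vec_def by blast
  moreover have "facet X y x \<and> \<not> (vec x y \<or> vec y x) \<longleftrightarrow> facet X y x \<and> g y < g x"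
    using facet_le[of y x] facet_asym[of y x] unfolding vec_def by auto
  ultimately show ?thesis unfolding arc_def fibre_doubleton[OF False] by blast
qed

lemma arc_cells: "arc X V x y \<Longrightarrow> x \<in> cells X" "arc X V x y \<Longrightarrow> y \<in> cells X"
  unfolding arc_def using facet_cells by auto

lemma lin_h_less: "lin r (cells_of_dim X n)"
proof -
  have "x = y" if "x \<in> cells_of_dim X n" "y \<in> cells_of_dim X n" "g x = g y" for x y
    using same_value[of x y] facet_dim[of x y] facet_dim[of y x] that
    unfolding cells_of_dim_def vec_def by auto
  then show ?thesis unfolding lin_def h_less_def by (auto simp: linorder_neq_iff)
qed

lemma h_less_same_dim:
  "x \<in> cells X \<Longrightarrow> y \<in> cells X \<Longrightarrow> cdim X x = cdim X y \<Longrightarrow> r x y \<longleftrightarrow> g x < g y"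
  unfolding h_less_def by auto

lemma same_dim_value:
  "x \<in> cells X \<Longrightarrow> y \<in> cells X \<Longrightarrow> cdim X x = cdim X y \<Longrightarrow> g x = g y \<Longrightarrow> x = y"
  using same_value[of x y] facet_dim[of x y] facet_dim[of y x] unfolding vec_def by auto

section \<open>Paths of the vector field\<close>

text \<open>A strict order followed by every arc: a vector is climbed at constant value, and every
  other arc lowers the value. It makes the graph acyclic and its paths free of repetitions, hence
  finite in number.\<close>

definition descends :: "'a \<Rightarrow> 'a \<Rightarrow> bool" where
  "descends x y \<longleftrightarrow> g y < g x \<or> g y = g x \<and> cdim X x < cdim X y"

lemma arc_descends: "arc X V x y \<Longrightarrow> descends x y"
  unfolding arc_iff descends_def vec_def using facet_dim by auto

lemma descends_trans: "descends x y \<Longrightarrow> descends y z \<Longrightarrow> descends x z"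
  unfolding descends_def by auto

lemma descends_irrefl: "\<not> descends x x"
  unfolding descends_def by auto

lemma paths_distinct:
  assumes "p \<in> paths X V x y"
  shows "distinct p" "sorted_wrt descends p"
proof -
  have "successively descends p"
    using assms arc_descends unfolding paths_def by (auto elim: successively_mono)
  then show "sorted_wrt descends p"
    by (simp add: successively_conv_sorted_wrt transpI[of descends] descends_trans)
  then show "distinct p"
    using descends_irrefl by (induction p) auto
qed

lemma finite_paths: "finite (paths X V x y)"
proof (rule finite_subset)
  show "paths X V x y \<subseteq> {p. set p \<subseteq> cells X \<and> distinct p}"
    using paths_distinct unfolding paths_def by auto
qed (rule finite_subset_distinct[OF finite_cells])

lemma paths_step:
  assumes "x \<in> cells X"
  shows "paths X V x y = (if x = y then {[x]} else {}) \<union> (\<Union>z\<in>{z \<in> cells X. arc X V x z}. (#) x ` paths X V z y)"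
    (is "_ = ?A \<union> ?B")
proof (intro subset_antisym subsetI)
  fix p assume p: "p \<in> paths X V x y"
  then obtain q where pq: "p = x # q" unfolding paths_def by (cases p) auto
  show "p \<in> ?A \<union> ?B"
  proof (cases q)
    case Nil
    then show ?thesis using p pq unfolding paths_def by auto
  next
    case (Cons z q')
    then have "arc X V x z" "q \<in> paths X V z y" using p pq unfolding paths_def by auto
    then show ?thesis using pq arc_cells by blast
  qed
next
  fix p assume p: "p \<in> ?A \<union> ?B"
  show "p \<in> paths X V x y"
  proof (cases "p \<in> ?A")
    case True
    then show ?thesis using assms unfolding paths_def by (auto split: if_splits)
  next
    case False
    then obtain z q where "arc X V x z" "q \<in> paths X V z y" "p = x # q" using p by blast
    then show ?thesis using assms unfolding paths_def by (cases q) auto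
  qed
qed

lemma reaches_refl: "x \<in> cells X \<Longrightarrow> reaches X V x x"
  unfolding reaches_def by (subst paths_step) auto

lemma reaches_step: "arc X V x z \<Longrightarrow> reaches X V z y \<Longrightarrow> reaches X V x y"
  unfolding reaches_def using arc_cells by (subst paths_step) auto

lemma reaches_cases:
  assumes "reaches X V x y"
  obtains "x = y" "x \<in> cells X" | z where "arc X V x z" "reaches X V z y"
proof -
  have "x \<in> cells X" using assms unfolding reaches_def paths_def by (auto intro: hd_in_set)
  then show thesis using assms that unfolding reaches_def by (subst (asm) paths_step) (auto split: if_splits)
qed

lemma reaches_cells: "reaches X V x y \<Longrightarrow> x \<in> cells X" "reaches X V x y \<Longrightarrow> y \<in> cells X"
  unfolding reaches_def paths_def by (auto intro: hd_in_set last_in_set)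

lemma reaches_iff: "reaches X V x y \<longleftrightarrow> x \<in> cells X \<and> (arc X V)\<^sup>*\<^sup>* x y"
proof
  assume "reaches X V x y"
  then obtain p where p: "p \<in> paths X V x y" unfolding reaches_def by blast
  then show "x \<in> cells X \<and> (arc X V)\<^sup>*\<^sup>* x y"
  proof (induction p arbitrary: x)
    case Nil
    then show ?case unfolding paths_def by simp
  next
    case (Cons z p)
    then have z: "z = x" "x \<in> cells X" unfolding paths_def by auto
    have "z # p \<in> (if x = y then {[x]} else {}) \<union> (\<Union>z\<in>{z \<in> cells X. arc X V x z}. (#) x ` paths X V z y)"
      using Cons.prems paths_step[OF z(2)] by metis
    then show ?case using Cons.IH z
      by (auto split: if_splits intro: converse_rtranclp_into_rtranclp)
  qed
next
  assume *: "x \<in> cells X \<and> (arc X V)\<^sup>*\<^sup>* x y"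
  then have "(arc X V)\<^sup>*\<^sup>* x y" "x \<in> cells X" by auto
  then show "reaches X V x y"
  proof (induction rule: converse_rtranclp_induct)
    case base
    then show ?case by (rule reaches_refl)
  next
    case (step y z)
    then show ?case using reaches_step arc_cells by blast
  qed
qed

lemma reaches_descends: "reaches X V x y \<Longrightarrow> x = y \<or> descends x y"
proof -
  assume "reaches X V x y"
  then have "(arc X V)\<^sup>*\<^sup>* x y" unfolding reaches_iff by blast
  then show ?thesis
    by (induction rule: rtranclp_induct) (auto dest: arc_descends intro: descends_trans)
qed

lemma reaches_le: "reaches X V x y \<Longrightarrow> g y \<le> g x"
  using reaches_descends unfolding descends_def by fastforce

text \<open>Going up along a vector is compensated by the fact that its upper cell can never be entered
  from above and left upwards again.\<close>

lemma reaches_dim: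
  assumes "reaches X V w c" "c \<in> Crit V"
  shows "cdim X c \<le> cdim X w \<and> ((\<exists>s. vec s w) \<longrightarrow> cdim X c < cdim X w)"
proof -
  have "(arc X V)\<^sup>*\<^sup>* w c" using assms(1) unfolding reaches_iff by blast
  then show ?thesis
  proof (induction rule: converse_rtranclp_induct)
    case base
    then show ?case using assms(2) vec_not_Crit by blast
  next
    case (step w z)
    from step.hyps(1)[unfolded arc_iff] show ?case
    proof
      assume v: "vec w z"
      then have "cdim X z = cdim X w + 1" using facet_dim unfolding vec_def by blast
      moreover have "cdim X c < cdim X z" using step.IH v by blast
      ultimately show ?thesis using vec_asym v by auto
    next
      assume "facet X z w \<and> g z < g w"
      then show ?thesis using step.IH facet_dim by fastforce
    qed
  qed
qed

text \<open>With a critical second argument this is the linear functional which reads the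
  coefficient of that cell after flowing down along the vectors; between critical cells of
  successive dimensions it is the incidence of the Morse complex.\<close>

definition np :: "'a \<Rightarrow> 'a \<Rightarrow> bit" where
  "np x y = of_nat (card (paths X V x y))"

lemma np_unreachable: "\<not> reaches X V x y \<Longrightarrow> np x y = 0"
  unfolding np_def reaches_def by simp

lemma np_refl:
  assumes "x \<in> cells X"
  shows "np x x = 1"
proof -
  have "paths X V z x = {}" if "arc X V x z" for z
    using reaches_descends[of z x] arc_descends[OF that] descends_trans descends_irrefl
    unfolding reaches_def by metis
  then have "paths X V x x = {[x]}" by (subst paths_step[OF assms]) auto
  then show ?thesis unfolding np_def by simp
qed

lemma np_step:
  assumes "x \<in> cells X" "x \<noteq> y"
  shows "np x y = (\<Sum>z\<in>{z \<in> cells X. arc X V x z}. np z y)"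
proof -
  have "card (paths X V x y) = card (\<Union>z\<in>{z \<in> cells X. arc X V x z}. (#) x ` paths X V z y)"
    using assms(2) by (subst paths_step[OF assms(1)]) simp
  also have "\<dots> = (\<Sum>z\<in>{z \<in> cells X. arc X V x z}. card ((#) x ` paths X V z y))"
  proof (rule card_UN_disjoint)
    show "\<forall>i\<in>{z \<in> cells X. arc X V x z}. \<forall>j\<in>{z \<in> cells X. arc X V x z}. i \<noteq> j \<longrightarrow>
        (#) x ` paths X V i y \<inter> (#) x ` paths X V j y = {}"
      unfolding paths_def by auto
  qed (use finite_cells finite_paths in auto)
  also have "\<dots> = (\<Sum>z\<in>{z \<in> cells X. arc X V x z}. card (paths X V z y))"
    by (intro sum.cong refl card_image) simp
  finally show ?thesis unfolding np_def by (simp add: of_nat_sum)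
qed

text \<open>Values do not rise along paths. This is the triangularity which
  \<open>lazy_transfer\<close> asks of its functionals.\<close>

lemma np_lead: "np i a = 1 \<Longrightarrow> a \<in> Crit V \<Longrightarrow> i = a \<or> g a < g i"
  using reaches_descends[of i a] np_unreachable[of i a] reaches_cells[of i a] Crit_value[of a i]
  unfolding descends_def by fastforce

lemma np_dim: "c \<in> Crit V \<Longrightarrow> cdim X w < cdim X c \<Longrightarrow> np w c = 0"
  using reaches_dim[of w c] np_unreachable by fastforce

lemma sum_cells_of_dim_inc:
  assumes "y \<in> cells X" "cdim X y = n + 1"
  shows "(\<Sum>i\<in>cells_of_dim X n. f i * inc X i y) = (\<Sum>i\<in>{i. facet X i y}. f i)"
proof -
  have "(\<Sum>i\<in>cells_of_dim X n. f i * inc X i y) = (\<Sum>i\<in>{i. facet X i y}. f i * inc X i y)"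
  proof (rule sum.mono_neutral_right)
    show "{i. facet X i y} \<subseteq> cells_of_dim X n"
      using assms facet_cells facet_dim unfolding cells_of_dim_def by fastforce
    show "\<forall>i\<in>cells_of_dim X n - {i. facet X i y}. f i * inc X i y = 0"
      using assms unfolding facet_def cells_of_dim_def by auto
  qed (use finite_cells in \<open>auto simp: cells_of_dim_def\<close>)
  also have "\<dots> = (\<Sum>i\<in>{i. facet X i y}. f i)"
    by (intro sum.cong) (auto simp: facet_def)
  finally show ?thesis .
qed

text \<open>The arcs leaving a critical cell go exactly to its facets, so the paths split according
  to their first arc.\<close>

lemma np_Crit_boundary:
  assumes "y \<in> Crit V" "cdim X y = n + 1" "cdim X c = n"
  shows "(\<Sum>i\<in>cells_of_dim X n. np i c * inc X i y) = np y c"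
proof -
  have y: "y \<in> cells X" "y \<noteq> c" using Crit_cells assms by auto
  have "{z \<in> cells X. arc X V y z} = {i. facet X i y}"
  proof (intro set_eqI iffI; clarify)
    fix i assume "arc X V y i"
    then show "facet X i y" using vec_not_Crit(1) assms(1) unfolding arc_iff by blast
  next
    fix i assume i: "facet X i y"
    then have "i \<in> cells X" "g i \<le> g y" using facet_cells facet_le by blast+
    moreover have "g i \<noteq> g y"
      using Crit_value[OF assms(1) \<open>i \<in> cells X\<close>] i facet_irrefl by blast
    ultimately show "i \<in> cells X \<and> arc X V y i" using i unfolding arc_iff by simp
  qed
  then show ?thesis unfolding np_step[OF y] sum_cells_of_dim_inc[OF y(1) assms(2)] by simp
qed

text \<open>Paths from \<open>t\<close> start through any facet except \<open>s\<close>. Paths from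
  \<open>s\<close> to \<open>c\<close> must climb to \<open>t\<close>, since all other arcs lead
  below the dimension of \<open>c\<close>. Hence \<open>s\<close> contributes as much as all other
  facets together, and the sum is even.\<close>

lemma np_vec_boundary:
  assumes "vec s t" "cdim X s = n" "c \<in> Crit V" "cdim X c = n"
  shows "(\<Sum>i\<in>cells_of_dim X n. np i c * inc X i t) = 0"
proof -
  have t: "t \<in> cells X" "cdim X t = n + 1" "facet X s t" "g s = g t" "t \<noteq> c" "s \<noteq> c" "s \<in> cells X"
    using assms vec_cells[OF assms(1)] facet_dim vec_not_Crit[OF assms(1)] unfolding vec_def by auto
  have "{z \<in> cells X. arc X V t z} = {i. facet X i t} - {s}"
  proof (intro set_eqI iffI)
    fix i assume "i \<in> {z \<in> cells X. arc X V t z}"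
    then show "i \<in> {i. facet X i t} - {s}"
      using vec_asym[OF assms(1)] t(4) unfolding arc_iff by auto
  next
    fix i assume i: "i \<in> {i. facet X i t} - {s}"
    then have "i \<in> cells X" "g i \<le> g t" using facet_cells facet_le by blast+
    moreover have "g i \<noteq> g t"
      using vec_unique[OF assms(1) \<open>i \<in> cells X\<close>] i facet_irrefl t(4) by auto
    ultimately show "i \<in> {z \<in> cells X. arc X V t z}" using i unfolding arc_iff by simp
  qed
  then have npt: "np t c = (\<Sum>i\<in>{i. facet X i t} - {s}. np i c)" using np_step[OF t(1,5)] by simp
  have "np s c = (\<Sum>z\<in>{z \<in> cells X. arc X V s z}. np z c)" by (rule np_step[OF t(7,6)])
  also have "\<dots> = (\<Sum>z\<in>{t}. np z c)"
  proof (rule sum.mono_neutral_right)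
    show "{t} \<subseteq> {z \<in> cells X. arc X V s z}" using assms(1) t arc_iff by blast
    show "\<forall>i\<in>{z \<in> cells X. arc X V s z} - {t}. np i c = 0"
    proof
      fix i assume i: "i \<in> {z \<in> cells X. arc X V s z} - {t}"
      then have "facet X i s"
        using vec_fun[OF assms(1), of i] unfolding arc_iff by blast
      then show "np i c = 0" using facet_dim[of i s] assms by (intro np_dim) auto
    qed
  qed (use finite_cells in auto)
  finally have "np s c = np t c" by simp
  moreover have "finite {i. facet X i t}"
    by (rule finite_subset[OF _ finite_cells]) (auto simp: facet_def)
  ultimately have "(\<Sum>i\<in>{i. facet X i t}. np i c) = np t c + np t c"
    using npt t(3) by (simp add: sum.remove)
  then show ?thesis unfolding sum_cells_of_dim_inc[OF t(1,2)] by (simp add: bit_add_self)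
qed

text \<open>If the lower cell of a vector reaches a critical cell through one of its facets, then so does
  the upper cell: its boundary contains that facet an even number of times.\<close>

lemma vec_reaches:
  assumes "vec x z" "reaches X V x b" "b \<in> Crit V"
  shows "reaches X V z b"
  using assms(1,2)
\<comment> \<open>The facet \<open>w\<close> through which the path continues may itself be the
  lower cell of a vector. That vector has a smaller value than \<open>x\<close>, so the induction is
  by value.\<close>
proof (induction "card {y \<in> cells X. g y < g x}" arbitrary: x z rule: less_induct)
  case less
  note xz = less.prems(1)
  have xb: "x \<noteq> b" using vec_not_Crit[OF xz] assms(3) by blast
  then obtain w where w: "arc X V x w" "reaches X V w b"
    using less.prems(2) reaches_cases by blast
  show ?case
  proof (cases "w = z")
    case False
    then have wx: "facet X w x" "g w < g x"
      using w(1) vec_fun[OF xz, of w] unfolding arc_iff by blast+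
    have c: "w \<in> cells X" "z \<in> cells X" "x \<in> cells X" "facet X x z" "g x = g z"
      using wx vec_cells[OF xz] facet_cells xz unfolding vec_def by auto
    have "(\<Sum>u\<in>cells X. inc X w u * inc X u z) =
        inc X w x * inc X x z + (\<Sum>u\<in>cells X - {x}. inc X w u * inc X u z)"
      by (rule sum.remove[OF finite_cells c(3)])
    then have "(\<Sum>u\<in>cells X - {x}. inc X w u * inc X u z) = 1"
      using facet_facet_even[OF c(1,2)] wx(1) c(4) bit_add_eq_0_iff unfolding facet_def by auto
    then obtain u where u: "u \<in> cells X" "u \<noteq> x" "inc X w u = 1" "inc X u z = 1"
      using bit_sum_mult_eq_1D[of "inc X w" "\<lambda>u. inc X u z"] by blast
    then have fu: "facet X w u" "facet X u z" using c inc_eq_1 by auto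
    have gu: "g u < g z"
      using facet_le[OF fu(2)] vec_unique[OF xz u(1)] u(2) c(5) fu(2) facet_irrefl
      by (metis order_less_le)
    have zu: "arc X V z u" using fu(2) gu unfolding arc_iff by blast
    have "reaches X V u b"
    proof (cases "g w = g u")
      case True
      then have v: "vec w u" using fu(1) unfolding vec_def by blast
      have "{y \<in> cells X. g y < g w} \<subset> {y \<in> cells X. g y < g x}" using wx(2) c(1) by auto
      then have "card {y \<in> cells X. g y < g w} < card {y \<in> cells X. g y < g x}"
        using finite_cells by (intro psubset_card_mono) auto
      then show ?thesis using less.hyps[OF _ v w(2)] by blast
    next
      case False
      then have "arc X V u w" using fu(1) facet_le[OF fu(1)] unfolding arc_iff by auto
      then show ?thesis using w(2) by (rule reaches_step)
    qed
    then show ?thesis using zu by (rule reaches_step[rotated])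
  qed (use w in simp)
qed

end

context filtered
begin

section \<open>The pairing\<close>

text \<open>The condition \<open>cdim X x + 1 = n\<close>, instead of a truncated subtraction, makes
  the row set empty for \<open>n = 0\<close>.\<close>

definition rowset :: "nat \<Rightarrow> 'a set" where
  "rowset n = {x \<in> cells X. cdim X x + 1 = n}"

lemma rowset_Suc: "rowset (n + 1) = cells_of_dim X n"
  unfolding rowset_def cells_of_dim_def by auto

lemma lin_rowset: "lin r (rowset n)"
  by (rule lin_subset[OF lin_h_less[of "n - 1"]]) (auto simp: rowset_def cells_of_dim_def)

lemma finite_sets: "finite (rowset n)" "finite (cells_of_dim X n)"
  unfolding rowset_def cells_of_dim_def using finite_cells by auto

lemma lazy_boundary:
  "lazy r r (rowset n) (cells_of_dim X n) (boundary_matrix X n) (R_mat X g n) (U_mat X g n)"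
  and R_mat_support: "R_mat X g n x y = 1 \<Longrightarrow> x \<in> rowset n"
proof -
  let ?cs = "ordered_list r (cells_of_dim X n)"
  note cs = ordered_list[OF lin_h_less[of n] finite_sets(2)]
  have M: "x \<in> rowset n" if "boundary_matrix X n x y = 1" for x y
    using that unfolding boundary_matrix_def rowset_def by (auto split: if_splits)
  have lc: "lin r (set ?cs)" using lin_h_less cs(1) by simp
  obtain R U where "lazy_reduction r ?cs (boundary_matrix X n) = (R, U)"
    "lazy r r (rowset n) (set ?cs) (boundary_matrix X n) R U"
    "\<And>x z. R x z = 1 \<Longrightarrow> x \<in> rowset n"
    by (rule lazy_reduction_lazy[where M = "boundary_matrix X n", OF lin_rowset[of n] lc finite_sets(1) cs(3,2) M]) auto
  then show "lazy r r (rowset n) (cells_of_dim X n) (boundary_matrix X n) (R_mat X g n) (U_mat X g n)"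
    "R_mat X g n x y = 1 \<Longrightarrow> x \<in> rowset n"
    using cs(1) by (auto simp: R_mat_def U_mat_def reduced_boundary_def)
qed

abbreviation matched_cells :: "'a \<Rightarrow> 'a \<Rightarrow> bool" where
  "matched_cells x y \<equiv> matched X g (cdim X x) x y"

lemma matched_iff_pivot:
  "matched X g n x y \<longleftrightarrow> y \<in> cells_of_dim X (n + 1) \<and> pivot r (rowset (n + 1)) (R_mat X g (n + 1)) y x"
proof -
  have "low r (R_mat X g (n + 1)) y = Some x \<longleftrightarrow> pivot r (rowset (n + 1)) (R_mat X g (n + 1)) y x"
    by (rule low_eq_Some_iff[OF lin_rowset finite_sets(1)]) (rule R_mat_support)
  then show ?thesis unfolding matched_def rowset_Suc lead_def by blast
qed

lemma matched_dims:
  "matched X g n x y \<Longrightarrow> x \<in> cells X" "matched X g n x y \<Longrightarrow> y \<in> cells X"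
  "matched X g n x y \<Longrightarrow> cdim X x = n" "matched X g n x y \<Longrightarrow> cdim X y = n + 1"
  unfolding matched_def cells_of_dim_def by auto

lemma matched_inj:
  assumes "matched X g n x y" "matched X g m x z" shows "y = z"
proof -
  have "m = n" using matched_dims(3) assms by metis
  then show ?thesis using assms lazy_inj[OF lazy_boundary] unfolding matched_iff_pivot by blast
qed

lemma matched_fun:
  assumes "matched X g n x y" "matched X g m z y" shows "x = z"
proof -
  have "m = n" using matched_dims(4)[OF assms(1)] matched_dims(4)[OF assms(2)] by simp
  then show ?thesis using assms lead_unique[OF lin_rowset] unfolding matched_iff_pivot by blast
qed

lemma boundary_facet:
  "boundary_matrix X n x y = 1 \<longleftrightarrow> facet X x y \<and> cdim X y = n"
  using facet_dim[of x y] unfolding boundary_matrix_def facet_def by auto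

text \<open>A column which contains a birth cell as its lowest entry shows that the boundary of this cell
  is a combination of preceding columns.\<close>

lemma matched_boundary_zero:
  assumes "matched X g n x y" "w \<in> rowset n"
  shows "R_mat X g n w x = 0"
proof (rule ccontr)
  assume nz: "R_mat X g n w x \<noteq> 0"
  let ?J = "cells_of_dim X n" and ?v = "\<lambda>i. R_mat X g (n + 1) i y"
  note L = lazy_boundary[of n]
  have y: "y \<in> cells_of_dim X (n + 1)" and piv: "lead r ?J ?v x" and x: "x \<in> ?J"
    using assms(1) unfolding matched_iff_pivot rowset_Suc by (auto simp: lead_def)
  \<comment> \<open>As the boundary of a boundary vanishes, the reduced column \<open>y\<close> is a
    cycle, and its last cell is \<open>x\<close>.\<close>
  have cyc: "(\<Sum>i\<in>?J. boundary_matrix X n u i * ?v i) = 0" if u: "u \<in> rowset n" for u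
  proof (rule lazy_functional[OF lazy_boundary[of "n + 1", unfolded rowset_Suc] _ y])
    fix z assume z: "z \<in> cells_of_dim X (n + 1)"
    have "(\<Sum>i\<in>?J. boundary_matrix X n u i * boundary_matrix X (n + 1) i z) =
        (\<Sum>i\<in>?J. inc X u i * inc X i z)"
      using u z by (intro sum.cong) (auto simp: boundary_matrix_def rowset_def cells_of_dim_def)
    also have "\<dots> = (\<Sum>i\<in>cells X. inc X u i * inc X i z)"
    proof (rule sum.mono_neutral_left)
      show "\<forall>i\<in>cells X - ?J. inc X u i * inc X i z = 0"
      proof
        fix i assume "i \<in> cells X - ?J"
        then show "inc X u i * inc X i z = 0"
          using facet_dim[of u i] u
          by (cases "inc X u i") (auto simp: cells_of_dim_def rowset_def facet_def)
      qed
    qed (use finite_cells in \<open>auto simp: cells_of_dim_def\<close>)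
    also have "\<dots> = 0" using facet_facet_even u z by (simp add: rowset_def cells_of_dim_def)
    finally show "(\<Sum>i\<in>?J. boundary_matrix X n u i * boundary_matrix X (n + 1) i z) = 0" .
  qed
  \<comment> \<open>\<open>e\<close> holds the coefficients of the boundary of this cycle in the
    columns of \<open>R\<close>. By triangularity \<open>e x = 1\<close>, so a pivot of column
    \<open>x\<close> would keep the combination from vanishing.\<close>
  define e where "e z = (\<Sum>i\<in>?J. U_mat X g n z i * ?v i)" for z
  have zero: "(\<Sum>z\<in>?J. R_mat X g n u z * e z) = 0" if "u \<in> rowset n" for u
    unfolding e_def lazy_comb[OF L that, of ?v, symmetric] by (rule cyc[OF that])
  have "e x = U_mat X g n x x * ?v x + (\<Sum>i\<in>?J - {x}. U_mat X g n x i * ?v i)"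
    unfolding e_def by (rule sum.remove[OF finite_sets(2) x])
  also have "(\<Sum>i\<in>?J - {x}. U_mat X g n x i * ?v i) = 0"
  proof (rule bit_sum_eq_0I)
    fix i assume i: "i \<in> ?J - {x}" "U_mat X g n x i * ?v i = 1"
    then have "r x i" using lazy_upper[OF L x, of i] by (auto simp: bit_mult_eq_1_iff)
    moreover have "r i x" using piv i unfolding lead_def by (auto simp: bit_mult_eq_1_iff)
    ultimately show False using lin_asym[OF lin_h_less] by blast
  qed
  finally have "e x = 1" using lazy_diag[OF L x] piv unfolding lead_def by simp
  moreover obtain a where "pivot r (rowset n) (R_mat X g n) x a"
    using nz assms(2) lead_exists[OF lin_rowset finite_sets(1), of w n "\<lambda>i. R_mat X g n i x"] by auto
  ultimately obtain l where l: "lead r (rowset n) (\<lambda>i. \<Sum>z\<in>?J. R_mat X g n i z * e z) l"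
    using lazy_comb_lead[OF L subset_refl x, of e] by blast
  then show False using zero[of l] unfolding lead_def by simp
qed

text \<open>The column of a birth cell is zero and has no pivot; so no cell is both a birth and a
  death cell.\<close>

lemma matched_chain: "matched X g n x y \<Longrightarrow> matched X g m w x \<Longrightarrow> False"
proof -
  assume *: "matched X g n x y" "matched X g m w x"
  then have "n = m + 1" using matched_dims by metis
  then show False
    using matched_boundary_zero[OF *(1), of w] *(2) unfolding matched_iff_pivot lead_def by auto
qed

lemma R_mat_le:
  assumes "y \<in> cells_of_dim X n" "R_mat X g n i y = 1" shows "g i \<le> g y"
proof -
  obtain x where "x = y \<or> r x y" "boundary_matrix X n i x = 1"
    using lazy_support[OF lazy_boundary R_mat_support[OF assms(2)] assms] by blast
  then have "g x \<le> g y" "g i \<le> g x"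
    using facet_le boundary_facet unfolding h_less_def by auto
  then show ?thesis by simp
qed

text \<open>Preceding columns of this dimension have values below \<open>g t = g s\<close>, and so
  do all rows in which their reduced versions have entries. None of them has an entry in row
  \<open>s\<close> or beyond, so the reduction leaves column \<open>t\<close> as it is.\<close>

lemma vec_columns:
  assumes "vec s t" "cdim X t = n"
  shows "pivot r (rowset n) (R_mat X g n) t s"
    and "\<And>x. x \<in> cells_of_dim X n \<Longrightarrow> x \<noteq> t \<Longrightarrow> U_mat X g n x t = 0"
    and "\<And>i. i \<in> rowset n \<Longrightarrow> R_mat X g n i t = boundary_matrix X n i t"
proof -
  note L = lazy_boundary[of n]
  have t: "t \<in> cells_of_dim X n" "facet X s t" "g s = g t"
    using assms vec_cells[OF assms(1)] unfolding vec_def cells_of_dim_def by auto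
  have s: "s \<in> rowset n" using facet_dim[OF t(2)] facet_cells[OF t(2)] assms(2) unfolding rowset_def by simp
  have lt: "g x < g t" if "x \<in> cells_of_dim X n" "r x t" for x
    using that t h_less_same_dim[of x t] unfolding cells_of_dim_def by auto
  have low: "i = s \<or> r i s" if "i \<in> rowset n" "R_mat X g n i t = 1" for i
  proof -
    have "g i \<le> g s" using R_mat_le[OF t(1) that(2)] t by simp
    moreover have "i \<in> cells X" "cdim X i = cdim X s" "s \<in> cells X" using that(1) s unfolding rowset_def by auto
    ultimately show ?thesis using h_less_same_dim same_dim_value by fastforce
  qed
  show U: "U_mat X g n x t = 0" if x: "x \<in> cells_of_dim X n" "x \<noteq> t" for x
  proof (rule ccontr)
    assume "U_mat X g n x t \<noteq> 0"
    then have U: "U_mat X g n x t = 1" by simp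
    show False
    proof (cases "\<exists>b. pivot r (rowset n) (R_mat X g n) t b \<and> b = s")
      case True
      then obtain a where a: "pivot r (rowset n) (R_mat X g n) x a" "r s a"
        using lazy_pivot[OF L x(1) t(1) U x(2)] by blast
      then have "g a \<le> g x" "g s \<le> g a" using R_mat_le[OF x(1)] unfolding lead_def h_less_def by auto
      then show False using lt[OF x(1) lazy_upper[OF L x(1) t(1) U x(2)]] t(3) by simp
    next
      case False
      then have "R_mat X g n s t \<noteq> 1" using low s unfolding lead_def by blast
      then have "(\<Sum>z\<in>cells_of_dim X n - {t}. R_mat X g n s z * U_mat X g n z t) = 1"
        using lazy_eq'[OF L s t(1)] boundary_facet[of n s t] t(2) assms(2) by auto
      then obtain z where z: "z \<in> cells_of_dim X n" "z \<noteq> t" "R_mat X g n s z = 1" "U_mat X g n z t = 1"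
        using bit_sum_mult_eq_1D[of "\<lambda>z. R_mat X g n s z" "\<lambda>z. U_mat X g n z t"] by blast
      then have "g s \<le> g z" "g z < g t" using R_mat_le lt lazy_upper[OF L z(1) t(1) z(4,2)] by auto
      then show False using t(3) by simp
    qed
  qed
  show R: "R_mat X g n i t = boundary_matrix X n i t" if "i \<in> rowset n" for i
  proof -
    have "(\<Sum>z\<in>cells_of_dim X n - {t}. R_mat X g n i z * U_mat X g n z t) = 0"
      by (rule sum.neutral) (use U in auto)
    then show ?thesis using lazy_eq'[OF L that t(1)] by simp
  qed
  show "pivot r (rowset n) (R_mat X g n) t s"
    using low s R[OF s] boundary_facet[of n s t] t(2) assms(2) unfolding lead_def by auto
qed

lemma vec_matched: "vec s t \<Longrightarrow> matched_cells s t"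
proof -
  assume v: "vec s t"
  then have t: "t \<in> cells X" "cdim X t = cdim X s + 1"
    using facet_dim facet_cells unfolding vec_def by auto
  then show ?thesis
    using vec_columns(1)[OF v t(2)] unfolding matched_iff_pivot cells_of_dim_def by simp
qed

text \<open>Vectors are pairs of the reduction and a cell belongs to one pair only, so a pair with a
  noncritical component is a vector.\<close>

lemma matched_Crit:
  assumes "matched X g n x y" shows "x \<in> Crit V \<longleftrightarrow> y \<in> Crit V"
proof
  assume x: "x \<in> Crit V"
  show "y \<in> Crit V"
  proof (rule ccontr)
    assume "y \<notin> Crit V"
    then obtain z where "vec y z \<or> vec z y" using not_Crit_vec matched_dims(2)[OF assms] by blast
    then show False
      using vec_matched matched_chain matched_fun[OF assms] assms x vec_not_Crit by metis
  qed
next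
  assume y: "y \<in> Crit V"
  show "x \<in> Crit V"
  proof (rule ccontr)
    assume "x \<notin> Crit V"
    then obtain z where "vec x z \<or> vec z x" using not_Crit_vec matched_dims(1)[OF assms] by blast
    then show False
      using vec_matched matched_chain matched_inj[OF assms] assms y vec_not_Crit by metis
  qed
qed

lemma matched_not_Crit:
  assumes "matched X g n x y" "x \<notin> Crit V" shows "vec x y"
proof -
  obtain z where "vec x z \<or> vec z x" using not_Crit_vec matched_dims(1) assms by blast
  then show ?thesis using vec_matched matched_chain matched_inj assms(1) by metis
qed

section \<open>Relations of critical cells\<close>

abbreviation lt where "lt \<equiv> \<lambda>x y. g x < g y"

definition Cr :: "nat \<Rightarrow> 'a set" where
  "Cr n = {x \<in> Crit V. cdim X x = n}"

definition CrR :: "nat \<Rightarrow> 'a set" where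
  "CrR n = {x \<in> Crit V. cdim X x + 1 = n}"

lemma lin_lt: "A \<subseteq> Crit V \<Longrightarrow> lin lt A"
proof -
  assume A: "A \<subseteq> Crit V"
  have "x = y \<or> g x < g y \<or> g y < g x" if "x \<in> A" "y \<in> A" for x y
    using that A Crit_value[of y x] Crit_cells[of x] by force
  then show ?thesis unfolding lin_def by auto
qed

text \<open>An application of \<open>lazy_transfer\<close> to the path counts. Noncritical columns
  are annihilated: the lower cell of a vector is a birth cell and has a zero column, while the
  column of an upper cell is its unreduced boundary, which \<open>np_vec_boundary\<close> kills.
  Thus the matrix \<open>U_mat\<close> of the whole complex also reduces the Morse complex.\<close>

lemma critical_boundary:
  "\<exists>R. lazy lt lt (CrR n) (Cr n) (\<lambda>a y. np y a) R (U_mat X g n) \<and>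
     (\<forall>y\<in>Cr n. \<forall>a. pivot lt (CrR n) R y a \<longleftrightarrow> matched_cells a y)"
proof -
  note L = lazy_boundary[of n]
  let ?R = "\<lambda>a y. \<Sum>i\<in>rowset n. np i a * R_mat X g n i y"
  let ?M = "\<lambda>a y. \<Sum>i\<in>rowset n. np i a * boundary_matrix X n i y"
  have sub: "CrR n \<subseteq> rowset n" "Cr n \<subseteq> cells_of_dim X n"
    using Crit_cells unfolding CrR_def Cr_def rowset_def cells_of_dim_def by auto
  have mt: "pivot r (rowset n) (R_mat X g n) y a \<longleftrightarrow> matched_cells a y" if y: "y \<in> cells_of_dim X n" for y a
  proof
    assume p: "pivot r (rowset n) (R_mat X g n) y a"
    then have "n = cdim X a + 1" unfolding lead_def rowset_def by auto
    then show "matched_cells a y" using p y unfolding matched_iff_pivot by simp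
  next
    assume m: "matched_cells a y"
    then have "n = cdim X a + 1" using matched_dims(4) y unfolding cells_of_dim_def by auto
    then show "pivot r (rowset n) (R_mat X g n) y a" using m unfolding matched_iff_pivot by simp
  qed
  have rows: "rowset n = cells_of_dim X (cdim X a)" if "a \<in> CrR n" for a
    using that unfolding CrR_def rowset_def cells_of_dim_def by auto
  have dimn: "n = cdim X a + 1" "a \<in> Crit V" if "a \<in> CrR n" for a using that unfolding CrR_def by auto
  have M: "(\<Sum>i\<in>rowset n. np i a * boundary_matrix X n i y) =
      (\<Sum>i\<in>cells_of_dim X (cdim X a). np i a * inc X i y)"
    if "a \<in> CrR n" "y \<in> cells_of_dim X n" for a y
    using that dimn[OF that(1)] unfolding rows[OF that(1)]
    by (intro sum.cong) (auto simp: boundary_matrix_def cells_of_dim_def)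
  have T: "lazy r r (CrR n) (Cr n) ?M ?R (U_mat X g n)"
    and P: "\<And>y a. y \<in> Cr n \<Longrightarrow> pivot r (CrR n) ?R y a \<longleftrightarrow> pivot r (rowset n) (R_mat X g n) y a"
  proof -
    have 1: "i = a \<or> r a i" if "a \<in> CrR n" "i \<in> rowset n" "np i a = 1" for a i
      using np_lead[OF that(3)] that(1) unfolding CrR_def h_less_def by auto
    have 2: "np a a = 1" if "a \<in> CrR n" for a using np_refl that sub(1) unfolding rowset_def by auto
    have 3: "(\<Sum>i\<in>rowset n. np i a * R_mat X g n i y) = 0"
      if a: "a \<in> CrR n" and y: "y \<in> cells_of_dim X n - Cr n" for a y
    proof -
      have yc: "y \<in> cells X" "y \<notin> Crit V" "cdim X y = n" using y unfolding cells_of_dim_def Cr_def by auto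
      from not_Crit_vec[OF yc(1,2)] show ?thesis
      proof
        assume "\<exists>z. vec y z"
        then obtain z where "matched X g n y z" using vec_matched yc by blast
        then show ?thesis using matched_boundary_zero by (intro sum.neutral) auto
      next
        assume "\<exists>s. vec s y"
        then obtain s where s: "vec s y" by blast
        then have "cdim X s + 1 = n" using facet_dim[of s y] yc(3) unfolding vec_def by simp
        then have "cdim X s = cdim X a" using dimn[OF a] by simp
        have "(\<Sum>i\<in>rowset n. np i a * R_mat X g n i y) = ?M a y"
          using vec_columns(3)[OF s yc(3)] by (intro sum.cong) auto
        also have "\<dots> = 0"
          using M[OF a, of y] y np_vec_boundary[OF s \<open>cdim X s = cdim X a\<close> dimn(2)[OF a] refl] by simp
        finally show ?thesis .
      qed
    qed
    have 4: "a \<in> CrR n" if "y \<in> Cr n" "pivot r (rowset n) (R_mat X g n) y a" for a y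
      using that mt[of y a] matched_Crit[of _ a y] sub(2) unfolding Cr_def CrR_def lead_def rowset_def by auto
    show "lazy r r (CrR n) (Cr n) ?M ?R (U_mat X g n)"
      by (rule lazy_transfer(1)[OF L sub]) (fact 1 2 3 4)+
    show "pivot r (CrR n) ?R y a \<longleftrightarrow> pivot r (rowset n) (R_mat X g n) y a" if "y \<in> Cr n" for y a
      by (rule lazy_transfer(2)[OF L sub]) (fact 1 2 3 4 that)+
  qed
  have r: "r x y \<longleftrightarrow> lt x y" if "x \<in> CrR n \<and> y \<in> CrR n \<or> x \<in> Cr n \<and> y \<in> Cr n" for x y
    using h_less_same_dim[of x y] that Crit_cells unfolding CrR_def Cr_def by auto
  have lin: "lin lt (CrR n)" "lin lt (Cr n)" using lin_lt unfolding CrR_def Cr_def by auto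
  have Mnp: "?M a y = np y a" if "a \<in> CrR n" "y \<in> Cr n" for a y
    using M[OF that(1), of y] np_Crit_boundary[of y "cdim X a" a] that sub dimn[OF that(1)]
    unfolding Cr_def by auto
  have "lazy lt lt (CrR n) (Cr n) (\<lambda>a y. np y a) ?R (U_mat X g n)"
    by (rule lazy_cong(1)[OF T lin]) (use r Mnp in auto)
  moreover have "pivot lt (CrR n) ?R y a \<longleftrightarrow> matched_cells a y" if y: "y \<in> Cr n" for y a
  proof -
    have "pivot lt (CrR n) ?R y a \<longleftrightarrow> pivot r (CrR n) ?R y a"
      by (rule lazy_cong(2)[OF T lin]) (use r Mnp in auto)
    then show ?thesis using P[OF y] mt[of y a] y sub by auto
  qed
  ultimately show ?thesis by blast
qed

end

section \<open>The dual complex\<close>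

text \<open>Dimensions are reflected at the top dimension, which keeps them natural numbers. With
  \<open>- g\<close> as function, the reversed order of the coboundary matrices becomes an order by
  increasing values.\<close>

definition dual :: "'a lefschetz \<Rightarrow> 'a lefschetz" where
  "dual X = \<lparr>cells = cells X, cdim = (\<lambda>x. Max (cdim X ` cells X) - cdim X x),
    inc = (\<lambda>x y. inc X y x)\<rparr>"

lemma dual_simps [simp]: "cells (dual X) = cells X" "inc (dual X) x y = inc X y x"
  "facet (dual X) x y = facet X y x"
  unfolding dual_def facet_def by auto

lemma fibre_field_dual [simp]: "fibre_field (dual X) (\<lambda>x. - g x) = fibre_field X g"
  unfolding fibre_field_def by simp

lemma arc_dual [simp]: "arc (dual X) V x y = arc X V y x"
  unfolding arc_def by (auto simp: insert_commute)

lemma paths_dual: "paths (dual X) V x y = rev ` paths X V y x"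
proof -
  have "rev p \<in> paths X V y x" if "p \<in> paths (dual X) V x y" for p
    using that unfolding paths_def by (auto simp: hd_rev last_rev)
  moreover have "rev p \<in> paths (dual X) V x y" if "p \<in> paths X V y x" for p
    using that unfolding paths_def by (auto simp: hd_rev last_rev)
  moreover have "p \<in> rev ` A" if "rev p \<in> A" for p :: "'a list" and A
    using that image_eqI[of p rev "rev p" A] by simp
  ultimately show ?thesis by blast
qed

lemma reaches_dual [simp]: "reaches (dual X) V x y = reaches X V y x"
  unfolding reaches_def paths_dual by simp

lemma card_paths_dual: "card (paths (dual X) V x y) = card (paths X V y x)"
  unfolding paths_dual by (rule card_image) (simp add: inj_on_def)

context filtered
begin

lemma cdim_dual: "x \<in> cells X \<Longrightarrow> cdim (dual X) x + cdim X x = Max (cdim X ` cells X)"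
  unfolding dual_def using finite_cells by simp

lemma dual_filtered: "filtered (dual X) (\<lambda>x. - g x)"
proof
  have "cdim (dual X) x + 1 = cdim (dual X) y" if "x \<in> cells X" "y \<in> cells X" "inc X y x \<noteq> 0" for x y
    using that cdim_dual[of x] cdim_dual[of y] facet_dim[of y x] unfolding facet_def by auto
  moreover have "(\<Sum>z\<in>cells X. inc X z x * inc X y z) = 0" if "x \<in> cells X" "y \<in> cells X" for x y
    using facet_facet_even[OF that(2,1)] by (simp add: mult.commute)
  ultimately show "lefschetz_complex (dual X)"
    using finite_cells unfolding lefschetz_complex_def by simp
  show "dMf (dual X) (\<lambda>x. - g x)"
    unfolding dMf_def dual_simps neg_equal_iff_equal neg_le_iff_le
  proof (intro conjI allI)
    fix a
    have "{x \<in> cells X. - g x = a} = {x \<in> cells X. g x = - a}" by auto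
    then show "card {x \<in> cells X. - g x = a} \<le> 2" using g unfolding dMf_def by metis
  next
    show "\<forall>x\<in>cells X. \<forall>y\<in>cells X. x \<noteq> y \<and> g x = g y \<longrightarrow> inc X y x = 1 \<or> inc X x y = 1"
      using g unfolding dMf_def by blast
  qed (use g in \<open>unfold dMf_def, blast\<close>)
qed

end

text \<open>The dual is interpreted beside the complex under the prefix \<open>D\<close>. Both
  assumptions hold for every filtered complex, so the results are exported to
  \<open>filtered\<close> afterwards.\<close>

locale filtered_pair = filtered X g + D: filtered "dual X" "\<lambda>x. - g x"
  for X :: "'a lefschetz" and g :: "'a \<Rightarrow> real"
begin

text \<open>The bound on \<open>n\<close> keeps the truncated subtraction exact.\<close>

lemma dual_dim_sets:
  assumes "n \<le> Max (cdim X ` cells X)"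
  shows "cells_of_dim (dual X) (Max (cdim X ` cells X) - n) = cells_of_dim X n"
    "D.rowset (Max (cdim X ` cells X) - n) = cells_of_dim X (n + 1)"
  using cdim_dual assms unfolding cells_of_dim_def D.rowset_def by fastforce+

lemma h_less_dual: "x \<in> cells X \<Longrightarrow> y \<in> cells X \<Longrightarrow> h_less (dual X) (\<lambda>x. - g x) x y \<longleftrightarrow> r y x"
  using cdim_dual[of x] cdim_dual[of y] unfolding h_less_def by auto

lemma lazy_dual_boundary:
  assumes "n \<le> Max (cdim X ` cells X)"
  defines "m \<equiv> Max (cdim X ` cells X) - n"
  shows "lazy (conv r) (conv r) (cells_of_dim X (n + 1)) (cells_of_dim X n)
      (\<lambda>y x. boundary_matrix X (n + 1) x y) (R_mat (dual X) (\<lambda>x. - g x) m) (U_mat (dual X) (\<lambda>x. - g x) m)"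
    and "\<And>v a. lead (conv r) (cells_of_dim X (n + 1)) v a \<longleftrightarrow>
      lead (h_less (dual X) (\<lambda>x. - g x)) (cells_of_dim X (n + 1)) v a"
proof -
  note L = D.lazy_boundary[of m, unfolded m_def dual_dim_sets[OF assms(1)]]
  have M: "boundary_matrix (dual X) (Max (cdim X ` cells X) - n) x y = boundary_matrix X (n + 1) y x"
    if "x \<in> cells_of_dim X (n + 1)" "y \<in> cells_of_dim X n" for x y
    using that assms(1) cdim_dual[of x] cdim_dual[of y]
    unfolding boundary_matrix_def cells_of_dim_def by auto
  have sub: "cells_of_dim X k \<subseteq> cells X" for k unfolding cells_of_dim_def by auto
  have h: "h_less (dual X) (\<lambda>x. - g x) x y \<longleftrightarrow> r y x" if "x \<in> cells_of_dim X k" "y \<in> cells_of_dim X k" for x y k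
    using h_less_dual that sub by blast
  show "lazy (conv r) (conv r) (cells_of_dim X (n + 1)) (cells_of_dim X n)
      (\<lambda>y x. boundary_matrix X (n + 1) x y) (R_mat (dual X) (\<lambda>x. - g x) m) (U_mat (dual X) (\<lambda>x. - g x) m)"
    unfolding m_def
    by (rule lazy_cong(1)[OF L lin_converse[OF lin_h_less] lin_converse[OF lin_h_less]])
      (use h M in auto)
  show "\<And>v a. lead (conv r) (cells_of_dim X (n + 1)) v a \<longleftrightarrow>
      lead (h_less (dual X) (\<lambda>x. - g x)) (cells_of_dim X (n + 1)) v a"
    using h unfolding lead_def by blast
qed

lemma dim_le_Max: "x \<in> cells X \<Longrightarrow> cdim X x \<le> Max (cdim X ` cells X)"
  using finite_cells by simp

text \<open>The two reductions concern a matrix and its transpose with both orders reversed; by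
  \<open>lazy_dual_pivot\<close> these have the same pivots.\<close>

lemma matched_dual: "D.matched_cells y x \<longleftrightarrow> matched_cells x y"
proof (cases "x \<in> cells X \<and> y \<in> cells X \<and> cdim X y = cdim X x + 1")
  case True
  let ?n = "cdim X x" and ?N = "Max (cdim X ` cells X)"
  have n: "?n \<le> ?N" "?N - ?n = cdim (dual X) y + 1"
    using True dim_le_Max[of x] cdim_dual[of y] by auto
  have xy: "x \<in> cells_of_dim X ?n" "y \<in> cells_of_dim X (?n + 1)" using True unfolding cells_of_dim_def by auto
  have "D.matched_cells y x \<longleftrightarrow> x \<in> cells_of_dim (dual X) (?N - ?n) \<and>
      pivot (h_less (dual X) (\<lambda>x. - g x)) (D.rowset (?N - ?n)) (R_mat (dual X) (\<lambda>x. - g x) (?N - ?n)) x y"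
    unfolding D.matched_iff_pivot n(2) by simp
  also have "\<dots> \<longleftrightarrow> pivot (conv r) (cells_of_dim X (?n + 1)) (R_mat (dual X) (\<lambda>x. - g x) (?N - ?n)) x y"
    unfolding dual_dim_sets[OF n(1)] lazy_dual_boundary(2)[OF n(1)] using xy by simp
  also have "\<dots> \<longleftrightarrow> pivot r (cells_of_dim X ?n) (R_mat X g (?n + 1)) y x"
    using lazy_dual_pivot[OF lazy_boundary[of "?n + 1", unfolded rowset_Suc] lazy_dual_boundary(1)[OF n(1)] xy]
    by simp
  also have "\<dots> \<longleftrightarrow> matched_cells x y"
    unfolding matched_iff_pivot rowset_Suc using xy by simp
  finally show ?thesis .
next
  case False
  have "\<not> matched_cells x y" using False matched_dims by blast
  moreover have "\<not> D.matched_cells y x"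
  proof
    assume m: "D.matched_cells y x"
    then have "x \<in> cells X" "y \<in> cells X" "cdim (dual X) x = cdim (dual X) y + 1"
      using D.matched_dims(1,2,4)[OF m] by auto
    then show False using False cdim_dual[of x] cdim_dual[of y] by auto
  qed
  ultimately show ?thesis by blast
qed

text \<open>The coboundary matrix and the boundary matrix of the dual agree on the cells concerned,
  and so do the orders; the rest is uniqueness of lazy factorisations.\<close>

lemma U_perp_dual:
  assumes "x \<in> cells_of_dim X n" "y \<in> cells_of_dim X n"
  shows "U_perp_mat X g n x y = U_mat (dual X) (\<lambda>x. - g x) (Max (cdim X ` cells X) - n) x y"
proof -
  let ?cs = "ordered_list (conv r) (cells_of_dim X n)"
  have n: "n \<le> Max (cdim X ` cells X)" using assms(1) dim_le_Max unfolding cells_of_dim_def by auto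
  note lin = lin_converse[OF lin_h_less[of n]] lin_converse[OF lin_h_less[of "n + 1"]]
  note cs = ordered_list[OF lin(1) finite_sets(2)]
  have M: "u \<in> cells_of_dim X (n + 1)" if "coboundary_matrix X n u v = 1" for u v
    using that unfolding coboundary_matrix_def cells_of_dim_def by (auto split: if_splits)
  have lc: "lin (conv r) (set ?cs)" using lin cs(1) by simp
  obtain R U where *: "lazy_reduction (conv r) ?cs (coboundary_matrix X n) = (R, U)"
    "lazy (conv r) (conv r) (cells_of_dim X (n + 1)) (set ?cs) (coboundary_matrix X n) R U"
    by (rule lazy_reduction_lazy[where M = "coboundary_matrix X n", OF lin(2) lc finite_sets(2) cs(3,2) M]) auto
  have L: "lazy (conv r) (conv r) (cells_of_dim X (n + 1)) (cells_of_dim X n)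
      (\<lambda>y x. boundary_matrix X (n + 1) x y) R U"
    by (rule lazy_cong(1)[OF *(2)[unfolded cs(1)] lin(2,1)])
      (auto simp: coboundary_matrix_def boundary_matrix_def cells_of_dim_def)
  have "U_perp_mat X g n = U"
    using *(1) by (simp add: U_perp_mat_def reduced_coboundary_def Let_def)
  then show ?thesis using lazy_unique[OF L lazy_dual_boundary(1)[OF n] assms(2)] assms(1) by blast
qed

lemma np_dual: "D.np x y = np y x"
  unfolding np_def D.np_def fibre_field_dual card_paths_dual ..

text \<open>\<open>CrR (n + 2)\<close> consists of the critical cells of dimension
  \<open>n + 1\<close>, which index the rows of the coboundary matrix. The case of an empty
  \<open>Cr n\<close> is split off because \<open>n\<close> may then exceed the top dimension, where
  the subtraction in the dual is not exact.\<close>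

lemma critical_coboundary:
  "\<exists>R. lazy (conv lt) (conv lt) (CrR (n + 2)) (Cr n) (\<lambda>b x. np b x) R (U_perp_mat X g n) \<and>
     (\<forall>x\<in>Cr n. \<forall>b. pivot (conv lt) (CrR (n + 2)) R x b \<longleftrightarrow> matched_cells x b)"
proof (cases "Cr n = {}")
  case True
  then have "lazy (conv lt) (conv lt) (CrR (n + 2)) (Cr n) (\<lambda>b x. np b x) R (U_perp_mat X g n)" for R
    using lin_converse[OF lin_lt[of "CrR (n + 2)"]] lin_converse[OF lin_lt[of "{}"]] finite_Crit
    unfolding lazy_def by (auto simp: CrR_def)
  then show ?thesis using True by blast
next
  case False
  let ?N = "Max (cdim X ` cells X)"
  have n: "n \<le> ?N" using False dim_le_Max Crit_cells unfolding Cr_def by auto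
  have sets: "D.CrR (?N - n) = CrR (n + 2)" "D.Cr (?N - n) = Cr n"
    using n cdim_dual Crit_cells unfolding D.CrR_def CrR_def D.Cr_def Cr_def fibre_field_dual
    by (fastforce)+
  obtain R where L: "lazy D.lt D.lt (CrR (n + 2)) (Cr n) (\<lambda>b x. np b x) R (U_mat (dual X) (\<lambda>x. - g x) (?N - n))"
    and P: "\<forall>x\<in>Cr n. \<forall>b. pivot D.lt (CrR (n + 2)) R x b \<longleftrightarrow> D.matched_cells b x"
    using D.critical_boundary[of "?N - n", unfolded sets np_dual] by blast
  have eq: "D.lt = conv lt" by auto
  have U: "U_perp_mat X g n x y = U_mat (dual X) (\<lambda>x. - g x) (?N - n) x y" if "x \<in> Cr n" "y \<in> Cr n" for x y
    using that Crit_cells by (intro U_perp_dual) (auto simp: Cr_def cells_of_dim_def)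
  have "lazy (conv lt) (conv lt) (CrR (n + 2)) (Cr n) (\<lambda>b x. np b x) R (U_perp_mat X g n)"
    using L U unfolding lazy_def eq by simp
  then show ?thesis using P unfolding eq matched_dual by blast
qed

end

context filtered
begin

lemma pair: "filtered_pair X g"
  using filtered_axioms dual_filtered by (rule filtered_pair.intro)

lemmas critical_coboundary = filtered_pair.critical_coboundary[OF pair]
lemmas matched_dual = filtered_pair.matched_dual[OF pair]
lemmas U_perp_dual = filtered_pair.U_perp_dual[OF pair]
lemmas np_dual = filtered_pair.np_dual[OF pair]

end

section \<open>Cancellations\<close>

lemma cancel_simps [simp]:
  "cells (cancel s t C) = cells C - {s, t}" "cdim (cancel s t C) = cdim C"
  "inc (cancel s t C) x y = inc C x y + inc C s y * inc C x t"
  unfolding cancel_def by auto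

text \<open>The inductive definition puts a cancellation in front, whereas the existence proof below
  adds the last one.\<close>

lemma cancels_to_snoc:
  assumes "cancels_to g A C C1" "(s, Some t) \<notin> A" "shallow C1 g s t"
  shows "cancels_to g (insert (s, Some t) A) C (cancel s t C1)"
  using assms
proof (induction rule: cancels_to.induct)
  case (cancels_to_empty C)
  then show ?case
    using cancels_to.cancels_to_step[of s t "{(s, Some t)}"] cancels_to.cancels_to_empty by force
next
  case (cancels_to_step s' t' P C C')
  have "insert (s, Some t) P - {(s', Some t')} = insert (s, Some t) (P - {(s', Some t')})"
    using cancels_to_step.hyps(1) cancels_to_step.prems(1) by auto
  then show ?case
    using cancels_to.cancels_to_step[of s' t' "insert (s, Some t) P"] cancels_to_step by auto
qed

lemma cancels_to_cells:
  "cancels_to g A C C1 \<Longrightarrow> cells C1 = cells C - {x. \<exists>s t. (s, Some t) \<in> A \<and> (x = s \<or> x = t)}"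
proof (induction rule: cancels_to.induct)
  case (cancels_to_step s t P C C')
  then show ?case by auto
qed simp

lemma cancels_to_dim:
  "cancels_to g A C C1 \<Longrightarrow> cdim C1 = cdim C \<and>
     ((\<forall>x y. inc C x y = 1 \<longrightarrow> cdim C y = cdim C x + 1) \<longrightarrow>
      (\<forall>x y. inc C1 x y = 1 \<longrightarrow> cdim C1 y = cdim C1 x + 1))"
proof (induction rule: cancels_to.induct)
  case (cancels_to_step s t P C C')
  have st: "inc C s t = 1" using cancels_to_step.hyps(2) unfolding shallow_def facet_def by auto
  have "cdim C y = cdim C x + 1"
    if d: "\<forall>x y. inc C x y = 1 \<longrightarrow> cdim C y = cdim C x + 1" and xy: "inc (cancel s t C) x y = 1" for x y
  proof -
    have "inc C x y = 1 \<or> inc C s y = 1 \<and> inc C x t = 1"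
      using xy by (cases "inc C x y"; cases "inc C s y"; cases "inc C x t") auto
    moreover have "cdim C t = cdim C s + 1" using d st by blast
    ultimately show ?thesis using d by auto
  qed
  then have "(\<forall>x y. inc C x y = 1 \<longrightarrow> cdim C y = cdim C x + 1) \<longrightarrow>
      (\<forall>x y. inc (cancel s t C) x y = 1 \<longrightarrow> cdim (cancel s t C) y = cdim (cancel s t C) x + 1)"
    unfolding cancel_simps(2) by blast
  then show ?case using cancels_to_step.IH unfolding cancel_simps(2) by blast
qed simp

text \<open>Cancelling \<open>(s, t)\<close> adds column \<open>t\<close> to all columns with an
  entry in row \<open>s\<close>. So a column becomes itself plus some columns of cancelled death
  cells. Since \<open>cancel\<close> keeps the incidences of removed cells defined, the zeros
  produced in the rows of cancelled birth cells can still be referred to.\<close>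

lemma cancels_to_columns:
  assumes "cancels_to g A C C1"
  shows "\<exists>T. finite T \<and> (\<forall>t\<in>T. \<exists>s. (s, Some t) \<in> A) \<and>
     (\<forall>x. inc C1 x y = inc C x y + (\<Sum>t\<in>T. inc C x t)) \<and>
     (\<forall>s t. (s, Some t) \<in> A \<longrightarrow> inc C1 s y = 0)"
  using assms
proof (induction rule: cancels_to.induct)
  case (cancels_to_empty C)
  show ?case by (rule exI[of _ "{}"]) simp
next
  case (cancels_to_step s t P C C')
  obtain T where T: "finite T" "\<forall>t'\<in>T. \<exists>s'. (s', Some t') \<in> P - {(s, Some t)}"
    "\<forall>x. inc C' x y = inc (cancel s t C) x y + (\<Sum>t'\<in>T. inc (cancel s t C) x t')"
    "\<forall>s' t'. (s', Some t') \<in> P - {(s, Some t)} \<longrightarrow> inc C' s' y = 0"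
    using cancels_to_step.IH by blast
  \<comment> \<open>\<open>e\<close> tells whether this cancellation contributes column
    \<open>t\<close> to the final column \<open>y\<close>. Coefficients being mod 2,
    \<open>T'\<close> is \<open>T\<close> with the membership of \<open>t\<close> toggled if
    \<open>e\<close> is 1.\<close>
  define e where "e = inc C s y + (\<Sum>t'\<in>T. inc C s t')"
  define T' where "T' = (if e = 0 then T else if t \<in> T then T - {t} else insert t T)"
  have st: "inc C s t = 1" using cancels_to_step.hyps(2) unfolding shallow_def facet_def by auto
  have eq: "inc C' x y = inc C x y + (\<Sum>t'\<in>T. inc C x t') + e * inc C x t" for x
  proof -
    have "(\<Sum>t'\<in>T. inc C x t' + inc C s t' * inc C x t) =
        (\<Sum>t'\<in>T. inc C x t') + (\<Sum>t'\<in>T. inc C s t') * inc C x t"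
      by (simp add: sum.distrib sum_distrib_right)
    then show ?thesis using T(3) unfolding e_def cancel_simps by (simp add: distrib_right add_ac)
  qed
  have T': "(\<Sum>t'\<in>T'. inc C x t') = (\<Sum>t'\<in>T. inc C x t') + e * inc C x t" for x
  proof (cases "t \<in> T")
    case True
    then have "(\<Sum>t'\<in>T. inc C x t') = inc C x t + (\<Sum>t'\<in>T - {t}. inc C x t')"
      using T(1) by (simp add: sum.remove)
    then show ?thesis
      using True unfolding T'_def by (cases e; cases "inc C x t") (auto simp flip: add.assoc)
  next
    case False
    then show ?thesis unfolding T'_def using T(1) by (cases e) (auto simp: add.commute)
  qed
  have "inc C' s y = 0"
    using eq[of s] st unfolding e_def by (simp add: bit_add_self)
  moreover have "finite T'" "\<forall>t'\<in>T'. \<exists>s'. (s', Some t') \<in> P"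
    using T(1,2) cancels_to_step.hyps(1) unfolding T'_def by auto
  ultimately show ?case
    using eq T' T(4) by (intro exI[of _ T']) (auto simp: add.assoc)
qed

text \<open>Unlike \<open>dual\<close> this keeps \<open>cdim\<close>: cancellations look only at
  incidences and values, so a mere transposition turns statements on columns into statements on
  rows.\<close>

definition opposite :: "'a lefschetz \<Rightarrow> 'a lefschetz" where
  "opposite C = \<lparr>cells = cells C, cdim = cdim C, inc = (\<lambda>x y. inc C y x)\<rparr>"

definition flip :: "'a bd_pair set \<Rightarrow> 'a bd_pair set" where
  "flip A = {(t, Some s) | s t. (s, Some t) \<in> A}"

lemma cancels_to_opposite:
  assumes "cancels_to g A C C1"
  shows "cancels_to (\<lambda>x. - g x) (flip A) (opposite C) (opposite C1)"
  using assms
proof (induction rule: cancels_to.induct)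
  case (cancels_to_empty C)
  then show ?case by (simp add: flip_def cancels_to.cancels_to_empty)
next
  case (cancels_to_step s t P C C')
  have "shallow (opposite C) (\<lambda>x. - g x) t s"
    using cancels_to_step.hyps(2) unfolding shallow_def facet_def opposite_def by auto
  moreover have "cancel t s (opposite C) = opposite (cancel s t C)"
    unfolding cancel_def opposite_def by (auto simp: fun_eq_iff mult.commute)
  moreover have "flip P - {(t, Some s)} = flip (P - {(s, Some t)})" "(t, Some s) \<in> flip P"
    using cancels_to_step.hyps(1) unfolding flip_def by auto
  ultimately show ?case
    using cancels_to.cancels_to_step[of t s "flip P"] cancels_to_step.IH by simp
qed

lemma cancels_to_rows:
  assumes "cancels_to g A C C1"
  shows "\<exists>S. finite S \<and> (\<forall>s\<in>S. \<exists>t. (s, Some t) \<in> A) \<and>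
     (\<forall>y. inc C1 x y = inc C x y + (\<Sum>s\<in>S. inc C s y)) \<and>
     (\<forall>s t. (s, Some t) \<in> A \<longrightarrow> inc C1 x t = 0)"
proof -
  have inc: "inc (opposite C) x y = inc C y x" for C :: "'a lefschetz" and x y
    unfolding opposite_def by simp
  have fl: "(t, Some s) \<in> flip A \<longleftrightarrow> (s, Some t) \<in> A" for s t
    unfolding flip_def by auto
  show ?thesis
    using cancels_to_columns[OF cancels_to_opposite[OF assms], of x] unfolding inc fl by blast
qed

text \<open>Entries of a partially reduced matrix which decide the update rule, for two pairs \<open>(i, p)\<close>
  and \<open>(j, q)\<close> with adjacent rows \<open>i\<close> and \<open>j\<close>.\<close>

lemma lazy_switch_value:
  assumes L: "lazy r c I J M R U"
    and p: "p \<in> J" "pivot r I R p i" and q: "q \<in> J" "pivot r I R q j"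
    and ij: "r i j" "\<And>z. z \<in> I \<Longrightarrow> r i z \<Longrightarrow> z = j \<or> r j z"
    and K: "K = {t \<in> J - {p, q}. \<exists>s. pivot r I R t s \<and> (r i s \<and> c t p \<or> r j s \<and> c t q)}"
    and T: "T \<subseteq> K" and y: "y = (if c p q then q else p)" and pq: "c p q \<or> c q p"
    and v: "\<And>i. i \<in> I \<Longrightarrow> v i = M i y + (\<Sum>t\<in>T. M i t)"
    and zero: "\<And>t s. t \<in> K \<Longrightarrow> pivot r I R t s \<Longrightarrow> v s = 0"
  shows "if c p q then v i = R i q else v j = U q p"
proof -
  note li = lazy_linI[OF L] and lj = lazy_linJ[OF L]
  have I: "i \<in> I" "j \<in> I" using p q unfolding lead_def by auto
  have ne: "p \<noteq> q" using pq lin_irrefl[OF lj] by blast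
  \<comment> \<open>Pivots of \<open>K\<close> lie beyond \<open>i\<close> or \<open>j\<close>; as
    \<open>j\<close> directly follows \<open>i\<close> and is the pivot of \<open>q\<close>, which
    is not in \<open>K\<close>, they lie beyond \<open>j\<close>.\<close>
  have big: "r j s" if t: "t \<in> K" "pivot r I R t s" for t s
  proof -
    have "s \<in> I" using t(2) unfolding lead_def by blast
    obtain s' where "pivot r I R t s'" "r i s' \<or> r j s'" and tJ: "t \<in> J" "t \<noteq> q"
      using t(1) unfolding K by blast
    then have "r i s \<or> r j s" using lead_unique[OF li t(2)] by blast
    then show ?thesis using ij(2)[OF \<open>s \<in> I\<close>] lazy_inj[OF L tJ(1) q(1) t(2)] q(2) tJ(2) by blast
  qed
  have inK: "x \<in> K" if "x \<in> J" "x \<noteq> p" "x \<noteq> q" "pivot r I R x a" "r j a" "c x p \<or> c x q" for x a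
    using that K lin_trans[OF li ij(1)] by blast
  have cl: "x \<in> K" if t: "t \<in> K" and x: "x \<in> J" "U x t = 1" for x t
  proof (cases "x = t")
    case False
    have tJ: "t \<in> J" using t K by blast
    obtain s where s: "pivot r I R t s" "c t p \<or> c t q" using t K by blast
    obtain a where a: "pivot r I R x a" "r s a" using lazy_pivot[OF L x(1) tJ x(2) False] s by blast
    have "r j a" using big[OF t s(1)] a(2) lin_trans[OF li] by blast
    moreover have "x \<noteq> p" "x \<noteq> q"
      using a(1) p q calculation lead_unique[OF li] ij(1) lin_asym[OF li] lin_irrefl[OF li] by metis+
    moreover have "c x p \<or> c x q" using lazy_upper[OF L x(1) tJ x(2) False] s(2) lin_trans[OF lj] by blast
    ultimately show ?thesis using inK[OF x(1) _ _ a(1)] by blast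
  qed (use t in simp)
  have yJ: "y \<in> J" "y \<notin> K" using y p q K by auto
  have KJ: "K \<subseteq> J" "p \<notin> K" "q \<notin> K" using K by auto
  \<comment> \<open>Any column other than \<open>p\<close> and \<open>q\<close> that is added to
    \<open>y\<close> precedes \<open>y\<close> and has its pivot beyond \<open>j\<close>, and hence
    belongs to \<open>K\<close>.\<close>
  have Uy: "U x y = 0" if x: "x \<in> J - K" "x \<noteq> p" "x \<noteq> q" for x
  proof (rule ccontr)
    assume "U x y \<noteq> 0"
    then have U: "U x y = 1" by simp
    have ne': "x \<noteq> y" "x \<in> J" using y x by auto
    obtain a where a: "pivot r I R x a" "\<forall>b. pivot r I R y b \<longrightarrow> r b a"
      using lazy_pivot[OF L ne'(2) yJ(1) U ne'(1)] by blast
    moreover have "pivot r I R y i \<or> pivot r I R y j" using y p(2) q(2) by (cases "c p q") auto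
    ultimately have "r i a \<or> r j a" by blast
    moreover have "a \<in> I" using a(1) unfolding lead_def by blast
    ultimately have "r j a" using ij(2) lazy_inj[OF L ne'(2) q(1) a(1)] q(2) x(3) by blast
    moreover have "c x p \<or> c x q"
      using lazy_upper[OF L ne'(2) yJ(1) U ne'(1)] y by (cases "c p q") auto
    ultimately show False using inK[OF ne'(2) x(2,3) a(1)] x(1) by blast
  qed
  have sum: "(\<Sum>x\<in>J - K. R l x * U x y) = R l p * U p y + R l q * U q y" for l
  proof -
    have "(\<Sum>x\<in>J - K. R l x * U x y) = (\<Sum>x\<in>{p, q}. R l x * U x y)"
      using lazy_finJ[OF L] p q KJ Uy by (intro sum.mono_neutral_right) auto
    then show ?thesis using ne by simp
  qed
  have small: "R s p = 0 \<and> R s q = 0" if "s \<in> I" "r j s" for s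
  proof -
    have "r i s" using ij(1) that(2) lin_trans[OF li] by blast
    then have "R s p \<noteq> 1" "R s q \<noteq> 1"
      using p(2) q(2) that lin_asym[OF li] lin_irrefl[OF li] unfolding lead_def by blast+
    then show ?thesis by simp
  qed
  \<comment> \<open>After the elimination of \<open>K\<close> only \<open>p\<close> and
    \<open>q\<close> are left. For \<open>y = q\<close> one has \<open>U p q = 0\<close>, and row
    \<open>i\<close> shows \<open>R i q\<close>. For \<open>y = p\<close> row \<open>j\<close> shows
    \<open>U q p\<close>, because \<open>p\<close> has no entry there and \<open>q\<close> has its
    pivot.\<close>
  have main: "v l = R l p * U p y + R l q * U q y" if lI: "l \<in> I" for l
    unfolding sum[symmetric]
  proof (rule lazy_partial_reduction[where v = v, OF L yJ KJ(1) T cl v _ lI])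
    fix t assume t: "t \<in> K"
    obtain s where s: "pivot r I R t s" using t K by blast
    then have "s \<in> I" unfolding lead_def by blast
    then show "\<exists>s. pivot r I R t s \<and> v s = 0 \<and> (\<Sum>x\<in>J - K. R s x * U x y) = 0"
      using s zero[OF t s] small[OF _ big[OF t s]] unfolding sum by auto
  qed
  show ?thesis
  proof (cases "c p q")
    case True
    have "U p q = 0"
    proof (rule ccontr)
      assume "U p q \<noteq> 0"
      then have "U p q = 1" by simp
      then obtain a where "pivot r I R p a" "r j a" using lazy_pivot[OF L p(1) q(1) _ ne] q(2) by blast
      then have "r j i" using lead_unique[OF li p(2)] by blast
      then show False using ij(1) lin_asym[OF li] by blast
    qed
    then show ?thesis using True main[OF I(1)] y lazy_diag[OF L q(1)] by simp
  next
    case False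
    have "R j p \<noteq> 1" using p(2) I ij(1) lin_asym[OF li] lin_irrefl[OF li] unfolding lead_def by blast
    then show ?thesis using False main[OF I(2)] y q(2) unfolding lead_def by simp
  qed
qed

section \<open>Cancelling nested pairs in the Morse complex\<close>

context filtered
begin

lemma BD_Some: "(x, Some y) \<in> BD X g \<longleftrightarrow> matched_cells x y"
  using matched_dims(3) unfolding BD_def BD_dim_def by auto

lemma BD_None: "(x, None) \<in> BD X g \<longleftrightarrow> x \<in> cells X \<and> (\<forall>y. \<not> matched_cells x y) \<and> (\<forall>z. \<not> matched_cells z x)"
proof -
  have "(\<exists>m z. matched X g m x z \<or> matched X g m z x) \<longleftrightarrow> (\<exists>z. matched_cells x z \<or> matched_cells z x)"
    using matched_dims(3) by metis
  then show ?thesis unfolding BD_def BD_dim_def cells_of_dim_def by auto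
qed

lemma morse_inc: "inc (morse_complex X V) x y = (if cdim X y = cdim X x + 1 then np y x else 0)"
  unfolding morse_complex_def np_def by simp

lemma morse_cells [simp]: "cells (morse_complex X V) = Crit V" "cdim (morse_complex X V) = cdim X"
  unfolding morse_complex_def by simp_all

text \<open>Pairs may be cancelled in the order of their death values.\<close>

lemma cancels_to_exists:
  assumes "finite N" and N: "\<And>\<beta>. \<beta> \<in> N \<Longrightarrow> \<exists>s t. \<beta> = (s, Some t) \<and> matched_cells s t \<and> s \<in> Crit V"
    and cl: "\<And>s t s' t'. (s, Some t) \<in> N \<Longrightarrow> matched_cells s' t' \<Longrightarrow> s' \<in> Crit V \<Longrightarrow>
      cdim X s' = cdim X s \<Longrightarrow> g s < g s' \<Longrightarrow> g t' < g t \<Longrightarrow> (s', Some t') \<in> N"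
  shows "\<exists>C. cancels_to g N (morse_complex X V) C"
  using assms
\<comment> \<open>The pair with the largest death value is cancelled last; removing it from
  \<open>N\<close> preserves the closure condition.\<close>
proof (induction "card N" arbitrary: N)
  case 0
  then show ?case using cancels_to.cancels_to_empty by (metis card_eq_0_iff)
next
  case (Suc n)
  let ?d = "\<lambda>\<beta>. g (death \<beta>)"
  have "N \<noteq> {}" using Suc.hyps(2) by auto
  then obtain \<beta> where "\<beta> \<in> N" and max0: "\<And>\<gamma>. \<gamma> \<in> N \<Longrightarrow> ?d \<gamma> \<le> ?d \<beta>"
  proof -
    have "Max (?d ` N) \<in> ?d ` N" using \<open>N \<noteq> {}\<close> Suc.prems(1) by (intro Max_in) auto
    then obtain \<beta> where b: "\<beta> \<in> N" "Max (?d ` N) = ?d \<beta>" by blast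
    have "?d \<gamma> \<le> ?d \<beta>" if "\<gamma> \<in> N" for \<gamma>
      unfolding b(2)[symmetric] using that Suc.prems(1) by (intro Max_ge) auto
    then show ?thesis using b(1) that by blast
  qed
  then obtain s t where st: "(s, Some t) \<in> N" "\<beta> = (s, Some t)" "matched_cells s t" "s \<in> Crit V"
    using Suc.prems(2) by metis
  let ?N = "N - {(s, Some t)}"
  have tC: "t \<in> Crit V" using matched_Crit st by blast
  have max: "g t' < g t" if "(s', Some t') \<in> ?N" for s' t'
  proof -
    have m: "matched_cells s' t'" "s' \<in> Crit V" using Suc.prems(2)[of "(s', Some t')"] that by auto
    have "g t' \<le> g t" using max0[of "(s', Some t')"] st(2) that by auto
    moreover have "t' \<noteq> t" using matched_fun[OF m(1), of _ s] st(3) that by auto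
    ultimately show ?thesis using Crit_value[OF tC, of t'] matched_dims(2)[OF m(1)] by force
  qed
  have "\<exists>C. cancels_to g ?N (morse_complex X V) C"
  proof (rule Suc.hyps(1))
    show "n = card ?N" using Suc.hyps(2) Suc.prems(1) st(1) by simp
    show "(s', Some t') \<in> ?N" if "(a, Some b) \<in> ?N" "matched_cells s' t'" "s' \<in> Crit V"
      "cdim X s' = cdim X a" "g a < g s'" "g t' < g b" for a b s' t'
      using Suc.prems(3)[of a b s' t'] that max[OF that(1)] by auto
  qed (use Suc.prems in auto)
  then obtain C where C: "cancels_to g ?N (morse_complex X V) C" by blast
  let ?m = "cdim X t"
  have m: "?m = cdim X s + 1" using matched_dims(4)[OF st(3)] .
  obtain R where L: "lazy lt lt (CrR ?m) (Cr ?m) (\<lambda>a y. np y a) R (U_mat X g ?m)"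
    and P: "\<forall>y\<in>Cr ?m. \<forall>a. pivot lt (CrR ?m) R y a \<longleftrightarrow> matched_cells a y"
    using critical_boundary by blast
  note li = lazy_linI[OF L]
  have tJ: "t \<in> Cr ?m" and sI: "s \<in> CrR ?m" using tC st m unfolding Cr_def CrR_def by auto
  have dim: "cdim C = cdim X" "\<And>x y. inc C x y = 1 \<Longrightarrow> cdim X y = cdim X x + 1"
    using cancels_to_dim[OF C] morse_inc by (auto split: if_splits)
  have notN: "(s', Some t') \<in> ?N" if "matched_cells s' t'" "s' \<in> Crit V" "cdim X s' = cdim X s" "g s < g s'" "g t' < g t" for s' t'
    using Suc.prems(3)[OF st(1) that] that by auto
  \<comment> \<open>After the other cancellations a column \<open>y\<close> up to \<open>t\<close>
    is a combination of reduced columns up to \<open>t\<close>. A lowest entry beyond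
    \<open>s\<close> would be the birth cell of a pair with a smaller death value, hence by the
    closure condition of a cancelled pair, whose row is zero. So \<open>s\<close> is lowest in
    column \<open>t\<close> and does not occur in earlier columns, which is shallowness.\<close>
  have main: "(\<forall>i\<in>CrR ?m. g s < g i \<longrightarrow> inc C i y = 0) \<and> (y = t \<longrightarrow> inc C s y = 1) \<and> (y \<noteq> t \<longrightarrow> inc C s y = 0)"
    if y: "y \<in> Cr ?m" "g y \<le> g t" for y
  proof -
    obtain T where T: "finite T" "\<forall>t'\<in>T. \<exists>s'. (s', Some t') \<in> ?N"
      "\<forall>x. inc C x y = inc (morse_complex X V) x y + (\<Sum>t'\<in>T. inc (morse_complex X V) x t')"
      "\<forall>s' t'. (s', Some t') \<in> ?N \<longrightarrow> inc C s' y = 0"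
      using cancels_to_columns[OF C, of y] by blast
    let ?T = "{t' \<in> T. cdim X t' = ?m}"
    define a where "a x = (if x = y then 1 else 0) + (if x \<in> ?T then 1 else 0 :: bit)" for x
    define e where "e z = (\<Sum>x\<in>Cr ?m. U_mat X g ?m z x * a x)" for z
    have TJ: "?T \<subseteq> Cr ?m" "\<forall>t'\<in>?T. g t' < g t"
    proof -
      have "t' \<in> Crit V \<and> g t' < g t" if t'T: "t' \<in> T" for t'
      proof -
        obtain s' where s': "(s', Some t') \<in> ?N" using bspec[OF T(2) t'T] by (rule exE)
        have "\<exists>a b. (s', Some t') = (a, Some b) \<and> matched_cells a b \<and> a \<in> Crit V"
          by (rule Suc.prems(2)) (use s' in blast)
        then have mt: "matched_cells s' t'" "s' \<in> Crit V" by auto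
        then have "t' \<in> Crit V" using matched_Crit[OF mt(1)] by blast
        then show ?thesis using max[OF s'] by (rule conjI)
      qed
      then show "?T \<subseteq> Cr ?m" "\<forall>t'\<in>?T. g t' < g t" unfolding Cr_def by auto
    qed
    have inc_eq: "inc C i y = (\<Sum>z\<in>Cr ?m. R i z * e z)" if i: "i \<in> CrR ?m" for i
    proof -
      have im: "?m = cdim X i + 1" using i unfolding CrR_def by auto
      have "(\<Sum>t'\<in>T. inc (morse_complex X V) i t') = (\<Sum>t'\<in>?T. np t' i)"
        unfolding morse_inc im using T(1) by (intro sum.mono_neutral_cong_right) auto
      moreover have "inc (morse_complex X V) i y = np y i"
        using y im unfolding morse_inc Cr_def by auto
      ultimately have "inc C i y = np y i + (\<Sum>t'\<in>?T. np t' i)" using T(3) by simp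
      also have "\<dots> = (\<Sum>x\<in>Cr ?m. np x i * a x)"
      proof -
        have "np x i * a x = (if x = y then np x i else 0) + (if x \<in> ?T then np x i else 0)" for x
          unfolding a_def by (simp add: distrib_left)
        then have "(\<Sum>x\<in>Cr ?m. np x i * a x) = np y i + (\<Sum>x\<in>Cr ?m. if x \<in> ?T then np x i else 0)"
          using y(1) lazy_finJ[OF L] by (simp add: sum.distrib)
        also have "(\<Sum>x\<in>Cr ?m. if x \<in> ?T then np x i else 0) = (\<Sum>t'\<in>?T. np t' i)"
          by (rule sum.mono_neutral_cong_right) (use lazy_finJ[OF L] TJ(1) in auto)
        finally show ?thesis by simp
      qed
      also have "\<dots> = (\<Sum>z\<in>Cr ?m. R i z * e z)" unfolding e_def by (rule lazy_comb[OF L i])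
      finally show ?thesis .
    qed
    have e: "z = t \<and> y = t \<or> g z < g t" if z: "z \<in> Cr ?m" "e z = 1" for z
    proof -
      obtain x where x: "x \<in> Cr ?m" "U_mat X g ?m z x = 1" "a x = 1"
        using z(2) bit_sum_mult_eq_1D[of "\<lambda>x. U_mat X g ?m z x" a "Cr ?m"] unfolding e_def by blast
      have "x = y \<or> x \<in> ?T" using x(3) unfolding a_def by (auto split: if_splits)
      then have "x = y \<or> g x < g t" using TJ by blast
      moreover have "y = t \<or> g y < g t"
        using y(2) Crit_value[OF tC] Crit_cells y(1) unfolding Cr_def by force
      moreover have "z = x \<or> g z < g x" using lazy_upper[OF L z(1) x(1,2)] by blast
      ultimately show ?thesis by auto
    qed
    have et: "e t = 1" if "y = t"
    proof -
      have "a t = 1" using that TJ(2) unfolding a_def by auto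
      moreover have "e t = U_mat X g ?m t t * a t + (\<Sum>x\<in>Cr ?m - {t}. U_mat X g ?m t x * a x)"
        unfolding e_def by (rule sum.remove[OF lazy_finJ[OF L] tJ])
      moreover have "(\<Sum>x\<in>Cr ?m - {t}. U_mat X g ?m t x * a x) = 0"
      proof (rule bit_sum_eq_0I)
        fix x assume x: "x \<in> Cr ?m - {t}" "U_mat X g ?m t x * a x = 1"
        then have "x \<in> ?T" using that unfolding a_def by (auto simp: bit_mult_eq_1_iff split: if_splits)
        moreover have "g t < g x" using lazy_upper[OF L tJ, of x] x by (auto simp: bit_mult_eq_1_iff)
        ultimately show False using TJ(2) by fastforce
      qed
      ultimately show ?thesis using lazy_diag[OF L tJ] by simp
    qed
    have leadC: "lead lt (CrR ?m) (\<lambda>i. inc C i y) l \<longleftrightarrow> lead lt (CrR ?m) (\<lambda>i. \<Sum>z\<in>Cr ?m. R i z * e z) l" for l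
      by (rule lead_cong) (rule inc_eq)
    have lead_le: "l = s \<and> z = t \<or> g l < g s" if l: "lead lt (CrR ?m) (\<lambda>i. inc C i y) l"
      and z: "z \<in> Cr ?m" "e z = 1" "pivot lt (CrR ?m) R z l" for l z
    proof (rule ccontr)
      assume neg: "\<not> ?thesis"
      have mz: "matched_cells l z" using P z by blast
      have lI: "l \<in> Crit V" "cdim X l = cdim X s" using l m unfolding lead_def CrR_def by auto
      show False
      proof (cases "z = t")
        case True
        then have "l = s" using matched_fun[OF mz] st(3) by blast
        then show ?thesis using True neg by blast
      next
        case False
        then have "g z < g t" using e z by blast
        moreover have "l \<noteq> s" using matched_inj[OF mz] st(3) False by blast
        then have "g s < g l" using neg Crit_value[OF st(4)] Crit_cells[OF lI(1)] by force
        ultimately have "(l, Some z) \<in> ?N" using notN[OF mz lI] by blast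
        then show ?thesis using T(4) l unfolding lead_def by auto
      qed
    qed
    have ub: "g i \<le> g s \<and> (y \<noteq> t \<longrightarrow> i \<noteq> s)" if i: "i \<in> CrR ?m" "inc C i y = 1" for i
    proof -
      obtain z l where z: "z \<in> Cr ?m" "e z = 1" "pivot lt (CrR ?m) R z l"
        and l: "lead lt (CrR ?m) (\<lambda>i. inc C i y) l"
        using lazy_comb_nonzero[OF L subset_refl i(1), of e] inc_eq[OF i(1)] i(2) leadC by auto
      have "i = l \<or> g i < g l" using l i unfolding lead_def by blast
      then show ?thesis using lead_le[OF l z] e[OF z(1,2)] by auto
    qed
    have one: "inc C s y = 1" if yt: "y = t"
    proof -
      have piv: "pivot lt (CrR ?m) R t s" using P tJ st(3) by blast
      obtain z l where z: "z \<in> Cr ?m" "e z = 1" "pivot lt (CrR ?m) R z l"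
        and l': "lead lt (CrR ?m) (\<lambda>i. \<Sum>z\<in>Cr ?m. R i z * e z) l"
        and le: "\<forall>z'\<in>Cr ?m. \<forall>l'. e z' = 1 \<longrightarrow> pivot lt (CrR ?m) R z' l' \<longrightarrow> l' = l \<or> g l' < g l"
        using lazy_comb_lead[OF L subset_refl tJ, of e] et[OF yt] piv by blast
      have l: "lead lt (CrR ?m) (\<lambda>i. inc C i y) l" using l' leadC by blast
      have s: "s = l \<or> g s < g l" using le tJ et[OF yt] piv by blast
      have "l = s" using lead_le[OF l z] s by auto
      then show ?thesis using l unfolding lead_def by blast
    qed
    show ?thesis
    proof (intro conjI ballI impI)
      fix i assume "i \<in> CrR ?m" "g s < g i"
      then show "inc C i y = 0" using ub[of i] by (cases "inc C i y") auto
    next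
      assume "y \<noteq> t"
      then show "inc C s y = 0" using ub[OF sI] by (cases "inc C s y") auto
    qed (rule one)
  qed
  have gone: "\<not> (\<exists>s' t'. (s', Some t') \<in> ?N \<and> (x = s' \<or> x = t'))" if "x = s \<or> x = t" for x
  proof
    assume "\<exists>s' t'. (s', Some t') \<in> ?N \<and> (x = s' \<or> x = t')"
    then obtain s' t' where *: "(s', Some t') \<in> ?N" "x = s' \<or> x = t'" by blast
    have mt: "matched_cells s' t'" using Suc.prems(2)[of "(s', Some t')"] *(1) by auto
    show False
      using that *(2)
    proof (elim disjE)
      assume "x = s" "x = s'"
      then show False using matched_inj[OF mt] st(3) *(1) by auto
    next
      assume "x = s" "x = t'"
      then show False using matched_chain[OF st(3)] mt by blast
    next
      assume "x = t" "x = s'"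
      then show False using matched_chain[OF mt] st(3) by blast
    next
      assume "x = t" "x = t'"
      then show False using matched_fun[OF mt] st(3) *(1) by auto
    qed
  qed
  have cellsC: "cells C = Crit V - {x. \<exists>s' t'. (s', Some t') \<in> ?N \<and> (x = s' \<or> x = t')}"
    using cancels_to_cells[OF C] by simp
  have "shallow C g s t"
    unfolding shallow_def
  proof (intro conjI allI impI)
    show "facet C s t"
      using main[OF tJ order_refl] gone tC st(4) unfolding facet_def cellsC by auto
  next
    fix x assume x: "facet C x t"
    then have "x \<in> CrR ?m" using dim(2)[of x t] unfolding facet_def cellsC CrR_def by auto
    then show "g x \<le> g s" using main[OF tJ order_refl] x unfolding facet_def by force
  next
    fix y assume y: "facet C s y"
    then have "y \<in> Cr ?m" using dim(2)[of s y] m unfolding facet_def cellsC Cr_def by auto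
    then show "g t \<le> g y" using main[of y] y unfolding facet_def by force
  qed
  then have "cancels_to g (insert (s, Some t) ?N) (morse_complex X V) (cancel s t C)"
    by (intro cancels_to_snoc[OF C]) simp_all
  moreover have "insert (s, Some t) ?N = N" using st(1) by auto
  ultimately show ?case by metis
qed

end

section \<open>Transposition of critical cells\<close>

text \<open>In the early case \<open>U t s = 0\<close> and \<open>v a = R i q\<close>; in the late
  case \<open>v a = U t s\<close>. The disjunction therefore states both update rules at once, in
  the form in which the algorithm tests them.\<close>

lemma (in row_swap) switch:
  assumes L': "lazy r' c I J M R' U'"
    and same: "\<And>y a. y \<in> J \<Longrightarrow> pivot r I R y a \<longleftrightarrow> pivot r' I R' y a"
    and p: "p \<in> J" "pivot r I R p i" and q: "q \<in> J" "pivot r I R q j"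
    and K: "K = {t \<in> J - {p, q}. \<exists>s. pivot r I R t s \<and> (r i s \<and> c t p \<or> r j s \<and> c t q)}"
    and T: "T \<subseteq> K"
    and st: "(a, s, t) = (if c p q then (i, q, p) else (j, p, q))"
    and v: "\<And>i. i \<in> I \<Longrightarrow> v i = M i s + (\<Sum>t\<in>T. M i t)"
    and zero: "\<And>t b. t \<in> K \<Longrightarrow> pivot r I R t b \<Longrightarrow> v b = 0"
    and xy: "x \<in> J" "y \<in> J"
  shows "U' x y = (if U t s = 1 \<or> v a = 1 then add_row t s U else U) x y"
proof -
  have adj: "z = j \<or> r j z" if "z \<in> I" "r i z" for z
    using swapped_adjacent(1)[OF sw li lin' that(1)] lin_total[OF li that(1) ij(2)] that(2)
      lin_irrefl[OF li] lin_asym[OF li] by metis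
  have ne: "p \<noteq> q" using lead_unique[OF li] p q ij by metis
  then have pq: "c p q \<or> c q p" using lin_total[OF lj p(1) q(1)] by blast
  have s: "s = (if c p q then q else p)" using st by (auto split: if_splits)
  note val = lazy_switch_value[OF L p q ij(4) adj K T s pq v zero]
  show ?thesis
  proof (cases "c p q")
    case True
    have "U p q = 0"
    proof (rule ccontr)
      assume "U p q \<noteq> 0"
      then have "U p q = 1" by simp
      then obtain a where "pivot r I R p a" "r j a" using lazy_pivot[OF L p(1) q(1) _ ne] q(2) by blast
      then have "r j i" using lead_unique[OF li p(2)] by blast
      then show False using ij(6) by blast
    qed
    then show ?thesis using True st val update_early[OF L' p q True xy] by simp
  next
    case False
    then show ?thesis using st val update_late[OF L' same p q _ xy] pq by simp
  qed
qed

text \<open>If \<open>p\<close> comes first, the update touches row \<open>p\<close>, whose entry in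
  column \<open>p\<close> is the diagonal one. Otherwise it touches row \<open>q\<close>, and only
  if \<open>U q p = 1\<close>; adding the diagonal entry of \<open>p\<close> then deletes this
  entry. So column \<open>p\<close> can only lose entries.\<close>

lemma (in row_swap) switch_mono:
  assumes L': "lazy r' c I J M R' U'"
    and same: "\<And>y a. y \<in> J \<Longrightarrow> pivot r I R y a \<longleftrightarrow> pivot r' I R' y a"
    and p: "p \<in> J" "pivot r I R p i" and q: "q \<in> J" "pivot r I R q j"
    and x: "x \<in> J" "U' x p = 1"
  shows "U x p = 1"
proof -
  have ne: "p \<noteq> q" using lead_unique[OF li] p q ij by metis
  then consider "c p q" | "c q p" using lin_total[OF lj p(1) q(1)] by blast
  then show ?thesis
  proof cases
    case 1
    show ?thesis
      using update_early[OF L' p q 1 x(1) p(1)] x(2) lazy_diag[OF L p(1)]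
      by (cases "x = p") (auto simp: add_row_def split: if_splits)
  next
    case 2
    show ?thesis
      using update_late[OF L' same p q 2 x(1) p(1)] x(2)
      by (cases "x = q") (auto simp: add_row_def split: if_splits)
  qed
qed

text \<open>Equal vector fields have the same critical cells and the same numbers of paths. So the
  Morse boundary matrices coincide, and only the orders of their rows and columns differ.\<close>

locale two_functions = G: filtered X g + H: filtered X g'
  for X :: "'a lefschetz" and g g' :: "'a \<Rightarrow> real" +
  assumes V_eq: "fibre_field X g' = fibre_field X g"
begin

lemma same_sets: "H.Cr n = G.Cr n" "H.CrR n = G.CrR n" "H.np = G.np"
  unfolding H.Cr_def G.Cr_def H.CrR_def G.CrR_def V_eq H.np_def G.np_def by (auto simp: fun_eq_iff)

lemma vec_facet: "filtered X f \<Longrightarrow> filtered.vec X f s t \<longleftrightarrow> facet X s t \<and> {s, t} \<in> fibre_field X f"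
  using filtered.fibre_doubleton[of X f s t] filtered.facet_asym[of X f s t]
    filtered.facet_irrefl[of X f s] filtered.vec_def[of X f] by metis

lemma same_vec: "H.vec s t \<longleftrightarrow> G.vec s t"
  using vec_facet[OF G.filtered_axioms] vec_facet[OF H.filtered_axioms] V_eq by simp

lemma lin_lt': "A \<subseteq> Crit G.V \<Longrightarrow> lin H.lt A"
  using H.lin_lt V_eq by simp

lemma G_sub: "G.Cr n \<subseteq> Crit G.V" "G.CrR n \<subseteq> Crit G.V"
  unfolding G.Cr_def G.CrR_def by auto

text \<open>As long as no exchanged column is added to another one across the exchange, and the rows
  keep their order, the old factorisation remains lazy.\<close>

lemma keep_boundary:
  assumes up: "\<And>x y. x \<in> G.Cr n \<Longrightarrow> y \<in> G.Cr n \<Longrightarrow> x \<noteq> y \<Longrightarrow> g x < g y \<Longrightarrow> U_mat X g n x y = 1 \<Longrightarrow> g' x < g' y"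
    and rows: "\<And>x y. x \<in> G.CrR n \<Longrightarrow> y \<in> G.CrR n \<Longrightarrow> g x < g y \<longleftrightarrow> g' x < g' y"
    and y: "y \<in> G.Cr n"
  shows "x \<in> G.Cr n \<Longrightarrow> U_mat X g' n x y = U_mat X g n x y"
    and "H.matched_cells a y \<longleftrightarrow> G.matched_cells a y"
proof -
  obtain R where L: "lazy G.lt G.lt (G.CrR n) (G.Cr n) (\<lambda>a y. G.np y a) R (U_mat X g n)"
    and P: "\<forall>y\<in>G.Cr n. \<forall>a. pivot G.lt (G.CrR n) R y a \<longleftrightarrow> G.matched_cells a y"
    using G.critical_boundary by blast
  obtain R' where L': "lazy H.lt H.lt (G.CrR n) (G.Cr n) (\<lambda>a y. G.np y a) R' (U_mat X g' n)"
    and P': "\<forall>y\<in>G.Cr n. \<forall>a. pivot H.lt (G.CrR n) R' y a \<longleftrightarrow> H.matched_cells a y"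
    using H.critical_boundary[of n] unfolding same_sets by blast
  have *: "lazy H.lt H.lt (G.CrR n) (G.Cr n) (\<lambda>a y. G.np y a) R (U_mat X g n)"
    "\<And>y a. y \<in> G.Cr n \<Longrightarrow> pivot H.lt (G.CrR n) R y a \<longleftrightarrow> pivot G.lt (G.CrR n) R y a"
  proof -
    note re = lazy_reorder[OF L lin_lt'[OF G_sub(2)] lin_lt'[OF G_sub(1)]]
    have 1: "g' x < g' y" if "x \<in> G.Cr n" "y \<in> G.Cr n" "U_mat X g n x y = 1" "x \<noteq> y" for x y
      using up that lazy_upper[OF L] by blast
    have 2: "pivot H.lt (G.CrR n) R y a" if "pivot G.lt (G.CrR n) R y a" for y a
      using that rows unfolding lead_def by blast
    have 3: "g' b < g' a" if "pivot G.lt (G.CrR n) R x a" "pivot G.lt (G.CrR n) R y b" "g b < g a" for x y a b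
      using that rows unfolding lead_def by blast
    show "lazy H.lt H.lt (G.CrR n) (G.Cr n) (\<lambda>a y. G.np y a) R (U_mat X g n)"
      by (rule re(1)) (use 1 2 3 in blast)+
    show "pivot H.lt (G.CrR n) R y a \<longleftrightarrow> pivot G.lt (G.CrR n) R y a" if "y \<in> G.Cr n" for y a
      by (rule re(2)) (use 1 2 3 that in blast)+
  qed
  show "x \<in> G.Cr n \<Longrightarrow> U_mat X g' n x y = U_mat X g n x y"
    using lazy_unique[OF L' *(1) y] by blast
  show "H.matched_cells a y \<longleftrightarrow> G.matched_cells a y"
    using lazy_unique_pivot[OF L' *(1) y] *(2) P P' y by blast
qed

lemma keep_coboundary:
  assumes up: "\<And>x y. x \<in> G.Cr n \<Longrightarrow> y \<in> G.Cr n \<Longrightarrow> x \<noteq> y \<Longrightarrow> g y < g x \<Longrightarrow> U_perp_mat X g n x y = 1 \<Longrightarrow> g' y < g' x"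
    and rows: "\<And>x y. x \<in> G.CrR (n + 2) \<Longrightarrow> y \<in> G.CrR (n + 2) \<Longrightarrow> g x < g y \<longleftrightarrow> g' x < g' y"
    and y: "y \<in> G.Cr n"
  shows "x \<in> G.Cr n \<Longrightarrow> U_perp_mat X g' n x y = U_perp_mat X g n x y"
    and "H.matched_cells y b \<longleftrightarrow> G.matched_cells y b"
proof -
  let ?r = "conv G.lt" and ?r' = "conv H.lt" and ?I = "G.CrR (n + 2)"
  obtain R where L: "lazy ?r ?r ?I (G.Cr n) (\<lambda>b x. G.np b x) R (U_perp_mat X g n)"
    and P: "\<forall>y\<in>G.Cr n. \<forall>a. pivot ?r ?I R y a \<longleftrightarrow> G.matched_cells y a"
    using G.critical_coboundary by blast
  obtain R' where L': "lazy ?r' ?r' ?I (G.Cr n) (\<lambda>b x. G.np b x) R' (U_perp_mat X g' n)"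
    and P': "\<forall>y\<in>G.Cr n. \<forall>a. pivot ?r' ?I R' y a \<longleftrightarrow> H.matched_cells y a"
    using H.critical_coboundary[of n] unfolding same_sets by blast
  have *: "lazy ?r' ?r' ?I (G.Cr n) (\<lambda>b x. G.np b x) R (U_perp_mat X g n)"
    "\<And>y a. y \<in> G.Cr n \<Longrightarrow> pivot ?r' ?I R y a \<longleftrightarrow> pivot ?r ?I R y a"
  proof -
    note re = lazy_reorder[OF L lin_converse[OF lin_lt'[OF G_sub(2)]] lin_converse[OF lin_lt'[OF G_sub(1)]]]
    have 1: "g' y < g' x" if "x \<in> G.Cr n" "y \<in> G.Cr n" "U_perp_mat X g n x y = 1" "x \<noteq> y" for x y
      using up that lazy_upper[OF L] by blast
    have 2: "pivot ?r' ?I R y a" if "pivot ?r ?I R y a" for y a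
      using that rows unfolding lead_def by blast
    have 3: "g' a < g' b" if "pivot ?r ?I R x a" "pivot ?r ?I R y b" "g a < g b" for x y a b
      using that rows unfolding lead_def by blast
    show "lazy ?r' ?r' ?I (G.Cr n) (\<lambda>b x. G.np b x) R (U_perp_mat X g n)"
      by (rule re(1)) (use 1 2 3 in blast)+
    show "pivot ?r' ?I R y a \<longleftrightarrow> pivot ?r ?I R y a" if "y \<in> G.Cr n" for y a
      by (rule re(2)) (use 1 2 3 that in blast)+
  qed
  show "x \<in> G.Cr n \<Longrightarrow> U_perp_mat X g' n x y = U_perp_mat X g n x y"
    using lazy_unique[OF L' *(1) y] by blast
  show "H.matched_cells y b \<longleftrightarrow> G.matched_cells y b"
    using lazy_unique_pivot[OF L' *(1) y] *(2) P P' y by blast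
qed

text \<open>Pairs with a noncritical component are vectors, which both functions share; only the
  critical pairs have to be compared.\<close>

lemma matched_same_Crit:
  assumes "\<And>x y. x \<in> Crit G.V \<Longrightarrow> y \<in> Crit G.V \<Longrightarrow> H.matched_cells x y \<longleftrightarrow> G.matched_cells x y"
  shows "H.matched_cells x y \<longleftrightarrow> G.matched_cells x y" and "BD X g' = BD X g"
proof -
  show *: "H.matched_cells x y \<longleftrightarrow> G.matched_cells x y" for x y
  proof (cases "x \<in> Crit G.V")
    case True
    have "H.matched_cells x y \<Longrightarrow> y \<in> Crit G.V" using H.matched_Crit[of "cdim X x" x y] V_eq True by simp
    moreover have "G.matched_cells x y \<Longrightarrow> y \<in> Crit G.V" using G.matched_Crit[of "cdim X x" x y] True by simp
    ultimately show ?thesis using assms True by blast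
  next
    case False
    have F: "x \<notin> Crit H.V" using False V_eq by simp
    have "H.matched_cells x y \<longleftrightarrow> H.vec x y"
      using H.matched_not_Crit[OF _ F] H.vec_matched[of x y] by blast
    moreover have "G.matched_cells x y \<longleftrightarrow> G.vec x y"
      using G.matched_not_Crit[OF _ False] G.vec_matched[of x y] by blast
    ultimately show ?thesis using same_vec by simp
  qed
  show "BD X g' = BD X g"
  proof (rule set_eqI)
    fix \<beta> :: "'a bd_pair"
    obtain a c where \<beta>: "\<beta> = (a, c)" by (cases \<beta>)
    show "\<beta> \<in> BD X g' \<longleftrightarrow> \<beta> \<in> BD X g"
      unfolding \<beta> by (cases c) (simp_all only: H.BD_Some G.BD_Some H.BD_None G.BD_None *)
  qed
qed

lemma same_order:
  assumes "\<And>x y. x \<in> Crit G.V \<Longrightarrow> y \<in> Crit G.V \<Longrightarrow> g x < g y \<longleftrightarrow> g' x < g' y"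
  shows "BD X g' = BD X g"
    and "\<And>x y. x \<in> G.Cr n \<Longrightarrow> y \<in> G.Cr n \<Longrightarrow> U_mat X g' n x y = U_mat X g n x y"
    and "\<And>x y. x \<in> G.Cr n \<Longrightarrow> y \<in> G.Cr n \<Longrightarrow> U_perp_mat X g' n x y = U_perp_mat X g n x y"
proof -
  have up: "g' x < g' y" if "x \<in> G.Cr m" "y \<in> G.Cr m" "g x < g y" for x y m
    using assms[of x y] that G_sub(1)[of m] by auto
  have rows: "g x < g y \<longleftrightarrow> g' x < g' y" if "x \<in> G.CrR m" "y \<in> G.CrR m" for x y m
    using assms[of x y] that G_sub(2)[of m] by auto
  show "BD X g' = BD X g"
  proof (rule matched_same_Crit(2))
    fix x y assume "x \<in> Crit G.V" "y \<in> Crit G.V"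
    then have y: "y \<in> G.Cr (cdim X y)" unfolding G.Cr_def by simp
    show "H.matched_cells x y \<longleftrightarrow> G.matched_cells x y"
      by (rule keep_boundary(2)[OF up rows y])
  qed
  show "U_mat X g' n x y = U_mat X g n x y" if "x \<in> G.Cr n" "y \<in> G.Cr n" for x y
    by (rule keep_boundary(1)[OF up rows that(2,1)])
  show "U_perp_mat X g' n x y = U_perp_mat X g n x y" if "x \<in> G.Cr n" "y \<in> G.Cr n" for x y
    by (rule keep_coboundary(1)[OF up rows that(2,1)])
qed

end

text \<open>\<open>U0\<close> and \<open>W0\<close> say that, as columns, neither of the two cells
  is added to the other in the boundary and coboundary reductions. So only their exchange as rows
  can have an effect: on \<open>U_mat\<close> one dimension above that of \<open>u\<close>, and on
  \<open>U_perp_mat\<close> one dimension below.\<close>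

locale swap_two = two_functions +
  fixes u w :: 'a
  assumes uw: "u \<in> Crit G.V" "w \<in> Crit G.V" "g u < g w" "g' w < g' u"
    and ord: "\<And>x y. x \<in> Crit G.V \<Longrightarrow> y \<in> Crit G.V \<Longrightarrow> {x, y} \<noteq> {u, w} \<Longrightarrow> g x < g y \<longleftrightarrow> g' x < g' y"
    and U0: "cdim X u = cdim X w \<Longrightarrow> U_mat X g (cdim X u) u w = 0"
    and W0: "cdim X u = cdim X w \<Longrightarrow> U_perp_mat X g (cdim X u) w u = 0"
begin

lemma order_dim:
  "x \<in> Crit G.V \<Longrightarrow> y \<in> Crit G.V \<Longrightarrow> cdim X x = m \<Longrightarrow> cdim X y = m \<Longrightarrow> \<not> (cdim X u = m \<and> cdim X w = m) \<Longrightarrow>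
    g x < g y \<longleftrightarrow> g' x < g' y"
  by (rule ord) (auto simp: doubleton_eq_iff)

lemma upU:
  assumes "x \<in> G.Cr n" "y \<in> G.Cr n" "g x < g y" "U_mat X g n x y = 1"
  shows "g' x < g' y"
proof (cases "x = u \<and> y = w")
  case True
  then show ?thesis using U0 assms unfolding G.Cr_def by auto
next
  case False
  then have "{x, y} \<noteq> {u, w}" using assms(3) uw(3) by (auto simp: doubleton_eq_iff)
  then show ?thesis using ord[of x y] assms unfolding G.Cr_def by auto
qed

lemma upW:
  assumes "x \<in> G.Cr n" "y \<in> G.Cr n" "g y < g x" "U_perp_mat X g n x y = 1"
  shows "g' y < g' x"
proof (cases "x = w \<and> y = u")
  case True
  then show ?thesis using W0 assms unfolding G.Cr_def by auto
next
  case False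
  then have "{y, x} \<noteq> {u, w}" using assms(3) uw(3) by (auto simp: doubleton_eq_iff)
  then show ?thesis using ord[of y x] assms unfolding G.Cr_def by auto
qed

lemma rows_same:
  assumes "\<not> (cdim X u + 1 = n \<and> cdim X w + 1 = n)" "x \<in> G.CrR n" "y \<in> G.CrR n"
  shows "g x < g y \<longleftrightarrow> g' x < g' y"
  using assms unfolding G.CrR_def by (intro order_dim[of x y "n - 1"]) auto

lemma U_same:
  assumes "\<not> (cdim X u + 1 = n \<and> cdim X w + 1 = n)" "x \<in> G.Cr n" "y \<in> G.Cr n"
  shows "U_mat X g' n x y = U_mat X g n x y"
  using keep_boundary(1)[of n, OF upU rows_same[OF assms(1)] assms(3,2)] .

lemma W_same:
  assumes "\<not> (cdim X u = n + 1 \<and> cdim X w = n + 1)" "x \<in> G.Cr n" "y \<in> G.Cr n"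
  shows "U_perp_mat X g' n x y = U_perp_mat X g n x y"
proof -
  have "\<not> (cdim X u + 1 = n + 2 \<and> cdim X w + 1 = n + 2)" using assms(1) by simp
  from keep_coboundary(1)[of n, OF upW rows_same[OF this] assms(3,2)] show ?thesis .
qed

text \<open>The pairing is read off the boundary matrix unless the two cells are rows of it. In that
  case it is read off the transposed matrix, where they are columns and the order of the rows is
  unchanged.\<close>

lemma matched_same: "H.matched_cells x y \<longleftrightarrow> G.matched_cells x y"
  and BD_same: "BD X g' = BD X g"
proof -
  have *: "H.matched_cells x y \<longleftrightarrow> G.matched_cells x y" if xy: "x \<in> Crit G.V" "y \<in> Crit G.V" for x y
  proof (cases "cdim X u + 1 = cdim X y \<and> cdim X w + 1 = cdim X y")
    case False
    then show ?thesis
      by (intro keep_boundary(2)[of "cdim X y", OF upU rows_same]) (use xy in \<open>auto simp: G.Cr_def\<close>)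
  next
    case True
    show ?thesis
    proof (cases "cdim X y = cdim X x + 1")
      case False
      then show ?thesis using H.matched_dims(4) G.matched_dims(4) by blast
    next
      case dims: True
      show ?thesis
        by (rule keep_coboundary(2)[of "cdim X x", OF upW rows_same])
          (use xy dims True in \<open>auto simp: G.Cr_def\<close>)
    qed
  qed
  show "H.matched_cells x y \<longleftrightarrow> G.matched_cells x y" using matched_same_Crit(1)[OF *] .
  show "BD X g' = BD X g" using matched_same_Crit(2)[OF *] .
qed

lemma swapped_lt:
  assumes "A \<subseteq> Crit G.V" "u \<in> A" "w \<in> A"
  shows "swapped G.lt H.lt A u w" "swapped (conv G.lt) (conv H.lt) A w u"
proof -
  show "swapped G.lt H.lt A u w" using assms uw ord unfolding swapped_def by blast
  have "g y < g x \<longleftrightarrow> g' y < g' x" if "x \<in> A" "y \<in> A" "{x, y} \<noteq> {w, u}" for x y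
    using ord[of y x] that assms(1) by (auto simp: insert_commute)
  then show "swapped (conv G.lt) (conv H.lt) A w u" using assms uw unfolding swapped_def by blast
qed

lemma U_unpaired:
  assumes n: "cdim X u + 1 = n" "cdim X w + 1 = n" and no: "\<And>y. \<not> G.matched_cells w y"
    and xy: "x \<in> G.Cr n" "y \<in> G.Cr n"
  shows "U_mat X g' n x y = U_mat X g n x y"
proof -
  obtain R where L: "lazy G.lt G.lt (G.CrR n) (G.Cr n) (\<lambda>a y. G.np y a) R (U_mat X g n)"
    and P: "\<forall>y\<in>G.Cr n. \<forall>a. pivot G.lt (G.CrR n) R y a \<longleftrightarrow> G.matched_cells a y"
    using G.critical_boundary by blast
  obtain R' where L': "lazy H.lt H.lt (G.CrR n) (G.Cr n) (\<lambda>a y. G.np y a) R' (U_mat X g' n)"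
    using H.critical_boundary[of n] unfolding same_sets by blast
  have uwI: "u \<in> G.CrR n" "w \<in> G.CrR n" using uw n unfolding G.CrR_def by auto
  have cols: "g x < g y \<longleftrightarrow> g' x < g' y" if "x \<in> G.Cr n" "y \<in> G.Cr n" for x y
    using that n order_dim[of x y n] unfolding G.Cr_def by auto
  interpret S: row_swap G.lt H.lt G.lt "G.CrR n" "G.Cr n" "\<lambda>a y. G.np y a" R "U_mat X g n" u w
    using L swapped_lt(1)[OF G_sub(2) uwI] lin_lt'[OF G_sub(2)] by unfold_locales
  have "lazy H.lt G.lt (G.CrR n) (G.Cr n) (\<lambda>a y. G.np y a) R (U_mat X g n)"
    using P no by (intro S.lazy_unpaired) blast
  then have "lazy H.lt H.lt (G.CrR n) (G.Cr n) (\<lambda>a y. G.np y a) R (U_mat X g n)"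
    by (rule lazy_cong(1)) (use cols lin_lt'[OF G_sub(1)] lin_lt'[OF G_sub(2)] in auto)
  then show ?thesis using lazy_unique[OF L' _ xy(2)] xy(1) by blast
qed

text \<open>In the reversed order it is \<open>w\<close> that is moved behind \<open>u\<close>;
  hence \<open>u\<close> takes the place of the row without pivot, instead of \<open>w\<close> as in
  the boundary case.\<close>

lemma W_unpaired:
  assumes n: "cdim X u = n + 1" "cdim X w = n + 1" and no: "\<And>x. \<not> G.matched_cells x u"
    and xy: "x \<in> G.Cr n" "y \<in> G.Cr n"
  shows "U_perp_mat X g' n x y = U_perp_mat X g n x y"
proof -
  let ?r = "conv G.lt" and ?r' = "conv H.lt" and ?I = "G.CrR (n + 2)"
  obtain R where L: "lazy ?r ?r ?I (G.Cr n) (\<lambda>b x. G.np b x) R (U_perp_mat X g n)"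
    and P: "\<forall>y\<in>G.Cr n. \<forall>a. pivot ?r ?I R y a \<longleftrightarrow> G.matched_cells y a"
    using G.critical_coboundary by blast
  obtain R' where L': "lazy ?r' ?r' ?I (G.Cr n) (\<lambda>b x. G.np b x) R' (U_perp_mat X g' n)"
    using H.critical_coboundary[of n] unfolding same_sets by blast
  have uwI: "u \<in> ?I" "w \<in> ?I" using uw n unfolding G.CrR_def by auto
  have cols: "g x < g y \<longleftrightarrow> g' x < g' y" if "x \<in> G.Cr n" "y \<in> G.Cr n" for x y
    using that n order_dim[of x y n] unfolding G.Cr_def by auto
  interpret S: row_swap ?r ?r' ?r ?I "G.Cr n" "\<lambda>b x. G.np b x" R "U_perp_mat X g n" w u
    using L swapped_lt(2)[OF G_sub(2) uwI] lin_converse[OF lin_lt'[OF G_sub(2)]] by unfold_locales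
  have "lazy ?r' ?r ?I (G.Cr n) (\<lambda>b x. G.np b x) R (U_perp_mat X g n)"
    using P no by (intro S.lazy_unpaired) blast
  then have "lazy ?r' ?r' ?I (G.Cr n) (\<lambda>b x. G.np b x) R (U_perp_mat X g n)"
    by (rule lazy_cong(1))
      (use cols lin_converse[OF lin_lt'[OF G_sub(1)]] lin_converse[OF lin_lt'[OF G_sub(2)]] in auto)
  then show ?thesis using lazy_unique[OF L' _ xy(2)] xy(1) by blast
qed

lemma nested_pairs_mem:
  assumes "(s, Some t) \<in> nested_pairs g (BD X g) \<sigma> \<tau>"
    and "{\<sigma>, \<tau>} = {(a, Some b), (a', Some b')}"
  shows "G.matched_cells s t" "s \<in> Crit G.V" "t \<in> Crit G.V" "(s, Some t) \<notin> {\<sigma>, \<tau>}"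
    "g a < g s \<and> g t \<le> g b \<or> g a' < g s \<and> g t \<le> g b'"
proof -
  have *: "(s, Some t) \<in> BD X g" "g s \<noteq> g t" "(s, Some t) \<notin> {\<sigma>, \<tau>}"
    "ereal (g s) > birth_value g \<sigma> \<and> ereal (g t) \<le> death_value g \<sigma> \<or>
     ereal (g s) > birth_value g \<tau> \<and> ereal (g t) \<le> death_value g \<tau>"
    using assms(1) unfolding nested_pairs_def off_diagonal_def by (auto simp: birth_value_def death_value_def)
  then show m: "G.matched_cells s t" and "(s, Some t) \<notin> {\<sigma>, \<tau>}" using G.BD_Some by auto
  show sC: "s \<in> Crit G.V" using G.matched_not_Crit[OF m] *(2) unfolding G.vec_def by blast
  then show "t \<in> Crit G.V" using G.matched_Crit m by blast
  have "\<sigma> = (a, Some b) \<and> \<tau> = (a', Some b') \<or> \<sigma> = (a', Some b') \<and> \<tau> = (a, Some b)"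
    using assms(2) by (simp add: doubleton_eq_iff)
  then show "g a < g s \<and> g t \<le> g b \<or> g a' < g s \<and> g t \<le> g b'"
    using *(4) by (auto simp: birth_value_def death_value_def)
qed

lemma nested_pairs_memI:
  assumes "{\<sigma>, \<tau>} = {(a, Some b), (a', Some b')}"
    and "G.matched_cells s t" "s \<in> Crit G.V" "(s, Some t) \<notin> {\<sigma>, \<tau>}"
    and "g a < g s \<and> g t \<le> g b \<or> g a' < g s \<and> g t \<le> g b'"
  shows "(s, Some t) \<in> nested_pairs g (BD X g) \<sigma> \<tau>"
proof -
  have "g s \<noteq> g t"
    using G.Crit_value[OF assms(3) G.matched_dims(2)[OF assms(2)]] G.matched_dims(4)[OF assms(2)] by auto
  moreover have "\<sigma> = (a, Some b) \<and> \<tau> = (a', Some b') \<or> \<sigma> = (a', Some b') \<and> \<tau> = (a, Some b)"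
    using assms(1) by (simp add: doubleton_eq_iff)
  ultimately show ?thesis
    using assms(2,4,5) G.BD_Some unfolding nested_pairs_def off_diagonal_def
    by (auto simp: birth_value_def death_value_def)
qed

text \<open>The instance of \<open>switch\<close> in which \<open>v\<close> is the column of
  \<open>death \<sigma>\<close> in the partially cancelled complex. Since \<sigma> has the later
  death cell, the names \<sigma> and \<tau> merge the two possible orders of \<open>p\<close> and
  \<open>q\<close>.\<close>

lemma U_switch:
  assumes k: "cdim X u = k" "cdim X w = k" and m: "G.matched_cells u p" "G.matched_cells w q"
    and st: "{\<sigma>, \<tau>} = {(u, Some p), (w, Some q)}" and less: "g (death \<tau>) < g (death \<sigma>)"
    and C: "partially_cancelled X g (BD X g) \<sigma> \<tau> C"
    and xy: "x \<in> G.Cr (k + 1)" "y \<in> G.Cr (k + 1)"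
  shows "U_mat X g' (k + 1) x y =
    (if U_mat X g (k + 1) (death \<tau>) (death \<sigma>) = 1 \<or> inc C (birth \<tau>) (death \<sigma>) = 1
     then add_row (death \<tau>) (death \<sigma>) (U_mat X g (k + 1)) else U_mat X g (k + 1)) x y"
proof -
  let ?n = "k + 1" and ?s = "death \<sigma>"
  let ?N = "nested_pairs g (BD X g) \<sigma> \<tau>"
  obtain R where L: "lazy G.lt G.lt (G.CrR ?n) (G.Cr ?n) (\<lambda>a y. G.np y a) R (U_mat X g ?n)"
    and P: "\<forall>y\<in>G.Cr ?n. \<forall>a. pivot G.lt (G.CrR ?n) R y a \<longleftrightarrow> G.matched_cells a y"
    using G.critical_boundary by blast
  obtain R' where L1: "lazy H.lt H.lt (G.CrR ?n) (G.Cr ?n) (\<lambda>a y. G.np y a) R' (U_mat X g' ?n)"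
    and P': "\<forall>y\<in>G.Cr ?n. \<forall>a. pivot H.lt (G.CrR ?n) R' y a \<longleftrightarrow> H.matched_cells a y"
    using H.critical_boundary[of ?n] unfolding same_sets by blast
  have uwI: "u \<in> G.CrR ?n" "w \<in> G.CrR ?n" using uw k unfolding G.CrR_def by auto
  have cols: "g x < g y \<longleftrightarrow> g' x < g' y" if "x \<in> G.Cr ?n" "y \<in> G.Cr ?n" for x y
    using that k order_dim[of x y ?n] unfolding G.Cr_def by auto
  have L': "lazy H.lt G.lt (G.CrR ?n) (G.Cr ?n) (\<lambda>a y. G.np y a) R' (U_mat X g' ?n)"
    by (rule lazy_cong(1)[OF L1]) (use cols lin_lt'[OF G_sub(2)] G.lin_lt[OF G_sub(1)] in auto)
  interpret S: row_swap G.lt H.lt G.lt "G.CrR ?n" "G.Cr ?n" "\<lambda>a y. G.np y a" R "U_mat X g ?n" u w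
    using L swapped_lt(1)[OF G_sub(2) uwI] lin_lt'[OF G_sub(2)] by unfold_locales
  have pC: "p \<in> Crit G.V" "q \<in> Crit G.V" using G.matched_Crit m uw by blast+
  have pq: "p \<in> G.Cr ?n" "q \<in> G.Cr ?n" using pC G.matched_dims(4)[OF m(1)] G.matched_dims(4)[OF m(2)] k
    unfolding G.Cr_def by auto
  have piv: "pivot G.lt (G.CrR ?n) R p u" "pivot G.lt (G.CrR ?n) R q w" using P pq m by auto
  have same: "pivot G.lt (G.CrR ?n) R y a \<longleftrightarrow> pivot H.lt (G.CrR ?n) R' y a" if "y \<in> G.Cr ?n" for y a
    using P P' that matched_same by blast
  \<comment> \<open>The death cells of the nested pairs of dimension \<open>k\<close>, expressed by
    columns and pivots.\<close>
  let ?K = "{t \<in> G.Cr ?n - {p, q}. \<exists>s. pivot G.lt (G.CrR ?n) R t s \<and> (g u < g s \<and> g t < g p \<or> g w < g s \<and> g t < g q)}"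
  obtain T where T: "finite T" "\<forall>t\<in>T. \<exists>s. (s, Some t) \<in> ?N"
    "\<forall>x. inc C x ?s = inc (morse_complex X G.V) x ?s + (\<Sum>t\<in>T. inc (morse_complex X G.V) x t)"
    "\<forall>s t. (s, Some t) \<in> ?N \<longrightarrow> inc C s ?s = 0"
    using cancels_to_columns[OF C[unfolded partially_cancelled_def], of ?s] by blast
  \<comment> \<open>Cancelled death cells of other dimensions have no incidence with the rows
    considered, so they are dropped from the sum.\<close>
  let ?T = "{t \<in> T. cdim X t = ?n}"
  have cases: "\<sigma> = (w, Some q) \<and> \<tau> = (u, Some p) \<and> g p < g q \<or>
      \<sigma> = (u, Some p) \<and> \<tau> = (w, Some q) \<and> g q < g p"
    using st less by (auto simp: doubleton_eq_iff)
  have TK: "?T \<subseteq> ?K"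
  proof
    fix t assume t: "t \<in> ?T"
    then obtain s where s: "(s, Some t) \<in> ?N" using T(2) by blast
    note N = nested_pairs_mem[OF s st]
    have tC: "t \<in> G.Cr ?n" using N(3) t unfolding G.Cr_def by auto
    have ne: "t \<noteq> p" "t \<noteq> q"
      using G.matched_fun[OF N(1)] m N(4) cases by auto
    then have "g t \<noteq> g p" "g t \<noteq> g q"
      using G.Crit_value pC G.Crit_cells[OF N(3)] by metis+
    then show "t \<in> ?K" using N(5) tC ne P N(1) by (auto simp: order_less_le)
  qed
  have v: "inc C i ?s = G.np ?s i + (\<Sum>t\<in>?T. G.np t i)" if i: "i \<in> G.CrR ?n" for i
  proof -
    have im: "cdim X i = k" using i unfolding G.CrR_def by auto
    have "cdim X ?s = k + 1" using cases pq unfolding G.Cr_def by auto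
    then have "inc (morse_complex X G.V) i ?s = G.np ?s i" unfolding G.morse_inc im by simp
    moreover have "(\<Sum>t\<in>T. inc (morse_complex X G.V) i t) = (\<Sum>t\<in>?T. G.np t i)"
      unfolding G.morse_inc im using T(1) by (intro sum.mono_neutral_cong_right) auto
    ultimately show ?thesis using T(3) by simp
  qed
  have zero: "inc C b ?s = 0" if t: "t \<in> ?K" "pivot G.lt (G.CrR ?n) R t b" for t b
  proof -
    have b: "G.matched_cells b t" using P t by blast
    have bC: "b \<in> Crit G.V" using t(2) unfolding lead_def G.CrR_def by auto
    have "(b, Some t) \<notin> {\<sigma>, \<tau>}" using t(1) cases by auto
    moreover obtain s where s: "pivot G.lt (G.CrR ?n) R t s" "g u < g s \<and> g t < g p \<or> g w < g s \<and> g t < g q"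
      using t(1) by blast
    have "s = b" using lead_unique[OF S.li s(1) t(2)] .
    then have "g u < g b \<and> g t \<le> g p \<or> g w < g b \<and> g t \<le> g q" using s(2) by auto
    ultimately show ?thesis using T(4) nested_pairs_memI[OF st b bC] by blast
  qed
  have sel: "(birth \<tau>, death \<sigma>, death \<tau>) = (if g p < g q then (u, q, p) else (w, p, q))"
    using cases by auto
  show ?thesis
    by (rule S.switch[OF L' same pq(1) piv(1) pq(2) piv(2) refl TK sel v zero xy])
qed

text \<open>Reversing the orders makes \<open>w\<close> and \<open>u\<close> play the parts of the
  rows \<open>i\<close> and \<open>j\<close>, so \<open>q\<close> and \<open>p\<close> change places
  too, and the row of \<open>birth \<sigma>\<close> in the cancelled complex replaces the
  column.\<close>

lemma W_switch:
  assumes k: "cdim X u = k + 1" "cdim X w = k + 1" and m: "G.matched_cells p u" "G.matched_cells q w"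
    and st: "{\<sigma>, \<tau>} = {(p, Some u), (q, Some w)}" and less: "g (birth \<sigma>) < g (birth \<tau>)"
    and C: "partially_cancelled X g (BD X g) \<sigma> \<tau> C"
    and xy: "x \<in> G.Cr k" "y \<in> G.Cr k"
  shows "U_perp_mat X g' k x y =
    (if U_perp_mat X g k (birth \<tau>) (birth \<sigma>) = 1 \<or> inc C (birth \<sigma>) (death \<tau>) = 1
     then add_row (birth \<tau>) (birth \<sigma>) (U_perp_mat X g k) else U_perp_mat X g k) x y"
proof -
  let ?s = "birth \<sigma>" and ?N = "nested_pairs g (BD X g) \<sigma> \<tau>"
  let ?r = "conv G.lt" and ?r' = "conv H.lt" and ?I = "G.CrR (k + 2)"
  obtain R where L: "lazy ?r ?r ?I (G.Cr k) (\<lambda>b x. G.np b x) R (U_perp_mat X g k)"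
    and P: "\<forall>y\<in>G.Cr k. \<forall>a. pivot ?r ?I R y a \<longleftrightarrow> G.matched_cells y a"
    using G.critical_coboundary by blast
  obtain R' where L1: "lazy ?r' ?r' ?I (G.Cr k) (\<lambda>b x. G.np b x) R' (U_perp_mat X g' k)"
    and P': "\<forall>y\<in>G.Cr k. \<forall>a. pivot ?r' ?I R' y a \<longleftrightarrow> H.matched_cells y a"
    using H.critical_coboundary[of k] unfolding same_sets by blast
  have uwI: "u \<in> ?I" "w \<in> ?I" using uw k unfolding G.CrR_def by auto
  have cols: "g x < g y \<longleftrightarrow> g' x < g' y" if "x \<in> G.Cr k" "y \<in> G.Cr k" for x y
    using that k order_dim[of x y k] unfolding G.Cr_def by auto
  have L': "lazy ?r' ?r ?I (G.Cr k) (\<lambda>b x. G.np b x) R' (U_perp_mat X g' k)"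
    by (rule lazy_cong(1)[OF L1])
      (use cols lin_converse[OF lin_lt'[OF G_sub(2)]] lin_converse[OF G.lin_lt[OF G_sub(1)]] in auto)
  interpret S: row_swap ?r ?r' ?r ?I "G.Cr k" "\<lambda>b x. G.np b x" R "U_perp_mat X g k" w u
    using L swapped_lt(2)[OF G_sub(2) uwI] lin_converse[OF lin_lt'[OF G_sub(2)]] by unfold_locales
  have pC: "p \<in> Crit G.V" "q \<in> Crit G.V" using G.matched_Crit m uw by blast+
  have pq: "p \<in> G.Cr k" "q \<in> G.Cr k" using pC G.matched_dims(4)[OF m(1)] G.matched_dims(4)[OF m(2)] k
    unfolding G.Cr_def by auto
  have piv: "pivot ?r ?I R p u" "pivot ?r ?I R q w" using P pq m by auto
  have same: "pivot ?r ?I R y a \<longleftrightarrow> pivot ?r' ?I R' y a" if "y \<in> G.Cr k" for y a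
    using P P' that matched_same by blast
  let ?K = "{t \<in> G.Cr k - {q, p}. \<exists>s. pivot ?r ?I R t s \<and> (g s < g w \<and> g q < g t \<or> g s < g u \<and> g p < g t)}"
  obtain T where T: "finite T" "\<forall>s\<in>T. \<exists>t. (s, Some t) \<in> ?N"
    "\<forall>y. inc C ?s y = inc (morse_complex X G.V) ?s y + (\<Sum>s\<in>T. inc (morse_complex X G.V) s y)"
    "\<forall>s t. (s, Some t) \<in> ?N \<longrightarrow> inc C ?s t = 0"
    using cancels_to_rows[OF C[unfolded partially_cancelled_def], of ?s] by blast
  let ?T = "{t \<in> T. cdim X t = k}"
  have cases: "\<sigma> = (p, Some u) \<and> \<tau> = (q, Some w) \<and> g p < g q \<or>
      \<sigma> = (q, Some w) \<and> \<tau> = (p, Some u) \<and> g q < g p"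
    using st less by (auto simp: doubleton_eq_iff)
  have TK: "?T \<subseteq> ?K"
  proof
    fix s assume s: "s \<in> ?T"
    then obtain t where t: "(s, Some t) \<in> ?N" using T(2) by blast
    note N = nested_pairs_mem[OF t st]
    have sC: "s \<in> G.Cr k" using N(2) s unfolding G.Cr_def by auto
    have ne: "s \<noteq> p" "s \<noteq> q" "t \<noteq> u" "t \<noteq> w"
      using G.matched_inj[OF N(1)] G.matched_fun[OF N(1)] m N(4) cases by auto
    then have "g t \<noteq> g u" "g t \<noteq> g w"
      using G.Crit_value uw(1,2) G.Crit_cells[OF N(3)] by metis+
    then show "s \<in> ?K" using N(5) sC ne P N(1) by (auto simp: order_less_le)
  qed
  have v: "inc C ?s i = G.np i ?s + (\<Sum>t\<in>?T. G.np i t)" if i: "i \<in> ?I" for i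
  proof -
    have im: "cdim X i = k + 1" using i unfolding G.CrR_def by auto
    have "cdim X ?s = k" using cases pq unfolding G.Cr_def by auto
    then have "inc (morse_complex X G.V) ?s i = G.np i ?s" unfolding G.morse_inc im by simp
    moreover have "(\<Sum>t\<in>T. inc (morse_complex X G.V) t i) = (\<Sum>t\<in>?T. G.np i t)"
      unfolding G.morse_inc im using T(1) by (intro sum.mono_neutral_cong_right) auto
    ultimately show ?thesis using T(3) by simp
  qed
  have zero: "inc C ?s b = 0" if t: "t \<in> ?K" "pivot ?r ?I R t b" for t b
  proof -
    have b: "G.matched_cells t b" using P t by blast
    have tC: "t \<in> Crit G.V" using t(1) unfolding G.Cr_def by auto
    have "(t, Some b) \<notin> {\<sigma>, \<tau>}" using t(1) cases by auto
    moreover obtain s where s: "pivot ?r ?I R t s" "g s < g w \<and> g q < g t \<or> g s < g u \<and> g p < g t"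
      using t(1) by blast
    have "s = b" using lead_unique[OF S.li s(1) t(2)] .
    then have "g p < g t \<and> g b \<le> g u \<or> g q < g t \<and> g b \<le> g w" using s(2) by auto
    ultimately show ?thesis using T(4) nested_pairs_memI[OF st b tC] by blast
  qed
  have sel: "(death \<tau>, birth \<sigma>, birth \<tau>) = (if g p < g q then (w, p, q) else (u, q, p))"
    using cases by auto
  show ?thesis
    by (rule S.switch[OF L' same pq(2) piv(2) pq(1) piv(1) refl TK sel v zero xy])
qed

lemma U_mono:
  assumes k: "cdim X u = k" "cdim X w = k" and m: "G.matched_cells u p"
    and x: "x \<in> G.Cr (k + 1)" "U_mat X g' (k + 1) x p = 1"
  shows "U_mat X g (k + 1) x p = 1"
proof -
  let ?n = "k + 1"
  obtain R where L: "lazy G.lt G.lt (G.CrR ?n) (G.Cr ?n) (\<lambda>a y. G.np y a) R (U_mat X g ?n)"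
    and P: "\<forall>y\<in>G.Cr ?n. \<forall>a. pivot G.lt (G.CrR ?n) R y a \<longleftrightarrow> G.matched_cells a y"
    using G.critical_boundary by blast
  obtain R' where L1: "lazy H.lt H.lt (G.CrR ?n) (G.Cr ?n) (\<lambda>a y. G.np y a) R' (U_mat X g' ?n)"
    and P': "\<forall>y\<in>G.Cr ?n. \<forall>a. pivot H.lt (G.CrR ?n) R' y a \<longleftrightarrow> H.matched_cells a y"
    using H.critical_boundary[of ?n] unfolding same_sets by blast
  have uwI: "u \<in> G.CrR ?n" "w \<in> G.CrR ?n" using uw k unfolding G.CrR_def by auto
  have cols: "g x < g y \<longleftrightarrow> g' x < g' y" if "x \<in> G.Cr ?n" "y \<in> G.Cr ?n" for x y
    using that k order_dim[of x y ?n] unfolding G.Cr_def by auto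
  have L': "lazy H.lt G.lt (G.CrR ?n) (G.Cr ?n) (\<lambda>a y. G.np y a) R' (U_mat X g' ?n)"
    by (rule lazy_cong(1)[OF L1]) (use cols lin_lt'[OF G_sub(2)] G.lin_lt[OF G_sub(1)] in auto)
  interpret S: row_swap G.lt H.lt G.lt "G.CrR ?n" "G.Cr ?n" "\<lambda>a y. G.np y a" R "U_mat X g ?n" u w
    using L swapped_lt(1)[OF G_sub(2) uwI] lin_lt'[OF G_sub(2)] by unfold_locales
  have same: "pivot G.lt (G.CrR ?n) R y a \<longleftrightarrow> pivot H.lt (G.CrR ?n) R' y a" if "y \<in> G.Cr ?n" for y a
    using P P' that matched_same by blast
  have col: "y \<in> G.Cr ?n \<and> pivot G.lt (G.CrR ?n) R y a" if "G.matched_cells a y" "a \<in> Crit G.V" "cdim X a = k" for a y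
    using that P G.matched_Crit[OF that(1)] G.matched_dims(4)[OF that(1)] unfolding G.Cr_def by auto
  show ?thesis
  proof (cases "\<exists>q. G.matched_cells w q")
    case True
    then obtain q where q: "G.matched_cells w q" by blast
    from S.switch_mono[OF L' same] col[OF m uw(1) k(1)] col[OF q uw(2) k(2)] x show ?thesis by blast
  next
    case False
    have "U_mat X g' ?n x p = U_mat X g ?n x p"
      using U_unpaired[of ?n x p] k False x(1) col[OF m uw(1) k(1)] by auto
    then show ?thesis using x by simp
  qed
qed

lemma W_mono:
  assumes k: "cdim X u = k + 1" "cdim X w = k + 1" and m: "G.matched_cells q w"
    and x: "x \<in> G.Cr k" "U_perp_mat X g' k x q = 1"
  shows "U_perp_mat X g k x q = 1"
proof -
  let ?r = "conv G.lt" and ?r' = "conv H.lt" and ?I = "G.CrR (k + 2)"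
  obtain R where L: "lazy ?r ?r ?I (G.Cr k) (\<lambda>b x. G.np b x) R (U_perp_mat X g k)"
    and P: "\<forall>y\<in>G.Cr k. \<forall>a. pivot ?r ?I R y a \<longleftrightarrow> G.matched_cells y a"
    using G.critical_coboundary by blast
  obtain R' where L1: "lazy ?r' ?r' ?I (G.Cr k) (\<lambda>b x. G.np b x) R' (U_perp_mat X g' k)"
    and P': "\<forall>y\<in>G.Cr k. \<forall>a. pivot ?r' ?I R' y a \<longleftrightarrow> H.matched_cells y a"
    using H.critical_coboundary[of k] unfolding same_sets by blast
  have uwI: "u \<in> ?I" "w \<in> ?I" using uw k unfolding G.CrR_def by auto
  have cols: "g x < g y \<longleftrightarrow> g' x < g' y" if "x \<in> G.Cr k" "y \<in> G.Cr k" for x y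
    using that k order_dim[of x y k] unfolding G.Cr_def by auto
  have L': "lazy ?r' ?r ?I (G.Cr k) (\<lambda>b x. G.np b x) R' (U_perp_mat X g' k)"
    by (rule lazy_cong(1)[OF L1])
      (use cols lin_converse[OF lin_lt'[OF G_sub(2)]] lin_converse[OF G.lin_lt[OF G_sub(1)]] in auto)
  interpret S: row_swap ?r ?r' ?r ?I "G.Cr k" "\<lambda>b x. G.np b x" R "U_perp_mat X g k" w u
    using L swapped_lt(2)[OF G_sub(2) uwI] lin_converse[OF lin_lt'[OF G_sub(2)]] by unfold_locales
  have same: "pivot ?r ?I R y a \<longleftrightarrow> pivot ?r' ?I R' y a" if "y \<in> G.Cr k" for y a
    using P P' that matched_same by blast
  have col: "y \<in> G.Cr k \<and> pivot ?r ?I R y a" if "G.matched_cells y a" "a \<in> Crit G.V" "cdim X a = k + 1" for a y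
    using that P G.matched_Crit[OF that(1)] G.matched_dims(4)[OF that(1)] unfolding G.Cr_def by auto
  show ?thesis
  proof (cases "\<exists>p. G.matched_cells p u")
    case True
    then obtain p where p: "G.matched_cells p u" by blast
    from S.switch_mono[OF L' same] col[OF m uw(2) k(2)] col[OF p uw(1) k(1)] x show ?thesis by blast
  next
    case False
    have "U_perp_mat X g' k x q = U_perp_mat X g k x q"
      using W_unpaired[of k x q] k False x(1) col[OF m uw(2) k(2)] by auto
    then show ?thesis using x by simp
  qed
qed

end

section \<open>Moves\<close>

lemma dMf_dual: "dMf (dual X) (\<lambda>x. - g x) \<longleftrightarrow> dMf X g"
proof -
  have "{x \<in> cells X. - g x = a} = {x \<in> cells X. g x = - a}" for a by auto
  then have "(\<forall>a. card {x \<in> cells X. - g x = a} \<le> 2) \<longleftrightarrow> (\<forall>a. card {x \<in> cells X. g x = a} \<le> 2)"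
    by simp (metis minus_minus)
  then show ?thesis
    unfolding dMf_def dual_simps neg_equal_iff_equal neg_le_iff_le by blast
qed

text \<open>A move acts on its interval as the affine contraction that fixes \<open>\<xi>\<close>
  and sends \<open>a\<close> to \<open>\<delta>\<close>; in this form monotonicity and injectivity
  are evident.\<close>

lemma lin_coeff_affine:
  assumes "a < \<xi>"
  shows "lin_coeff a \<xi> v * \<delta> + (1 - lin_coeff a \<xi> v) * \<xi> = \<xi> - (\<xi> - \<delta>) / (\<xi> - a) * (\<xi> - v)"
proof -
  have "lin_coeff a \<xi> v * \<delta> + (1 - lin_coeff a \<xi> v) * \<xi> = \<xi> - lin_coeff a \<xi> v * (\<xi> - \<delta>)"
    by (simp add: algebra_simps)
  then show ?thesis unfolding lin_coeff_def by (simp add: mult.commute)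
qed

context filtered
begin

text \<open>Apart from monotonicity along facets, being a discrete Morse function is a property of
  the fibres alone.\<close>

lemma same_fibres:
  assumes le: "\<And>x y. facet X x y \<Longrightarrow> g' x \<le> g' y"
    and eq: "\<And>x y. x \<in> cells X \<Longrightarrow> y \<in> cells X \<Longrightarrow> g' x = g' y \<longleftrightarrow> g x = g y"
  shows "dMf X g'" "fibre_field X g' = V"
proof -
  have fib: "{y \<in> cells X. g' y = g' x} = {y \<in> cells X. g y = g x}" if "x \<in> cells X" for x
    using eq that by auto
  show "fibre_field X g' = V" unfolding fibre_field_def using fib by (intro image_cong) auto
  show "dMf X g'"
    unfolding dMf_def
  proof (intro conjI ballI impI allI)
    fix x y assume "x \<in> cells X" "y \<in> cells X" "inc X x y = 1"
    then show "g' x \<le> g' y" using le inc_eq_1 by blast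
  next
    fix x y assume "x \<in> cells X" "y \<in> cells X" "x \<noteq> y \<and> g' x = g' y"
    then show "inc X x y = 1 \<or> inc X y x = 1" using eq g unfolding dMf_def by blast
  next
    fix a
    show "card {x \<in> cells X. g' x = a} \<le> 2"
    proof (cases "\<exists>x\<in>cells X. g' x = a")
      case True
      then obtain x where "x \<in> cells X" "g' x = a" by blast
      then show ?thesis using fib[of x] g unfolding dMf_def by auto
    next
      case False
      then have e: "{x \<in> cells X. g' x = a} = {}" by blast
      show ?thesis unfolding e by simp
    qed
  qed
qed

text \<open>The moved cells are closed under partners in vectors, by \<open>vec_reaches\<close>, and
  under cofacets of value at most \<open>\<xi>\<close>. They land in the interval from
  \<open>\<delta>\<close> to \<open>\<xi>\<close>, which was empty, and their values do not
  decrease. So no inequality along a facet is violated and no new coincidence of values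
  arises.\<close>

lemma right_move_geometry:
  assumes rm: "right_move X (b, Some d) \<delta> \<xi> g g'" and bC: "b \<in> Crit V" and dC: "d \<in> Crit V"
  defines "moved \<equiv> \<lambda>x. g b \<le> g x \<and> g x \<le> \<xi> \<and> reaches X V x b \<and> (x \<notin> Crit V \<or> x = b)"
  shows "dMf X g'" "fibre_field X g' = V" "g' b = \<delta>" "\<And>x. x \<in> Crit V \<Longrightarrow> x \<noteq> b \<Longrightarrow> g' x = g x"
    "g b < \<delta>" "\<delta> < \<xi>" "\<xi> < g d" "\<And>x. x \<in> cells X \<Longrightarrow> g x < \<delta> \<or> \<xi> < g x"
    "\<And>x. x \<in> cells X \<Longrightarrow> moved x \<Longrightarrow> \<delta> \<le> g' x \<and> g' x \<le> \<xi>"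
    "\<And>x. x \<in> cells X \<Longrightarrow> \<not> moved x \<Longrightarrow> g' x = g x"
proof -
  define \<phi> where "\<phi> v = \<xi> - (\<xi> - \<delta>) / (\<xi> - g b) * (\<xi> - v)" for v
  have b: "b \<in> cells X" using bC Crit_cells by blast
  show ord: "g b < \<delta>" "\<delta> < \<xi>" "\<xi> < g d" using rm unfolding right_move_def Let_def by auto
  show gap: "g x < \<delta> \<or> \<xi> < g x" if "x \<in> cells X" for x
    using rm that unfolding right_move_def Let_def by force
  have byp: "\<not> reaches X V e b" if "e \<in> Crit V" "g b < g e" "g e < \<delta>" for e
    using rm that unfolding right_move_def Let_def right_bypassed_def by auto
  have moved_alt: "(g b \<le> g x \<and> g x \<le> \<xi> \<and> (reaches X V x b \<or> x = b) \<and> x \<notin> Crit V - {b}) \<longleftrightarrow> moved x" for x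
    unfolding moved_def using reaches_refl[OF b] by auto
  have g': "g' x = (if moved x then \<phi> (g x) else g x)" if "x \<in> cells X" for x
    using rm that moved_alt[of x] ord lin_coeff_affine[of "g b" \<xi> "g x" \<delta>]
    unfolding right_move_def Let_def \<phi>_def by auto
  define c where "c = (\<xi> - \<delta>) / (\<xi> - g b)"
  have c: "0 < c" "c < 1" unfolding c_def using ord by auto
  have \<phi>: "\<phi> v = \<xi> - c * (\<xi> - v)" for v unfolding \<phi>_def c_def ..
  have \<phi>_b: "\<phi> (g b) = \<delta>" unfolding \<phi>_def using ord by simp
  have \<phi>_mono: "\<phi> v \<le> \<phi> w \<longleftrightarrow> v \<le> w" for v w unfolding \<phi> using c(1) by simp
  have \<phi>_inj: "\<phi> v = \<phi> w \<longleftrightarrow> v = w" for v w unfolding \<phi> using c(1) by simp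
  have \<phi>_xi: "\<phi> \<xi> = \<xi>" unfolding \<phi> by simp
  have \<phi>_ge: "v \<le> \<phi> v" if "v \<le> \<xi>" for v
  proof -
    have "c * (\<xi> - v) \<le> 1 * (\<xi> - v)" using c that by (intro mult_right_mono) auto
    then show ?thesis unfolding \<phi> by simp
  qed
  have \<phi>_range: "\<delta> \<le> \<phi> v \<and> \<phi> v \<le> \<xi>" if "g b \<le> v" "v \<le> \<xi>" for v
    using \<phi>_mono[of "g b" v] \<phi>_mono[of v \<xi>] \<phi>_b \<phi>_xi that by simp
  show "g' b = \<delta>" using g'[OF b] \<phi>_b reaches_refl[OF b] ord unfolding moved_def by auto
  show "g' x = g x" if "x \<in> Crit V" "x \<noteq> b" for x
    using g'[OF Crit_cells[OF that(1)]] that unfolding moved_def by auto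
  show "\<delta> \<le> g' x \<and> g' x \<le> \<xi>" if "x \<in> cells X" "moved x" for x
    using g'[OF that(1)] \<phi>_range[of "g x"] that(2) unfolding moved_def by auto
  show "g' x = g x" if "x \<in> cells X" "\<not> moved x" for x
    using g'[OF that(1)] that(2) by auto
  \<comment> \<open>Any other critical cell of value at most \<open>\<xi>\<close> that reaches
    \<open>b\<close> would lie below \<open>\<delta>\<close> and be bypassed, which the move
    forbids.\<close>
  have crit_moved: "x \<notin> Crit V \<or> x = b" if "x \<in> cells X" "g b \<le> g x" "g x \<le> \<xi>" "reaches X V x b" for x
  proof (rule ccontr)
    assume "\<not> ?thesis"
    then have x: "x \<in> Crit V" "x \<noteq> b" by auto
    then have "g b < g x" using Crit_value[OF bC that(1)] that(2) by force
    then show False using byp[OF x(1)] gap[OF that(1)] that by auto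
  qed
  have reach_mate: "reaches X V x b \<longleftrightarrow> reaches X V y b" if "vec x y" for x y
    using vec_reaches[OF that _ bC] reaches_step[of x y b] that unfolding arc_iff by blast
  have same_value_moved: "moved x \<longleftrightarrow> moved y" if "x \<in> cells X" "y \<in> cells X" "g x = g y" for x y
  proof (cases "x = y")
    case False
    then have "vec x y \<or> vec y x" using same_value that by blast
    then have "(reaches X V x b \<longleftrightarrow> reaches X V y b) \<and> x \<notin> Crit V \<and> y \<notin> Crit V"
      using reach_mate vec_not_Crit by blast
    then show ?thesis using that(3) unfolding moved_def by auto
  qed simp
  show "dMf X g'" "fibre_field X g' = V"
  proof -
    have le: "g' x \<le> g' y" if f: "facet X x y" for x y
    proof -
      have xy: "x \<in> cells X" "y \<in> cells X" "g x \<le> g y" using f facet_cells facet_le by auto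
      show ?thesis
      proof (cases "moved x")
        case mx: True
        show ?thesis
        proof (cases "moved y")
          case True
          then show ?thesis using mx g' xy \<phi>_mono by simp
        next
          case False
          \<comment> \<open>A cofacet of a moved cell reaches \<open>b\<close> as well, so it is
            moved too unless its value exceeds \<open>\<xi>\<close>.\<close>
          have "\<xi> < g y"
          proof (rule ccontr)
            assume "\<not> \<xi> < g y"
            then have v: "g b \<le> g y" "g y \<le> \<xi>" using mx xy(3) unfolding moved_def by auto
            have "reaches X V y b"
            proof (cases "g x = g y")
              case True
              then have "vec x y" using f unfolding vec_def by blast
              then show ?thesis using reach_mate mx unfolding moved_def by blast
            next
              case False
              then have "arc X V y x" using f xy(3) unfolding arc_iff by auto
              then show ?thesis using reaches_step mx unfolding moved_def by blast
            qed
            then show False using False crit_moved[OF xy(2) v] v unfolding moved_def by blast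
          qed
          moreover have "\<delta> \<le> \<phi> (g x) \<and> \<phi> (g x) \<le> \<xi>"
            using \<phi>_range[of "g x"] mx unfolding moved_def by blast
          moreover have "g' x = \<phi> (g x)" "g' y = g y" using g' xy(1,2) mx False by auto
          ultimately show ?thesis by linarith
        qed
      next
        case False
        moreover have "g y \<le> g' y"
        proof (cases "moved y")
          case True
          then have "g y \<le> \<xi>" unfolding moved_def by blast
          then show ?thesis using \<phi>_ge g'[OF xy(2)] True by simp
        qed (use g'[OF xy(2)] in simp)
        ultimately show ?thesis using xy(3) g'[OF xy(1)] by simp
      qed
    qed
    have eq: "g' x = g' y \<longleftrightarrow> g x = g y" if xy: "x \<in> cells X" "y \<in> cells X" for x y
    proof -
      have out: "g' u \<noteq> g' v" if "u \<in> cells X" "v \<in> cells X" "moved u" "\<not> moved v" for u v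
      proof -
        have "g' u = \<phi> (g u)" "g' v = g v" using g' that by auto
        moreover have "\<delta> \<le> \<phi> (g u) \<and> \<phi> (g u) \<le> \<xi>"
          using \<phi>_range[of "g u"] that(3) unfolding moved_def by blast
        ultimately show ?thesis using gap[OF that(2)] by auto
      qed
      show ?thesis
      proof (cases "moved x \<longleftrightarrow> moved y")
        case True
        then show ?thesis using g'[OF xy(1)] g'[OF xy(2)] \<phi>_inj by auto
      next
        case False
        then show ?thesis using out[OF xy] out[OF xy(2,1)] same_value_moved[OF xy] by metis
      qed
    qed
    show "dMf X g'" by (rule same_fibres(1)) (use le eq in blast)+
    show "fibre_field X g' = V" by (rule same_fibres(2)) (use le eq in blast)+
  qed
qed

text \<open>Among the critical cells only \<open>b\<close> changes its value, and it jumps only over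
  those with values between its old value and \<open>\<delta>\<close>.\<close>

lemma right_move_order:
  assumes rm: "right_move X (b, Some d) \<delta> \<xi> g g'" and bC: "b \<in> Crit V" and dC: "d \<in> Crit V"
    and xy: "x \<in> Crit V" "y \<in> Crit V" and nb: "x = b \<Longrightarrow> \<not> (g b < g y \<and> g y < \<delta>)"
    "y = b \<Longrightarrow> \<not> (g b < g x \<and> g x < \<delta>)"
  shows "g x < g y \<longleftrightarrow> g' x < g' y"
proof -
  note geo = right_move_geometry[OF rm bC dC]
  have A: "g b < g z \<longleftrightarrow> g' b < g' z" "g z < g b \<longleftrightarrow> g' z < g' b"
    if "z \<in> Crit V" "\<not> (g b < g z \<and> g z < \<delta>)" for z
  proof -
    show "g b < g z \<longleftrightarrow> g' b < g' z"
      using geo(3,5,6) geo(4)[OF that(1)] geo(8)[OF Crit_cells[OF that(1)]] that(2)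
      by (cases "z = b") force+
    show "g z < g b \<longleftrightarrow> g' z < g' b"
      using geo(3,5) geo(4)[OF that(1)] that(2) Crit_value[OF bC Crit_cells[OF that(1)]]
      by (cases "z = b") force+
  qed
  show ?thesis
  proof (cases "x = b")
    case True
    then show ?thesis using A(1)[OF xy(2) nb(1)] by simp
  next
    case False
    then show ?thesis using A(2)[OF xy(1) nb(2)] geo(4) xy by (cases "y = b") auto
  qed
qed

text \<open>Negation exchanges the ends of the interval, so the linear coefficient \<open>t\<close>
  becomes \<open>1 - t\<close>. The geometry of down moves is thereby inherited from right moves on
  the dual.\<close>

lemma down_right_move:
  assumes "down_move X (b, Some d) \<delta> \<xi> g g'"
  shows "right_move (dual X) (d, Some b) (- \<delta>) (- \<xi>) (\<lambda>x. - g x) (\<lambda>x. - g' x)"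
proof -
  have ord: "g b < \<xi>" "\<xi> < \<delta>" "\<delta> < g d" using assms unfolding down_move_def Let_def by auto
  have t: "lin_coeff (- g d) (- \<xi>) (- v) = 1 - lin_coeff \<xi> (g d) v" for v
    unfolding lin_coeff_def using ord by (simp add: field_simps)
  have "right_bypassed (dual X) (d, Some b) (- \<delta>) (\<lambda>x. - g x) = down_bypassed X (b, Some d) \<delta> g"
    unfolding right_bypassed_def down_bypassed_def by auto
  moreover have "{x \<in> cells X. - \<delta> \<le> - g x \<and> - g x \<le> - \<xi>} = {x \<in> cells X. \<xi> \<le> g x \<and> g x \<le> \<delta>}"
    by auto
  moreover have "(\<lambda>x. - g' x) = (\<lambda>x. if x \<in> cells X \<and> - g d \<le> - g x \<and> - g x \<le> - \<xi> \<and>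
      (reaches X V d x \<or> x = d) \<and> x \<notin> Crit V - {d}
      then let t = lin_coeff (- g d) (- \<xi>) (- g x) in t * (- \<delta>) + (1 - t) * (- \<xi>) else - g x)"
    using assms unfolding down_move_def Let_def t by (auto simp: fun_eq_iff algebra_simps)
  ultimately show ?thesis
    using assms ord unfolding right_move_def down_move_def Let_def fst_conv snd_conv option.sel by simp
qed

lemma down_move_geometry:
  assumes dm: "down_move X (b, Some d) \<delta> \<xi> g g'" and bC: "b \<in> Crit V" and dC: "d \<in> Crit V"
  defines "moved \<equiv> \<lambda>x. \<xi> \<le> g x \<and> g x \<le> g d \<and> reaches X V d x \<and> (x \<notin> Crit V \<or> x = d)"
  shows "dMf X g'" "fibre_field X g' = V" "g' d = \<delta>" "\<And>x. x \<in> Crit V \<Longrightarrow> x \<noteq> d \<Longrightarrow> g' x = g x"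
    "\<delta> < g d" "\<xi> < \<delta>" "g b < \<xi>" "\<And>x. x \<in> cells X \<Longrightarrow> g x < \<xi> \<or> \<delta> < g x"
    "\<And>x. x \<in> cells X \<Longrightarrow> moved x \<Longrightarrow> \<xi> \<le> g' x \<and> g' x \<le> \<delta>"
    "\<And>x. x \<in> cells X \<Longrightarrow> \<not> moved x \<Longrightarrow> g' x = g x"
proof -
  interpret D: filtered "dual X" "\<lambda>x. - g x" by (rule dual_filtered)
  note geo = D.right_move_geometry[OF down_right_move[OF dm], unfolded fibre_field_dual, OF dC bC]
  show "dMf X g'" using geo(1) unfolding dMf_dual .
  show "fibre_field X g' = V" using geo(2) fibre_field_dual[of X g'] by simp
  show "g' d = \<delta>" "\<delta> < g d" "\<xi> < \<delta>" "g b < \<xi>" using geo(3,5,6,7) by auto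
  show "g' x = g x" if "x \<in> Crit V" "x \<noteq> d" for x using geo(4)[OF that] by simp
  show "g x < \<xi> \<or> \<delta> < g x" if "x \<in> cells X" for x using geo(8)[of x] that by auto
  show "\<xi> \<le> g' x \<and> g' x \<le> \<delta>" if "x \<in> cells X" "moved x" for x
    using geo(9)[of x] that unfolding moved_def by auto
  show "g' x = g x" if "x \<in> cells X" "\<not> moved x" for x
    using geo(10)[of x] that unfolding moved_def by auto
qed

lemma down_move_order:
  assumes dm: "down_move X (b, Some d) \<delta> \<xi> g g'" and bC: "b \<in> Crit V" and dC: "d \<in> Crit V"
    and xy: "x \<in> Crit V" "y \<in> Crit V" and nd: "x = d \<Longrightarrow> \<not> (\<delta> < g y \<and> g y < g d)"
    "y = d \<Longrightarrow> \<not> (\<delta> < g x \<and> g x < g d)"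
  shows "g x < g y \<longleftrightarrow> g' x < g' y"
proof -
  interpret D: filtered "dual X" "\<lambda>x. - g x" by (rule dual_filtered)
  have "- g y < - g x \<longleftrightarrow> - g' y < - g' x"
    by (rule D.right_move_order[OF down_right_move[OF dm], unfolded fibre_field_dual, OF dC bC xy(2,1)])
      (use nd in auto)
  then show ?thesis by simp
qed

section \<open>Effect of the moves on pairs and relations\<close>

text \<open>A column that is added to another one has a pivot, and thus belongs to a death
  cell.\<close>

lemma U_zero_not_death:
  assumes "x \<in> Crit V" "y \<in> Crit V" "cdim X x = cdim X y" "x \<noteq> y" "\<And>z. \<not> matched_cells z x"
  shows "U_mat X g (cdim X x) x y = 0"
proof (rule ccontr)
  assume "U_mat X g (cdim X x) x y \<noteq> 0"
  moreover obtain R where L: "lazy lt lt (CrR (cdim X x)) (Cr (cdim X x)) (\<lambda>a y. np y a) R (U_mat X g (cdim X x))"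
    and P: "\<forall>y\<in>Cr (cdim X x). \<forall>a. pivot lt (CrR (cdim X x)) R y a \<longleftrightarrow> matched_cells a y"
    using critical_boundary by blast
  moreover have "x \<in> Cr (cdim X x)" "y \<in> Cr (cdim X x)" using assms unfolding Cr_def by auto
  ultimately show False using lazy_pivot[OF L, of x y] assms(4,5) by auto
qed

lemma W_zero_not_birth:
  assumes "x \<in> Crit V" "y \<in> Crit V" "cdim X x = cdim X y" "x \<noteq> y" "\<And>z. \<not> matched_cells x z"
  shows "U_perp_mat X g (cdim X x) x y = 0"
proof (rule ccontr)
  assume "U_perp_mat X g (cdim X x) x y \<noteq> 0"
  moreover obtain R where L: "lazy (conv lt) (conv lt) (CrR (cdim X x + 2)) (Cr (cdim X x)) (\<lambda>b x. np b x) R (U_perp_mat X g (cdim X x))"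
    and P: "\<forall>y\<in>Cr (cdim X x). \<forall>a. pivot (conv lt) (CrR (cdim X x + 2)) R y a \<longleftrightarrow> matched_cells y a"
    using critical_coboundary by blast
  moreover have "x \<in> Cr (cdim X x)" "y \<in> Cr (cdim X x)" using assms unfolding Cr_def by auto
  ultimately show False using lazy_pivot[OF L, of x y] assms(4,5) by auto
qed

lemma U_one:
  assumes "x \<in> Crit V" "y \<in> Crit V" "cdim X x = cdim X y" "x \<noteq> y" "U_mat X g (cdim X x) x y = 1"
  shows "g x < g y" and "matched_cells a' y \<Longrightarrow> \<exists>a. matched_cells a x \<and> g a' < g a"
proof -
  obtain R where L: "lazy lt lt (CrR (cdim X x)) (Cr (cdim X x)) (\<lambda>a y. np y a) R (U_mat X g (cdim X x))"
    and P: "\<forall>y\<in>Cr (cdim X x). \<forall>a. pivot lt (CrR (cdim X x)) R y a \<longleftrightarrow> matched_cells a y"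
    using critical_boundary by blast
  have xy: "x \<in> Cr (cdim X x)" "y \<in> Cr (cdim X x)" using assms unfolding Cr_def by auto
  show "g x < g y" using lazy_upper[OF L xy assms(5,4)] .
  show "matched_cells a' y \<Longrightarrow> \<exists>a. matched_cells a x \<and> g a' < g a"
    using lazy_pivot[OF L xy assms(5,4)] P xy by blast
qed

lemma W_one:
  assumes "x \<in> Crit V" "y \<in> Crit V" "cdim X x = cdim X y" "x \<noteq> y" "U_perp_mat X g (cdim X x) x y = 1"
  shows "g y < g x" and "matched_cells y a' \<Longrightarrow> \<exists>a. matched_cells x a \<and> g a < g a'"
proof -
  obtain R where L: "lazy (conv lt) (conv lt) (CrR (cdim X x + 2)) (Cr (cdim X x)) (\<lambda>b x. np b x) R (U_perp_mat X g (cdim X x))"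
    and P: "\<forall>y\<in>Cr (cdim X x). \<forall>a. pivot (conv lt) (CrR (cdim X x + 2)) R y a \<longleftrightarrow> matched_cells y a"
    using critical_coboundary by blast
  have xy: "x \<in> Cr (cdim X x)" "y \<in> Cr (cdim X x)" using assms unfolding Cr_def by auto
  show "g y < g x" using lazy_upper[OF L xy assms(5,4)] .
  show "matched_cells y a' \<Longrightarrow> \<exists>a. matched_cells x a \<and> g a < g a'"
    using lazy_pivot[OF L xy assms(5,4)] P xy by blast
qed

text \<open>The set of nested pairs satisfies the closure condition of
  \<open>cancels_to_exists\<close>, except that \<sigma> or \<tau> itself could be nested inside one
  of its members; \<open>cl\<close> excludes this.\<close>

lemma nested_cancellable:
  assumes st: "{\<sigma>, \<tau>} = {(a, Some b), (a', Some b')}"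
    and cl: "\<And>s t s' t'. matched_cells s t \<Longrightarrow> matched_cells s' t' \<Longrightarrow> s \<in> Crit V \<Longrightarrow> s' \<in> Crit V \<Longrightarrow>
      t \<in> Crit V \<Longrightarrow> (s, Some t) \<notin> {\<sigma>, \<tau>} \<Longrightarrow> (s', Some t') \<in> {\<sigma>, \<tau>} \<Longrightarrow> cdim X s' = cdim X s \<Longrightarrow> g s < g s' \<Longrightarrow> g t' < g t \<Longrightarrow>
      g a < g s \<and> g t \<le> g b \<or> g a' < g s \<and> g t \<le> g b' \<Longrightarrow> False"
  shows "\<exists>C. partially_cancelled X g (BD X g) \<sigma> \<tau> C"
proof -
  let ?N = "nested_pairs g (BD X g) \<sigma> \<tau>"
  have st': "\<sigma> = (a, Some b) \<and> \<tau> = (a', Some b') \<or> \<sigma> = (a', Some b') \<and> \<tau> = (a, Some b)"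
    using st by (simp add: doubleton_eq_iff)
  have mem: "\<beta> \<in> ?N \<longleftrightarrow> (\<exists>s t. \<beta> = (s, Some t) \<and> matched_cells s t \<and> s \<in> Crit V \<and> \<beta> \<notin> {\<sigma>, \<tau>} \<and>
      (g a < g s \<and> g t \<le> g b \<or> g a' < g s \<and> g t \<le> g b'))" for \<beta>
  proof
    assume \<beta>: "\<beta> \<in> ?N"
    have "death_value g \<beta> \<le> death_value g \<sigma> \<or> death_value g \<beta> \<le> death_value g \<tau>"
      using \<beta> unfolding nested_pairs_def by auto
    then have "snd \<beta> \<noteq> None" using st' by (cases "snd \<beta>") (auto simp: death_value_def)
    then obtain s t where \<beta>': "\<beta> = (s, Some t)" by (cases \<beta>) auto
    then have *: "(s, Some t) \<in> BD X g" "g s \<noteq> g t" "\<beta> \<notin> {\<sigma>, \<tau>}"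
      "g a < g s \<and> g t \<le> g b \<or> g a' < g s \<and> g t \<le> g b'"
      using \<beta> st' unfolding nested_pairs_def off_diagonal_def
      by (auto simp: birth_value_def death_value_def)
    then have m: "matched_cells s t" using BD_Some by blast
    then have "s \<in> Crit V" using matched_not_Crit[OF m] *(2) unfolding vec_def by blast
    then show "\<exists>s t. \<beta> = (s, Some t) \<and> matched_cells s t \<and> s \<in> Crit V \<and> \<beta> \<notin> {\<sigma>, \<tau>} \<and>
      (g a < g s \<and> g t \<le> g b \<or> g a' < g s \<and> g t \<le> g b')" using \<beta>' m * by blast
  next
    assume "\<exists>s t. \<beta> = (s, Some t) \<and> matched_cells s t \<and> s \<in> Crit V \<and> \<beta> \<notin> {\<sigma>, \<tau>} \<and>
      (g a < g s \<and> g t \<le> g b \<or> g a' < g s \<and> g t \<le> g b')"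
    then obtain s t where \<beta>: "\<beta> = (s, Some t)" "matched_cells s t" "s \<in> Crit V" "\<beta> \<notin> {\<sigma>, \<tau>}"
      "g a < g s \<and> g t \<le> g b \<or> g a' < g s \<and> g t \<le> g b'" by blast
    have "g s \<noteq> g t"
      using Crit_value[OF \<beta>(3) matched_dims(2)[OF \<beta>(2)]] matched_dims(4)[OF \<beta>(2)] by auto
    then show "\<beta> \<in> ?N" using \<beta> st' BD_Some unfolding nested_pairs_def off_diagonal_def
      by (auto simp: birth_value_def death_value_def)
  qed
  have "?N \<subseteq> (\<lambda>(s, t). (s, Some t)) ` (cells X \<times> cells X)"
    using mem matched_dims by fastforce
  then have "finite ?N" using finite_cells finite_subset by blast
  moreover have "\<exists>s t. \<beta> = (s, Some t) \<and> matched_cells s t \<and> s \<in> Crit V" if "\<beta> \<in> ?N" for \<beta>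
    using that mem by blast
  moreover have "(s', Some t') \<in> ?N"
    if *: "(s, Some t) \<in> ?N" "matched_cells s' t'" "s' \<in> Crit V" "cdim X s' = cdim X s" "g s < g s'" "g t' < g t" for s t s' t'
  proof -
    have N: "matched_cells s t" "s \<in> Crit V" "(s, Some t) \<notin> {\<sigma>, \<tau>}"
      "g a < g s \<and> g t \<le> g b \<or> g a' < g s \<and> g t \<le> g b'" using *(1) mem by blast+
    then have "t \<in> Crit V" using matched_Crit by blast
    then have "(s', Some t') \<notin> {\<sigma>, \<tau>}" using cl[OF N(1) *(2) N(2) *(3) _ N(3) _ *(4,5,6) N(4)] by blast
    moreover have "g a < g s' \<and> g t' \<le> g b \<or> g a' < g s' \<and> g t' \<le> g b'" using N(4) *(5,6) by auto
    ultimately show ?thesis using mem *(2,3) by blast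
  qed
  ultimately show ?thesis using cancels_to_exists[of ?N] unfolding partially_cancelled_def by blast
qed

end

context filtered
begin

definition agree :: "(nat \<Rightarrow> 'a mat) \<Rightarrow> (nat \<Rightarrow> 'a mat) \<Rightarrow> bool" where
  "agree A B \<longleftrightarrow> (\<forall>x\<in>Crit V. \<forall>y\<in>Crit V. cdim X x = cdim X y \<longrightarrow> A (cdim X x) x y = B (cdim X x) x y)"

lemma agreeI:
  assumes "\<And>n x y. x \<in> Cr n \<Longrightarrow> y \<in> Cr n \<Longrightarrow> A n x y = B n x y"
  shows "agree A B"
  unfolding agree_def
proof (intro ballI impI)
  fix x y assume "x \<in> Crit V" "y \<in> Crit V" "cdim X x = cdim X y"
  then show "A (cdim X x) x y = B (cdim X x) x y" by (intro assms) (simp_all add: Cr_def)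
qed

lemma cohom_rel_iff:
  assumes "\<sigma> \<noteq> \<tau>" "matched_cells s s'" "matched_cells t t'" "\<sigma> = (s, Some s')" "\<tau> = (t, Some t')" "cdim X s = cdim X t"
  shows "cohom_rel X W \<tau> \<sigma> \<longleftrightarrow> W (cdim X t) t s = 1"
proof -
  have "cdim X s' \<noteq> cdim X t" "s \<in> cells X" "t \<in> cells X"
    using matched_dims(1,4)[OF assms(2)] matched_dims(1,4)[OF assms(3)] assms(6) by auto
  moreover have "s \<noteq> t" using matched_inj[OF assms(2)] assms(1,3,4,5) by auto
  ultimately show ?thesis
    using assms unfolding cohom_rel_def cell_rel_def components_def by auto
qed

lemma hom_rel_iff:
  assumes "\<sigma> \<noteq> \<tau>" "matched_cells s s'" "matched_cells t t'" "\<sigma> = (s, Some s')" "\<tau> = (t, Some t')" "cdim X s = cdim X t"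
  shows "hom_rel X U \<tau> \<sigma> \<longleftrightarrow> U (cdim X t + 1) t' s' = 1"
proof -
  have "cdim X s \<noteq> cdim X t'" "s' \<in> cells X" "t' \<in> cells X" "cdim X s' = cdim X t'" "cdim X t' = cdim X t + 1"
    using matched_dims(2,4)[OF assms(2)] matched_dims(2,4)[OF assms(3)] assms(6) by auto
  moreover have "s' \<noteq> t'" using matched_fun[OF assms(2)] assms(1,3,4,5) by auto
  ultimately show ?thesis
    using assms unfolding hom_rel_def cell_rel_def components_def by auto
qed

end

section \<open>Right moves: pairs and relations when the birth cell is shifted\<close>

locale right_step = filtered X g
  for X :: "'a lefschetz" and g :: "'a \<Rightarrow> real" +
  fixes b d :: 'a and \<delta> \<xi> :: real and g' :: "'a \<Rightarrow> real"
  assumes rm: "right_move X (b, Some d) \<delta> \<xi> g g'" and bC: "b \<in> Crit V" and dC: "d \<in> Crit V"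
    and m: "matched_cells b d"
begin

lemmas geo = right_move_geometry[OF rm bC dC]

sublocale T: two_functions X g g'
  using X geo(1,2) by unfold_locales

lemma no_bypass:
  assumes "right_bypassed X (b, Some d) \<delta> g = {}"
  shows "BD X g' = BD X g" "agree (U_mat X g') (U_mat X g)" "agree (U_perp_mat X g') (U_perp_mat X g)"
proof -
  have ord: "g x < g y \<longleftrightarrow> g' x < g' y" if "x \<in> Crit V" "y \<in> Crit V" for x y
    by (rule right_move_order[OF rm bC dC that]) (use assms that in \<open>auto simp: right_bypassed_def\<close>)
  show "BD X g' = BD X g" using T.same_order(1)[OF ord] .
  show "agree (U_mat X g') (U_mat X g)" by (rule agreeI) (rule T.same_order(2)[OF ord])
  show "agree (U_perp_mat X g') (U_perp_mat X g)" by (rule agreeI) (rule T.same_order(3)[OF ord])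
qed

end

text \<open>\<open>We\<close> is the matrix form of what \<open>may_move_right\<close> tests: in the
  coboundary reduction the bypassed cell is not added to \<open>b\<close>.\<close>

locale right_bypass = right_step +
  fixes e
  assumes e: "e \<in> right_bypassed X (b, Some d) \<delta> g"
    and We: "cdim X e = cdim X b \<Longrightarrow> U_perp_mat X g (cdim X b) e b = 0"
begin

lemma e_Crit: "e \<in> Crit V" "g b < g e" "g e < \<delta>"
  using e unfolding right_bypassed_def by auto

lemma only_e: "z \<in> Crit V \<Longrightarrow> g b < g z \<Longrightarrow> g z < \<delta> \<Longrightarrow> z = e"
proof -
  assume z: "z \<in> Crit V" "g b < g z" "g z < \<delta>"
  have "card (right_bypassed X (b, Some d) \<delta> g) \<le> Suc 0"
    using rm unfolding right_move_def Let_def by simp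
  moreover have "finite (right_bypassed X (b, Some d) \<delta> g)"
    using finite_Crit unfolding right_bypassed_def by simp
  moreover have "z \<in> right_bypassed X (b, Some d) \<delta> g" using z unfolding right_bypassed_def by simp
  ultimately show "z = e" using e card_le_Suc0_iff_eq by blast
qed

sublocale S: swap_two X g g' b e
proof unfold_locales
  show "b \<in> Crit V" "e \<in> Crit V" "g b < g e" using bC e_Crit by auto
  show "g' e < g' b" using geo(3) geo(4)[of e] e_Crit by (cases "e = b") auto
  show "g x < g y \<longleftrightarrow> g' x < g' y" if "x \<in> Crit V" "y \<in> Crit V" "{x, y} \<noteq> {b, e}" for x y
    by (rule right_move_order[OF rm bC dC that(1,2)]) (use only_e that in auto)
  \<comment> \<open>As a birth cell \<open>b\<close> has a zero column in the boundary reduction,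
    and a zero column is never added to another.\<close>
  show "U_mat X g (cdim X b) b e = 0" if "cdim X b = cdim X e"
    by (rule U_zero_not_death[OF bC e_Crit(1) that])
      (use e_Crit matched_chain[OF m] in auto)
  show "U_perp_mat X g (cdim X b) e b = 0" if "cdim X b = cdim X e" using We that by simp
qed

lemma BD_eq: "BD X g' = BD X g" by (rule S.BD_same)

text \<open>As rows of a coboundary matrix, \<open>b\<close> and \<open>e\<close> are transposed
  without effect, because \<open>b\<close> is not a death cell and hence no pivot there.\<close>

lemma W_agree: "agree (U_perp_mat X g') (U_perp_mat X g)"
  unfolding agree_def
proof (intro ballI impI)
  fix x y assume "x \<in> Crit V" "y \<in> Crit V" "cdim X x = cdim X y"
  then have xy: "x \<in> Cr (cdim X x)" "y \<in> Cr (cdim X x)" unfolding Cr_def by auto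
  show "U_perp_mat X g' (cdim X x) x y = U_perp_mat X g (cdim X x) x y"
  proof (cases "cdim X b = cdim X x + 1 \<and> cdim X e = cdim X x + 1")
    case True
    then show ?thesis using S.W_unpaired[OF _ _ _ xy] matched_chain[OF m] by blast
  next
    case False
    then show ?thesis using S.W_same[OF False xy] by blast
  qed
qed

lemma U_agree:
  assumes "\<not> (cdim X e = cdim X b \<and> (\<exists>f. matched_cells e f))"
  shows "agree (U_mat X g') (U_mat X g)"
  unfolding agree_def
proof (intro ballI impI)
  fix x y assume "x \<in> Crit V" "y \<in> Crit V" "cdim X x = cdim X y"
  then have xy: "x \<in> Cr (cdim X x)" "y \<in> Cr (cdim X x)" unfolding Cr_def by auto
  show "U_mat X g' (cdim X x) x y = U_mat X g (cdim X x) x y"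
  proof (cases "cdim X b + 1 = cdim X x \<and> cdim X e + 1 = cdim X x")
    case True
    then show ?thesis using S.U_unpaired[OF _ _ _ xy] assms by auto
  next
    case False
    then show ?thesis using S.U_same[OF False xy] by blast
  qed
qed

lemma U_mono:
  assumes "x \<in> Crit V" "cdim X x = cdim X d" "U_mat X g' (cdim X d) x d = 1"
  shows "U_mat X g (cdim X d) x d = 1"
proof -
  have d: "cdim X d = cdim X b + 1" using matched_dims(4)[OF m] .
  have xy: "x \<in> Cr (cdim X d)" "d \<in> Cr (cdim X d)" using assms dC unfolding Cr_def by auto
  show ?thesis
  proof (cases "cdim X e = cdim X b")
    case True
    then show ?thesis using S.U_mono[OF refl True m, of x] assms xy d by simp
  next
    case False
    then have "\<not> (cdim X b + 1 = cdim X d \<and> cdim X e + 1 = cdim X d)" using d by simp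
    from S.U_same[OF this xy] show ?thesis using assms by simp
  qed
qed

lemma switch_result:
  assumes bs: "birth_switch X (BD X g) (b, Some d) e s U'" and fn: "fn s = g"
    and hom: "agree (hom s) (U_mat X g)" and cohom: "agree (cohom s) (U_perp_mat X g)"
  shows "agree U' (U_mat X g')"
proof (cases "\<exists>f. matched_cells e f \<and> cdim X e = cdim X b")
  case False
  then have "U' = hom s" using bs BD_Some unfolding birth_switch_def Let_def by auto
  moreover have "agree (U_mat X g') (U_mat X g)" using U_agree False by blast
  ultimately show ?thesis using hom unfolding agree_def by auto
next
  case True
  let ?k = "cdim X b"
  have kk: "cdim X e = ?k" using True by blast
  have cond: "\<exists>y. (e, Some y) \<in> BD X g \<and> cdim X e = ?k" using True BD_Some by blast
  then obtain \<beta> \<sigma> \<tau> C where \<beta>: "\<beta> \<in> BD X g" "birth \<beta> = e" "snd \<beta> \<noteq> None"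
    and st: "{\<sigma>, \<tau>} = {(b, Some d), \<beta>}" and less: "g (death \<tau>) < g (death \<sigma>)"
    and C: "partially_cancelled X g (BD X g) \<sigma> \<tau> C"
    and U': "U' = (if \<not> cohom_rel X (cohom s) \<tau> \<sigma> \<and>
                 (hom_rel X (hom s) \<tau> \<sigma> \<or> inc C (birth \<tau>) (death \<sigma>) = 1)
              then (hom s)(?k + 1 := add_row (death \<tau>) (death \<sigma>) (hom s (?k + 1)))
              else hom s)"
    using bs unfolding birth_switch_def Let_def fn fst_conv by auto
  obtain f where f: "\<beta> = (e, Some f)" using \<beta>(2,3) by (cases \<beta>) auto
  have mf: "matched_cells e f" using \<beta>(1) BD_Some unfolding f by blast
  have ne: "b \<noteq> e" using e_Crit by auto
  have st': "{\<sigma>, \<tau>} = {(b, Some d), (e, Some f)}" using st unfolding f .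
  have cases: "\<sigma> = (e, Some f) \<and> \<tau> = (b, Some d) \<or> \<sigma> = (b, Some d) \<and> \<tau> = (e, Some f)"
    using st' by (auto simp: doubleton_eq_iff)
  then obtain s1 s2 t1 t2 where \<sigma>: "\<sigma> = (s1, Some s2)" and \<tau>: "\<tau> = (t1, Some t2)"
    and ms: "matched_cells s1 s2" "cdim X s1 = ?k" "s1 \<in> Crit V" and mt: "matched_cells t1 t2" "cdim X t1 = ?k" "t1 \<in> Crit V"
    using m mf kk bC e_Crit by blast
  have \<sigma>\<tau>: "\<sigma> \<noteq> \<tau>" using cases ne by auto
  have C2: "s2 \<in> Crit V" "t2 \<in> Crit V" "cdim X s2 = ?k + 1" "cdim X t2 = ?k + 1"
    using matched_Crit[OF ms(1)] ms matched_dims(4)[OF ms(1)] matched_Crit[OF mt(1)] mt matched_dims(4)[OF mt(1)] by auto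
  \<comment> \<open>The negative condition of the rule is fulfilled: a relation from
    \<open>e\<close> to \<open>b\<close> is excluded by \<open>We\<close>, one from \<open>b\<close>
    to \<open>e\<close> by the order of the values.\<close>
  have "U_perp_mat X g ?k t1 s1 = 0"
  proof (cases "t1 = e")
    case True
    then show ?thesis using cases \<sigma> \<tau> ne We kk by auto
  next
    case False
    then have "t1 = b" "s1 = e" using cases \<sigma> \<tau> by auto
    then show ?thesis
      using W_one(1)[of b e] bC e_Crit ne kk by (cases "U_perp_mat X g ?k t1 s1") auto
  qed
  moreover have "cohom s ?k t1 s1 = U_perp_mat X g ?k t1 s1"
    using cohom ms mt unfolding agree_def by metis
  ultimately have nc: "\<not> cohom_rel X (cohom s) \<tau> \<sigma>"
    using cohom_rel_iff[OF \<sigma>\<tau> ms(1) mt(1) \<sigma> \<tau>] ms mt by simp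
  have homeq: "hom s (?k + 1) x y = U_mat X g (?k + 1) x y"
    if "x \<in> Crit V" "y \<in> Crit V" "cdim X x = ?k + 1" "cdim X y = ?k + 1" for x y
    using hom that unfolding agree_def by metis
  have hr: "hom_rel X (hom s) \<tau> \<sigma> \<longleftrightarrow> U_mat X g (?k + 1) t2 s2 = 1"
    using hom_rel_iff[OF \<sigma>\<tau> ms(1) mt(1) \<sigma> \<tau>] ms mt homeq[OF C2(2,1,4,3)] by simp
  show ?thesis
    unfolding agree_def
  proof (intro ballI impI)
    fix x y assume xy: "x \<in> Crit V" "y \<in> Crit V" "cdim X x = cdim X y"
    show "U' (cdim X x) x y = U_mat X g' (cdim X x) x y"
    proof (cases "cdim X x = ?k + 1")
      case True
      then have xyC: "x \<in> Cr (?k + 1)" "y \<in> Cr (?k + 1)" using xy unfolding Cr_def by auto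
      have "U_mat X g' (?k + 1) x y =
          (if U_mat X g (?k + 1) (death \<tau>) (death \<sigma>) = 1 \<or> inc C (birth \<tau>) (death \<sigma>) = 1
           then add_row (death \<tau>) (death \<sigma>) (U_mat X g (?k + 1)) else U_mat X g (?k + 1)) x y"
        by (rule S.U_switch[OF refl kk m mf st' less C xyC])
      also have "\<dots> = U' (?k + 1) x y"
        using nc hr homeq[OF xy(1,2)] homeq[OF C2(1) xy(2)] C2 True xy(3) homeq[OF C2(2) xy(2)]
        unfolding U' \<sigma> \<tau> by (auto simp: add_row_def)
      finally show ?thesis using True by simp
    next
      case False
      then have "U' (cdim X x) x y = hom s (cdim X x) x y" unfolding U' by simp
      moreover have "\<dots> = U_mat X g (cdim X x) x y" using hom xy unfolding agree_def by blast
      moreover have "\<dots> = U_mat X g' (cdim X x) x y"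
        using S.U_same[of "cdim X x" x y] False xy unfolding Cr_def by auto
      ultimately show ?thesis by simp
    qed
  qed
qed

lemma switch_exists:
  assumes fn: "fn s = g"
  shows "\<exists>U'. birth_switch X (BD X g) (b, Some d) e s U'"
proof (cases "\<exists>f. (e, Some f) \<in> BD X g \<and> cdim X e = cdim X b")
  case True
  then obtain f where f: "(e, Some f) \<in> BD X g" "cdim X e = cdim X b" by blast
  have mf: "matched_cells e f" using f BD_Some by blast
  have fd: "f \<in> Crit V" "f \<noteq> d"
    using matched_Crit[OF mf] e_Crit matched_fun[OF mf] m by auto
  then have "g f \<noteq> g d" using Crit_value[OF dC Crit_cells[OF fd(1)]] by auto
  then obtain \<sigma> \<tau> where st: "{\<sigma>, \<tau>} = {(b, Some d), (e, Some f)}" and less: "g (death \<tau>) < g (death \<sigma>)"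
  proof (cases "g f < g d")
    case True
    then show thesis by (intro that[of "(b, Some d)" "(e, Some f)"]) auto
  next
    case False
    then show thesis using \<open>g f \<noteq> g d\<close> by (intro that[of "(e, Some f)" "(b, Some d)"]) auto
  qed
  \<comment> \<open>A nested pair enclosing one of the two pairs would have its birth cell strictly
    between \<open>b\<close> and \<open>e\<close>, but \<open>e\<close> is the only critical cell
    that is bypassed.\<close>
  have "\<exists>C. partially_cancelled X g (BD X g) \<sigma> \<tau> C"
  proof (rule nested_cancellable[OF st])
    fix s t s' t'
    assume *: "matched_cells s t" "matched_cells s' t'" "s \<in> Crit V" "s' \<in> Crit V"
      "(s, Some t) \<notin> {\<sigma>, \<tau>}" "(s', Some t') \<in> {\<sigma>, \<tau>}" "g s < g s'"
      "g b < g s \<and> g t \<le> g d \<or> g e < g s \<and> g t \<le> g f"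
    then have "s' = b \<or> s' = e" using st by auto
    then have "g b < g s" "g s < g e" using * e_Crit by auto
    then have "s = e" using only_e[OF *(3)] e_Crit by auto
    then show False using \<open>g s < g e\<close> by simp
  qed
  then obtain C where C: "partially_cancelled X g (BD X g) \<sigma> \<tau> C" by blast
  show ?thesis
    unfolding birth_switch_def Let_def fn fst_conv if_P[OF True]
    by (rule exI, rule exI[of _ "(e, Some f)"], rule exI[of _ \<sigma>], rule exI[of _ \<tau>], rule exI[of _ C],
        intro conjI, rule f(1), simp, simp, rule st, rule less, rule C, rule refl)
next
  case False
  show ?thesis unfolding birth_switch_def Let_def fn fst_conv if_not_P[OF False] by (rule exI, rule refl)
qed

end

section \<open>Down moves: pairs and relations when the death cell is shifted\<close>

locale down_step = filtered X g
  for X :: "'a lefschetz" and g :: "'a \<Rightarrow> real" +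
  fixes b d :: 'a and \<delta> \<xi> :: real and g' :: "'a \<Rightarrow> real"
  assumes rm: "down_move X (b, Some d) \<delta> \<xi> g g'" and bC: "b \<in> Crit V" and dC: "d \<in> Crit V"
    and m: "matched_cells b d"
begin

lemmas geo = down_move_geometry[OF rm bC dC]

sublocale T: two_functions X g g'
  using X geo(1,2) by unfold_locales

lemma no_bypass:
  assumes "down_bypassed X (b, Some d) \<delta> g = {}"
  shows "BD X g' = BD X g" "agree (U_mat X g') (U_mat X g)" "agree (U_perp_mat X g') (U_perp_mat X g)"
proof -
  have ord: "g x < g y \<longleftrightarrow> g' x < g' y" if "x \<in> Crit V" "y \<in> Crit V" for x y
    by (rule down_move_order[OF rm bC dC that]) (use assms that in \<open>auto simp: down_bypassed_def\<close>)
  show "BD X g' = BD X g" using T.same_order(1)[OF ord] .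
  show "agree (U_mat X g') (U_mat X g)" by (rule agreeI) (rule T.same_order(2)[OF ord])
  show "agree (U_perp_mat X g') (U_perp_mat X g)" by (rule agreeI) (rule T.same_order(3)[OF ord])
qed

end

locale down_bypass = down_step +
  fixes e
  assumes e: "e \<in> down_bypassed X (b, Some d) \<delta> g"
    and Ue: "cdim X e = cdim X d \<Longrightarrow> U_mat X g (cdim X d) e d = 0"
begin

lemma e_Crit: "e \<in> Crit V" "g e < g d" "\<delta> < g e"
  using e unfolding down_bypassed_def by auto

lemma only_e: "z \<in> Crit V \<Longrightarrow> g z < g d \<Longrightarrow> \<delta> < g z \<Longrightarrow> z = e"
proof -
  assume z: "z \<in> Crit V" "g z < g d" "\<delta> < g z"
  have "card (down_bypassed X (b, Some d) \<delta> g) \<le> Suc 0"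
    using rm unfolding down_move_def Let_def by simp
  moreover have "finite (down_bypassed X (b, Some d) \<delta> g)"
    using finite_Crit unfolding down_bypassed_def by simp
  moreover have "z \<in> down_bypassed X (b, Some d) \<delta> g" using z unfolding down_bypassed_def by simp
  ultimately show "z = e" using e card_le_Suc0_iff_eq by blast
qed

sublocale S: swap_two X g g' e d
proof unfold_locales
  show "d \<in> Crit V" "e \<in> Crit V" "g e < g d" using dC e_Crit by auto
  show "g' d < g' e" using geo(3) geo(4)[of e] e_Crit by (cases "e = d") auto
  show "g x < g y \<longleftrightarrow> g' x < g' y" if "x \<in> Crit V" "y \<in> Crit V" "{x, y} \<noteq> {e, d}" for x y
    by (rule down_move_order[OF rm bC dC that(1,2)]) (use only_e that in auto)
  show "U_mat X g (cdim X e) e d = 0" if "cdim X e = cdim X d" using Ue that by simp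
  show "U_perp_mat X g (cdim X e) d e = 0" if "cdim X e = cdim X d"
    using W_zero_not_birth[OF dC e_Crit(1)] that e_Crit(2) matched_chain[OF _ m] by force
qed

lemma BD_eq: "BD X g' = BD X g" by (rule S.BD_same)

text \<open>As rows of a boundary matrix, \<open>e\<close> and \<open>d\<close> are transposed
  without effect, because \<open>d\<close> is not a birth cell and hence no pivot there.\<close>

lemma U_agree: "agree (U_mat X g') (U_mat X g)"
  unfolding agree_def
proof (intro ballI impI)
  fix x y assume "x \<in> Crit V" "y \<in> Crit V" "cdim X x = cdim X y"
  then have xy: "x \<in> Cr (cdim X x)" "y \<in> Cr (cdim X x)" unfolding Cr_def by auto
  show "U_mat X g' (cdim X x) x y = U_mat X g (cdim X x) x y"
  proof (cases "cdim X e + 1 = cdim X x \<and> cdim X d + 1 = cdim X x")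
    case True
    then show ?thesis using S.U_unpaired[OF _ _ _ xy] matched_chain[OF _ m] by blast
  next
    case False
    then show ?thesis using S.U_same[OF False xy] by blast
  qed
qed

lemma W_agree:
  assumes "\<not> (cdim X e = cdim X d \<and> (\<exists>f. matched_cells f e))"
  shows "agree (U_perp_mat X g') (U_perp_mat X g)"
  unfolding agree_def
proof (intro ballI impI)
  fix x y assume "x \<in> Crit V" "y \<in> Crit V" "cdim X x = cdim X y"
  then have xy: "x \<in> Cr (cdim X x)" "y \<in> Cr (cdim X x)" unfolding Cr_def by auto
  show "U_perp_mat X g' (cdim X x) x y = U_perp_mat X g (cdim X x) x y"
  proof (cases "cdim X e = cdim X x + 1 \<and> cdim X d = cdim X x + 1")
    case True
    then show ?thesis using S.W_unpaired[OF _ _ _ xy] assms by auto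
  next
    case False
    then show ?thesis using S.W_same[OF False xy] by blast
  qed
qed

lemma W_mono:
  assumes "x \<in> Crit V" "cdim X x = cdim X b" "U_perp_mat X g' (cdim X b) x b = 1"
  shows "U_perp_mat X g (cdim X b) x b = 1"
proof -
  have d: "cdim X d = cdim X b + 1" using matched_dims(4)[OF m] .
  have xy: "x \<in> Cr (cdim X b)" "b \<in> Cr (cdim X b)" using assms bC unfolding Cr_def by auto
  show ?thesis
  proof (cases "cdim X e = cdim X d")
    case True
    then show ?thesis using S.W_mono[of "cdim X b" b x] m assms xy d by simp
  next
    case False
    then have "\<not> (cdim X e = cdim X b + 1 \<and> cdim X d = cdim X b + 1)" using d by simp
    from S.W_same[OF this xy] show ?thesis using assms by simp
  qed
qed

lemma switch_result:
  assumes bs: "death_switch X (BD X g) (b, Some d) e s W'" and fn: "fn s = g"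
    and hom: "agree (hom s) (U_mat X g)" and cohom: "agree (cohom s) (U_perp_mat X g)"
  shows "agree W' (U_perp_mat X g')"
proof (cases "\<exists>f. matched_cells f e \<and> cdim X f = cdim X b")
  case False
  then have "W' = cohom s" using bs BD_Some unfolding death_switch_def Let_def by auto
  moreover have "agree (U_perp_mat X g') (U_perp_mat X g)"
    by (rule W_agree) (use False matched_dims(4) m in fastforce)
  ultimately show ?thesis using cohom unfolding agree_def by auto
next
  case True
  let ?k = "cdim X b"
  have dk: "cdim X d = ?k + 1" "cdim X e = ?k + 1" using matched_dims(4) m True by auto
  have cond: "\<exists>x. (x, Some e) \<in> BD X g \<and> cdim X x = ?k" using True BD_Some by blast
  then obtain \<beta> \<sigma> \<tau> C where \<beta>: "\<beta> \<in> BD X g" "snd \<beta> = Some e"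
    and st: "{\<sigma>, \<tau>} = {(b, Some d), \<beta>}" and less: "g (birth \<sigma>) < g (birth \<tau>)"
    and C: "partially_cancelled X g (BD X g) \<sigma> \<tau> C"
    and W': "W' = (if \<not> hom_rel X (hom s) \<tau> \<sigma> \<and>
                 (cohom_rel X (cohom s) \<tau> \<sigma> \<or> inc C (birth \<sigma>) (death \<tau>) = 1)
              then (cohom s)(?k := add_row (birth \<tau>) (birth \<sigma>) (cohom s ?k))
              else cohom s)"
    using bs unfolding death_switch_def Let_def fn fst_conv by auto
  obtain f where f: "\<beta> = (f, Some e)" using \<beta>(2) by (cases \<beta>) auto
  have mf: "matched_cells f e" using \<beta>(1) BD_Some unfolding f by blast
  have kk: "cdim X f = ?k" using matched_dims(4)[OF mf] dk by simp
  have fC: "f \<in> Crit V" using matched_Crit[OF mf] e_Crit by blast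
  have ne: "d \<noteq> e" using e_Crit by auto
  have st': "{\<sigma>, \<tau>} = {(f, Some e), (b, Some d)}" using st unfolding f by (simp add: insert_commute)
  have cases: "\<sigma> = (f, Some e) \<and> \<tau> = (b, Some d) \<or> \<sigma> = (b, Some d) \<and> \<tau> = (f, Some e)"
    using st' by (auto simp: doubleton_eq_iff)
  then obtain s1 s2 t1 t2 where \<sigma>: "\<sigma> = (s1, Some s2)" and \<tau>: "\<tau> = (t1, Some t2)"
    and ms: "matched_cells s1 s2" "cdim X s1 = ?k" "s1 \<in> Crit V" and mt: "matched_cells t1 t2" "cdim X t1 = ?k" "t1 \<in> Crit V"
    using m mf kk bC fC by blast
  have \<sigma>\<tau>: "\<sigma> \<noteq> \<tau>" using cases ne by auto
  have C2: "s2 \<in> Crit V" "t2 \<in> Crit V" "cdim X s2 = ?k + 1" "cdim X t2 = ?k + 1"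
    using matched_Crit[OF ms(1)] ms matched_dims(4)[OF ms(1)] matched_Crit[OF mt(1)] mt matched_dims(4)[OF mt(1)] by auto
  have "U_mat X g (?k + 1) t2 s2 = 0"
  proof (cases "t2 = e")
    case True
    then show ?thesis using cases \<sigma> \<tau> ne Ue dk by auto
  next
    case False
    then have "t2 = d" "s2 = e" using cases \<sigma> \<tau> by auto
    then show ?thesis
      using U_one(1)[of d e] dC e_Crit ne dk by (cases "U_mat X g (?k + 1) t2 s2") auto
  qed
  moreover have "hom s (?k + 1) t2 s2 = U_mat X g (?k + 1) t2 s2"
    using hom C2 unfolding agree_def by metis
  ultimately have nc: "\<not> hom_rel X (hom s) \<tau> \<sigma>"
    using hom_rel_iff[OF \<sigma>\<tau> ms(1) mt(1) \<sigma> \<tau>] ms mt by simp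
  have cohomeq: "cohom s ?k x y = U_perp_mat X g ?k x y"
    if "x \<in> Crit V" "y \<in> Crit V" "cdim X x = ?k" "cdim X y = ?k" for x y
    using cohom that unfolding agree_def by metis
  have hr: "cohom_rel X (cohom s) \<tau> \<sigma> \<longleftrightarrow> U_perp_mat X g ?k t1 s1 = 1"
    using cohom_rel_iff[OF \<sigma>\<tau> ms(1) mt(1) \<sigma> \<tau>] ms mt cohomeq[OF mt(3) ms(3) mt(2) ms(2)] by simp
  show ?thesis
    unfolding agree_def
  proof (intro ballI impI)
    fix x y assume xy: "x \<in> Crit V" "y \<in> Crit V" "cdim X x = cdim X y"
    show "W' (cdim X x) x y = U_perp_mat X g' (cdim X x) x y"
    proof (cases "cdim X x = ?k")
      case True
      then have xyC: "x \<in> Cr ?k" "y \<in> Cr ?k" using xy unfolding Cr_def by auto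
      have "U_perp_mat X g' ?k x y =
          (if U_perp_mat X g ?k (birth \<tau>) (birth \<sigma>) = 1 \<or> inc C (birth \<sigma>) (death \<tau>) = 1
           then add_row (birth \<tau>) (birth \<sigma>) (U_perp_mat X g ?k) else U_perp_mat X g ?k) x y"
        by (rule S.W_switch[OF dk(2,1) mf m st' less C xyC])
      also have "\<dots> = W' ?k x y"
        using nc hr cohomeq[OF xy(1,2)] cohomeq[OF ms(3) xy(2)] ms True xy(3) cohomeq[OF mt(3) xy(2)] mt
        unfolding W' \<sigma> \<tau> by (auto simp: add_row_def)
      finally show ?thesis using True by simp
    next
      case False
      then have "W' (cdim X x) x y = cohom s (cdim X x) x y" unfolding W' by simp
      moreover have "\<dots> = U_perp_mat X g (cdim X x) x y" using cohom xy unfolding agree_def by blast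
      moreover have "\<dots> = U_perp_mat X g' (cdim X x) x y"
        using S.W_same[of "cdim X x" x y] False xy dk unfolding Cr_def by auto
      ultimately show ?thesis by simp
    qed
  qed
qed

lemma switch_exists:
  assumes fn: "fn s = g"
  shows "\<exists>W'. death_switch X (BD X g) (b, Some d) e s W'"
proof (cases "\<exists>f. (f, Some e) \<in> BD X g \<and> cdim X f = cdim X b")
  case True
  then obtain f where f: "(f, Some e) \<in> BD X g" "cdim X f = cdim X b" by blast
  have mf: "matched_cells f e" using f BD_Some by blast
  have fd: "f \<in> Crit V" "f \<noteq> b"
    using matched_Crit[OF mf] e_Crit matched_inj[OF mf] m by auto
  then have "g f \<noteq> g b" using Crit_value[OF bC Crit_cells[OF fd(1)]] by auto
  then obtain \<sigma> \<tau> where st: "{\<sigma>, \<tau>} = {(b, Some d), (f, Some e)}" and less: "g (birth \<sigma>) < g (birth \<tau>)"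
  proof (cases "g b < g f")
    case True
    then show thesis by (intro that[of "(b, Some d)" "(f, Some e)"]) auto
  next
    case False
    then show thesis using \<open>g f \<noteq> g b\<close> by (intro that[of "(f, Some e)" "(b, Some d)"]) auto
  qed
  \<comment> \<open>A nested pair enclosing one of the two pairs would have its death cell strictly
    between \<open>e\<close> and \<open>d\<close>, and no critical cell lies there.\<close>
  have "\<exists>C. partially_cancelled X g (BD X g) \<sigma> \<tau> C"
  proof (rule nested_cancellable[OF st])
    fix s t s' t'
    assume *: "matched_cells s t" "matched_cells s' t'" "t \<in> Crit V"
      "(s, Some t) \<notin> {\<sigma>, \<tau>}" "(s', Some t') \<in> {\<sigma>, \<tau>}" "g t' < g t"
      "g b < g s \<and> g t \<le> g d \<or> g f < g s \<and> g t \<le> g e"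
    have "t \<noteq> d" using matched_fun[OF *(1)] m *(4) st by auto
    then have "g t \<noteq> g d" using Crit_value[OF dC Crit_cells[OF *(3)]] by auto
    moreover have "t' = d \<or> t' = e" using st *(5) by auto
    ultimately have "g t < g d" "g e < g t" using * e_Crit by auto
    then have "t = e" using only_e[OF *(3)] e_Crit by auto
    then show False using \<open>g e < g t\<close> by simp
  qed
  then obtain C where C: "partially_cancelled X g (BD X g) \<sigma> \<tau> C" by blast
  show ?thesis
    unfolding death_switch_def Let_def fn fst_conv if_P[OF True]
    by (rule exI, rule exI[of _ "(f, Some e)"], rule exI[of _ \<sigma>], rule exI[of _ \<tau>], rule exI[of _ C],
        intro conjI, rule f(1), simp, rule st, rule less, rule C, rule refl)
next
  case False
  show ?thesis unfolding death_switch_def Let_def fn fst_conv if_not_P[OF False] by (rule exI, rule refl)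
qed

end

section \<open>Reversing a block of cells\<close>

text \<open>\<open>A\<close> and \<open>B\<close> stand for the lower and the upper cells of the
  path. Only order and pairing enter the assumptions, so that the dual complex with \<open>A\<close>
  and \<open>B\<close> exchanged is a second instance, which takes care of the coboundary
  matrices.\<close>

locale block_reversal = G: filtered X g + H: filtered X h'
  for X :: "'a lefschetz" and g h' :: "'a \<Rightarrow> real" +
  fixes A B :: "'a set" and k :: nat
  assumes AB: "A \<subseteq> cells_of_dim X k" "B \<subseteq> cells_of_dim X (k + 1)"
    and out: "\<And>z. z \<in> cells X \<Longrightarrow> z \<notin> A \<union> B \<Longrightarrow> h' z = g z"
    and block: "\<And>z. z \<in> cells X \<Longrightarrow> z \<notin> A \<union> B \<Longrightarrow>
      (\<forall>x\<in>A \<union> B. g z < g x \<and> g z < h' x) \<or> (\<forall>x\<in>A \<union> B. g x < g z \<and> h' x < g z)"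
    and GA: "\<And>a. a \<in> A \<Longrightarrow> \<exists>y\<in>B. G.matched_cells a y"
    and GB: "\<And>y. y \<in> B \<Longrightarrow> \<exists>a\<in>A. G.matched_cells a y"
    and HA: "\<And>a. a \<in> A \<Longrightarrow> \<exists>y\<in>B. H.vec a y"
    and HB: "\<And>y. y \<in> B \<Longrightarrow> \<exists>a\<in>A. H.vec a y"
    and span: "\<And>x y. y \<in> B \<Longrightarrow> x \<in> cells_of_dim X (k + 1) \<Longrightarrow> U_mat X g (k + 1) x y = 1 \<Longrightarrow> x \<in> B"
begin

lemma AB_dim: "x \<in> A \<Longrightarrow> cdim X x = k" "x \<in> B \<Longrightarrow> cdim X x = k + 1" "x \<in> A \<Longrightarrow> x \<in> cells X"
  "x \<in> B \<Longrightarrow> x \<in> cells X" "x \<in> A \<Longrightarrow> x \<notin> B"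
proof -
  show *: "x \<in> A \<Longrightarrow> cdim X x = k" "x \<in> B \<Longrightarrow> cdim X x = k + 1" "x \<in> A \<Longrightarrow> x \<in> cells X"
    "x \<in> B \<Longrightarrow> x \<in> cells X"
    using AB unfolding cells_of_dim_def by auto
  show "x \<in> A \<Longrightarrow> x \<notin> B" using *(1,2) by auto
qed

lemma block_dim: "x \<in> A \<union> B \<Longrightarrow> x \<in> cells_of_dim X m \<Longrightarrow> m = k \<and> x \<in> A \<or> m = k + 1 \<and> x \<in> B"
  using AB_dim(1,2)[of x] unfolding cells_of_dim_def by auto

lemma same_outside:
  assumes S: "S \<subseteq> cells_of_dim X m"
  shows "same_outside G.r H.r S (S \<inter> (A \<union> B))"
proof -
  have rG: "G.r x y \<longleftrightarrow> g x < g y" and rH: "H.r x y \<longleftrightarrow> h' x < h' y" if "x \<in> S" "y \<in> S" for x y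
    using G.h_less_same_dim[of x y] H.h_less_same_dim[of x y] that S unfolding cells_of_dim_def by auto
  have SX: "x \<in> cells X" if "x \<in> S" for x using that S unfolding cells_of_dim_def by auto
  show ?thesis
    unfolding same_outside_def
  proof (intro conjI ballI impI)
    fix x y assume xy: "x \<in> S" "y \<in> S" "x \<in> S \<inter> (A \<union> B)" "y \<notin> S \<inter> (A \<union> B)"
    then have y: "y \<notin> A \<union> B" "x \<in> A \<union> B" by auto
    show "G.r x y \<longleftrightarrow> H.r x y" "G.r y x \<longleftrightarrow> H.r y x"
      using rG[OF xy(1,2)] rG[OF xy(2,1)] rH[OF xy(1,2)] rH[OF xy(2,1)]
        block[OF SX[OF xy(2)] y(1)] out[OF SX[OF xy(2)] y(1)] y(2) by fastforce+
  next
    fix x y assume xy: "x \<in> S - S \<inter> (A \<union> B)" "y \<in> S - S \<inter> (A \<union> B)"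
    then show "G.r x y \<longleftrightarrow> H.r x y" using rG rH out SX by auto
  next
    fix z assume z: "z \<in> S - S \<inter> (A \<union> B)"
    then show "(\<forall>a\<in>S \<inter> (A \<union> B). G.r z a) \<or> (\<forall>a\<in>S \<inter> (A \<union> B). G.r a z)"
      using block[of z] SX[of z] rG by auto
  qed auto
qed

lemma boundary_outside:
  assumes y: "y \<in> cells_of_dim X n" "y \<notin> A \<union> B"
  shows "x \<in> cells_of_dim X n \<Longrightarrow> x \<notin> A \<union> B \<Longrightarrow> U_mat X h' n x y = U_mat X g n x y"
    and "H.matched_cells a y \<longleftrightarrow> G.matched_cells a y"
proof -
  note L = G.lazy_boundary[of n] and L' = H.lazy_boundary[of n]
  have mG: "pivot G.r (G.rowset n) (R_mat X g n) y a \<longleftrightarrow> G.matched_cells a y" if "y \<in> cells_of_dim X n" for y a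
    using that G.matched_iff_pivot[of "cdim X a" a y] G.matched_dims(4)[of "cdim X a" a y]
    unfolding lead_def G.rowset_def cells_of_dim_def by auto
  have mH: "pivot H.r (G.rowset n) (R_mat X h' n) y a \<longleftrightarrow> H.matched_cells a y" if "y \<in> cells_of_dim X n" for y a
    using that H.matched_iff_pivot[of "cdim X a" a y] H.matched_dims(4)[of "cdim X a" a y]
    unfolding lead_def H.rowset_def G.rowset_def cells_of_dim_def by auto
  have rowdim: "G.rowset n \<subseteq> cells_of_dim X (n - 1)" unfolding G.rowset_def cells_of_dim_def by auto
  have finish: "(x \<in> cells_of_dim X n \<longrightarrow> x \<notin> A \<union> B \<longrightarrow> U_mat X h' n x y = U_mat X g n x y) \<and>
      (H.matched_cells a y \<longleftrightarrow> G.matched_cells a y)"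
    if N: "lazy H.r H.r (G.rowset n) (cells_of_dim X n) (boundary_matrix X n) R U"
      and U: "\<And>x. x \<in> cells_of_dim X n \<Longrightarrow> x \<notin> A \<union> B \<Longrightarrow> U x y = U_mat X g n x y"
      and P: "pivot H.r (G.rowset n) R y a \<longleftrightarrow> pivot G.r (G.rowset n) (R_mat X g n) y a" for R U x a
  proof -
    have "pivot H.r (G.rowset n) (R_mat X h' n) y a \<longleftrightarrow> pivot H.r (G.rowset n) R y a"
      using lazy_unique_pivot[OF L' N y(1)] .
    then have "H.matched_cells a y \<longleftrightarrow> G.matched_cells a y"
      using P mG[OF y(1)] mH[OF y(1)] by blast
    moreover have "U_mat X h' n x y = U x y" if "x \<in> cells_of_dim X n"
      using lazy_unique[OF L' N y(1)] that by blast
    ultimately show ?thesis using U by simp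
  qed
  have "(x \<in> cells_of_dim X n \<longrightarrow> x \<notin> A \<union> B \<longrightarrow> U_mat X h' n x y = U_mat X g n x y) \<and>
      (H.matched_cells a y \<longleftrightarrow> G.matched_cells a y)" for x a
  proof -
    consider "n = k + 1" | "n = k" | "n \<noteq> k" "n \<noteq> k + 1" by blast
    then show ?thesis
    proof cases
      \<comment> \<open>Rows and columns are both permuted. The columns in \<open>B\<close> are
        upper cells of vectors of \<open>h'\<close>, so they are reduced as they stand and the block
        lemma applies.\<close>
      case 1
      have "x \<in> G.rowset n \<inter> (A \<union> B) \<longleftrightarrow> x \<in> A" "x \<in> cells_of_dim X n \<inter> (A \<union> B) \<longleftrightarrow> x \<in> B" for x
        using AB_dim(1-4)[of x] 1 unfolding G.rowset_def cells_of_dim_def by auto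
      then have sA: "G.rowset n \<inter> (A \<union> B) = A" and sB: "cells_of_dim X n \<inter> (A \<union> B) = B"
        by blast+
      have pB: "\<exists>a\<in>A. pivot G.r (G.rowset n) (R_mat X g n) y a" if "y \<in> B" for y
        using GB[OF that] mG[of y] AB(2) that 1 by blast
      have pN: "a \<notin> A" if "y \<in> cells_of_dim X n - B" "pivot G.r (G.rowset n) (R_mat X g n) y a" for y a
        using that mG[of y a] GA[of a] G.matched_inj[of _ a y] by blast
      have new: "\<exists>a\<in>A. H.vec a y \<and> (\<forall>l. pivot H.r (G.rowset n) (boundary_matrix X n) y l \<longleftrightarrow> l = a)" if yB: "y \<in> B" for y
      proof -
        obtain a where a: "a \<in> A" "H.vec a y" using HB[OF yB] by blast
        have d: "cdim X y = n" using AB_dim(2)[OF yB] 1 by simp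
        have "pivot H.r (G.rowset n) (boundary_matrix X n) y l \<longleftrightarrow> pivot H.r (G.rowset n) (R_mat X h' n) y l" for l
          using H.vec_columns(3)[OF a(2) d] by (intro lead_cong) simp
        then show ?thesis
          using a H.vec_columns(1)[OF a(2) d] lead_unique[OF lazy_linI[OF L']] by metis
      qed
      note bl = lazy_block[OF L lazy_linI[OF L'] lazy_linJ[OF L']
          same_outside[OF rowdim, unfolded sA] same_outside[OF subset_refl, of n, unfolded sB]]
      have sp: "x \<in> B" if "b \<in> B" "x \<in> cells_of_dim X n" "U_mat X g n x b = 1" for b x
        using span that 1 by blast
      have nw: "\<exists>a\<in>A. pivot H.r (G.rowset n) (boundary_matrix X n) b a" if "b \<in> B" for b
        using new[OF that] by blast
      have ij: "b = b'" if "b \<in> B" "b' \<in> B" "pivot H.r (G.rowset n) (boundary_matrix X n) b a"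
        "pivot H.r (G.rowset n) (boundary_matrix X n) b' a" for b b' a
        using new[OF that(1)] new[OF that(2)] that(3,4) H.vec_fun by metis
      have "\<exists>U'. lazy H.r H.r (G.rowset n) (cells_of_dim X n) (boundary_matrix X n)
          (\<lambda>i y. if y \<in> B then boundary_matrix X n i y else R_mat X g n i y) U' \<and>
          (\<forall>x\<in>cells_of_dim X n - B. \<forall>y\<in>cells_of_dim X n - B. U' x y = U_mat X g n x y)"
        by (rule bl(1)) (fact pB pN sp nw ij)+
      then obtain U' where U': "lazy H.r H.r (G.rowset n) (cells_of_dim X n) (boundary_matrix X n)
          (\<lambda>i y. if y \<in> B then boundary_matrix X n i y else R_mat X g n i y) U'"
        "\<forall>x\<in>cells_of_dim X n - B. \<forall>y\<in>cells_of_dim X n - B. U' x y = U_mat X g n x y"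
        by blast
      have yB: "y \<in> cells_of_dim X n - B" using y by blast
      have P: "pivot H.r (G.rowset n) (\<lambda>i y. if y \<in> B then boundary_matrix X n i y else R_mat X g n i y) y a
          \<longleftrightarrow> pivot G.r (G.rowset n) (R_mat X g n) y a"
        by (rule bl(2)) (fact pB pN sp nw ij yB)+
      show ?thesis by (rule finish[OF U'(1) _ P]) (use U'(2) y in blast)
    next
      \<comment> \<open>Only the columns in \<open>A\<close> are permuted; they belong to birth
        cells and are never added to others.\<close>
      case 2
      have sA: "G.rowset n \<inter> (A \<union> B) = {}"
      proof -
        have "\<not> (x \<in> G.rowset n \<and> (x \<in> A \<or> x \<in> B))" for x
          using AB_dim(1,2)[of x] 2 unfolding G.rowset_def by auto
        then show ?thesis by blast
      qed
      note so = same_outside[OF subset_refl, of n] and so' = same_outside[OF rowdim, unfolded sA]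
      have up: "H.r x y" if xy: "x \<in> cells_of_dim X n" "y \<in> cells_of_dim X n" "U_mat X g n x y = 1" "x \<noteq> y" for x y
      proof -
        obtain a where "G.matched_cells a x"
          using lazy_pivot[OF L xy] mG xy(1) by blast
        then have "x \<notin> A" using GA[of x] G.matched_chain by blast
        moreover have "x \<notin> B" using block_dim[of x n] AB_dim(2)[of x] xy(1) 2 unfolding cells_of_dim_def by auto
        ultimately show ?thesis
          using same_outside_imp[OF so xy(1,2) lazy_upper[OF L xy]] by blast
      qed
      have ord: "H.r x y \<longleftrightarrow> G.r x y" if "x \<in> G.rowset n" "y \<in> G.rowset n" for x y
        using so' that unfolding same_outside_def by blast
      have l2: "pivot H.r (G.rowset n) (R_mat X g n) y' a" if "pivot G.r (G.rowset n) (R_mat X g n) y' a" for y' a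
        using that ord unfolding lead_def by blast
      have l3: "H.r b a" if "pivot G.r (G.rowset n) (R_mat X g n) x' a" "pivot G.r (G.rowset n) (R_mat X g n) y' b"
        "G.r b a" for x' y' a b
        using that ord unfolding lead_def by blast
      note re = lazy_reorder[OF L lazy_linI[OF L'] lazy_linJ[OF L']]
      have R1: "lazy H.r H.r (G.rowset n) (cells_of_dim X n) (boundary_matrix X n) (R_mat X g n) (U_mat X g n)"
        by (rule re(1)) (use up l2 l3 in blast)+
      have R2: "pivot H.r (G.rowset n) (R_mat X g n) y a \<longleftrightarrow> pivot G.r (G.rowset n) (R_mat X g n) y a"
        by (rule re(2)) (use up l2 l3 y in blast)+
      show ?thesis by (rule finish[OF R1 _ R2]) (rule refl)
    next
      \<comment> \<open>At most rows are permuted, those in \<open>B\<close> when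
        \<open>n = k + 2\<close>. They are death cells and hence no pivots, so the block lemma
        applies with an empty set of columns.\<close>
      case 3
      have sB: "cells_of_dim X n \<inter> (A \<union> B) = {}"
        using block_dim[of _ n] 3 by blast
      let ?A = "G.rowset n \<inter> (A \<union> B)"
      have AB': "?A \<subseteq> B"
      proof
        fix x assume x: "x \<in> ?A"
        then have "cdim X x + 1 = n" unfolding G.rowset_def by simp
        then show "x \<in> B" using x AB_dim(1)[of x] 3 by auto
      qed
      have pN: "a \<notin> ?A" if "y \<in> cells_of_dim X n - {}" "pivot G.r (G.rowset n) (R_mat X g n) y a" for y a
      proof -
        have "G.matched_cells a y" using that mG by blast
        then show ?thesis using GB[of a] AB' G.matched_chain by blast
      qed
      note bl = lazy_block[OF L lazy_linI[OF L'] lazy_linJ[OF L']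
          same_outside[OF rowdim] same_outside[OF subset_refl, of n, unfolded sB]]
      obtain U' where U': "lazy H.r H.r (G.rowset n) (cells_of_dim X n) (boundary_matrix X n) (R_mat X g n) U'"
        "\<forall>x\<in>cells_of_dim X n. \<forall>y\<in>cells_of_dim X n. U' x y = U_mat X g n x y"
      proof -
        have "\<exists>U'. lazy H.r H.r (G.rowset n) (cells_of_dim X n) (boundary_matrix X n)
            (\<lambda>i y. if y \<in> {} then boundary_matrix X n i y else R_mat X g n i y) U' \<and>
            (\<forall>x\<in>cells_of_dim X n - {}. \<forall>y\<in>cells_of_dim X n - {}. U' x y = U_mat X g n x y)"
          by (rule bl(1)) (fact pN | simp)+
        then show ?thesis using that by auto
      qed
      have "pivot H.r (G.rowset n) (\<lambda>i y. if y \<in> {} then boundary_matrix X n i y else R_mat X g n i y) y a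
          \<longleftrightarrow> pivot G.r (G.rowset n) (R_mat X g n) y a"
        by (rule bl(2)) (fact pN | simp add: y)+
      then have P: "pivot H.r (G.rowset n) (R_mat X g n) y a \<longleftrightarrow> pivot G.r (G.rowset n) (R_mat X g n) y a"
        by simp
      show ?thesis by (rule finish[OF U'(1) _ P]) (use U'(2) y in blast)
    qed
  qed
  then show "x \<in> cells_of_dim X n \<Longrightarrow> x \<notin> A \<union> B \<Longrightarrow> U_mat X h' n x y = U_mat X g n x y"
    and "H.matched_cells a y \<longleftrightarrow> G.matched_cells a y" by blast+
qed

end

context filtered
begin

text \<open>The pivot of a column added to \<open>d\<close> lies beyond the pivot \<open>b\<close>
  of \<open>d\<close>, and its value is at most that of its own column.\<close>

lemma U_span:
  assumes m: "matched_cells b d" and x: "x \<in> cells_of_dim X (cdim X d)" "x \<noteq> d" "U_mat X g (cdim X d) x d = 1"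
  shows "g b \<le> g x" "g x < g d"
proof -
  note L = lazy_boundary[of "cdim X d"]
  have d: "d \<in> cells_of_dim X (cdim X d)" "cdim X d = cdim X b + 1"
    using matched_dims(2,4)[OF m] unfolding cells_of_dim_def by auto
  have "pivot r (rowset (cdim X d)) (R_mat X g (cdim X d)) d b"
    using m d unfolding matched_iff_pivot by simp
  then obtain a where a: "pivot r (rowset (cdim X d)) (R_mat X g (cdim X d)) x a" "r b a"
    using lazy_pivot[OF L x(1) d(1) x(3,2)] by blast
  then have "g a \<le> g x" using R_mat_le[OF x(1)] unfolding lead_def by blast
  then show "g b \<le> g x" using a(2) unfolding h_less_def by auto
  have "r x d" using lazy_upper[OF L x(1) d(1) x(3,2)] .
  then show "g x < g d" using x(1) unfolding h_less_def cells_of_dim_def by auto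
qed

end

section \<open>Reversing the path\<close>

text \<open>The list \<open>\<rho>\<close> runs from \<open>b\<close> to \<open>d\<close>, against
  the arcs; hence the reversals.\<close>

locale unique_path = filtered X g
  for X :: "'a lefschetz" and g :: "'a \<Rightarrow> real" +
  fixes b d :: 'a and \<rho> :: "'a list"
  assumes bC: "b \<in> Crit V" and dC: "d \<in> Crit V" and bd_dim: "cdim X d = cdim X b + 1"
    and path: "rev \<rho> \<in> paths X V d b" and uniq: "\<And>p. p \<in> paths X V d b \<Longrightarrow> p = rev \<rho>"
begin

definition m where "m = length \<rho> - 1"

lemma len: "length \<rho> = Suc m"
  using path unfolding paths_def m_def by (cases \<rho>) auto

lemma ends: "\<rho> ! 0 = b" "\<rho> ! m = d"
  using path len unfolding paths_def
  by (auto simp: hd_rev last_rev hd_conv_nth last_conv_nth m_def)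

lemma cells_path: "i \<le> m \<Longrightarrow> \<rho> ! i \<in> cells X"
  using path len nth_mem[of i \<rho>] unfolding paths_def by auto

lemma successively_path: "successively (\<lambda>x y. arc X V y x) \<rho>"
  using path unfolding paths_def by simp

lemma arc_path: "Suc i \<le> m \<Longrightarrow> arc X V (\<rho> ! Suc i) (\<rho> ! i)"
  using successively_nth[OF successively_path, of i] len by simp

lemma distinct_path: "distinct \<rho>"
  using paths_distinct(1)[OF path] by simp

lemma descends_path: "i < j \<Longrightarrow> j \<le> m \<Longrightarrow> descends (\<rho> ! j) (\<rho> ! i)"
  using paths_distinct(2)[OF path] sorted_wrt_nth_less[of "\<lambda>x y. descends y x" \<rho> i j] len
  by (simp add: sorted_wrt_rev)

lemma reaches_path: "i \<le> m \<Longrightarrow> reaches X V (\<rho> ! i) b"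
proof (induction i)
  case 0
  then show ?case using ends reaches_refl Crit_cells bC by simp
next
  case (Suc i)
  then show ?case using reaches_step[OF arc_path] by simp
qed

text \<open>The path is followed from \<open>d\<close>. A cell of the upper dimension that is not
  the lower cell of a vector is left downwards. From a cell of the dimension of \<open>b\<close> the
  path cannot descend further, since \<open>b\<close> is not reached from a lower dimension by
  \<open>reaches_dim\<close>; so it climbs a vector, whose upper cell is again not the lower cell of
  another one.\<close>

lemma shape_aux:
  "j \<le> m \<Longrightarrow> (even j \<longrightarrow> cdim X (\<rho> ! (m - j)) = cdim X b + 1 \<and> (\<forall>t. \<not> vec (\<rho> ! (m - j)) t)) \<and>
    (odd j \<longrightarrow> cdim X (\<rho> ! (m - j)) = cdim X b)"
proof (induction j)
  case 0
  then show ?case using ends bd_dim vec_not_Crit(1) dC by auto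
next
  case (Suc j)
  let ?y = "\<rho> ! (m - j)" and ?w = "\<rho> ! (m - Suc j)"
  have e: "Suc (m - Suc j) = m - j" using Suc.prems by simp
  have a: "arc X V ?y ?w" using arc_path[of "m - Suc j"] Suc.prems e by auto
  show ?case
  proof (cases "even j")
    case True
    then have y: "cdim X ?y = cdim X b + 1" "\<not> vec ?y ?w" using Suc by auto
    then have "facet X ?w ?y" using a unfolding arc_iff by blast
    then show ?thesis using facet_dim[of ?w ?y] y True by auto
  next
    case False
    then have y: "cdim X ?y = cdim X b" using Suc by auto
    have "\<not> facet X ?w ?y"
    proof
      assume f: "facet X ?w ?y"
      have "cdim X b \<le> cdim X ?w" using reaches_dim[OF reaches_path bC, of "m - Suc j"] by simp
      then show False using facet_dim[OF f] y by simp
    qed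
    then have v: "vec ?y ?w" using a unfolding arc_iff by blast
    then have "cdim X ?w = cdim X b + 1" using facet_dim[of ?y ?w] y unfolding vec_def by simp
    then show ?thesis using vec_asym[OF v] False by auto
  qed
qed

lemma odd_m: "odd m"
proof (rule ccontr)
  assume "\<not> odd m"
  then show False using shape_aux[of m] ends by auto
qed

lemma dim_path: "i \<le> m \<Longrightarrow> cdim X (\<rho> ! i) = (if even i then cdim X b else cdim X b + 1)"
  using shape_aux[of "m - i"] odd_m by auto

lemma vec_path: "Suc i \<le> m \<Longrightarrow> odd i \<Longrightarrow> vec (\<rho> ! Suc i) (\<rho> ! i)"
  using arc_path[of i] dim_path[of i] dim_path[of "Suc i"] facet_dim[of "\<rho> ! i" "\<rho> ! Suc i"]
  unfolding arc_iff by auto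

lemma facet_path: "Suc i \<le> m \<Longrightarrow> even i \<Longrightarrow> facet X (\<rho> ! i) (\<rho> ! Suc i) \<and> g (\<rho> ! i) < g (\<rho> ! Suc i)"
  using arc_path[of i] dim_path[of i] dim_path[of "Suc i"] facet_dim[of "\<rho> ! Suc i" "\<rho> ! i"]
  unfolding arc_iff vec_def by auto

lemma index_unique: "i \<le> m \<Longrightarrow> j \<le> m \<Longrightarrow> \<rho> ! i = \<rho> ! j \<Longrightarrow> i = j"
  using distinct_path len by (simp add: nth_eq_iff_index_eq)

text \<open>Any other incidence between two cells of the path would give a shortcut and hence a second path.\<close>

lemma facet_within_path:
  assumes "i \<le> m" "j \<le> m" and f: "facet X (\<rho> ! i) (\<rho> ! j)"
  shows "even i" "odd j" "j = Suc i \<or> i = Suc j"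
proof -
  show par: "even i" "odd j"
    using facet_dim[OF f] dim_path[OF assms(1)] dim_path[OF assms(2)] by (auto split: if_splits)
  show "j = Suc i \<or> i = Suc j"
  proof (cases "vec (\<rho> ! i) (\<rho> ! j)")
    case True
    then have "j \<noteq> m" using ends vec_not_Crit(2) dC by metis
    then have j: "Suc j \<le> m" using assms(2) by simp
    have "\<rho> ! Suc j = \<rho> ! i"
      using vec_unique[OF True, of "\<rho> ! Suc j"] vec_path[OF j par(2)] True vec_cells[of "\<rho> ! Suc j" "\<rho> ! j"]
      unfolding vec_def by auto
    then show ?thesis using index_unique[OF j assms(1)] by auto
  next
    case False
    then have a: "arc X V (\<rho> ! j) (\<rho> ! i)" using f facet_le[OF f] unfolding arc_iff vec_def by auto
    have "i < j"
    proof (rule ccontr)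
      assume "\<not> i < j"
      moreover have "i \<noteq> j" using par by auto
      ultimately have "descends (\<rho> ! i) (\<rho> ! j)" using descends_path[of j i] assms by simp
      then show False using arc_descends[OF a] descends_trans descends_irrefl by blast
    qed
    show ?thesis
    proof (rule ccontr)
      assume "\<not> ?thesis"
      then have ij: "Suc i < j" using \<open>i < j\<close> by simp
      let ?q = "rev (take (Suc i) \<rho> @ drop j \<rho>)"
      have "successively (\<lambda>x y. arc X V y x) (take (Suc i) \<rho> @ drop (Suc i) \<rho>)"
        "successively (\<lambda>x y. arc X V y x) (take j \<rho> @ drop j \<rho>)" using successively_path by simp_all
      then have s: "successively (\<lambda>x y. arc X V y x) (take (Suc i) \<rho>)"
        "successively (\<lambda>x y. arc X V y x) (drop j \<rho>)"
        unfolding successively_append_iff by blast+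
      have ends': "last (take (Suc i) \<rho>) = \<rho> ! i" "hd (drop j \<rho>) = \<rho> ! j"
        "last (drop j \<rho>) = d" "take (Suc i) \<rho> \<noteq> []" "drop j \<rho> \<noteq> []"
        using assms len ends by (auto simp: take_Suc_conv_app_nth hd_drop_conv_nth last_drop last_conv_nth)
      have hd: "hd (take (Suc i) \<rho>) = b" using ends len by (cases \<rho>) auto
      have "set (take (Suc i) \<rho> @ drop j \<rho>) \<subseteq> cells X"
        using path set_take_subset[of "Suc i" \<rho>] set_drop_subset[of j \<rho>] unfolding paths_def by auto
      then have "?q \<in> paths X V d b"
        using s ends' hd a unfolding paths_def successively_rev mem_Collect_eq successively_append_iff
        by (auto simp: hd_rev last_rev hd_append)
      then have "length ?q = length \<rho>" using uniq by (metis length_rev)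
      then show False using ij assms len by simp
    qed
  qed
qed

lemma values_increase:
  assumes "i < j" "j \<le> m" "odd i" "odd j" shows "g (\<rho> ! i) < g (\<rho> ! j)"
  using descends_path[OF assms(1,2)] dim_path[of i] dim_path[of j] assms unfolding descends_def by auto

abbreviation h' where "h' \<equiv> reverse_values \<rho> g"

lemma h'_path: "i \<le> m \<Longrightarrow> h' (\<rho> ! i) = g (\<rho> ! (m - 2 * (i div 2)))"
proof -
  assume i: "i \<le> m"
  have "(THE j. j < length \<rho> \<and> \<rho> ! j = \<rho> ! i) = i"
    using i len index_unique by (intro the_equality) auto
  then show ?thesis using i len nth_mem[of i \<rho>] unfolding reverse_values_def by simp
qed

lemma h'_out: "x \<notin> set \<rho> \<Longrightarrow> h' x = g x"
  unfolding reverse_values_def by (simp add: Let_def)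

lemma set_path: "x \<in> set \<rho> \<longleftrightarrow> (\<exists>i\<le>m. x = \<rho> ! i)"
  using len by (auto simp: in_set_conv_nth less_Suc_eq_le)

text \<open>As \<open>m\<close> is odd, \<open>m - 2 * (i div 2)\<close> is an odd position and
  holds an upper cell. The values of these cells increase strictly along \<open>\<rho>\<close>, so
  \<open>h'\<close> is constant on the positions \<open>2 * j\<close> and \<open>2 * j + 1\<close>
  and decreases with \<open>j\<close>.\<close>

lemma h'_eq_iff:
  assumes "i \<le> m" "j \<le> m"
  shows "h' (\<rho> ! i) \<le> h' (\<rho> ! j) \<longleftrightarrow> j div 2 \<le> i div 2" "h' (\<rho> ! i) = h' (\<rho> ! j) \<longleftrightarrow> i div 2 = j div 2"
proof -
  have odd: "odd (m - 2 * (i div 2))" if "i \<le> m" for i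
    using odd_m that by (simp add: even_diff_nat)
  have le: "2 * (i div 2) < m" if "i \<le> m" for i using odd_m that by (cases "i = m") (auto elim!: oddE)
  have less: "h' (\<rho> ! i) < h' (\<rho> ! j)" if ij: "i \<le> m" "j \<le> m" "j div 2 < i div 2" for i j
    unfolding h'_path[OF ij(1)] h'_path[OF ij(2)]
    by (rule values_increase) (use odd[OF ij(1)] odd[OF ij(2)] le[OF ij(1)] ij in auto)
  have eq: "h' (\<rho> ! i) = h' (\<rho> ! j)" if "i \<le> m" "j \<le> m" "i div 2 = j div 2" for i j
    using h'_path that by simp
  show "h' (\<rho> ! i) \<le> h' (\<rho> ! j) \<longleftrightarrow> j div 2 \<le> i div 2" "h' (\<rho> ! i) = h' (\<rho> ! j) \<longleftrightarrow> i div 2 = j div 2"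
    using less[OF assms] less[OF assms(2,1)] eq[OF assms] by (cases "i div 2" "j div 2" rule: linorder_cases; simp)+
qed

end

locale path_reversal = unique_path +
  assumes interval: "{x \<in> cells X. g b \<le> g x \<and> g x \<le> g d} = set \<rho>"
    and m_bd: "matched_cells b d"
begin

lemma inside: "x \<in> set \<rho> \<Longrightarrow> g b \<le> g x \<and> g x \<le> g d"
  using interval by blast

lemma outside: "x \<in> cells X \<Longrightarrow> x \<notin> set \<rho> \<Longrightarrow> g x < g b \<or> g d < g x"
  using interval by force

lemma h'_range: "x \<in> set \<rho> \<Longrightarrow> g b < h' x \<and> h' x \<le> g d"
proof -
  assume "x \<in> set \<rho>"
  then obtain i where i: "i \<le> m" "x = \<rho> ! i" using set_path by blast
  let ?j = "m - 2 * (i div 2)"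
  have j: "?j \<le> m" "odd ?j" using odd_m i(1) by (simp_all add: even_diff_nat)
  then have jin: "\<rho> ! ?j \<in> set \<rho>" using set_path by blast
  have "g (\<rho> ! ?j) \<noteq> g b"
  proof
    assume "g (\<rho> ! ?j) = g b"
    then have "\<rho> ! ?j = \<rho> ! 0" using Crit_value[OF bC cells_path[OF j(1)]] ends by simp
    then show False using index_unique[OF j(1), of 0] j(2) by simp
  qed
  then show ?thesis using inside[OF jin] h'_path[OF i(1)] i(2) by simp
qed

lemma h'_fibre_in: "i \<le> m \<Longrightarrow> {y \<in> cells X. h' y = h' (\<rho> ! i)} = {\<rho> ! (2 * (i div 2)), \<rho> ! (2 * (i div 2) + 1)}"
proof -
  assume i: "i \<le> m"
  have i2: "2 * (i div 2) + 1 \<le> m" using i odd_m by (cases "i = m") (auto elim!: oddE)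
  have ri: "\<rho> ! i \<in> set \<rho>" using i set_path by blast
  show ?thesis
  proof (intro set_eqI iffI)
    fix y assume y: "y \<in> {y \<in> cells X. h' y = h' (\<rho> ! i)}"
    have "y \<in> set \<rho>"
    proof (rule ccontr)
      assume n: "y \<notin> set \<rho>"
      then show False using h'_range[OF ri] h'_out[OF n] outside[of y] y by auto
    qed
    then obtain j where j: "j \<le> m" "y = \<rho> ! j" using set_path by blast
    then have "j div 2 = i div 2" using h'_eq_iff(2)[OF j(1) i] y by simp
    then have "j = 2 * (i div 2) \<or> j = 2 * (i div 2) + 1" by presburger
    then show "y \<in> {\<rho> ! (2 * (i div 2)), \<rho> ! (2 * (i div 2) + 1)}" using j by auto
  next
    fix y assume "y \<in> {\<rho> ! (2 * (i div 2)), \<rho> ! (2 * (i div 2) + 1)}"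
    moreover have "2 * (i div 2) \<le> m \<and> 2 * (i div 2) div 2 = i div 2"
      "2 * (i div 2) + 1 \<le> m \<and> (2 * (i div 2) + 1) div 2 = i div 2" using i2 by auto
    ultimately obtain j where j: "j \<le> m" "y = \<rho> ! j" "j div 2 = i div 2" by blast
    then show "y \<in> {y \<in> cells X. h' y = h' (\<rho> ! i)}" using h'_eq_iff(2)[OF j(1) i] cells_path by auto
  qed
qed

lemma h'_fibre_out:
  "x \<in> cells X \<Longrightarrow> x \<notin> set \<rho> \<Longrightarrow> {y \<in> cells X. h' y = h' x} = {y \<in> cells X. g y = g x}"
proof -
  assume x: "x \<in> cells X" "x \<notin> set \<rho>"
  have "h' y = h' x \<longleftrightarrow> g y = g x" if y: "y \<in> cells X" for y
  proof (cases "y \<in> set \<rho>")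
    case True
    then show ?thesis using h'_range[OF True] inside[OF True] h'_out[OF x(2)] outside[OF x] by auto
  next
    case False
    then show ?thesis using h'_out x(2) by simp
  qed
  then show ?thesis by blast
qed

lemma h'_vec: "2 * j + 1 \<le> m \<Longrightarrow> facet X (\<rho> ! (2 * j)) (\<rho> ! (2 * j + 1)) \<and> h' (\<rho> ! (2 * j)) = h' (\<rho> ! (2 * j + 1))"
  using facet_path[of "2 * j"] h'_eq_iff(2)[of "2 * j" "2 * j + 1"] by simp

lemma dMf_h': "dMf X h'"
  unfolding dMf_def
proof (intro conjI ballI impI allI)
  fix x y assume xy: "x \<in> cells X" "y \<in> cells X" "inc X x y = 1"
  then have f: "facet X x y" using inc_eq_1 by blast
  note le = facet_le[OF f]
  show "h' x \<le> h' y"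
  proof (cases "x \<in> set \<rho>"; cases "y \<in> set \<rho>")
    assume "x \<in> set \<rho>" "y \<in> set \<rho>"
    then obtain i j where ij: "i \<le> m" "j \<le> m" "x = \<rho> ! i" "y = \<rho> ! j" using set_path by metis
    \<comment> \<open>Incident cells are neighbours on the path. With the facet at an even position
      the quotient \<open>i div 2\<close> of the facet is not smaller than that of the cofacet, and
      \<open>h'\<close> decreases in this quotient.\<close>
    have fi: "even i" "odd j" "j = Suc i \<or> i = Suc j" using facet_within_path[OF ij(1,2)] f ij by auto
    then have "j div 2 \<le> i div 2" by (auto elim!: evenE oddE)
    then show ?thesis using h'_eq_iff(1)[OF ij(1,2)] ij by simp
  next
    assume a: "x \<in> set \<rho>" "y \<notin> set \<rho>"
    then show ?thesis using h'_range[OF a(1)] inside[OF a(1)] h'_out[OF a(2)] outside[OF xy(2) a(2)] le by auto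
  next
    assume a: "x \<notin> set \<rho>" "y \<in> set \<rho>"
    then show ?thesis using h'_range[OF a(2)] inside[OF a(2)] h'_out[OF a(1)] outside[OF xy(1) a(1)] le by auto
  next
    assume "x \<notin> set \<rho>" "y \<notin> set \<rho>"
    then show ?thesis using h'_out le by simp
  qed
next
  fix x y assume xy: "x \<in> cells X" "y \<in> cells X" "x \<noteq> y \<and> h' x = h' y"
  show "inc X x y = 1 \<or> inc X y x = 1"
  proof (cases "x \<in> set \<rho>")
    case True
    then obtain i where i: "i \<le> m" "x = \<rho> ! i" using set_path by blast
    have i2: "2 * (i div 2) + 1 \<le> m" using i odd_m by (cases "i = m") (auto elim!: oddE)
    have "x \<in> {y \<in> cells X. h' y = h' (\<rho> ! i)}" "y \<in> {y \<in> cells X. h' y = h' (\<rho> ! i)}" using xy i by auto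
    then have "{x, y} = {\<rho> ! (2 * (i div 2)), \<rho> ! (2 * (i div 2) + 1)}"
      using h'_fibre_in[OF i(1)] xy(3) by auto
    then show ?thesis using h'_vec[OF i2] inc_eq_1 xy(1,2) by (auto simp: doubleton_eq_iff)
  next
    case False
    have "y \<in> {y \<in> cells X. g y = g x}" using h'_fibre_out[OF xy(1) False] xy by auto
    then show ?thesis using same_value[of x y] xy inc_eq_1 unfolding vec_def by auto
  qed
next
  fix a
  show "card {x \<in> cells X. h' x = a} \<le> 2"
  proof (cases "\<exists>x\<in>cells X. h' x = a")
    case True
    then obtain x where x: "x \<in> cells X" "h' x = a" by blast
    show ?thesis
    proof (cases "x \<in> set \<rho>")
      case True
      then obtain i where i: "i \<le> m" "x = \<rho> ! i" using set_path by blast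
      show ?thesis using h'_fibre_in[OF i(1)] x(2) i(2) card_2_iff'[of "{\<rho> ! (2 * (i div 2)), \<rho> ! (2 * (i div 2) + 1)}"]
        card_insert_le_m1[of 2 "{\<rho> ! (2 * (i div 2) + 1)}" "\<rho> ! (2 * (i div 2))"] by simp
    next
      case False
      then show ?thesis using h'_fibre_out[OF x(1) False] x(2) g unfolding dMf_def by auto
    qed
  next
    case False
    then have e: "{x \<in> cells X. h' x = a} = {}" by blast
    show ?thesis unfolding e by simp
  qed
qed

lemma Crit_path: "x \<in> Crit V \<Longrightarrow> x \<in> set \<rho> \<Longrightarrow> x = b \<or> x = d"
proof -
  assume x: "x \<in> Crit V" "x \<in> set \<rho>"
  then obtain i where i: "i \<le> m" "x = \<rho> ! i" using set_path by blast
  show ?thesis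
  proof (rule ccontr)
    assume n: "\<not> ?thesis"
    then have i0: "i \<noteq> 0" "i \<noteq> m" using i ends by metis+
    show False
    proof (cases "even i")
      case True
      then obtain j where "i = Suc j" "odd j" using i0(1) by (cases i) auto
      then show False using vec_path[of j] i x vec_not_Crit(1) by auto
    next
      case False
      then show False using vec_path[of i] i i0 x vec_not_Crit(2) by auto
    qed
  qed
qed

lemma set_path_bd: "b \<in> set \<rho>" "d \<in> set \<rho>"
  using ends set_path by (metis le0, metis le_refl)

lemma fibre_field_h': "fibre_field X h' = reverse_field \<rho> (b, Some d) V"
proof (intro set_eqI iffI)
  fix S assume "S \<in> fibre_field X h'"
  then obtain x where x: "x \<in> cells X" "S = {y \<in> cells X. h' y = h' x}" unfolding fibre_field_def by blast
  show "S \<in> reverse_field \<rho> (b, Some d) V"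
  proof (cases "x \<in> set \<rho>")
    case True
    then obtain i where i: "i \<le> m" "x = \<rho> ! i" using set_path by blast
    have "2 * (i div 2) + 1 < length \<rho>" using i odd_m len by (cases "i = m") (auto elim!: oddE)
    moreover have "S = {\<rho> ! (2 * (i div 2)), \<rho> ! (2 * (i div 2) + 1)}" using h'_fibre_in[OF i(1)] x i by simp
    ultimately show ?thesis unfolding reverse_field_def by blast
  next
    case False
    have S: "S = {y \<in> cells X. g y = g x}" using x h'_fibre_out[OF x(1) False] by simp
    then have "S \<in> V" "x \<in> S" using x(1) unfolding fibre_field_def by auto
    then show ?thesis using False set_path_bd unfolding reverse_field_def by auto
  qed
next
  fix S assume S: "S \<in> reverse_field \<rho> (b, Some d) V"
  show "S \<in> fibre_field X h'"
  proof (cases "\<exists>j. 2 * j + 1 < length \<rho> \<and> S = {\<rho> ! (2 * j), \<rho> ! (2 * j + 1)}")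
    case True
    then obtain j where "2 * j + 1 < length \<rho>" and S2: "S = {\<rho> ! (2 * j), \<rho> ! (2 * j + 1)}" by blast
    then have j: "2 * j + 1 \<le> m" "S = {\<rho> ! (2 * j), \<rho> ! (2 * j + 1)}" using len by auto
    then have "S = {y \<in> cells X. h' y = h' (\<rho> ! (2 * j))}" using h'_fibre_in[of "2 * j"] by simp
    then show ?thesis using cells_path[of "2 * j"] j unfolding fibre_field_def by auto
  next
    case False
    then have S': "S \<in> V" "\<not> (card S = 2 \<and> S \<subseteq> set \<rho>)" "S \<noteq> {b}" "S \<noteq> {d}"
      using S unfolding reverse_field_def by auto
    then obtain x where x: "x \<in> cells X" "S = {y \<in> cells X. g y = g x}" unfolding fibre_field_def by blast
    have "x \<notin> set \<rho>"
    proof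
      assume xp: "x \<in> set \<rho>"
      have sub: "S \<subseteq> set \<rho>"
      proof
        fix y assume "y \<in> S"
        then have "y \<in> cells X" "g y = g x" using x(2) by blast+
        then have "y \<in> {x \<in> cells X. g b \<le> g x \<and> g x \<le> g d}" using inside[OF xp] by simp
        then show "y \<in> set \<rho>" unfolding interval .
      qed
      show False
      proof (cases "x \<in> Crit V")
        case True
        then have "S = {x}" using x Crit_value by blast
        then show False using Crit_path[OF True xp] S'(3,4) by blast
      next
        case False
        then obtain y where y: "vec x y \<or> vec y x" using not_Crit_vec x(1) by blast
        from y obtain u w where uw: "vec u w" "x = u \<or> x = w" by blast
        have "g u = g x" using uw unfolding vec_def by auto
        moreover have "g w = g u" using uw(1) unfolding vec_def by simp
        ultimately have "S = {u, w}" "u \<noteq> w"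
          using x(2) vec_unique[OF uw(1)] vec_cells[OF uw(1)] by auto
        then show False using S'(2) sub by simp
      qed
    qed
    then show ?thesis using h'_fibre_out[OF x(1)] x unfolding fibre_field_def by blast
  qed
qed

end

context filtered
begin

lemma vec_iff: "vec x y \<longleftrightarrow> facet X x y \<and> {x, y} \<in> V"
proof (cases "facet X x y")
  case True
  then have "x \<noteq> y" "\<not> vec y x" using facet_irrefl facet_asym[of x y] unfolding vec_def by auto
  then show ?thesis using fibre_doubleton[of x y] True by blast
qed (simp add: vec_def)

text \<open>The right-hand side depends on the values only through the pairs and the vector field,
  both of which the moves preserve.\<close>

lemma off_diagonal_iff:
  "\<beta> \<in> off_diagonal g (BD X g) \<longleftrightarrow> \<beta> \<in> BD X g \<and> (fst \<beta> \<in> Crit V)"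
proof -
  obtain x o' where \<beta>: "\<beta> = (x, o')" by fastforce
  show ?thesis
  proof (cases o')
    case None
    have "x \<in> Crit V" if p: "(x, None) \<in> BD X g"
    proof (rule ccontr)
      assume "x \<notin> Crit V"
      then obtain y where "vec x y \<or> vec y x" using not_Crit_vec[of x] p unfolding BD_None by blast
      then have "matched_cells x y \<or> matched_cells y x" using vec_matched[of x y] vec_matched[of y x] by blast
      then show False using p unfolding BD_None by blast
    qed
    then show ?thesis unfolding \<beta> None off_diagonal_def birth_value_def death_value_def by auto
  next
    case (Some y)
    have "g x \<noteq> g y \<longleftrightarrow> x \<in> Crit V" if m: "matched_cells x y"
    proof
      assume "g x \<noteq> g y"
      then show "x \<in> Crit V" using matched_not_Crit[OF m] unfolding vec_def by blast
    next
      assume x: "x \<in> Crit V"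
      then show "g x \<noteq> g y"
        using Crit_value[OF x, of y] matched_dims(2,4)[OF m] by auto
    qed
    then show ?thesis
      unfolding \<beta> Some off_diagonal_def birth_value_def death_value_def by (auto simp: BD_Some)
  qed
qed

end

context path_reversal
begin

definition A where "A = {\<rho> ! i | i. i \<le> m \<and> even i}"
definition B where "B = {\<rho> ! i | i. i \<le> m \<and> odd i}"

lemma AB_path: "A \<union> B = set \<rho>"
  unfolding A_def B_def set_eq_iff Un_iff set_path by blast

lemma A_dim: "x \<in> A \<Longrightarrow> x \<in> cells_of_dim X (cdim X b)"
  and B_dim: "x \<in> B \<Longrightarrow> x \<in> cells_of_dim X (cdim X b + 1)"
  unfolding A_def B_def cells_of_dim_def using cells_path dim_path by auto

sublocale H: filtered X h'
  using X dMf_h' by unfold_locales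

lemma A_matched: "a \<in> A \<Longrightarrow> \<exists>y\<in>B. matched_cells a y"
proof -
  assume "a \<in> A"
  then obtain i where i: "i \<le> m" "even i" "a = \<rho> ! i" unfolding A_def by blast
  show ?thesis
  proof (cases i)
    case 0
    then show ?thesis using i(3) m_bd ends odd_m unfolding B_def by auto
  next
    case (Suc j)
    then have "vec (\<rho> ! i) (\<rho> ! j)" "\<rho> ! j \<in> B" using vec_path[of j] i unfolding B_def by auto
    then show ?thesis using vec_matched i(3) by blast
  qed
qed

lemma B_matched: "y \<in> B \<Longrightarrow> \<exists>a\<in>A. matched_cells a y"
proof -
  assume "y \<in> B"
  then obtain i where i: "i \<le> m" "odd i" "y = \<rho> ! i" unfolding B_def by blast
  show ?thesis
  proof (cases "i = m")
    case True
    have "b \<in> A" using ends(1) unfolding A_def by force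
    then show ?thesis using True i(3) m_bd ends(2) by metis
  next
    case False
    then have "vec (\<rho> ! Suc i) (\<rho> ! i)" "\<rho> ! Suc i \<in> A"
      using vec_path[of i] i unfolding A_def by (simp, auto)
    then show ?thesis using vec_matched i(3) by blast
  qed
qed

lemma A_vec: "a \<in> A \<Longrightarrow> \<exists>y\<in>B. H.vec a y"
proof -
  assume "a \<in> A"
  then obtain j where j: "2 * j \<le> m" "a = \<rho> ! (2 * j)" unfolding A_def by (auto elim!: evenE)
  then have j1: "2 * j + 1 \<le> m" using odd_m by (cases "2 * j = m") (use odd_m in presburger, simp)
  have "\<rho> ! (2 * j + 1) \<in> B" unfolding B_def using j1 by auto
  then show ?thesis using h'_vec[OF j1] j(2) unfolding H.vec_def by blast
qed

lemma B_vec: "y \<in> B \<Longrightarrow> \<exists>a\<in>A. H.vec a y"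
proof -
  assume "y \<in> B"
  then obtain j where j: "2 * j + 1 \<le> m" "y = \<rho> ! (2 * j + 1)" unfolding B_def by (auto elim!: oddE)
  have "\<rho> ! (2 * j) \<in> A" unfolding A_def using j by auto
  then show ?thesis using h'_vec[OF j(1)] j(2) unfolding H.vec_def by blast
qed

lemma path_parts:
  assumes "x \<in> cells X" "g b \<le> g x" "g x \<le> g d"
  shows "cdim X x = cdim X b \<Longrightarrow> x \<in> A" "cdim X x = cdim X b + 1 \<Longrightarrow> x \<in> B"
proof -
  have "x \<in> set \<rho>" using assms interval by blast
  then obtain i where i: "i \<le> m" "x = \<rho> ! i" using set_path by blast
  then show "cdim X x = cdim X b \<Longrightarrow> x \<in> A" "cdim X x = cdim X b + 1 \<Longrightarrow> x \<in> B"
    using dim_path[OF i(1)] unfolding A_def B_def by (auto split: if_splits)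
qed

text \<open>The columns used to reduce a column of the path have values between those of
  \<open>b\<close> and \<open>d\<close>, and by \<open>interval\<close> such cells are on the
  path.\<close>

lemma span_B:
  assumes "y \<in> B" "x \<in> cells_of_dim X (cdim X b + 1)" "U_mat X g (cdim X b + 1) x y = 1"
  shows "x \<in> B"
proof (cases "x = y")
  case False
  have y: "cdim X y = cdim X b + 1" using B_dim[OF assms(1)] unfolding cells_of_dim_def by simp
  obtain a where a: "a \<in> A" "matched_cells a y" using B_matched assms(1) by blast
  have "g a \<le> g x" "g x < g y" using U_span[OF a(2), of x] assms(2,3) False unfolding y by auto
  moreover have "g b \<le> g a" "g y \<le> g d" using a(1) assms(1) AB_path inside by blast+
  ultimately show ?thesis using path_parts(2)[of x] assms(2) unfolding cells_of_dim_def by auto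
qed (use assms in simp)

lemma separated:
  assumes "z \<in> cells X" "z \<notin> A \<union> B"
  shows "(\<forall>x\<in>A \<union> B. g z < g x \<and> g z < h' x) \<or> (\<forall>x\<in>A \<union> B. g x < g z \<and> h' x < g z)"
proof -
  have "z \<notin> set \<rho>" using assms AB_path by blast
  then show ?thesis using outside[OF assms(1)] inside h'_range AB_path by fastforce
qed

sublocale BR: block_reversal X g h' A B "cdim X b"
proof unfold_locales
  show "A \<subseteq> cells_of_dim X (cdim X b)" "B \<subseteq> cells_of_dim X (cdim X b + 1)" using A_dim B_dim by blast+
  show "h' z = g z" if "z \<notin> A \<union> B" for z using that AB_path h'_out by blast
qed (fact separated A_matched B_matched A_vec B_vec span_B)+

text \<open>In the dual the cells of \<open>B\<close> are the lower ones. Their dimension is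
  computed by a subtraction which is exact because the cell \<open>d\<close> of dimension
  \<open>cdim X b + 1\<close> exists.\<close>

lemma dual_block: "block_reversal (dual X) (\<lambda>x. - g x) (\<lambda>x. - h' x) B A (Max (cdim X ` cells X) - cdim X b - 1)"
proof -
  let ?N = "Max (cdim X ` cells X)"
  interpret D: filtered "dual X" "\<lambda>x. - g x" by (rule dual_filtered)
  interpret DH: filtered "dual X" "\<lambda>x. - h' x" by (rule H.dual_filtered)
  have N: "cdim X b + 1 \<le> ?N"
    using filtered_pair.dim_le_Max[OF pair, of d] Crit_cells dC bd_dim by auto
  have dims: "cells_of_dim X (cdim X b + 1) = cells_of_dim (dual X) (?N - cdim X b - 1)"
    "cells_of_dim X (cdim X b) = cells_of_dim (dual X) (?N - cdim X b - 1 + 1)"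
  proof -
    have "cdim X y = cdim X b + 1 \<longleftrightarrow> cdim (dual X) y = ?N - cdim X b - 1"
      "cdim X y = cdim X b \<longleftrightarrow> cdim (dual X) y = ?N - cdim X b - 1 + 1" if "y \<in> cells X" for y
      using cdim_dual[OF that] N by auto
    then show "cells_of_dim X (cdim X b + 1) = cells_of_dim (dual X) (?N - cdim X b - 1)"
      "cells_of_dim X (cdim X b) = cells_of_dim (dual X) (?N - cdim X b - 1 + 1)"
      unfolding cells_of_dim_def dual_simps by blast+
  qed
  show ?thesis
  proof unfold_locales
    show "B \<subseteq> cells_of_dim (dual X) (?N - cdim X b - 1)" "A \<subseteq> cells_of_dim (dual X) (?N - cdim X b - 1 + 1)"
      using A_dim B_dim unfolding dims by blast+
    show "- h' z = - g z" if "z \<notin> B \<union> A" for z using that AB_path h'_out by auto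
    show "(\<forall>x\<in>B \<union> A. - g z < - g x \<and> - g z < - h' x) \<or> (\<forall>x\<in>B \<union> A. - g x < - g z \<and> - h' x < - g z)"
      if "z \<in> cells (dual X)" "z \<notin> B \<union> A" for z
      using separated[of z] that by auto
    show "\<exists>y\<in>A. D.matched_cells a y" if "a \<in> B" for a using B_matched[OF that] matched_dual by blast
    show "\<exists>a\<in>B. D.matched_cells a y" if "y \<in> A" for y using A_matched[OF that] matched_dual by blast
    show "\<exists>y\<in>A. DH.vec a y" if "a \<in> B" for a
      using B_vec[OF that] unfolding DH.vec_def H.vec_def by auto
    show "\<exists>a\<in>B. DH.vec a y" if "y \<in> A" for y
      using A_vec[OF that] unfolding DH.vec_def H.vec_def by auto
    show "x \<in> A" if y: "y \<in> A" and x: "x \<in> cells_of_dim (dual X) (?N - cdim X b - 1 + 1)"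
      and u: "U_mat (dual X) (\<lambda>x. - g x) (?N - cdim X b - 1 + 1) x y = 1" for x y
    proof (cases "x = y")
      case False
      have dy: "cdim (dual X) y = ?N - cdim X b - 1 + 1"
        using A_dim[OF y, unfolded dims(2)] unfolding cells_of_dim_def by blast
      obtain a where a: "a \<in> B" "D.matched_cells a y" using A_matched[OF y] matched_dual by blast
      have "g x \<le> g a" "g y < g x" using D.U_span[OF a(2), of x] x u False unfolding dy by auto
      moreover have "g b \<le> g y" "g a \<le> g d" using a(1) y AB_path inside by blast+
      moreover have "x \<in> cells X" "cdim X x = cdim X b" using x[folded dims(2)] unfolding cells_of_dim_def by auto
      ultimately show ?thesis using path_parts(1)[of x] by auto
    qed (use y in simp)
  qed
qed

lemma U_reversed:
  assumes "x \<in> cells_of_dim X n" "y \<in> cells_of_dim X n" "x \<notin> set \<rho>" "y \<notin> set \<rho>"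
  shows "U_mat X h' n x y = U_mat X g n x y"
  by (rule BR.boundary_outside(1)[OF assms(2) _ assms(1)]) (use assms AB_path in auto)

lemma W_reversed:
  assumes "x \<in> cells_of_dim X n" "y \<in> cells_of_dim X n" "x \<notin> set \<rho>" "y \<notin> set \<rho>"
  shows "U_perp_mat X h' n x y = U_perp_mat X g n x y"
proof -
  let ?N = "Max (cdim X ` cells X)"
  have n: "n \<le> ?N" using assms(1) filtered_pair.dim_le_Max[OF pair, of x] unfolding cells_of_dim_def by auto
  have s: "cells_of_dim (dual X) (?N - n) = cells_of_dim X n"
    using filtered_pair.dual_dim_sets(1)[OF pair n] .
  have "U_mat (dual X) (\<lambda>x. - h' x) (?N - n) x y = U_mat (dual X) (\<lambda>x. - g x) (?N - n) x y"
    by (rule block_reversal.boundary_outside(1)[OF dual_block])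
      (use assms AB_path s in auto)
  then show ?thesis using U_perp_dual[OF assms(1,2)] H.U_perp_dual[OF assms(1,2)] by simp
qed

lemma matched_reversed:
  assumes "y \<in> cells X"
  shows "H.matched_cells a y \<longleftrightarrow> (if y \<in> set \<rho> then H.vec a y else matched_cells a y)"
proof (cases "y \<in> set \<rho>")
  case True
  have "H.vec a y" if m: "H.matched_cells a y"
  proof -
    have "y \<notin> A"
    proof
      assume "y \<in> A"
      then obtain z where "H.vec y z" using A_vec by blast
      then show False using H.matched_chain[OF H.vec_matched m] by blast
    qed
    then obtain c where c: "H.vec c y" using B_vec True AB_path by blast
    then have "a = c" using H.matched_fun[OF m H.vec_matched[OF c]] by blast
    then show ?thesis using c by simp
  qed
  then show ?thesis using True H.vec_matched by auto
next
  case False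
  have "y \<in> cells_of_dim X (cdim X y)" using assms unfolding cells_of_dim_def by simp
  then show ?thesis using BR.boundary_outside(2)[of y "cdim X y" a] False AB_path by auto
qed

lemma Crit_reversed: "Crit (fibre_field X h') = Crit V - {b, d}"
proof (intro set_eqI)
  fix x
  show "x \<in> Crit (fibre_field X h') \<longleftrightarrow> x \<in> Crit V - {b, d}"
  proof (cases "x \<in> set \<rho>")
    case True
    then have "x \<notin> Crit (fibre_field X h')"
      using A_vec B_vec H.vec_not_Crit AB_path by (metis UnE)
    then show ?thesis using Crit_path True by blast
  next
    case False
    then have "x \<in> Crit (fibre_field X h') \<longleftrightarrow> x \<in> Crit V"
      using h'_fibre_out[OF _ False] Crit_value H.Crit_value Crit_cells H.Crit_cells
      unfolding Crit_iff H.Crit_iff by (metis (mono_tags, lifting) mem_Collect_eq)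
    then show ?thesis using False set_path_bd by blast
  qed
qed

lemma off_path:
  assumes "x \<in> Crit V" "x \<noteq> b" "x \<noteq> d"
  shows "x \<notin> set \<rho>" "h' x = g x"
  using Crit_path[OF assms(1)] assms h'_out by auto

lemma pair_reversed:
  assumes "x \<in> Crit V" "x \<noteq> b" "x \<noteq> d"
  shows "H.matched_cells x y \<longleftrightarrow> matched_cells x y" "H.matched_cells y x \<longleftrightarrow> matched_cells y x"
proof -
  have x: "x \<notin> set \<rho>" "x \<in> cells X" using off_path[OF assms] Crit_cells assms(1) by auto
  then show "H.matched_cells y x \<longleftrightarrow> matched_cells y x" using matched_reversed[OF x(2), of y] by simp
  show "H.matched_cells x y \<longleftrightarrow> matched_cells x y"
  proof (cases "y \<in> cells X")
    case True
    have "\<not> H.vec x y" if "y \<in> set \<rho>"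
      using that x A_vec B_vec AB_path H.vec_asym H.vec_fun H.matched_fun H.vec_matched
      by (metis UnCI UnE)
    moreover have "\<not> matched_cells x y" if "y \<in> set \<rho>"
      using that x A_matched B_matched AB_path matched_chain matched_fun by (metis UnCI UnE)
    ultimately show ?thesis using matched_reversed[OF True, of x] by auto
  qed (use matched_dims(2)[of "cdim X x" x y] H.matched_dims(2)[of "cdim X x" x y] in blast)
qed

lemma off_diagonal_reversed: "off_diagonal h' (BD X h') = off_diagonal g (BD X g) - {(b, Some d)}"
proof (intro set_eqI)
  fix \<beta> :: "'a bd_pair"
  obtain x o' where \<beta>: "\<beta> = (x, o')" by fastforce
  show "\<beta> \<in> off_diagonal h' (BD X h') \<longleftrightarrow> \<beta> \<in> off_diagonal g (BD X g) - {(b, Some d)}"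
  proof (cases "x \<in> Crit V \<and> x \<noteq> b \<and> x \<noteq> d")
    case True
    then have "\<beta> \<in> BD X h' \<longleftrightarrow> \<beta> \<in> BD X g" unfolding \<beta>
      using pair_reversed[of x] Crit_cells
      by (cases o') (auto simp: BD_Some H.BD_Some BD_None H.BD_None)
    then show ?thesis
      using off_diagonal_iff[of \<beta>] H.off_diagonal_iff[of \<beta>] True \<beta> unfolding Crit_reversed by auto
  next
    case False
    have "(x, o') = (b, Some d)" if "(x, o') \<in> BD X g" "x = b \<or> x = d"
    proof (cases o')
      case None
      then show ?thesis using that m_bd BD_None by blast
    next
      case (Some y)
      then have "matched_cells x y" using that(1) BD_Some by blast
      then show ?thesis using that(2) m_bd matched_chain matched_inj Some by blast
    qed
    then show ?thesis
      using off_diagonal_iff[of \<beta>] H.off_diagonal_iff[of \<beta>] False \<beta> bC unfolding Crit_reversed by auto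
  qed
qed

lemma BD_reversed:
  "BD X h' = (off_diagonal g (BD X g) - {(b, Some d)}) \<union>
     {(x, Some y) | x y. facet X x y \<and> {x, y} \<in> reverse_field \<rho> (b, Some d) V}"
proof -
  have "BD X h' = off_diagonal h' (BD X h') \<union> {(x, Some y) | x y. H.vec x y}"
  proof (intro set_eqI)
    fix \<beta> :: "'a bd_pair"
    obtain x o' where \<beta>: "\<beta> = (x, o')" by fastforce
    show "\<beta> \<in> BD X h' \<longleftrightarrow> \<beta> \<in> off_diagonal h' (BD X h') \<union> {(x, Some y) | x y. H.vec x y}"
    proof (cases o')
      case None
      then show ?thesis unfolding \<beta> off_diagonal_def birth_value_def death_value_def by auto
    next
      case (Some y)
      show ?thesis
        using H.off_diagonal_iff[of \<beta>] H.matched_not_Crit[of "cdim X x" x y] H.vec_matched[of x y]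
        unfolding \<beta> Some by (auto simp: H.BD_Some)
    qed
  qed
  then show ?thesis unfolding off_diagonal_reversed H.vec_iff fibre_field_h' .
qed

end

section \<open>Running the algorithm\<close>

text \<open>\<open>w\<close> is the next element of \<open>F\<close> after \<open>c\<close>, or
  \<open>t\<close> if that comes first. Two points between \<open>c\<close> and \<open>w\<close> are
  produced because a move needs both \<open>\<delta>\<close> and \<open>\<xi>\<close> in an empty
  interval.\<close>

lemma gap_right:
  fixes c t :: real
  assumes "finite F" "c < t"
  obtains u v where "c < u" "u < v" "v < t" "\<And>z. z \<in> F \<Longrightarrow> z \<le> c \<or> v < z"
proof -
  define w where "w = Min (insert t {z \<in> F. c < z})"
  have fin: "finite (insert t {z \<in> F. c < z})" using assms(1) by simp
  have "w \<in> insert t {z \<in> F. c < z}" unfolding w_def using Min_in[OF fin] by blast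
  then have w: "c < w" using assms(2) by auto
  have le: "w \<le> z" if "z \<in> insert t {z \<in> F. c < z}" for z unfolding w_def using Min_le[OF fin that] .
  then have "w \<le> t" by blast
  show thesis
  proof (rule that)
    show "c < c + (w - c) / 3" "c + (w - c) / 3 < c + (w - c) / 2" "c + (w - c) / 2 < t"
      using w \<open>w \<le> t\<close> by (auto simp: field_simps)
    show "z \<le> c \<or> c + (w - c) / 2 < z" if "z \<in> F" for z
      using le[of z] that w by (cases "c < z") (auto simp: field_simps)
  qed
qed

lemma gap_left:
  fixes c t :: real
  assumes "finite F" "t < c"
  obtains u v where "t < u" "u < v" "v < c" "\<And>z. z \<in> F \<Longrightarrow> z < u \<or> c \<le> z"
proof -
  obtain u v where *: "- c < u" "u < v" "v < - t" "\<And>z. z \<in> uminus ` F \<Longrightarrow> z \<le> - c \<or> v < z"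
    using gap_right[of "uminus ` F" "- c" "- t"] assms by auto
  show thesis
  proof (rule that)
    show "t < - v" "- v < - u" "- u < c" using * by auto
    show "z < - v \<or> c \<le> z" if "z \<in> F" for z using *(4)[of "- z"] that by auto
  qed
qed

context filtered
begin

lemma matched_le:
  assumes "matched_cells x y" shows "g x \<le> g y"
proof -
  have "y \<in> cells_of_dim X (cdim X x + 1)" "R_mat X g (cdim X x + 1) x y = 1"
    using assms unfolding matched_iff_pivot lead_def by auto
  then show ?thesis using R_mat_le by blast
qed

lemma matched_less:
  assumes "matched_cells x y" "x \<in> Crit V" shows "g x < g y"
  using matched_le[OF assms(1)] Crit_value[OF assms(2), of y] matched_dims(2,4)[OF assms(1)] by fastforce

lemma Crit_less: "x \<in> Crit V \<Longrightarrow> y \<in> Crit V \<Longrightarrow> h_less X g x y \<longleftrightarrow> g x < g y"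
  using Crit_value[of x y] Crit_cells[of y] unfolding h_less_def by auto

text \<open>\<open>x\<close> is the one cell that may be bypassed; if none is bypassed, any cell can
  be taken for it.\<close>

lemma right_move_exists:
  assumes "g b < \<delta>" "\<delta> < \<xi>" "\<xi> < g d" "\<And>x. x \<in> cells X \<Longrightarrow> g x < \<delta> \<or> \<xi> < g x"
    and "\<And>e. e \<in> right_bypassed X (b, Some d) \<delta> g \<Longrightarrow> e = x \<and> \<not> reaches X V x b"
  shows "\<exists>g'. right_move X (b, Some d) \<delta> \<xi> g g'"
proof -
  have "{x \<in> cells X. \<delta> \<le> g x \<and> g x \<le> \<xi>} = {}" using assms(4) by fastforce
  moreover have "card (right_bypassed X (b, Some d) \<delta> g) \<le> card {x}"
    by (rule card_mono) (use assms(5) in auto)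
  ultimately show ?thesis using assms unfolding right_move_def by (auto simp: Let_def)
qed

lemma down_move_exists:
  assumes "g b < \<xi>" "\<xi> < \<delta>" "\<delta> < g d" "\<And>x. x \<in> cells X \<Longrightarrow> g x < \<xi> \<or> \<delta> < g x"
    and "\<And>e. e \<in> down_bypassed X (b, Some d) \<delta> g \<Longrightarrow> e = y \<and> \<not> reaches X V d y"
  shows "\<exists>g'. down_move X (b, Some d) \<delta> \<xi> g g'"
proof -
  have "{x \<in> cells X. \<xi> \<le> g x \<and> g x \<le> \<delta>} = {}" using assms(4) by fastforce
  moreover have "card (down_bypassed X (b, Some d) \<delta> g) \<le> card {y}"
    by (rule card_mono) (use assms(5) in auto)
  ultimately show ?thesis using assms unfolding down_move_def by (auto simp: Let_def)
qed

text \<open>Joining a path to \<open>x\<close> with one from \<open>x\<close> yields the unique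
  path. This describes its cells by reachability alone, which depends only on the vector field and
  so survives every move.\<close>

lemma unique_path_cells:
  assumes p: "p \<in> paths X V d b" and uniq: "\<And>q. q \<in> paths X V d b \<Longrightarrow> q = p"
  shows "set p = {x. reaches X V d x \<and> reaches X V x b}"
proof (intro set_eqI iffI)
  fix x assume "x \<in> set p"
  then obtain q q' where q: "p = q @ x # q'" by (meson split_list)
  have s: "successively (arc X V) (q @ [x])" "successively (arc X V) (x # q')"
    using p unfolding q paths_def by (auto simp: successively_append_iff)
  have "q @ [x] \<in> paths X V d x" "x # q' \<in> paths X V x b"
    using p s unfolding q paths_def by (auto simp: hd_append split: if_splits)
  then show "x \<in> {x. reaches X V d x \<and> reaches X V x b}" unfolding reaches_def by blast
next
  fix x assume "x \<in> {x. reaches X V d x \<and> reaches X V x b}"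
  then obtain q q' where q: "q \<in> paths X V d x" and q': "q' \<in> paths X V x b" unfolding reaches_def by blast
  obtain r' where r': "q' = x # r'" using q' unfolding paths_def by (cases q') auto
  obtain r where r: "q = r @ [x]" using q unfolding paths_def by (cases q rule: rev_cases) auto
  have "r @ x # r' \<in> paths X V d b"
    using q q' unfolding r r' paths_def by (auto simp: successively_append_iff hd_append split: if_splits)
  then show "x \<in> set p" using uniq by fastforce
qed

end

section \<open>Invariant, progress and completion of the algorithm\<close>

locale simplification = filtered X h
  for X :: "'a lefschetz" and h :: "'a \<Rightarrow> real" +
  fixes b d :: 'a
  assumes bC: "b \<in> Crit V" and dC: "d \<in> Crit V" and bd: "matched_cells b d"
    and unique: "\<exists>!p. p \<in> paths X V d b"
    and regions: "region_urcorner X h (cdim X b) (b, Some d) \<inter> region_llcorner X h (cdim X b) (b, Some d) = {}"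
begin

abbreviation \<alpha> :: "'a bd_pair" where "\<alpha> \<equiv> (b, Some d)"

text \<open>The last two conditions say that the only relations involving the components of the pair
  which can ever block a move are those of \<open>h\<close>, to which the forbidden regions refer.\<close>

definition inv :: "'a state \<Rightarrow> bool" where
  "inv s \<longleftrightarrow> filtered X (fn s) \<and> fibre_field X (fn s) = V \<and> BD X (fn s) = BD X h \<and> fn s b < fn s d \<and>
    (\<forall>x\<in>Crit V. x \<noteq> b \<longrightarrow> x \<noteq> d \<longrightarrow> fn s x = h x) \<and>
    agree (hom s) (U_mat X (fn s)) \<and> agree (cohom s) (U_perp_mat X (fn s)) \<and>
    (\<forall>x\<in>Crit V. cdim X x = cdim X d \<longrightarrow> U_mat X (fn s) (cdim X d) x d = 1 \<longrightarrow> U_mat X h (cdim X d) x d = 1) \<and>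
    (\<forall>x\<in>Crit V. cdim X x = cdim X b \<longrightarrow> U_perp_mat X (fn s) (cdim X b) x b = 1 \<longrightarrow>
      U_perp_mat X h (cdim X b) x b = 1)"

lemma invD:
  assumes "inv s"
  shows "filtered X (fn s)" "fibre_field X (fn s) = V" "BD X (fn s) = BD X h" "fn s b < fn s d"
    "\<And>x. x \<in> Crit V \<Longrightarrow> x \<noteq> b \<Longrightarrow> x \<noteq> d \<Longrightarrow> fn s x = h x"
    "agree (hom s) (U_mat X (fn s))" "agree (cohom s) (U_perp_mat X (fn s))"
    "\<And>x. x \<in> Crit V \<Longrightarrow> cdim X x = cdim X d \<Longrightarrow> U_mat X (fn s) (cdim X d) x d = 1 \<Longrightarrow> U_mat X h (cdim X d) x d = 1"
    "\<And>x. x \<in> Crit V \<Longrightarrow> cdim X x = cdim X b \<Longrightarrow> U_perp_mat X (fn s) (cdim X b) x b = 1 \<Longrightarrow>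
      U_perp_mat X h (cdim X b) x b = 1"
  using assms unfolding inv_def by blast+

lemma agree_iff: "filtered X g \<Longrightarrow> fibre_field X g = V \<Longrightarrow> filtered.agree X g A B \<longleftrightarrow> agree A B"
  using filtered.agree_def agree_def by metis

lemma agree_trans: "agree A B \<Longrightarrow> agree B C \<Longrightarrow> agree A C"
  unfolding agree_def by simp

lemma agree_sym: "agree A B \<Longrightarrow> agree B A"
  unfolding agree_def by simp

lemma agreeD: "agree A B \<Longrightarrow> x \<in> Crit V \<Longrightarrow> y \<in> Crit V \<Longrightarrow> cdim X x = cdim X y \<Longrightarrow> A (cdim X x) x y = B (cdim X x) x y"
  unfolding agree_def by blast

lemma matched_inv: "inv s \<Longrightarrow> matched X (fn s) (cdim X x) x y \<longleftrightarrow> matched_cells x y"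
  using filtered.BD_Some[OF invD(1), of s x y] invD(3)[of s] BD_Some[of x y] by simp

lemma bd_dim: "cdim X d = cdim X b + 1"
  using matched_dims(4)[OF bd] .

lemma b_neq_d: "b \<noteq> d"
  using bd_dim by auto

definition between :: "'a state \<Rightarrow> 'a set" where
  "between s = {x \<in> Crit V. fn s b < fn s x \<and> fn s x < fn s d}"

lemma critical_between_eq: "inv s \<Longrightarrow> critical_between X \<alpha> (fn s) = between s"
  unfolding critical_between_def between_def
  using filtered.Crit_less[OF invD(1), of s] invD(2)[of s] bC dC by auto

lemma finite_between: "finite (between s)"
  unfolding between_def using finite_Crit by simp

lemma between_value: "inv s \<Longrightarrow> x \<in> between s \<Longrightarrow> fn s x = h x"
  using invD(5)[of s x] unfolding between_def by auto

lemma inv_move: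
  assumes s: "inv s" and f: "dMf X g'" "fibre_field X g' = V" and BD: "BD X g' = BD X (fn s)" and less: "g' b < g' d"
    and same: "\<And>x. x \<in> Crit V \<Longrightarrow> x \<noteq> b \<Longrightarrow> x \<noteq> d \<Longrightarrow> g' x = fn s x"
    and U': "agree U' (U_mat X g')" and W': "agree W' (U_perp_mat X g')"
    and U: "\<And>x. x \<in> Crit V \<Longrightarrow> cdim X x = cdim X d \<Longrightarrow> U_mat X g' (cdim X d) x d = 1 \<Longrightarrow> U_mat X (fn s) (cdim X d) x d = 1"
    and W: "\<And>x. x \<in> Crit V \<Longrightarrow> cdim X x = cdim X b \<Longrightarrow> U_perp_mat X g' (cdim X b) x b = 1 \<Longrightarrow> U_perp_mat X (fn s) (cdim X b) x b = 1"
  shows "inv \<lparr>fn = g', hom = U', cohom = W'\<rparr>"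
proof -
  have "filtered X g'" using X f(1) by unfold_locales
  then show ?thesis
    unfolding inv_def using f(2) BD less same U' W' U W invD(3,5,8,9)[OF s] by auto
qed

lemma right_step:
  "inv s \<Longrightarrow> right_move X \<alpha> \<delta> \<xi> (fn s) g' \<Longrightarrow> right_step X (fn s) b d \<delta> \<xi> g'"
  using invD(1,2)[of s] matched_inv[of s b d] bC dC bd unfolding right_step_def right_step_axioms_def by simp

lemma down_step:
  "inv s \<Longrightarrow> down_move X \<alpha> \<delta> \<xi> (fn s) g' \<Longrightarrow> down_step X (fn s) b d \<delta> \<xi> g'"
  using invD(1,2)[of s] matched_inv[of s b d] bC dC bd unfolding down_step_def down_step_axioms_def by simp

lemma inv_squeeze_right:
  assumes s: "inv s" and rm: "right_move X \<alpha> \<delta> \<xi> (fn s) g'" and nb: "right_bypassed X \<alpha> \<delta> (fn s) = {}"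
  shows "inv (s\<lparr>fn := g'\<rparr>)"
proof -
  interpret S: right_step X "fn s" b d \<delta> \<xi> g' by (rule right_step[OF s rm])
  have V: "fibre_field X (fn s) = V" by (rule invD(2)[OF s])
  note ag = S.no_bypass[OF nb] and eq = agree_iff[OF invD(1,2)[OF s]]
  have g': "g' d = fn s d" "g' b = \<delta>" using S.geo(3,4) dC b_neq_d V by auto
  have "inv \<lparr>fn = g', hom = hom s, cohom = cohom s\<rparr>"
  proof (rule inv_move[OF s])
    show "dMf X g'" "fibre_field X g' = V" "BD X g' = BD X (fn s)" using S.geo(1,2) ag(1) V by auto
    show "g' b < g' d" using g' S.geo(6,7) by simp
    show "g' x = fn s x" if "x \<in> Crit V" "x \<noteq> b" for x using S.geo(4) that V by simp
    show "agree (hom s) (U_mat X g')" "agree (cohom s) (U_perp_mat X g')"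
      using ag(2,3) invD(6,7)[OF s] agree_trans agree_sym unfolding eq by blast+
    show "U_mat X (fn s) (cdim X d) x d = 1" if "x \<in> Crit V" "cdim X x = cdim X d" "U_mat X g' (cdim X d) x d = 1" for x
      using agreeD[OF ag(2)[unfolded eq] that(1) dC that(2)] that(2,3) by simp
    show "U_perp_mat X (fn s) (cdim X b) x b = 1" if "x \<in> Crit V" "cdim X x = cdim X b" "U_perp_mat X g' (cdim X b) x b = 1" for x
      using agreeD[OF ag(3)[unfolded eq] that(1) bC that(2)] that(2,3) by simp
  qed
  moreover have "s\<lparr>fn := g'\<rparr> = \<lparr>fn = g', hom = hom s, cohom = cohom s\<rparr>" by (cases s) simp
  ultimately show ?thesis by (simp only:)
qed

lemma inv_squeeze_down:
  assumes s: "inv s" and dm: "down_move X \<alpha> \<delta> \<xi> (fn s) g'" and nb: "down_bypassed X \<alpha> \<delta> (fn s) = {}"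
  shows "inv (s\<lparr>fn := g'\<rparr>)"
proof -
  interpret S: down_step X "fn s" b d \<delta> \<xi> g' by (rule down_step[OF s dm])
  have V: "fibre_field X (fn s) = V" by (rule invD(2)[OF s])
  note ag = S.no_bypass[OF nb] and eq = agree_iff[OF invD(1,2)[OF s]]
  have g': "g' b = fn s b" "g' d = \<delta>" using S.geo(3,4) bC b_neq_d V by auto
  have "inv \<lparr>fn = g', hom = hom s, cohom = cohom s\<rparr>"
  proof (rule inv_move[OF s])
    show "dMf X g'" "fibre_field X g' = V" "BD X g' = BD X (fn s)" using S.geo(1,2) ag(1) V by auto
    show "g' b < g' d" using g' S.geo(6,7) by simp
    show "g' x = fn s x" if "x \<in> Crit V" "x \<noteq> d" for x using S.geo(4) that V by simp
    show "agree (hom s) (U_mat X g')" "agree (cohom s) (U_perp_mat X g')"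
      using ag(2,3) invD(6,7)[OF s] agree_trans agree_sym unfolding eq by blast+
    show "U_mat X (fn s) (cdim X d) x d = 1" if "x \<in> Crit V" "cdim X x = cdim X d" "U_mat X g' (cdim X d) x d = 1" for x
      using agreeD[OF ag(2)[unfolded eq] that(1) dC that(2)] that(2,3) by simp
    show "U_perp_mat X (fn s) (cdim X b) x b = 1" if "x \<in> Crit V" "cdim X x = cdim X b" "U_perp_mat X g' (cdim X b) x b = 1" for x
      using agreeD[OF ag(3)[unfolded eq] that(1) bC that(2)] that(2,3) by simp
  qed
  moreover have "s\<lparr>fn := g'\<rparr> = \<lparr>fn = g', hom = hom s, cohom = cohom s\<rparr>" by (cases s) simp
  ultimately show ?thesis by (simp only:)
qed

text \<open>Both alternatives of the test give a zero entry: a death cell has no pivot in the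
  coboundary reduction and is never added, and otherwise the stored entry is zero and is correct by
  the invariant.\<close>

lemma right_bypass:
  assumes s: "inv s" and rm: "right_move X \<alpha> \<delta> \<xi> (fn s) g'" and x: "x \<in> between s" "fn s x < \<delta>"
    and may: "may_move_right X (BD X h) \<alpha> s x"
  shows "right_bypass X (fn s) b d \<delta> \<xi> g' x"
proof -
  interpret S: right_step X "fn s" b d \<delta> \<xi> g' by (rule right_step[OF s rm])
  have V: "fibre_field X (fn s) = V" by (rule invD(2)[OF s])
  have xC: "x \<in> Crit V" "x \<noteq> b" "fn s b < fn s x" using x unfolding between_def by auto
  show ?thesis
  proof unfold_locales
    show "x \<in> right_bypassed X \<alpha> \<delta> (fn s)" using xC x V unfolding right_bypassed_def by simp
    assume k: "cdim X x = cdim X b"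
    from may consider c where "(c, Some x) \<in> BD X h" | "\<not> cell_rel X (cohom s) x b"
      unfolding may_move_right_def by auto
    then show "U_perp_mat X (fn s) (cdim X b) x b = 0"
    proof cases
      case 1
      then have "\<not> matched X (fn s) (cdim X x) x z" for z
        using matched_chain[of _ x z _ c] BD_Some matched_inv[OF s] by blast
      then have "U_perp_mat X (fn s) (cdim X x) x b = 0"
        by (intro S.W_zero_not_birth) (use xC bC V k in auto)
      then show ?thesis using k by simp
    next
      case 2
      then have "cohom s (cdim X x) x b \<noteq> 1"
        using Crit_cells xC bC k unfolding cell_rel_def by blast
      then show ?thesis using agreeD[OF invD(7)[OF s] xC(1) bC k] k by simp
    qed
  qed
qed

lemma down_bypass:
  assumes s: "inv s" and dm: "down_move X \<alpha> \<delta> \<xi> (fn s) g'" and y: "y \<in> between s" "\<delta> < fn s y"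
    and may: "may_move_down X (BD X h) \<alpha> s y"
  shows "down_bypass X (fn s) b d \<delta> \<xi> g' y"
proof -
  interpret S: down_step X "fn s" b d \<delta> \<xi> g' by (rule down_step[OF s dm])
  have V: "fibre_field X (fn s) = V" by (rule invD(2)[OF s])
  have yC: "y \<in> Crit V" "y \<noteq> d" "fn s y < fn s d" using y unfolding between_def by auto
  show ?thesis
  proof unfold_locales
    show "y \<in> down_bypassed X \<alpha> \<delta> (fn s)" using yC y V unfolding down_bypassed_def by simp
    assume k: "cdim X y = cdim X d"
    from may consider c where "(y, c) \<in> BD X h" | "\<not> cell_rel X (hom s) y d"
      unfolding may_move_down_def by auto
    then show "U_mat X (fn s) (cdim X d) y d = 0"
    proof cases
      case 1
      have "\<not> matched_cells z y" for z
      proof (cases c)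
        case None
        then show ?thesis using 1 BD_None by blast
      next
        case (Some w)
        then have "matched_cells y w" using 1 BD_Some by blast
        then show ?thesis using matched_chain by blast
      qed
      then show ?thesis using S.U_zero_not_death[of y d] yC(1,2) dC V k matched_inv[OF s] by simp
    next
      case 2
      then have "hom s (cdim X y) y d \<noteq> 1"
        using Crit_cells yC dC k unfolding cell_rel_def by blast
      then show ?thesis using agreeD[OF invD(6)[OF s] yC(1) dC k] k by simp
    qed
  qed
qed

lemma inv_bypass:
  assumes s: "inv s" and step: "bypass_step X (BD X h) \<alpha> s s'"
  shows "inv s' \<and> between s' \<subset> between s"
  using step
proof cases
  case (bypass_right x \<delta> \<xi> g' U')
  have V: "fibre_field X (fn s) = V" by (rule invD(2)[OF s])
  have x: "x \<in> between s" using bypass_right(2) unfolding is_first_def critical_between_eq[OF s] by blast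
  interpret S: right_bypass X "fn s" b d \<delta> \<xi> g' x
    by (rule right_bypass[OF s bypass_right(4) x bypass_right(5,3)])
  note eq = agree_iff[OF invD(1,2)[OF s]]
  have g': "g' d = fn s d" "g' b = \<delta>" "\<delta> < fn s d" using S.geo(3,4,6,7) dC b_neq_d V by auto
  have same: "g' x = fn s x" if "x \<in> Crit V" "x \<noteq> b" for x using S.geo(4) that V by simp
  have "birth_switch X (BD X (fn s)) \<alpha> x s U'" using bypass_right(6) invD(3)[OF s] by simp
  from S.switch_result[OF this refl, unfolded eq, OF invD(6,7)[OF s]] have U': "agree U' (U_mat X g')" .
  have "inv \<lparr>fn = g', hom = U', cohom = cohom s\<rparr>"
  proof (rule inv_move[OF s])
    show "dMf X g'" "fibre_field X g' = V" "BD X g' = BD X (fn s)" using S.geo(1,2) S.BD_eq V by auto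
    show "g' b < g' d" using g' by simp
    show "g' x = fn s x" if "x \<in> Crit V" "x \<noteq> b" for x using same that .
    show "agree U' (U_mat X g')" by fact
    show "agree (cohom s) (U_perp_mat X g')"
      using S.W_agree invD(7)[OF s] agree_trans agree_sym unfolding eq by blast
    show "U_mat X (fn s) (cdim X d) x d = 1" if "x \<in> Crit V" "cdim X x = cdim X d" "U_mat X g' (cdim X d) x d = 1" for x
      using S.U_mono that V by simp
    show "U_perp_mat X (fn s) (cdim X b) x b = 1" if "x \<in> Crit V" "cdim X x = cdim X b" "U_perp_mat X g' (cdim X b) x b = 1" for x
      using agreeD[OF S.W_agree[unfolded eq] that(1) bC that(2)] that(2,3) by simp
  qed
  moreover have "between \<lparr>fn = g', hom = U', cohom = cohom s\<rparr> \<subseteq> between s"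
    unfolding between_def using same g' S.geo(5) by fastforce
  moreover have "x \<notin> between \<lparr>fn = g', hom = U', cohom = cohom s\<rparr>"
  proof -
    have "g' x = fn s x" by (rule same) (use x in \<open>auto simp: between_def\<close>)
    then show ?thesis using bypass_right(5) g' unfolding between_def by simp
  qed
  ultimately show ?thesis using x bypass_right(1) by blast
next
  case (bypass_down x y \<delta> \<xi> g' W')
  have V: "fibre_field X (fn s) = V" by (rule invD(2)[OF s])
  have y: "y \<in> between s" using bypass_down(4) unfolding is_last_def critical_between_eq[OF s] by blast
  interpret S: down_bypass X "fn s" b d \<delta> \<xi> g' y
    by (rule down_bypass[OF s bypass_down(6) y bypass_down(7,5)])
  note eq = agree_iff[OF invD(1,2)[OF s]]
  have g': "g' b = fn s b" "g' d = \<delta>" "fn s b < \<delta>" using S.geo(3,4,6,7) bC b_neq_d V by auto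
  have same: "g' x = fn s x" if "x \<in> Crit V" "x \<noteq> d" for x using S.geo(4) that V by simp
  have "death_switch X (BD X (fn s)) \<alpha> y s W'" using bypass_down(8) invD(3)[OF s] by simp
  from S.switch_result[OF this refl, unfolded eq, OF invD(6,7)[OF s]] have W': "agree W' (U_perp_mat X g')" .
  have "inv \<lparr>fn = g', hom = hom s, cohom = W'\<rparr>"
  proof (rule inv_move[OF s])
    show "dMf X g'" "fibre_field X g' = V" "BD X g' = BD X (fn s)" using S.geo(1,2) S.BD_eq V by auto
    show "g' b < g' d" using g' by simp
    show "g' x = fn s x" if "x \<in> Crit V" "x \<noteq> d" for x using same that .
    show "agree (hom s) (U_mat X g')"
      using S.U_agree invD(6)[OF s] agree_trans agree_sym unfolding eq by blast
    show "agree W' (U_perp_mat X g')" by fact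
    show "U_mat X (fn s) (cdim X d) x d = 1" if "x \<in> Crit V" "cdim X x = cdim X d" "U_mat X g' (cdim X d) x d = 1" for x
      using agreeD[OF S.U_agree[unfolded eq] that(1) dC that(2)] that(2,3) by simp
    show "U_perp_mat X (fn s) (cdim X b) x b = 1" if "x \<in> Crit V" "cdim X x = cdim X b" "U_perp_mat X g' (cdim X b) x b = 1" for x
      using S.W_mono that V by simp
  qed
  moreover have "between \<lparr>fn = g', hom = hom s, cohom = W'\<rparr> \<subseteq> between s"
    unfolding between_def using same g' S.geo(5) by fastforce
  moreover have "y \<notin> between \<lparr>fn = g', hom = hom s, cohom = W'\<rparr>"
  proof -
    have "g' y = fn s y" by (rule same) (use y in \<open>auto simp: between_def\<close>)
    then show ?thesis using bypass_down(7) g' unfolding between_def by simp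
  qed
  ultimately show ?thesis using y bypass_down(1) by blast
qed

lemma inv_step1:
  assumes "inv s" "step1 X V (BD X h) \<alpha> s s'" shows "inv s'"
proof -
  from assms(2) consider "bypass_step X (BD X h) \<alpha> s s'" | "squeeze_step X V \<alpha> s s'" unfolding step1_def by blast
  then show ?thesis
  proof cases
    case 1
    then show ?thesis using inv_bypass assms(1) by blast
  next
    case 2
    then show ?thesis by cases (use inv_squeeze_right inv_squeeze_down assms(1) in auto)
  qed
qed

lemma inv_steps:
  assumes "(step1 X V (BD X h) \<alpha>)\<^sup>*\<^sup>* s s'" "inv s" shows "inv s'"
  using assms by (induction rule: rtranclp_induct) (auto intro: inv_step1)

text \<open>A cell which blocks the birth cell of \<open>\<alpha>\<close> contributes a rectangle to the lower forbidden
  region whose corner has the values of critical cells between the components of \<open>\<alpha>\<close>.\<close>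

lemma blocked_right:
  assumes s: "inv s" and x: "x \<in> between s" and n: "\<not> may_move_right X (BD X h) \<alpha> s x"
  shows "\<exists>a\<in>between s. {ereal (h x)..\<infinity>} \<times> {ereal (h a)..\<infinity>} \<subseteq> region_llcorner X h (cdim X b) \<alpha>"
proof (cases "reaches X V x b")
  case True
  have "x \<in> Crit V" "x \<noteq> b" using x unfolding between_def by auto
  then show ?thesis using True x unfolding region_llcorner_def by fastforce
next
  case False
  interpret G: filtered X "fn s" by (rule invD(1)[OF s])
  have V: "fibre_field X (fn s) = V" by (rule invD(2)[OF s])
  have xC: "x \<in> Crit V" "x \<noteq> b" "fn s b < fn s x" using x unfolding between_def by auto
  have rel: "cell_rel X (cohom s) x b" using n False unfolding may_move_right_def V by auto
  then have k: "cdim X x = cdim X b" "cohom s (cdim X x) x b = 1" unfolding cell_rel_def by auto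
  then have one: "U_perp_mat X (fn s) (cdim X x) x b = 1"
    using agreeD[OF invD(7)[OF s] xC(1) bC k(1)] by simp
  obtain a where a: "matched_cells x a" "fn s a < fn s d"
    using G.W_one(2)[of x b d] xC bC k(1) one bd unfolding V matched_inv[OF s] by blast
  have aC: "a \<in> Crit V" using matched_Crit[OF a(1)] xC(1) by blast
  have "fn s x \<le> fn s a" using G.matched_le[of x a] a(1) matched_inv[OF s] by simp
  then have ab: "a \<in> between s" using a(2) aC xC(3) unfolding between_def by auto
  have "U_perp_mat X h (cdim X x) x b = 1" using invD(9)[OF s xC(1) k(1)] one k(1) by simp
  then have "cohom_rel X (U_perp_mat X h) (x, Some a) \<alpha>"
    using xC bC k(1) Crit_cells unfolding cohom_rel_def cell_rel_def components_def by auto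
  moreover have "(x, Some a) \<in> off_diagonal h (BD_dim X h (cdim X b))"
    using a(1) matched_less[OF a(1) xC(1)] k(1)
    unfolding off_diagonal_def BD_dim_def birth_value_def death_value_def by auto
  ultimately have "{birth_value h (x, Some a)..\<infinity>} \<times> {death_value h (x, Some a)..\<infinity>}
      \<subseteq> region_llcorner X h (cdim X b) \<alpha>"
    using xC(2) unfolding region_llcorner_def by blast
  then show ?thesis using ab unfolding birth_value_def death_value_def by auto
qed

text \<open>The mirror image for the upper region: if a relation blocks, the birth cell
  \<open>a\<close> of the pair of \<open>y\<close> is a pivot beyond \<open>b\<close> with value at
  most that of \<open>y\<close>, so it too lies between the components of
  \<open>\<alpha>\<close>.\<close>

lemma blocked_down:
  assumes s: "inv s" and y: "y \<in> between s" and n: "\<not> may_move_down X (BD X h) \<alpha> s y"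
  shows "\<exists>a\<in>between s. {-\<infinity>..ereal (h a)} \<times> {-\<infinity>..ereal (h y)} \<subseteq> region_urcorner X h (cdim X b) \<alpha>"
proof (cases "reaches X V d y")
  case True
  have "y \<in> Crit V" "y \<noteq> d" using y unfolding between_def by auto
  then show ?thesis using True y unfolding region_urcorner_def by fastforce
next
  case False
  interpret G: filtered X "fn s" by (rule invD(1)[OF s])
  have V: "fibre_field X (fn s) = V" by (rule invD(2)[OF s])
  have yC: "y \<in> Crit V" "y \<noteq> d" "fn s y < fn s d" using y unfolding between_def by auto
  have rel: "cell_rel X (hom s) y d" using n False unfolding may_move_down_def V by auto
  then have k: "cdim X y = cdim X d" "hom s (cdim X y) y d = 1" unfolding cell_rel_def by auto
  then have one: "U_mat X (fn s) (cdim X y) y d = 1"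
    using agreeD[OF invD(6)[OF s] yC(1) dC k(1)] by simp
  obtain a where a: "matched_cells a y" "fn s b < fn s a"
    using G.U_one(2)[of y d b] yC dC k(1) one bd unfolding V matched_inv[OF s] by blast
  have aC: "a \<in> Crit V" using matched_Crit[OF a(1)] yC(1) by blast
  have "fn s a \<le> fn s y" using G.matched_le[of a y] a(1) matched_inv[OF s] by simp
  then have ab: "a \<in> between s" using a(2) aC yC(3) unfolding between_def by auto
  have "U_mat X h (cdim X y) y d = 1" using invD(8)[OF s yC(1) k(1)] one k(1) by simp
  then have "hom_rel X (U_mat X h) (a, Some y) \<alpha>"
    using yC dC k(1) Crit_cells unfolding hom_rel_def cell_rel_def components_def by auto
  moreover have "(a, Some y) \<in> off_diagonal h (BD_dim X h (cdim X b))"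
    using a(1) matched_less[OF a(1) aC] k(1) bd_dim matched_dims(4)[OF a(1)]
    unfolding off_diagonal_def BD_dim_def birth_value_def death_value_def by auto
  ultimately have "{-\<infinity>..birth_value h (a, Some y)} \<times> {-\<infinity>..death_value h (a, Some y)}
      \<subseteq> region_urcorner X h (cdim X b) \<alpha>"
    using yC(2) unfolding region_urcorner_def by blast
  then show ?thesis using ab unfolding birth_value_def death_value_def by auto
qed

lemma progress:
  assumes s: "inv s" and ne: "between s \<noteq> {}"
  shows "\<exists>s'. bypass_step X (BD X h) \<alpha> s s'"
proof -
  interpret G: filtered X "fn s" by (rule invD(1)[OF s])
  have V: "fibre_field X (fn s) = V" by (rule invD(2)[OF s])
  have fin: "finite (fn s ` between s)" using finite_between by simp
  have "Min (fn s ` between s) \<in> fn s ` between s" "Max (fn s ` between s) \<in> fn s ` between s"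
    using Min_in[OF fin] Max_in[OF fin] ne by simp_all
  then obtain x y where xy: "x \<in> between s" "Min (fn s ` between s) = fn s x"
    "y \<in> between s" "Max (fn s ` between s) = fn s y" by blast
  have x: "x \<in> between s" "\<And>z. z \<in> between s \<Longrightarrow> fn s x \<le> fn s z"
    using xy(1) Min_le[OF fin] unfolding xy(2) by blast+
  have y: "y \<in> between s" "\<And>z. z \<in> between s \<Longrightarrow> fn s z \<le> fn s y"
    using xy(3) Max_ge[OF fin] unfolding xy(4) by blast+
  have C: "z \<in> Crit V" "z \<in> cells X" if "z \<in> between s" for z using that Crit_cells unfolding between_def by auto
  have inj: "z = w" if "z \<in> between s" "w \<in> between s" "fn s z = fn s w" for z w
    using G.Crit_value[of w z] C that unfolding V by auto
  have less: "h_less X (fn s) z w \<longleftrightarrow> fn s z < fn s w" if "z \<in> between s" "w \<in> between s" for z w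
    using G.Crit_less[of z w] C that unfolding V by blast
  have first: "is_first (h_less X (fn s)) (critical_between X \<alpha> (fn s)) x"
    unfolding is_first_def critical_between_eq[OF s] using x less inj by (metis order_le_less)
  have last: "is_last (h_less X (fn s)) (critical_between X \<alpha> (fn s)) y"
    unfolding is_last_def critical_between_eq[OF s] using y less inj by (metis order_le_less)
  have vals: "finite (fn s ` cells X)" using finite_cells by simp
  have xd: "fn s b < fn s x" "fn s x < fn s d" "fn s b < fn s y" "fn s y < fn s d"
    using x(1) y(1) unfolding between_def by auto
  show ?thesis
  proof (cases "may_move_right X (BD X h) \<alpha> s x")
    case True
    \<comment> \<open>Both numbers are placed before the next value after that of \<open>x\<close>,
      so \<open>x\<close> is the only critical cell that is bypassed.\<close>
    obtain \<delta> \<xi> where dx: "fn s x < \<delta>" "\<delta> < \<xi>" "\<xi> < fn s d"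
      and gap: "\<And>z. z \<in> fn s ` cells X \<Longrightarrow> z \<le> fn s x \<or> \<xi> < z"
      using gap_right[OF vals xd(2)] by blast
    have e: "e = x \<and> \<not> reaches X (fibre_field X (fn s)) x b" if "e \<in> right_bypassed X \<alpha> \<delta> (fn s)" for e
    proof -
      have eC: "e \<in> Crit V" "fn s b < fn s e" "fn s e < \<delta>" using that unfolding right_bypassed_def V by auto
      then have le: "fn s e \<le> fn s x" using gap[of "fn s e"] Crit_cells dx by fastforce
      then have "e \<in> between s" using eC xd unfolding between_def by auto
      then have "e = x" using inj x le by (metis order_antisym)
      then show ?thesis using True unfolding may_move_right_def by simp
    qed
    have nogap: "fn s z < \<delta> \<or> \<xi> < fn s z" if "z \<in> cells X" for z using gap[of "fn s z"] that dx(1) by auto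
    obtain g' where g': "right_move X \<alpha> \<delta> \<xi> (fn s) g'"
      using G.right_move_exists[of b \<delta> \<xi> d x] dx xd nogap e by auto
    interpret S: right_bypass X "fn s" b d \<delta> \<xi> g' x by (rule right_bypass[OF s g' x(1) dx(1) True])
    obtain U' where "birth_switch X (BD X h) \<alpha> x s U'" using S.switch_exists[OF refl] invD(3)[OF s] by auto
    then show ?thesis using bypass_step.bypass_right[OF first True g' dx(1)] by blast
  next
    case False
    have down: "may_move_down X (BD X h) \<alpha> s y"
    proof (rule ccontr)
      assume n: "\<not> ?thesis"
      obtain a where a: "a \<in> between s" "{ereal (h x)..\<infinity>} \<times> {ereal (h a)..\<infinity>} \<subseteq> region_llcorner X h (cdim X b) \<alpha>"
        using blocked_right[OF s x(1) False] by blast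
      obtain c where c: "c \<in> between s" "{-\<infinity>..ereal (h c)} \<times> {-\<infinity>..ereal (h y)} \<subseteq> region_urcorner X h (cdim X b) \<alpha>"
        using blocked_down[OF s y(1) n] by blast
      \<comment> \<open>\<open>x\<close> and \<open>y\<close> are extremal among the critical cells
        in between, and all of these still have their values under \<open>h\<close>. So the corner
        of the lower rectangle lies in the upper one.\<close>
      have "h x \<le> h c" "h a \<le> h y"
        using x(2)[OF c(1)] y(2)[OF a(1)] between_value[OF s] a(1) c(1) x(1) y(1) by auto
      then have "(ereal (h x), ereal (h a)) \<in> region_llcorner X h (cdim X b) \<alpha>"
        "(ereal (h x), ereal (h a)) \<in> region_urcorner X h (cdim X b) \<alpha>"
        using a(2) c(2) by auto
      then show False using regions by blast
    qed
    obtain \<xi> \<delta> where dx: "fn s b < \<xi>" "\<xi> < \<delta>" "\<delta> < fn s y"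
      and gap: "\<And>z. z \<in> fn s ` cells X \<Longrightarrow> z < \<xi> \<or> fn s y \<le> z"
      using gap_left[OF vals xd(3)] by blast
    have e: "e = y \<and> \<not> reaches X (fibre_field X (fn s)) d y" if "e \<in> down_bypassed X \<alpha> \<delta> (fn s)" for e
    proof -
      have eC: "e \<in> Crit V" "\<delta> < fn s e" "fn s e < fn s d" using that unfolding down_bypassed_def V by auto
      then have le: "fn s y \<le> fn s e" using gap[of "fn s e"] Crit_cells dx by fastforce
      then have "e \<in> between s" using eC xd unfolding between_def by auto
      then have "e = y" using inj y le by (metis order_antisym)
      then show ?thesis using down unfolding may_move_down_def by simp
    qed
    have nogap: "fn s z < \<xi> \<or> \<delta> < fn s z" if "z \<in> cells X" for z using gap[of "fn s z"] that dx(3) by auto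
    obtain g' where g': "down_move X \<alpha> \<delta> \<xi> (fn s) g'"
      using G.down_move_exists[of b \<xi> \<delta> d y] dx xd nogap e by auto
    interpret S: down_bypass X "fn s" b d \<delta> \<xi> g' y by (rule down_bypass[OF s g' y(1) dx(3) down])
    obtain W' where "death_switch X (BD X h) \<alpha> y s W'" using S.switch_exists[OF refl] invD(3)[OF s] by auto
    then show ?thesis using bypass_step.bypass_down[OF first False last down g' dx(3)] by blast
  qed
qed

lemma bypass_all:
  assumes "inv s"
  shows "\<exists>s'. (bypass_step X (BD X h) \<alpha>)\<^sup>*\<^sup>* s s' \<and> inv s' \<and> between s' = {}"
  using assms
proof (induction "card (between s)" arbitrary: s rule: less_induct)
  case less
  show ?case
  proof (cases "between s = {}")
    case True
    then show ?thesis using less.prems by blast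
  next
    case False
    obtain s' where s': "bypass_step X (BD X h) \<alpha> s s'" using progress[OF less.prems False] by blast
    have i: "inv s'" "between s' \<subset> between s" using inv_bypass[OF less.prems s'] by auto
    obtain s'' where "(bypass_step X (BD X h) \<alpha>)\<^sup>*\<^sup>* s' s''" "inv s''" "between s'' = {}"
      using less.hyps[OF psubset_card_mono[OF finite_between i(2)] i(1)] by blast
    then show ?thesis using converse_rtranclp_into_rtranclp[of "bypass_step X (BD X h) \<alpha>", OF s'] by blast
  qed
qed

lemma no_infinite_bypass:
  assumes "inv (run 0)" and step: "\<And>i. bypass_step X (BD X h) \<alpha> (run i) (run (Suc i))"
  shows False
proof -
  have i: "inv (run i)" for i
    by (induction i) (use assms(1) inv_bypass step in blast)+
  have "card (between (run (Suc i))) < card (between (run i))" for i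
    using inv_bypass[OF i step] psubset_card_mono[OF finite_between] by blast
  then have "card (between (run i)) + i \<le> card (between (run 0))" for i
    by (induction i) (auto intro: order_trans[OF _ less_imp_le] simp: Suc_le_eq, metis add.commute add_less_mono1 order_less_le_trans)
  from this[of "Suc (card (between (run 0)))"] show False by simp
qed

lemma rho_path:
  "rev (rho X V \<alpha>) \<in> paths X V d b" "p \<in> paths X V d b \<Longrightarrow> p = rev (rho X V \<alpha>)"
proof -
  have r: "rev (rho X V \<alpha>) = (THE p. p \<in> paths X V d b)" unfolding rho_def by simp
  show *: "rev (rho X V \<alpha>) \<in> paths X V d b" unfolding r by (rule theI'[OF unique])
  show "p \<in> paths X V d b \<Longrightarrow> p = rev (rho X V \<alpha>)" using * unique by blast
qed

lemma rho_cells: "set (rho X V \<alpha>) = {x. reaches X V d x \<and> reaches X V x b}"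
  using unique_path_cells[OF rho_path] by simp

lemma rho_between:
  assumes "inv s" "x \<in> set (rho X V \<alpha>)"
  shows "x \<in> cells X" "fn s b \<le> fn s x" "fn s x \<le> fn s d"
  using assms(2) filtered.reaches_le[OF invD(1)[OF assms(1)]] reaches_cells[of x b]
  unfolding rho_cells invD(2)[OF assms(1)] by auto

text \<open>The path always lies in the interval, as values do not rise along arcs; only the other
  inclusion is left.\<close>

lemma step1_doneI:
  assumes "inv s" "between s = {}"
    and "\<And>x. x \<in> cells X \<Longrightarrow> fn s b \<le> fn s x \<Longrightarrow> fn s x \<le> fn s d \<Longrightarrow> reaches X V d x \<and> reaches X V x b"
  shows "step1_done X V \<alpha> s"
proof -
  have "{x \<in> cells X. fn s b \<le> fn s x \<and> fn s x \<le> fn s d} = set (rho X V \<alpha>)"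
  proof (intro set_eqI iffI)
    fix x assume "x \<in> {x \<in> cells X. fn s b \<le> fn s x \<and> fn s x \<le> fn s d}"
    then show "x \<in> set (rho X V \<alpha>)" using assms(3) unfolding rho_cells by blast
  next
    fix x assume "x \<in> set (rho X V \<alpha>)"
    then show "x \<in> {x \<in> cells X. fn s b \<le> fn s x \<and> fn s x \<le> fn s d}"
      using rho_between[OF assms(1)] by blast
  qed
  then show ?thesis using assms(2) critical_between_eq[OF assms(1)] unfolding step1_done_def by simp
qed

text \<open>One move of each kind suffices. A right move with \<open>\<delta>\<close> above all
  values smaller than that of \<open>d\<close> leaves behind the cells that do not reach
  \<open>b\<close>. A down move to just above the new value of \<open>b\<close> then gets rid of
  those that are not reached from \<open>d\<close>. What remains are the cells of the path, by
  \<open>rho_cells\<close>.\<close>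

lemma squeeze_all:
  assumes s: "inv s" and e: "between s = {}"
  shows "\<exists>s'. (squeeze_step X V \<alpha>)\<^sup>*\<^sup>* s s' \<and> step1_done X V \<alpha> s'"
proof (cases "step1_done X V \<alpha> s")
  case True
  then show ?thesis by blast
next
  case False
  interpret G: filtered X "fn s" by (rule invD(1)[OF s])
  have V: "fibre_field X (fn s) = V" by (rule invD(2)[OF s])
  have db: "reaches X V d b" using rho_path(1) unfolding reaches_def by blast
  have vals: "finite (fn s ` cells X)" using finite_cells by simp
  obtain \<delta> \<xi> where dx: "fn s b < \<delta>" "\<delta> < \<xi>" "\<xi> < fn s d"
    and gap: "\<And>z. z \<in> fn s ` cells X \<Longrightarrow> z < \<delta> \<or> fn s d \<le> z"
    using gap_left[OF vals invD(4)[OF s]] by blast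
  have nb: "right_bypassed X \<alpha> \<delta> (fn s) = {}"
    using e dx unfolding right_bypassed_def between_def V by auto
  have nogap: "fn s z < \<delta> \<or> \<xi> < fn s z" if "z \<in> cells X" for z using gap[of "fn s z"] that dx(3) by auto
  obtain g' where g': "right_move X \<alpha> \<delta> \<xi> (fn s) g'"
    using G.right_move_exists[of b \<delta> \<xi> d b] dx nogap nb by auto
  interpret S: right_step X "fn s" b d \<delta> \<xi> g' by (rule right_step[OF s g'])
  define s1 where "s1 = s\<lparr>fn := g'\<rparr>"
  have s1: "inv s1" "fn s1 = g'" using inv_squeeze_right[OF s g' nb] unfolding s1_def by auto
  have step: "squeeze_step X V \<alpha> s s1"
    unfolding s1_def by (rule squeeze_step.squeeze_right) (use critical_between_eq[OF s] e False g' nb in auto)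
  have g1: "g' b = \<delta>" "g' d = fn s d" "\<And>x. x \<in> Crit V \<Longrightarrow> x \<noteq> b \<Longrightarrow> g' x = fn s x"
    using S.geo(3,4) dC b_neq_d V by auto
  have e1: "between s1 = {}"
    using e g1 dx unfolding between_def s1(2) by fastforce
  \<comment> \<open>An unmoved cell has a value below \<open>\<delta>\<close> or at least that of
    \<open>d\<close>, so in the new interval only \<open>d\<close> itself is unmoved.\<close>
  have reach1: "reaches X V x b" if x: "x \<in> cells X" "g' b \<le> g' x" "g' x \<le> g' d" for x
  proof (cases "fn s b \<le> fn s x \<and> fn s x \<le> \<xi> \<and> reaches X V x b \<and> (x \<notin> Crit V \<or> x = b)")
    case True
    then show ?thesis by blast
  next
    case False
    then have "g' x = fn s x" using S.geo(10)[OF x(1)] unfolding V by blast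
    then have "fn s x = fn s d" using x g1 gap[of "fn s x"] by auto
    then have "x = d" using G.Crit_value[of d x] dC x(1) unfolding V by blast
    then show ?thesis using db by simp
  qed
  show ?thesis
  proof (cases "step1_done X V \<alpha> s1")
    case True
    then show ?thesis using step by blast
  next
    case False
    have G1: "filtered X g'" using invD(1)[OF s1(1)] s1(2) by simp
    have V1: "fibre_field X g' = V" using invD(2)[OF s1(1)] s1(2) by simp
    have vals: "finite (g' ` cells X)" using finite_cells by simp
    have "g' b < g' d" using invD(4)[OF s1(1)] s1(2) by simp
    then obtain \<xi>' \<delta>' where dx': "g' b < \<xi>'" "\<xi>' < \<delta>'" "\<delta>' < g' d"
      and gap': "\<And>z. z \<in> g' ` cells X \<Longrightarrow> z \<le> g' b \<or> \<delta>' < z"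
      using gap_right[OF vals] by blast
    have nb': "down_bypassed X \<alpha> \<delta>' g' = {}"
      using e1 dx' unfolding down_bypassed_def between_def V1 s1(2) by auto
    have nogap': "g' z < \<xi>' \<or> \<delta>' < g' z" if "z \<in> cells X" for z using gap'[of "g' z"] that dx'(1) by auto
    obtain g'' where g'': "down_move X \<alpha> \<delta>' \<xi>' g' g''"
      using filtered.down_move_exists[OF G1, of b \<xi>' \<delta>' d d] dx' nogap' nb' by auto
    have g''': "down_move X \<alpha> \<delta>' \<xi>' (fn s1) g''" "down_bypassed X \<alpha> \<delta>' (fn s1) = {}" using g'' nb' s1(2) by auto
    interpret S1: down_step X g' b d \<delta>' \<xi>' g'' using down_step[OF s1(1) g'''(1)] s1(2) by simp
    define s2 where "s2 = s1\<lparr>fn := g''\<rparr>"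
    have s2: "inv s2" "fn s2 = g''" using inv_squeeze_down[OF s1(1) g'''] unfolding s2_def by auto
    have step': "squeeze_step X V \<alpha> s1 s2"
      unfolding s2_def by (rule squeeze_step.squeeze_down) (use critical_between_eq[OF s1(1)] e1 False g''' in auto)
    have g2: "g'' d = \<delta>'" "g'' b = g' b" "\<And>x. x \<in> Crit V \<Longrightarrow> x \<noteq> d \<Longrightarrow> g'' x = g' x"
      using S1.geo(3,4) bC b_neq_d V1 by auto
    have e2: "between s2 = {}"
      using e1 g2 dx' unfolding between_def s1(2) s2(2) by fastforce
    have "step1_done X V \<alpha> s2"
    proof (rule step1_doneI[OF s2(1) e2])
      fix x assume x: "x \<in> cells X" "fn s2 b \<le> fn s2 x" "fn s2 x \<le> fn s2 d"
      show "reaches X V d x \<and> reaches X V x b"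
      proof (cases "\<xi>' \<le> g' x \<and> g' x \<le> g' d \<and> reaches X V d x \<and> (x \<notin> Crit V \<or> x = d)")
        case True
        then show ?thesis using reach1[OF x(1)] dx' by auto
      next
        case False
        then have "g'' x = g' x" using S1.geo(10)[OF x(1)] unfolding V1 by blast
        then have "g' x = g' b" using x g2 gap'[of "g' x"] unfolding s2(2) by auto
        then have "x = b" using filtered.Crit_value[OF G1, of b x] bC x(1) unfolding V1 by blast
        then show ?thesis using db reaches_refl bC Crit_cells by blast
      qed
    qed
    then show ?thesis using step step' by (meson converse_rtranclp_into_rtranclp rtranclp.rtrancl_refl)
  qed
qed

lemma completion:
  assumes "inv s"
  shows "\<exists>s'. (step1 X V (BD X h) \<alpha>)\<^sup>*\<^sup>* s s' \<and> step1_done X V \<alpha> s'"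
proof -
  have sub: "bypass_step X (BD X h) \<alpha> \<le> step1 X V (BD X h) \<alpha>" "squeeze_step X V \<alpha> \<le> step1 X V (BD X h) \<alpha>"
    unfolding step1_def by auto
  obtain s1 where s1: "(bypass_step X (BD X h) \<alpha>)\<^sup>*\<^sup>* s s1" "inv s1" "between s1 = {}" using bypass_all[OF assms] by blast
  obtain s2 where s2: "(squeeze_step X V \<alpha>)\<^sup>*\<^sup>* s1 s2" "step1_done X V \<alpha> s2" using squeeze_all[OF s1(2,3)] by blast
  have "(step1 X V (BD X h) \<alpha>)\<^sup>*\<^sup>* s s1" "(step1 X V (BD X h) \<alpha>)\<^sup>*\<^sup>* s1 s2"
    using rtranclp_mono[OF sub(1)] rtranclp_mono[OF sub(2)] s1(1) s2(1) by auto
  then show ?thesis using s2(2) by (meson rtranclp_trans)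
qed

lemma remaining_components:
  assumes "\<beta> \<in> off_diagonal h (BD X h) - {\<alpha>}" "c \<in> components \<beta>"
  shows "c \<in> Crit V" "c \<noteq> b" "c \<noteq> d"
proof -
  obtain x z where \<beta>: "\<beta> = (x, z)" by fastforce
  have x: "x \<in> Crit V" "(x, z) \<in> BD X h" "(x, z) \<noteq> \<alpha>" using assms(1) off_diagonal_iff[of \<beta>] \<beta> by auto
  have "c \<in> Crit V \<and> c \<noteq> b \<and> c \<noteq> d"
  proof (cases z)
    case None
    then have "c = x" using assms(2) unfolding \<beta> components_def by simp
    then show ?thesis using x None BD_None[of x] bd by blast
  next
    case (Some y)
    then have xy: "matched_cells x y" using x BD_Some by blast
    have c: "c = x \<or> c = y" using assms(2) unfolding \<beta> Some components_def by simp
    have "y \<in> Crit V" using matched_Crit[OF xy] x(1) by blast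
    moreover have "x \<noteq> b" using matched_inj[OF xy, of _ d] bd x(3) Some by auto
    moreover have "y \<noteq> d" using matched_fun[OF xy, of _ b] bd x(3) Some by auto
    moreover have "x \<noteq> d" using matched_chain[OF xy, of _ b] bd by blast
    moreover have "y \<noteq> b" using matched_chain[OF bd, of _ x] xy by blast
    ultimately show ?thesis using c x(1) by blast
  qed
  then show "c \<in> Crit V" "c \<noteq> b" "c \<noteq> d" by auto
qed

text \<open>The components of the remaining pairs are critical cells off the path. There the
  reversal changes neither values nor matrix entries, and the moves have kept the values of
  \<open>h\<close>, so the stored data are already those of \<open>h'\<close>.\<close>

lemma result:
  assumes s: "inv s" and finished: "step1_done X V \<alpha> s" and out: "out = step2 X h V (BD X h) \<alpha> s"
  defines "h' \<equiv> res_fn out"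
  shows "topological_simplification X h h'" "res_field out = fibre_field X h'" "res_pairs out = BD X h'"
    "res_hom out = hom_rel_on X (U_mat X h') (off_diagonal h' (BD X h'))"
    "res_cohom out = cohom_rel_on X (U_perp_mat X h') (off_diagonal h' (BD X h'))"
proof -
  let ?\<rho> = "rho X V \<alpha>" and ?Q = "off_diagonal h (BD X h) - {\<alpha>}"
  interpret G: filtered X "fn s" by (rule invD(1)[OF s])
  have V: "fibre_field X (fn s) = V" by (rule invD(2)[OF s])
  interpret R: path_reversal X "fn s" b d ?\<rho>
  proof unfold_locales
    show "b \<in> Crit (fibre_field X (fn s))" "d \<in> Crit (fibre_field X (fn s))" using bC dC V by auto
    show "cdim X d = cdim X b + 1" by (rule bd_dim)
    show "rev ?\<rho> \<in> paths X (fibre_field X (fn s)) d b" using rho_path(1) V by simp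
    show "p = rev ?\<rho>" if "p \<in> paths X (fibre_field X (fn s)) d b" for p using rho_path(2) that V by simp
    show "{x \<in> cells X. fn s b \<le> fn s x \<and> fn s x \<le> fn s d} = set ?\<rho>"
      using finished unfolding step1_done_def by simp
    show "matched X (fn s) (cdim X b) b d" using matched_inv[OF s] bd by simp
  qed
  have h': "h' = reverse_values ?\<rho> (fn s)" unfolding h'_def out step2_def Let_def by simp
  have same: "off_diagonal (fn s) (BD X (fn s)) = off_diagonal h (BD X h)"
  proof (intro set_eqI)
    fix \<beta>
    show "\<beta> \<in> off_diagonal (fn s) (BD X (fn s)) \<longleftrightarrow> \<beta> \<in> off_diagonal h (BD X h)"
      using off_diagonal_iff[of \<beta>] G.off_diagonal_iff[of \<beta>] V invD(3)[OF s] by simp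
  qed
  have Q': "off_diagonal h' (BD X h') = ?Q" unfolding h' R.off_diagonal_reversed same ..
  have off: "c \<in> cells X" "c \<notin> set ?\<rho>" "h' c = h c" if "\<beta> \<in> ?Q" "c \<in> components \<beta>" for \<beta> c
    using remaining_components[OF that] R.off_path[of c] invD(5)[OF s, of c] Crit_cells unfolding V h' by auto
  show "topological_simplification X h h'"
    unfolding topological_simplification_def Q'
  proof (intro conjI ballI)
    show "dMf X h'" unfolding h' by (rule R.dMf_h')
    fix \<beta> assume \<beta>: "\<beta> \<in> ?Q"
    show "birth_value h' \<beta> = birth_value h \<beta>" "death_value h' \<beta> = death_value h \<beta>"
      using off(3)[OF \<beta>] unfolding birth_value_def death_value_def components_def
      by (auto split: option.splits)
  qed auto
  show "res_field out = fibre_field X h'"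
    unfolding h' R.fibre_field_h' unfolding out step2_def Let_def V by simp
  show "res_pairs out = BD X h'"
    unfolding h' R.BD_reversed same unfolding out step2_def Let_def V by simp
  have hom_cell: "cell_rel X (hom s) x y \<longleftrightarrow> cell_rel X (U_mat X h') x y"
    and cohom_cell: "cell_rel X (cohom s) x y \<longleftrightarrow> cell_rel X (U_perp_mat X h') x y"
    if xy: "\<beta> \<in> ?Q" "x \<in> components \<beta>" "\<gamma> \<in> ?Q" "y \<in> components \<gamma>" for \<beta> \<gamma> x y
  proof -
    have C: "x \<in> Crit V" "y \<in> Crit V" using remaining_components xy by blast+
    have "U_mat X h' (cdim X x) x y = hom s (cdim X x) x y"
      "U_perp_mat X h' (cdim X x) x y = cohom s (cdim X x) x y" if k: "cdim X x = cdim X y"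
      using R.U_reversed[of x "cdim X x" y] R.W_reversed[of x "cdim X x" y] off[OF xy(1,2)] off[OF xy(3,4)] k
        agreeD[OF invD(6)[OF s] C k] agreeD[OF invD(7)[OF s] C k]
      unfolding h' cells_of_dim_def by auto
    then show "cell_rel X (hom s) x y \<longleftrightarrow> cell_rel X (U_mat X h') x y"
      "cell_rel X (cohom s) x y \<longleftrightarrow> cell_rel X (U_perp_mat X h') x y"
      unfolding cell_rel_def by auto
  qed
  have comp: "fst \<beta> \<in> components \<beta>" "snd \<beta> = Some y \<Longrightarrow> y \<in> components \<beta>" for \<beta> :: "'a bd_pair" and y
    unfolding components_def by auto
  have "hom_rel X (hom s) \<beta> \<gamma> \<longleftrightarrow> hom_rel X (U_mat X h') \<beta> \<gamma>"
    "cohom_rel X (cohom s) \<beta> \<gamma> \<longleftrightarrow> cohom_rel X (U_perp_mat X h') \<beta> \<gamma>" if q: "\<beta> \<in> ?Q" "\<gamma> \<in> ?Q" for \<beta> \<gamma>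
  proof -
    show "hom_rel X (hom s) \<beta> \<gamma> \<longleftrightarrow> hom_rel X (U_mat X h') \<beta> \<gamma>"
      unfolding hom_rel_def using hom_cell[OF q(1) comp(2) q(2)] by blast
    show "cohom_rel X (cohom s) \<beta> \<gamma> \<longleftrightarrow> cohom_rel X (U_perp_mat X h') \<beta> \<gamma>"
      unfolding cohom_rel_def using cohom_cell[OF q(1) comp(1) q(2)] by blast
  qed
  then have "hom_rel_on X (hom s) ?Q = hom_rel_on X (U_mat X h') ?Q"
    "cohom_rel_on X (cohom s) ?Q = cohom_rel_on X (U_perp_mat X h') ?Q"
    unfolding hom_rel_on_def cohom_rel_on_def by blast+
  then show "res_hom out = hom_rel_on X (U_mat X h') (off_diagonal h' (BD X h'))"
    "res_cohom out = cohom_rel_on X (U_perp_mat X h') (off_diagonal h' (BD X h'))"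
    unfolding Q' unfolding out step2_def Let_def by auto
qed

lemma inv_start:
  "inv \<lparr>fn = h, hom = restrict_entries (Crit V) (U_mat X h), cohom = restrict_entries (Crit V) (U_perp_mat X h)\<rparr>"
  using filtered_axioms matched_less[OF bd bC] unfolding inv_def agree_def restrict_entries_def by simp

end

theorem theorem34:
  fixes X :: "'a lefschetz" and h :: "'a \<Rightarrow> real" and \<alpha> :: "'a bd_pair" and k :: nat
    and V :: "'a set set" and P :: "'a bd_pair set" and U W :: "nat \<Rightarrow> 'a mat"
  assumes "lefschetz_complex X"
    and "dMf X h"
    and "\<alpha> \<in> BD_dim X h k"
    and "reversible X h \<alpha>"
    and "region_urcorner X h k \<alpha> \<inter> region_llcorner X h k \<alpha> = {}"
    and "V = fibre_field X h"
    and "P = BD X h"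
    and "U = restrict_entries (Crit V) (U_mat X h)"
    and "W = restrict_entries (Crit V) (U_perp_mat X h)"
  shows "simplification_completes X h V P U W \<alpha> \<and>
    (\<forall>out. simplification_returns X h V P U W \<alpha> out \<longrightarrow>
       (let h' = res_fn out; Q' = off_diagonal h' (BD X h') in
          topological_simplification X h h' \<and>
          res_field out = fibre_field X h' \<and>
          res_pairs out = BD X h' \<and>
          res_hom out = hom_rel_on X (U_mat X h') Q' \<and>
          res_cohom out = cohom_rel_on X (U_perp_mat X h') Q'))"
proof -
  interpret filtered X h using assms(1,2) by unfold_locales
  obtain b d where \<alpha>: "\<alpha> = (b, Some d)"
    using assms(4) unfolding reversible_def by (metis prod.collapse)
  have off: "(b, Some d) \<in> off_diagonal h (BD X h)" and uniq: "\<exists>!p. p \<in> paths X (fibre_field X h) d b"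
    using assms(4) unfolding reversible_def \<alpha> by auto
  have bC: "b \<in> Crit (fibre_field X h)" and m: "matched_cells b d"
    using off off_diagonal_iff[of "(b, Some d)"] BD_Some by auto
  have k: "k = cdim X b" using assms(3) matched_dims(3)[of k b d] unfolding BD_dim_def \<alpha> by auto
  interpret S: simplification X h b d
    using bC m uniq matched_Crit[OF m] assms(5) by unfold_locales (auto simp: k \<alpha>)
  let ?s = "\<lparr>fn = h, hom = U, cohom = W\<rparr>"
  have s: "S.inv ?s" using S.inv_start unfolding assms(6,8,9) .
  have "simplification_completes X h V P U W \<alpha>"
    unfolding simplification_completes_def Let_def
  proof (intro conjI allI impI notI)
    assume "\<exists>run. run 0 = ?s \<and> (\<forall>i. bypass_step X P \<alpha> (run i) (run (Suc i)))"
    then show False using S.no_infinite_bypass s unfolding assms(7) \<alpha> by metis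
  next
    fix s assume "(step1 X V P \<alpha>)\<^sup>*\<^sup>* ?s s"
    then show "\<exists>s'. (step1 X V P \<alpha>)\<^sup>*\<^sup>* s s' \<and> step1_done X V \<alpha> s'"
      using S.completion S.inv_steps[OF _ s] unfolding assms(6,7) \<alpha> by blast
  qed
  moreover have "let h' = res_fn out; Q' = off_diagonal h' (BD X h') in
          topological_simplification X h h' \<and>
          res_field out = fibre_field X h' \<and>
          res_pairs out = BD X h' \<and>
          res_hom out = hom_rel_on X (U_mat X h') Q' \<and>
          res_cohom out = cohom_rel_on X (U_perp_mat X h') Q'"
    if ret: "simplification_returns X h V P U W \<alpha> out" for out
  proof -
    obtain s' where s': "(step1 X V P \<alpha>)\<^sup>*\<^sup>* ?s s'" "step1_done X V \<alpha> s'" "out = step2 X h V P \<alpha> s'"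
      using ret unfolding simplification_returns_def by blast
    have "S.inv s'" using S.inv_steps[OF _ s] s'(1) unfolding assms(6,7) \<alpha> by blast
    then show ?thesis
      using S.result[of s' out] s'(2,3) unfolding assms(6,7) \<alpha> Let_def by blast
  qed
  ultimately show ?thesis by blast
qed

end
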